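(* Let $G=\mathrm{PGL}_3$ and $\{\pi,\pi'\}=\{\pi_1,\pi_2\}$, or $G=\mathrm{PGSp}_4$ and $\{\pi,\pi'\}=\{\pi_{\mathrm{spin}},\pi_{\mathrm{st}}\}$. Let $\Gamma$ be a torsion-free finite-index subgroup of $W_{\mathrm{aff}}$. Then $$Z_2(\mathcal A_\Gamma,\pi,u)=Z_{\mathrm{semi}}(\mathcal A_\Gamma,\pi',u^{2/n_{\pi'}})^{n_{\pi'}}=Z(\mathcal A_\Gamma,\pi',u^{2/n_{\pi'}})^{n_{\pi'}}\left(\frac{1+u^{k_\Gamma/n_{\pi'}}}{1-u^{k_\Gamma/n_{\pi'}}}\right)^{\delta(\pi,\Gamma)(1-m_\Gamma)n_{\pi'}},$$ where, when $\mathcal A_\Gamma$ is a torus, $\delta(\pi,\Gamma)=0$ and the last factor is interpreted as $1$.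
   Context: **Apartments.** $V$ is a Euclidean plane with inner product $(\cdot,\cdot)$, $W$ the Weyl group, $\Lambda\supset\Lambda_r$ the coweight and coroot lattices; $W_{\mathrm{aff}}=\Lambda_r\rtimes W$ acts on $V$ by isometries. The apartment $\mathcal A$ is $V$ with the simplicial structure cut out by the walls; chambers are the closures of the components of the complement of the walls. Explicitly: - $\mathrm{PGL}_3$ (type $\tilde A_2$): $\Lambda$ is spanned by $\alpha_1,\alpha_2,\alpha_3$ of equal length with sum $0$; $W=S_3$ permutes them; $\Lambda_r=\{\sum c_i\alpha_i:c_i\in\mathbb Z,\ \sum c_i\equiv0\bmod3\}$; walls $\{\sum c_i\alpha_i:c_i-c_j=k\}$, $i\ne j$, $k\in\mathbb Z$. $\pi_1$ is the standard representation of $\mathrm{SL}_3(\mathbb C)$, with weights $\alpha_1,\alpha_2,\alpha_3$; $\pi_2$ its dual, with weights $-\alpha_1,-\alpha_2,-\alpha_3$. - $\mathrm{PGSp}_4$ (type $\tilde C_2$): $\Lambda=\mathbb Ze_1\oplus\mathbb Ze_2$, $e_1,e_2$ orthonormal; $W$ is the group of signed permutations; $\Lambda_r=\{x_1e_1+x_2e_2:x_1+x_2\text{ even}\}$; walls $x_1=k$, $x_2=k$, $x_1\pm x_2=k$. $\pi_{\mathrm{spin}}$ and $\pi_{\mathrm{st}}$ are the degree 4 spin and degree 5 standard representations of $\mathrm{Spin}_5(\mathbb C)$, with weights $\pm e_1,\pm e_2$, respectively $\pm e_1\pm e_2$ and $0$. $\mathrm{wt}'(\pi)$ is the set of nontrivial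 weights, of common length $\ell(\pi)$. $n_{\pi_1}=n_{\pi_2}=n_{\pi_{\mathrm{st}}}=1$, $n_{\pi_{\mathrm{spin}}}=2$. $\mathcal A_\Gamma=\Gamma\backslash\mathcal A$ is a torus if $\Gamma\subset\Lambda_r$ and a Klein bottle otherwise. **Invariants in the Klein bottle case.** $\Gamma$ is generated by a translation $t$ and a glide reflection $\sigma$ with $t\sigma=\sigma t^{-1}$; fix such a choice. The linear part of $\sigma$ is $\sigma_0(x)=-x+2\frac{(x,\alpha)}{(\alpha,\alpha)}\alpha$ for a nontrivial weight $\alpha$ of one of the two representations; $\sigma^2$ is translation by $k_\Gamma\alpha$, where $\alpha$ is chosen (up to sign) so that $k_\Gamma$ is a positive integer. $k_\Gamma$ depends only on $\Gamma$. $\Gamma$ is of type $\pi$ if $\alpha\in\mathrm{wt}'(\pi)$. $\delta(\pi,\Gamma)=1$ for type $\tilde A_2$; for type $\tilde C_2$, $\delta(\pi,\Gamma)=2$ if $\Gamma$ is not of type $\pi$ and $0$ if it is. $L_0,L_1$ are the glide reflection axes of $\sigma$ and $t\sigma$, and $m_\Gamma\in\{0,2\}$ is the number of these that are rational (contained in the 1-skeleton of $\mathcal A$). **Zeta functions of walks.** A $\pi$-geodesic in $\mathcal A$ is an oriented straight line with the direction of some $\lambda\in\mathrm{wt}'(\pi)$; it is rational if contained in the 1-skeleton, and semi-rational if it is not rational but becomes rational after translation by some $v\in\frac12\Lambda$. A closed $\pi$-geodesic in $\mathcal A_\Gamma$ is the image of an oriented segment from $v$ to $g(v)$ on a $\pi$-geodesic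 $L$ with $g\in\Gamma$, $g(L)=L$ (preserving orientation); it is (semi-)rational if $L$ is. Equivalence is change of starting point; primitive means not a repetition of a shorter one; $l(c)$ is the length divided by $\ell(\pi)$. $Z(\mathcal A_\Gamma,\pi,u)=\prod_c(1-u^{l(c)})^{-1}$ over equivalence classes of primitive rational closed $\pi$-geodesics, and $Z_{\mathrm{semi}}(\mathcal A_\Gamma,\pi,u)$ is the same product over the semi-rational ones. **Zeta function of galleries.** For $\lambda\in\mathrm{wt}'(\pi)$, $v\in\Lambda$, the $\pi$-chamber $C_{\lambda,v}$ is the union of the chambers meeting the open segment from $v$ to $v+\lambda$, together with its central directed edge from $v$ to $v+\lambda$ (two chambers for $\pi_1,\pi_2,\pi_{\mathrm{spin}}$; a square of four chambers for $\pi_{\mathrm{st}}$; different central edges give different $\pi$-chambers). A $\pi$-geodesic gallery is a sequence $(C_i)$ of $\pi$-chambers such that (1) for all $i<j$ the convex hull of $C_i$ and $C_j$ is $C_i\cup\dots\cup C_j$; (2) the terminal vertex of the central edge of $C_i$ is the initial vertex of that of $C_{i+1}$; and the walk of central edges has no backtracking. A closed $\pi$-geodesic gallery of length $n$ in $\mathcal A_\Gamma$ is the image of a bi-infinite one $(C_i)_{i\in\mathbb Z}$ with $C_{i+n}=\gamma C_i$ for all $i$ (with central edges) for some $\gamma\in\Gamma$; equivalence is change of starting $\pi$-chamber; primitive means not a repetition of a shorter one; $l(C)=n$. $Z_2(\mathcal A_\Gamma,\pi,u)=\prod_C(1-u^{l(C)})^{-1}$ over equivalence classes of primitive closed $\pi$-geodesic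 galleries. *)

theory Defs
  imports "HOL-Analysis.Analysis" "HOL-Algebra.Generated_Groups"
begin

section \<open>Apartments\<close>

text \<open>
  An apartment is given by its frame in the Euclidean plane: the vectors
  \<open>\<alpha>\<^sub>1, \<alpha>\<^sub>2, \<alpha>\<^sub>3\<close> in type affine \<open>A\<^sub>2\<close>, the vectors \<open>e\<^sub>1, e\<^sub>2\<close> in type affine \<open>C\<^sub>2\<close>.
  In type affine \<open>A\<^sub>2\<close> the coordinates \<open>c\<^sub>i\<close> of a point are unique only up to a common additive
  constant, which changes neither their differences nor, for integers, their sum modulo 3.
\<close>

datatype 'v apartment = is_PGL3: PGL3 'v 'v 'v | is_PGSp4: PGSp4 'v 'v

fun apartment_frame :: "'v::euclidean_space apartment \<Rightarrow> bool" where
  "apartment_frame (PGL3 a1 a2 a3) \<longleftrightarrow>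
     DIM('v) = 2 \<and> a1 + a2 + a3 = 0 \<and> norm a1 = norm a2 \<and> norm a2 = norm a3 \<and> a1 \<noteq> 0"
| "apartment_frame (PGSp4 e1 e2) \<longleftrightarrow>
     DIM('v) = 2 \<and> norm e1 = 1 \<and> norm e2 = 1 \<and> e1 \<bullet> e2 = 0"

fun coweights :: "'v::euclidean_space apartment \<Rightarrow> 'v set" where
  "coweights (PGL3 a1 a2 a3) =
     {of_int c1 *\<^sub>R a1 + of_int c2 *\<^sub>R a2 + of_int c3 *\<^sub>R a3 | c1 c2 c3 :: int. True}"
| "coweights (PGSp4 e1 e2) = {of_int x1 *\<^sub>R e1 + of_int x2 *\<^sub>R e2 | x1 x2 :: int. True}"

fun coroots :: "'v::euclidean_space apartment \<Rightarrow> 'v set" where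
  "coroots (PGL3 a1 a2 a3) =
     {of_int c1 *\<^sub>R a1 + of_int c2 *\<^sub>R a2 + of_int c3 *\<^sub>R a3 | c1 c2 c3 :: int.
        (c1 + c2 + c3) mod 3 = 0}"
| "coroots (PGSp4 e1 e2) =
     {of_int x1 *\<^sub>R e1 + of_int x2 *\<^sub>R e2 | x1 x2 :: int. even (x1 + x2)}"

fun weyl :: "'v::euclidean_space apartment \<Rightarrow> ('v \<Rightarrow> 'v) set" where
  "weyl (PGL3 a1 a2 a3) = {s. linear s \<and> s ` {a1, a2, a3} = {a1, a2, a3}}"
| "weyl (PGSp4 e1 e2) = {s. linear s \<and> s ` {e1, - e1, e2, - e2} = {e1, - e1, e2, - e2}}"

definition affine_weyl :: "'v::euclidean_space apartment \<Rightarrow> ('v \<Rightarrow> 'v) monoid" where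
  "affine_weyl A =
     \<lparr>carrier = {(\<lambda>x. s x + v) | s v. s \<in> weyl A \<and> v \<in> coroots A}, mult = (\<circ>), one = id\<rparr>"

definition coroot_translations :: "'v::euclidean_space apartment \<Rightarrow> ('v \<Rightarrow> 'v) set" where
  "coroot_translations A = {(\<lambda>x. x + v) | v. v \<in> coroots A}"

definition torsion_free :: "('v \<Rightarrow> 'v) set \<Rightarrow> bool" where
  "torsion_free \<Gamma> \<longleftrightarrow> (\<forall>g\<in>\<Gamma>. \<forall>n>0. g ^^ n = id \<longrightarrow> g = id)"

fun walls :: "'v::euclidean_space apartment \<Rightarrow> 'v set set" where
  "walls (PGL3 a1 a2 a3) =
     (\<Union>k::int. {{c1 *\<^sub>R a1 + c2 *\<^sub>R a2 + c3 *\<^sub>R a3 | c1 c2 c3. c1 - c2 = of_int k},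
                {c1 *\<^sub>R a1 + c2 *\<^sub>R a2 + c3 *\<^sub>R a3 | c1 c2 c3. c2 - c3 = of_int k},
                {c1 *\<^sub>R a1 + c2 *\<^sub>R a2 + c3 *\<^sub>R a3 | c1 c2 c3. c1 - c3 = of_int k}})"
| "walls (PGSp4 e1 e2) =
     (\<Union>k::int. {{x1 *\<^sub>R e1 + x2 *\<^sub>R e2 | x1 x2. x1 = of_int k},
                {x1 *\<^sub>R e1 + x2 *\<^sub>R e2 | x1 x2. x2 = of_int k},
                {x1 *\<^sub>R e1 + x2 *\<^sub>R e2 | x1 x2. x1 + x2 = of_int k},
                {x1 *\<^sub>R e1 + x2 *\<^sub>R e2 | x1 x2. x1 - x2 = of_int k}})"

definition skeleton :: "'v::euclidean_space apartment \<Rightarrow> 'v set" where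
  "skeleton A = \<Union> (walls A)"

definition chambers :: "'v::euclidean_space apartment \<Rightarrow> 'v set set" where
  "chambers A = closure ` components (- \<Union> (walls A))"


section \<open>Representations\<close>

datatype rep = Pi1 | Pi2 | Spin | St

text \<open>The nontrivial weights \<open>wt'(\<pi>)\<close>; empty if \<open>\<pi>\<close> belongs to the other group.\<close>

fun weights :: "'v::euclidean_space apartment \<Rightarrow> rep \<Rightarrow> 'v set" where
  "weights (PGL3 a1 a2 a3) Pi1 = {a1, a2, a3}"
| "weights (PGL3 a1 a2 a3) Pi2 = {- a1, - a2, - a3}"
| "weights (PGSp4 e1 e2) Spin = {e1, - e1, e2, - e2}"
| "weights (PGSp4 e1 e2) St = {e1 + e2, e1 - e2, - e1 + e2, - e1 - e2}"
| "weights _ _ = {}"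

fun n_rep :: "rep \<Rightarrow> nat" where
  "n_rep Spin = 2"
| "n_rep _ = 1"


section \<open>Loops and Euler products\<close>

text \<open>
  A closed geodesic or gallery is encoded as a pair of its length and its periodic
  extension to a bi-infinite path in the quotient. Changing the starting point is
  then a shift of the parameter, and an \<open>r\<close>-fold repetition keeps the path and
  multiplies the length by \<open>r\<close>.
\<close>

definition shift_equiv ::
    "(('l \<times> ('t::ab_group_add \<Rightarrow> 'q)) \<times> ('l \<times> ('t \<Rightarrow> 'q))) set" where
  "shift_equiv = {((l, c), (l', c')). l' = l \<and> (\<exists>s. c' = (\<lambda>t. c (t + s)))}"

definition primitive_loops ::
    "('l::semiring_1 \<times> ('t::ab_group_add \<Rightarrow> 'q)) set \<Rightarrow> ('l \<times> ('t \<Rightarrow> 'q)) set" where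
  "primitive_loops S =
     {(l, c) \<in> S. \<not> (\<exists>l' r. (l', c) \<in> S \<and> r > 1 \<and> l = of_nat r * l')}"

definition loop_classes ::
    "('l::semiring_1 \<times> ('t::ab_group_add \<Rightarrow> 'q)) set \<Rightarrow> ('l \<times> ('t \<Rightarrow> 'q)) set set" where
  "loop_classes S = primitive_loops S // shift_equiv"

definition class_length :: "('l \<times> ('t \<Rightarrow> 'q)) set \<Rightarrow> 'l" where
  "class_length X = the_elem (fst ` X)"

text \<open>
  The product of \<open>(1 - p (l c))\<^sup>-\<^sup>1\<close> over the classes of primitive loops \<open>c\<close> in \<open>S\<close>, as
  an unordered infinite product; \<open>p l\<close> plays the role of \<open>u\<^sup>l\<close>.
\<close>

definition euler_product ::
    "('l::semiring_1 \<times> ('t::ab_group_add \<Rightarrow> 'q)) set \<Rightarrow> ('l \<Rightarrow> complex) \<Rightarrow> complex" where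
  "euler_product S p =
     Lim (finite_subsets_at_top (loop_classes S))
       (\<lambda>F. \<Prod>X\<in>F. inverse (1 - p (class_length X)))"


section \<open>Zeta functions of walks\<close>

definition orbit_of :: "('v \<Rightarrow> 'v) set \<Rightarrow> 'v \<Rightarrow> 'v set" where
  "orbit_of \<Gamma> x = (\<lambda>g. g x) ` \<Gamma>"

definition line_through :: "'v::euclidean_space \<Rightarrow> 'v \<Rightarrow> 'v set" where
  "line_through v d = range (\<lambda>t::real. v + t *\<^sub>R d)"

definition rational_line :: "'v::euclidean_space apartment \<Rightarrow> 'v set \<Rightarrow> bool" where
  "rational_line A L \<longleftrightarrow> L \<subseteq> skeleton A"

definition semirational_line :: "'v::euclidean_space apartment \<Rightarrow> 'v set \<Rightarrow> bool" where
  "semirational_line A L \<longleftrightarrow>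
     \<not> rational_line A L \<and> (\<exists>x\<in>coweights A. rational_line A ((\<lambda>y. y + (1/2) *\<^sub>R x) ` L))"

text \<open>
  The closed geodesics lying on geodesics with the property \<open>R\<close>. They are parametrised
  by \<open>t \<mapsto> v + t d\<close> with \<open>d\<close> a weight, i.e. with speed \<open>\<ell>(\<pi>) = norm d\<close>, so that the
  parameter length \<open>l\<close> is the length of the segment from \<open>v\<close> to \<open>g v\<close> divided by \<open>\<ell>(\<pi>)\<close>;
  \<open>l > 0\<close> because the segment has the orientation of the geodesic.
\<close>

definition closed_geodesics ::
    "'v::euclidean_space apartment \<Rightarrow> ('v \<Rightarrow> 'v) set \<Rightarrow> rep \<Rightarrow> ('v set \<Rightarrow> bool) \<Rightarrow>
     (real \<times> (real \<Rightarrow> 'v set)) set" where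
  "closed_geodesics A \<Gamma> \<pi> R =
     {(l, \<lambda>t. orbit_of \<Gamma> (v + t *\<^sub>R d)) | l v d.
        d \<in> weights A \<pi> \<and> R (line_through v d) \<and> l > 0 \<and>
        (\<exists>g\<in>\<Gamma>. g ` line_through v d = line_through v d \<and>
               (\<exists>r>0. g (v + d) - g v = r *\<^sub>R d) \<and>
               g v = v + l *\<^sub>R d)}"

text \<open>
  Lengths may be half-integral, so the zeta functions of walks involve fractional powers
  of \<open>u\<close>. They are therefore functions of a logarithm \<open>w\<close> of \<open>u\<close>, with \<open>u\<^sup>r\<close> read as
  \<open>exp (r w)\<close>; in particular \<open>Z(u\<^sup>r)\<close> is the value at \<open>r w\<close>.
\<close>

definition Z_walk ::
    "'v::euclidean_space apartment \<Rightarrow> ('v \<Rightarrow> 'v) set \<Rightarrow> rep \<Rightarrow> complex \<Rightarrow> complex" where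
  "Z_walk A \<Gamma> \<pi> w =
     euler_product (closed_geodesics A \<Gamma> \<pi> (rational_line A)) (\<lambda>l. exp (of_real l * w))"

definition Z_semi ::
    "'v::euclidean_space apartment \<Rightarrow> ('v \<Rightarrow> 'v) set \<Rightarrow> rep \<Rightarrow> complex \<Rightarrow> complex" where
  "Z_semi A \<Gamma> \<pi> w =
     euler_product (closed_geodesics A \<Gamma> \<pi> (semirational_line A)) (\<lambda>l. exp (of_real l * w))"


section \<open>The zeta function of galleries\<close>

text \<open>
  A \<open>\<pi>\<close>-chamber is a triple: the underlying set, and the initial and terminal vertices of
  the central edge.
\<close>

definition pi_chamber ::
    "'v::euclidean_space apartment \<Rightarrow> 'v \<Rightarrow> 'v \<Rightarrow> 'v set \<times> 'v \<times> 'v" where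
  "pi_chamber A d v =
     (\<Union> {D \<in> chambers A. D \<inter> open_segment v (v + d) \<noteq> {}}, v, v + d)"

definition pi_chambers ::
    "'v::euclidean_space apartment \<Rightarrow> rep \<Rightarrow> ('v set \<times> 'v \<times> 'v) set" where
  "pi_chambers A \<pi> = {pi_chamber A d v | d v. d \<in> weights A \<pi> \<and> v \<in> coweights A}"

definition body :: "'v set \<times> 'v \<times> 'v \<Rightarrow> 'v set" where
  "body C = fst C"

definition initial :: "'v set \<times> 'v \<times> 'v \<Rightarrow> 'v" where
  "initial C = fst (snd C)"

definition terminal :: "'v set \<times> 'v \<times> 'v \<Rightarrow> 'v" where
  "terminal C = snd (snd C)"

definition act :: "('v \<Rightarrow> 'v) \<Rightarrow> 'v set \<times> 'v \<times> 'v \<Rightarrow> 'v set \<times> 'v \<times> 'v" where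
  "act g C = (g ` body C, g (initial C), g (terminal C))"

definition geodesic_gallery ::
    "'v::euclidean_space apartment \<Rightarrow> rep \<Rightarrow> (int \<Rightarrow> 'v set \<times> 'v \<times> 'v) \<Rightarrow> bool" where
  "geodesic_gallery A \<pi> C \<longleftrightarrow>
     (\<forall>i. C i \<in> pi_chambers A \<pi>) \<and>
     (\<forall>i j. i < j \<longrightarrow> convex hull (body (C i) \<union> body (C j)) = (\<Union>k\<in>{i..j}. body (C k))) \<and>
     (\<forall>i. terminal (C i) = initial (C (i + 1))) \<and>
     (\<forall>i. terminal (C (i + 1)) \<noteq> initial (C i))"

definition closed_galleries ::
    "'v::euclidean_space apartment \<Rightarrow> ('v \<Rightarrow> 'v) set \<Rightarrow> rep \<Rightarrow>
     (nat \<times> (int \<Rightarrow> ('v set \<times> 'v \<times> 'v) set)) set" where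
  "closed_galleries A \<Gamma> \<pi> =
     {(n, \<lambda>i. (\<lambda>g. act g (C i)) ` \<Gamma>) | n C.
        n > 0 \<and> geodesic_gallery A \<pi> C \<and> (\<exists>g\<in>\<Gamma>. \<forall>i. C (i + int n) = act g (C i))}"

definition Z_gallery ::
    "'v::euclidean_space apartment \<Rightarrow> ('v \<Rightarrow> 'v) set \<Rightarrow> rep \<Rightarrow> complex \<Rightarrow> complex" where
  "Z_gallery A \<Gamma> \<pi> u = euler_product (closed_galleries A \<Gamma> \<pi>) (\<lambda>n. u ^ n)"


section \<open>Invariants in the Klein bottle case\<close>

text \<open>
  A choice of generators \<open>t, \<sigma>\<close>, with the weight \<open>a\<close> spanning the axis direction of \<open>\<sigma>\<close>
  and the positive integer \<open>k\<close> such that \<open>\<sigma>\<^sup>2\<close> is the translation by \<open>k a\<close>.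
\<close>

definition klein_choice ::
    "'v::euclidean_space apartment \<Rightarrow> ('v \<Rightarrow> 'v) set \<Rightarrow>
     ('v \<Rightarrow> 'v) \<Rightarrow> ('v \<Rightarrow> 'v) \<Rightarrow> 'v \<Rightarrow> nat \<Rightarrow> bool" where
  "klein_choice A \<Gamma> t \<sigma> a k \<longleftrightarrow>
     generate (affine_weyl A) {t, \<sigma>} = \<Gamma> \<and>
     t \<in> coroot_translations A \<and>
     t \<otimes>\<^bsub>affine_weyl A\<^esub> \<sigma> = \<sigma> \<otimes>\<^bsub>affine_weyl A\<^esub> inv\<^bsub>affine_weyl A\<^esub> t \<and>
     a \<in> (\<Union>\<pi>. weights A \<pi>) \<and>
     (\<forall>x. \<sigma> x - \<sigma> 0 = - x + (2 * (x \<bullet> a) / (a \<bullet> a)) *\<^sub>R a) \<and>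
     k > 0 \<and> (\<forall>x. \<sigma> (\<sigma> x) = x + of_nat k *\<^sub>R a)"

fun delta :: "'v::euclidean_space apartment \<Rightarrow> rep \<Rightarrow> 'v \<Rightarrow> nat" where
  "delta (PGL3 a1 a2 a3) \<pi> a = 1"
| "delta (PGSp4 e1 e2) \<pi> a = (if a \<in> weights (PGSp4 e1 e2) \<pi> then 0 else 2)"

text \<open>The axis of a glide reflection \<open>g\<close> along \<open>a\<close>.\<close>

definition glide_axis :: "('v \<Rightarrow> 'v) \<Rightarrow> 'v::euclidean_space \<Rightarrow> 'v set" where
  "glide_axis g a = {x. \<exists>r::real. g x = x + r *\<^sub>R a}"

definition rational_axes ::
    "'v::euclidean_space apartment \<Rightarrow> ('v \<Rightarrow> 'v) \<Rightarrow> ('v \<Rightarrow> 'v) \<Rightarrow> 'v \<Rightarrow> nat" where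
  "rational_axes A t \<sigma> a =
     of_bool (rational_line A (glide_axis \<sigma> a)) +
     of_bool (rational_line A (glide_axis (t \<circ> \<sigma>) a))"

end

theory Submission imports Defs begin

text \<open>
  All three zeta functions are finite Euler products. A closed geodesic of the quotient is the image
  of an oriented line of the plane, unique up to \<open>\<Gamma>\<close> (\<open>line_lift_unique\<close>). If \<open>(L\<^sub>i)\<close> represents the \<open>\<Gamma>\<close>-orbits of oriented (semi-)rational lines with the direction of a weight, and
  \<open>l\<^sub>i\<close> is the smallest translation length along \<open>L\<^sub>i\<close> in its stabiliser, then the Euler product is
  the product of the factors \<open>1 / (1 - exp (l\<^sub>i w))\<close> (\<open>euler_product_line_reps\<close>).

  The comparison of galleries with geodesics is a statement about the plane. Convexity and
  the absence of backtracking force the central edges of a \<open>\<pi>\<close>-geodesic gallery to alternate between two weights \<open>d\<close>, \<open>d'\<close> of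
  \<open>\<pi>\<close> that are neither equal nor opposite (\<open>geodesic_gallery_straight\<close>), and conversely every such
  zigzag is geodesic (\<open>geodesic_straight_gallery\<close>). Its direction \<open>d + d'\<close> is \<open>n\<^bsub>\<pi>'\<^esub>\<close> times a weight of
  \<open>\<pi>'\<close>, and the line through the midpoints of its central edges is semi-rational for \<open>\<pi>'\<close>, one step
  having length \<open>n\<^bsub>\<pi>'\<^esub> / 2\<close>. Every semi-rational line arises, from exactly \<open>n\<^bsub>\<pi>'\<^esub>\<close> galleries up to a
  shift: if \<open>n\<^bsub>\<pi>'\<^esub> = 2\<close>, then the weights of \<open>\<pi>\<close> are coroots, so that all vertices of a gallery have the
  same type modulo the coroot lattice, and the two types give the two galleries. The action of
  \<open>\<Gamma>\<close> preserves types, hence the first equality (\<open>euler_product_galleries\<close>).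

  For the second equality, rational and semi-rational lines of a fixed direction \<open>D\<close> are the level
  lines of a linear form at integers and at half-integers respectively. As long as only
  translations of \<open>\<Gamma>\<close> preserve the directions in question, the levels are shifted by integers, so
  that the two kinds of lines have representatives with the same lengths
  (\<open>line_reps_on_translations\<close>). This settles the torus. For a Klein bottle the same holds for all directions except \<open>\<plusminus>a\<close>. The other
  directions fall into pairs interchanged by \<open>\<sigma>\<close>, while the number of weights of \<open>\<pi>'\<close>
  among \<open>\<plusminus>a\<close> is \<open>\<delta>(\<pi>, \<Gamma>)\<close>. On the levels of direction \<open>a\<close>, \<open>\<Gamma>\<close> acts through the infinite
  dihedral group generated by \<open>y \<mapsto> y + \<tau>\<close> and \<open>y \<mapsto> q - y\<close>, with fundamental interval \<open>[q/2, (q + \<tau>)/2]\<close>. Its ends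
  are the glide axes, on which geodesics close up after \<open>k/2\<close> instead of \<open>k\<close>. Comparing the integers
  with the half-integers in this interval yields the correction factor, which depends only on how
  many of its ends are integers (\<open>line_reps_on_axis\<close>, \<open>prod_parity\<close>).
\<close>

section \<open>Euler products over a finite set of representatives\<close>

lemma primitive_loopsI:
  fixes len :: "'i \<Rightarrow> 'l::linordered_semidom"
  assumes "(len i, P i) \<in> S" "len i > 0"
    and lens: "\<And>l. (l, P i) \<in> S \<Longrightarrow> \<exists>n>0. l = of_nat n * len i"
  shows "(len i, P i) \<in> primitive_loops S"
proof -
  have False if h: "(l', P i) \<in> S" "r > 1" "len i = of_nat r * l'" for l' and r :: nat
  proof -
    obtain n where n: "n > 0" "l' = of_nat n * len i" using lens[OF h(1)] by blast
    have "1 * len i = of_nat (r * n) * len i" using h(3) n(2) by (simp add: mult.assoc)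
    have "1 < r * n" using h(2) n(1) by (metis less_1_mult mult.right_neutral not_less_iff_gr_or_eq One_nat_def less_one)
    then have "(1 :: 'l) < of_nat (r * n)" by (metis of_nat_1 of_nat_less_iff)
    then have "1 * len i < of_nat (r * n) * len i" using assms(2) by (rule mult_strict_right_mono)
    then show False using \<open>1 * len i = of_nat (r * n) * len i\<close> by simp
  qed
  then show ?thesis unfolding primitive_loops_def using assms(1) by blast
qed

text \<open>
  The bookkeeping behind every Euler product below: if the paths \<open>P i\<close>, \<open>i \<in> I\<close>, represent all
  closed loops up to shift, are pairwise not shifts of each other, and the lengths with which
  \<open>P i\<close> closes up are the positive multiples of \<open>len i\<close>, then the classes of primitive
  loops correspond to the elements of \<open>I\<close>.
\<close>

lemma euler_product_representatives:
  fixes S :: "('l::linordered_semidom \<times> ('t::ab_group_add \<Rightarrow> 'q)) set"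
  assumes "finite I"
    and mem: "\<And>i. i \<in> I \<Longrightarrow> (len i, P i) \<in> S"
    and pos: "\<And>i. i \<in> I \<Longrightarrow> len i > 0"
    and lens: "\<And>i l. i \<in> I \<Longrightarrow> (l, P i) \<in> S \<Longrightarrow> \<exists>n>0. l = of_nat n * len i"
    and cover: "\<And>l c. (l, c) \<in> S \<Longrightarrow> \<exists>i\<in>I. \<exists>s. c = (\<lambda>t. P i (t + s))"
    and shift: "\<And>l c s. (l, c) \<in> S \<Longrightarrow> (l, \<lambda>t. c (t + s)) \<in> S"
    and dist: "\<And>i j s. i \<in> I \<Longrightarrow> j \<in> I \<Longrightarrow> P j = (\<lambda>t. P i (t + s)) \<Longrightarrow> i = j"
  shows "euler_product S p = (\<Prod>i\<in>I. inverse (1 - p (len i)))"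
proof -
  define cls where "cls = (\<lambda>i. shift_equiv `` {(len i, P i)})"
  have cl: "class_length (cls i) = len i" for i
  proof -
    have "(len i, \<lambda>t. P i (t + 0)) \<in> cls i"
      unfolding cls_def shift_equiv_def by blast
    then have "fst ` cls i = {len i}" unfolding cls_def shift_equiv_def by (auto simp: image_iff)
    then show ?thesis by (simp add: class_length_def)
  qed
  have clsI: "cls i \<in> loop_classes S" if "i \<in> I" for i
    unfolding loop_classes_def cls_def
    using that by (intro quotientI primitive_loopsI mem pos lens)
  have inj: "inj_on cls I"
  proof (rule inj_onI)
    fix i j assume ij: "i \<in> I" "j \<in> I" "cls i = cls j"
    have "(len j, P j) = (len j, \<lambda>t. P j (t + 0))" by simp
    then have "(len j, P j) \<in> cls j" unfolding cls_def shift_equiv_def by blast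
    then have "(len j, P j) \<in> cls i" using ij by simp
    then obtain s where "P j = (\<lambda>t. P i (t + s))" unfolding cls_def shift_equiv_def by auto
    then show "i = j" using dist ij by blast
  qed
  have surj: "X \<in> cls ` I" if X: "X \<in> loop_classes S" for X
  proof -
    obtain l c where lc: "(l, c) \<in> primitive_loops S" "X = shift_equiv `` {(l, c)}"
      using X unfolding loop_classes_def by (auto elim!: quotientE)
    have lcS: "(l, c) \<in> S" using lc(1) unfolding primitive_loops_def by blast
    obtain i s where i: "i \<in> I" "c = (\<lambda>t. P i (t + s))" using cover[OF lcS] by blast
    have Pc: "P i = (\<lambda>t. c (t + (- s)))" using i(2) by simp
    have "(l, P i) \<in> S" using shift[OF lcS, of "- s"] Pc by simp
    then obtain n where n: "n > 0" "l = of_nat n * len i" using lens i(1) by blast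
    have "(len i, c) \<in> S" using shift[OF mem[OF i(1)], of s] i(2) by simp
    then have "\<not> n > 1" using lc(1) n(2) unfolding primitive_loops_def by blast
    then have l: "l = len i" using n by (cases "n = 1") auto
    have "shift_equiv `` {(l, c)} = shift_equiv `` {(l, P i)}"
    proof (rule Set.set_eqI, rule iffI)
      fix y assume "y \<in> shift_equiv `` {(l, c)}"
      then obtain s' where y: "y = (l, \<lambda>t. c (t + s'))" unfolding shift_equiv_def by auto
      have "y = (l, \<lambda>t. P i (t + (s' + s)))" using y i(2) by (simp add: add.assoc)
      then show "y \<in> shift_equiv `` {(l, P i)}" unfolding shift_equiv_def by blast
    next
      fix y assume "y \<in> shift_equiv `` {(l, P i)}"
      then obtain s' where y: "y = (l, \<lambda>t. P i (t + s'))" unfolding shift_equiv_def by auto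
      have "y = (l, \<lambda>t. c (t + (s' + - s)))" using y Pc by (simp add: algebra_simps)
      then show "y \<in> shift_equiv `` {(l, c)}" unfolding shift_equiv_def by blast
    qed
    then have "X = cls i" using lc(2) l unfolding cls_def by simp
    then show ?thesis using i(1) by blast
  qed
  have eq: "loop_classes S = cls ` I" using clsI surj by blast
  have fin: "finite (loop_classes S)" using assms(1) eq by simp
  have "euler_product S p = (\<Prod>X\<in>loop_classes S. inverse (1 - p (class_length X)))"
    unfolding euler_product_def finite_subsets_at_top_finite[OF fin]
    by (rule tendsto_Lim) (auto simp: trivial_limit_def eventually_principal intro!: tendsto_eventually)
  also have "\<dots> = (\<Prod>i\<in>I. inverse (1 - p (len i)))"
    unfolding eq prod.reindex[OF inj] by (simp add: cl)
  finally show ?thesis .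
qed


section \<open>Plane geometry\<close>

text \<open>Countably many affine conditions cannot cover a line without one of them covering it alone.\<close>

lemma countable_affine_cover:
  fixes p q :: "'i \<Rightarrow> 'v::real_vector"
  assumes "countable I" "\<And>t::real. \<exists>i\<in>I. p i + t *\<^sub>R q i = 0"
  shows "\<exists>i\<in>I. p i = 0 \<and> q i = 0"
proof (rule ccontr)
  assume neg: "\<not> ?thesis"
  have "countable {t. p i + t *\<^sub>R q i = 0}" if "i \<in> I" for i
  proof (cases "q i = 0")
    case True
    then show ?thesis using neg that by auto
  next
    case False
    have "t = s" if "p i + t *\<^sub>R q i = 0" "p i + s *\<^sub>R q i = 0" for t s
    proof -
      have "t *\<^sub>R q i = s *\<^sub>R q i" using that by (metis add_left_cancel)
      then show ?thesis using False by simp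
    qed
    then have "\<exists>t. {t. p i + t *\<^sub>R q i = 0} \<subseteq> {t}" by blast
    then show ?thesis by (meson countable_empty countable_insert countable_subset)
  qed
  then have "countable (\<Union>i\<in>I. {t. p i + t *\<^sub>R q i = 0})" using assms(1) by blast
  moreover have "(\<Union>i\<in>I. {t. p i + t *\<^sub>R q i = 0}) = UNIV" using assms(2) by auto
  ultimately show False using uncountable_UNIV_real by simp
qed

lemma orthogonal_pair_zero:
  fixes x :: "'v::euclidean_space"
  assumes "DIM('v) = 2" "u \<noteq> 0" "v \<noteq> 0" "u \<bullet> v = 0" "x \<bullet> u = 0" "x \<bullet> v = 0"
  shows "x = 0"
proof (rule ccontr)
  assume x: "x \<noteq> 0"
  have "u \<noteq> v" "x \<noteq> u" "x \<noteq> v" using assms x by auto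
  moreover have "pairwise orthogonal {x, u, v}"
    using assms by (auto simp: pairwise_def orthogonal_def inner_commute)
  moreover have "0 \<notin> {x, u, v}" using assms x by auto
  ultimately have "independent {x, u, v}" "card {x, u, v} = 3"
    using pairwise_orthogonal_independent by (blast, simp)
  then show False using independent_bound[of "{x, u, v}"] assms(1) by simp
qed

lemma plane_decomposition:
  fixes x :: "'v::euclidean_space"
  assumes "DIM('v) = 2" "u \<noteq> 0" "v \<noteq> 0" "u \<bullet> v = 0"
  shows "x = (x \<bullet> u / (u \<bullet> u)) *\<^sub>R u + (x \<bullet> v / (v \<bullet> v)) *\<^sub>R v"
proof -
  have "x - ((x \<bullet> u / (u \<bullet> u)) *\<^sub>R u + (x \<bullet> v / (v \<bullet> v)) *\<^sub>R v) = 0"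
    by (rule orthogonal_pair_zero[OF assms])
      (use assms in \<open>simp_all add: inner_diff_left inner_add_left inner_commute[of v u]\<close>)
  then show ?thesis by simp
qed

lemma orthogonal_imp_multiple:
  fixes x :: "'v::euclidean_space"
  assumes "DIM('v) = 2" "u \<noteq> 0" "v \<noteq> 0" "u \<bullet> v = 0" "v \<bullet> x = 0"
  shows "x = (x \<bullet> u / (u \<bullet> u)) *\<^sub>R u"
  using plane_decomposition[OF assms(1-4), of x] assms(5) by (simp add: inner_commute)

lemma exists_orthogonal:
  fixes a :: "'v::euclidean_space"
  assumes "DIM('v) = 2" "a \<noteq> 0"
  obtains b where "b \<noteq> 0" "a \<bullet> b = 0"
proof -
  have "dim {a} < DIM('v)" using dim_le_card'[of "{a}"] assms by simp
  then obtain b where "b \<noteq> 0" "\<And>x. x \<in> span {a} \<Longrightarrow> orthogonal b x"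
    using orthogonal_to_subspace_exists by metis
  then show ?thesis using that[of b] by (simp add: orthogonal_def inner_commute span_base)
qed

section \<open>Lattices, weights and Weyl groups\<close>

lemma PGL3_inner:
  assumes "apartment_frame (PGL3 a b c)"
  shows "a \<bullet> a > 0" "b \<bullet> b = a \<bullet> a" "c \<bullet> c = a \<bullet> a"
    "a \<bullet> b = - (a \<bullet> a) / 2" "a \<bullet> c = - (a \<bullet> a) / 2" "b \<bullet> c = - (a \<bullet> a) / 2"
    "b \<bullet> a = - (a \<bullet> a) / 2" "c \<bullet> a = - (a \<bullet> a) / 2" "c \<bullet> b = - (a \<bullet> a) / 2"
    "c = - a - b"
proof -
  show c: "c = - a - b" using assms by (simp add: eq_neg_iff_add_eq_0 algebra_simps)
  show pos: "a \<bullet> a > 0" using assms by simp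
  have bb: "b \<bullet> b = a \<bullet> a" and cc: "c \<bullet> c = a \<bullet> a"
    using assms by (simp_all add: dot_square_norm)
  then show "b \<bullet> b = a \<bullet> a" "c \<bullet> c = a \<bullet> a" .
  have "c \<bullet> c = a \<bullet> a + 2 * (a \<bullet> b) + b \<bullet> b"
    unfolding c by (simp add: inner_diff_left inner_diff_right inner_commute)
  then show ab: "a \<bullet> b = - (a \<bullet> a) / 2" using bb cc by simp
  then show ba: "b \<bullet> a = - (a \<bullet> a) / 2" by (simp add: inner_commute)
  show ac: "a \<bullet> c = - (a \<bullet> a) / 2" unfolding c using ab by (simp add: inner_diff_right)
  show bc: "b \<bullet> c = - (a \<bullet> a) / 2" unfolding c using ba bb by (simp add: inner_diff_right)
  show "c \<bullet> a = - (a \<bullet> a) / 2" "c \<bullet> b = - (a \<bullet> a) / 2"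
    using ac bc by (simp_all add: inner_commute)
qed

lemma PGL3_distinct:
  assumes "apartment_frame (PGL3 a b c)"
  shows "a \<noteq> b" "b \<noteq> c" "a \<noteq> c" "a \<noteq> - b" "b \<noteq> - c" "a \<noteq> - c"
proof -
  note i = PGL3_inner[OF assms]
  have "a \<bullet> a \<noteq> a \<bullet> b" "b \<bullet> b \<noteq> b \<bullet> c" "a \<bullet> a \<noteq> a \<bullet> c"
    "a \<bullet> a \<noteq> a \<bullet> - b" "b \<bullet> b \<noteq> b \<bullet> - c" "a \<bullet> a \<noteq> a \<bullet> - c"
    unfolding inner_minus_right using i(1-9) by linarith+
  then show "a \<noteq> b" "b \<noteq> c" "a \<noteq> c" "a \<noteq> - b" "b \<noteq> - c" "a \<noteq> - c" by fastforce+
qed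

lemma PGSp4_inner:
  assumes "apartment_frame (PGSp4 e f)"
  shows "e \<bullet> e = 1" "f \<bullet> f = 1" "e \<bullet> f = 0" "f \<bullet> e = 0"
  using assms by (simp_all add: norm_eq_1 inner_commute)

lemma PGSp4_distinct:
  assumes "apartment_frame (PGSp4 e f)"
  shows "e \<noteq> f" "e \<noteq> - f" "f \<noteq> - e" "e \<noteq> - e" "f \<noteq> - f" "- e \<noteq> e" "- f \<noteq> f"
proof -
  note i = PGSp4_inner[OF assms]
  show "e \<noteq> f" using i by auto
  show "e \<noteq> - f" using i by (metis inner_minus_left neg_0_equal_iff_equal zero_neq_one)
  show "f \<noteq> - e" using i by (metis inner_minus_left neg_0_equal_iff_equal zero_neq_one)
  have "e \<noteq> 0" "f \<noteq> 0" using i by auto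
  then have "e + e \<noteq> 0" "f + f \<noteq> 0" by (simp_all add: scaleR_2[symmetric])
  then show "e \<noteq> - e" "f \<noteq> - f" "- e \<noteq> e" "- f \<noteq> f"
    by (metis add.right_inverse, metis add.right_inverse, metis add.left_inverse, metis add.left_inverse)
qed

lemma PGL3_decomposition:
  assumes "apartment_frame (PGL3 a b c)"
  obtains p q where "x = p *\<^sub>R a + q *\<^sub>R b"
proof -
  note i = PGL3_inner[OF assms]
  have o: "a \<bullet> (a + 2 *\<^sub>R b) = 0" using i by (simp add: inner_add_right)
  have "(a + 2 *\<^sub>R b) \<bullet> (a + 2 *\<^sub>R b) = 3 * (a \<bullet> a)"
    using i by (simp add: inner_add_right inner_add_left)
  then have "a + 2 *\<^sub>R b \<noteq> 0" using i(1) by auto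
  then obtain p q where "x = p *\<^sub>R a + q *\<^sub>R (a + 2 *\<^sub>R b)"
    using plane_decomposition[of a "a + 2 *\<^sub>R b" x] o assms by (metis apartment_frame.simps(1))
  then have "x = (p + q) *\<^sub>R a + (2 * q) *\<^sub>R b" by (simp add: algebra_simps)
  then show ?thesis using that by blast
qed

lemma PGSp4_decomposition:
  assumes "apartment_frame (PGSp4 e f)"
  obtains p q where "x = p *\<^sub>R e + q *\<^sub>R f"
  using plane_decomposition[of e f x] assms
  by (metis apartment_frame.simps(2) norm_zero zero_neq_one)

lemma apartment_DIM: "apartment_frame (A :: 'v::euclidean_space apartment) \<Longrightarrow> DIM('v) = 2"
  by (cases A) auto

lemma coroots_0: "0 \<in> coroots A"
  by (cases A) (auto intro!: exI[of _ "0::int"])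

lemma coroots_subset: "coroots A \<subseteq> coweights A"
  by (cases A) auto

lemma coweights_add: "x \<in> coweights A \<Longrightarrow> y \<in> coweights A \<Longrightarrow> x + y \<in> coweights A"
proof (induction A)
  case (PGL3 a b c)
  then obtain x1 x2 x3 y1 y2 y3 :: int where
    "x = of_int x1 *\<^sub>R a + of_int x2 *\<^sub>R b + of_int x3 *\<^sub>R c"
    "y = of_int y1 *\<^sub>R a + of_int y2 *\<^sub>R b + of_int y3 *\<^sub>R c" by auto
  then have "x + y = of_int (x1 + y1) *\<^sub>R a + of_int (x2 + y2) *\<^sub>R b + of_int (x3 + y3) *\<^sub>R c"
    by (simp add: algebra_simps)
  then show ?case unfolding coweights.simps by blast
next
  case (PGSp4 e f)
  then obtain x1 x2 y1 y2 :: int where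
    "x = of_int x1 *\<^sub>R e + of_int x2 *\<^sub>R f" "y = of_int y1 *\<^sub>R e + of_int y2 *\<^sub>R f" by auto
  then have "x + y = of_int (x1 + y1) *\<^sub>R e + of_int (x2 + y2) *\<^sub>R f" by (simp add: algebra_simps)
  then show ?case unfolding coweights.simps by blast
qed

lemma coweights_scale: "x \<in> coweights A \<Longrightarrow> of_int n *\<^sub>R x \<in> coweights A"
proof (induction A)
  case (PGL3 a b c)
  then obtain x1 x2 x3 :: int where
    "x = of_int x1 *\<^sub>R a + of_int x2 *\<^sub>R b + of_int x3 *\<^sub>R c" by auto
  then have "of_int n *\<^sub>R x =
      of_int (n * x1) *\<^sub>R a + of_int (n * x2) *\<^sub>R b + of_int (n * x3) *\<^sub>R c"
    by (simp add: algebra_simps)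
  then show ?case unfolding coweights.simps by blast
next
  case (PGSp4 e f)
  then obtain x1 x2 :: int where "x = of_int x1 *\<^sub>R e + of_int x2 *\<^sub>R f" by auto
  then have "of_int n *\<^sub>R x = of_int (n * x1) *\<^sub>R e + of_int (n * x2) *\<^sub>R f"
    by (simp add: algebra_simps)
  then show ?case unfolding coweights.simps by blast
qed

lemma coweights_minus: "x \<in> coweights A \<Longrightarrow> - x \<in> coweights A"
  using coweights_scale[of x A "- 1"] by simp

lemma coweights_diff: "x \<in> coweights A \<Longrightarrow> y \<in> coweights A \<Longrightarrow> x - y \<in> coweights A"
  using coweights_add[of x A "- y"] coweights_minus[of y A] by simp

lemma coroots_PGL3I:
  "(i + j + k) mod 3 = 0 \<Longrightarrow>
     of_int i *\<^sub>R a + of_int j *\<^sub>R b + of_int k *\<^sub>R c \<in> coroots (PGL3 a b c)"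
  unfolding coroots.simps
  by (rule CollectI, rule exI[of _ i], rule exI[of _ j], rule exI[of _ k]) simp

lemma coroots_add: "x \<in> coroots A \<Longrightarrow> y \<in> coroots A \<Longrightarrow> x + y \<in> coroots A"
proof (induction A)
  case (PGL3 a b c)
  then obtain x1 x2 x3 y1 y2 y3 :: int where xy:
    "x = of_int x1 *\<^sub>R a + of_int x2 *\<^sub>R b + of_int x3 *\<^sub>R c"
    "y = of_int y1 *\<^sub>R a + of_int y2 *\<^sub>R b + of_int y3 *\<^sub>R c"
    "(x1 + x2 + x3) mod 3 = 0" "(y1 + y2 + y3) mod 3 = 0" by auto
  then have "x + y = of_int (x1 + y1) *\<^sub>R a + of_int (x2 + y2) *\<^sub>R b + of_int (x3 + y3) *\<^sub>R c"
    by (simp add: algebra_simps)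
  moreover have "((x1 + y1) + (x2 + y2) + (x3 + y3)) mod 3 = 0" using xy(3,4) by presburger
  ultimately show ?case by (simp only: coroots_PGL3I)
next
  case (PGSp4 e f)
  then obtain x1 x2 y1 y2 :: int where xy:
    "x = of_int x1 *\<^sub>R e + of_int x2 *\<^sub>R f" "y = of_int y1 *\<^sub>R e + of_int y2 *\<^sub>R f"
    "even (x1 + x2)" "even (y1 + y2)" by auto
  then have "x + y = of_int (x1 + y1) *\<^sub>R e + of_int (x2 + y2) *\<^sub>R f" by (simp add: algebra_simps)
  moreover have "even ((x1 + y1) + (x2 + y2))" using xy(3,4) by presburger
  ultimately show ?case unfolding coroots.simps by blast
qed

lemma coroots_scale: "x \<in> coroots A \<Longrightarrow> of_int n *\<^sub>R x \<in> coroots A"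
proof (induction A)
  case (PGL3 a b c)
  then obtain x1 x2 x3 :: int where x:
    "x = of_int x1 *\<^sub>R a + of_int x2 *\<^sub>R b + of_int x3 *\<^sub>R c" "3 dvd (x1 + x2 + x3)"
    by (auto simp: mod_eq_0_iff_dvd)
  have "of_int n *\<^sub>R x = of_int (n * x1) *\<^sub>R a + of_int (n * x2) *\<^sub>R b + of_int (n * x3) *\<^sub>R c"
    using x by (simp add: algebra_simps)
  moreover have "n * x1 + n * x2 + n * x3 = n * (x1 + x2 + x3)" by (simp add: algebra_simps)
  then have "(n * x1 + n * x2 + n * x3) mod 3 = 0" using x(2) by simp
  ultimately show ?case by (simp only: coroots_PGL3I)
next
  case (PGSp4 e f)
  then obtain x1 x2 :: int where x: "x = of_int x1 *\<^sub>R e + of_int x2 *\<^sub>R f" "even (x1 + x2)" by auto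
  then have "of_int n *\<^sub>R x = of_int (n * x1) *\<^sub>R e + of_int (n * x2) *\<^sub>R f"
    by (simp add: algebra_simps)
  moreover have "even (n * x1 + n * x2)" using x(2) by (simp add: distrib_left[symmetric])
  ultimately show ?case unfolding coroots.simps by blast
qed

lemma coroots_minus: "x \<in> coroots A \<Longrightarrow> - x \<in> coroots A"
  using coroots_scale[of x A "- 1"] by simp

lemma coroots_diff: "x \<in> coroots A \<Longrightarrow> y \<in> coroots A \<Longrightarrow> x - y \<in> coroots A"
  using coroots_add[of x A "- y"] coroots_minus[of y A] by simp

text \<open>
  The quotient of the two lattices has order 3 or 2; the common multiple 6 avoids a case distinction.
\<close>

lemma coweights_multiple_coroot: "x \<in> coweights A \<Longrightarrow> 6 *\<^sub>R x \<in> coroots A"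
proof (induction A)
  case (PGL3 a b c)
  then obtain x1 x2 x3 :: int where
    "x = of_int x1 *\<^sub>R a + of_int x2 *\<^sub>R b + of_int x3 *\<^sub>R c" by auto
  then have "6 *\<^sub>R x = of_int (6 * x1) *\<^sub>R a + of_int (6 * x2) *\<^sub>R b + of_int (6 * x3) *\<^sub>R c"
    by (simp add: algebra_simps)
  moreover have "(6 * x1 + 6 * x2 + 6 * x3) mod 3 = 0" by presburger
  ultimately show ?case by (simp only: coroots_PGL3I)
next
  case (PGSp4 e f)
  then obtain x1 x2 :: int where "x = of_int x1 *\<^sub>R e + of_int x2 *\<^sub>R f" by auto
  then have "6 *\<^sub>R x = of_int (6 * x1) *\<^sub>R e + of_int (6 * x2) *\<^sub>R f" by (simp add: algebra_simps)
  moreover have "even (6 * x1 + 6 * x2)" by presburger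
  ultimately show ?case unfolding coroots.simps by blast
qed

lemma countable_coweights: "countable (coweights A)"
proof (cases A)
  case (PGL3 a b c)
  define h where "h = (\<lambda>(c1::int, c2::int, c3::int).
      of_int c1 *\<^sub>R a + of_int c2 *\<^sub>R b + of_int c3 *\<^sub>R c)"
  have "x \<in> range h" if x: "x \<in> coweights A" for x
  proof -
    obtain c1 c2 c3 :: int where "x = of_int c1 *\<^sub>R a + of_int c2 *\<^sub>R b + of_int c3 *\<^sub>R c"
      using x unfolding PGL3 by auto
    then have "x = h (c1, c2, c3)" by (simp add: h_def)
    then show ?thesis by (rule range_eqI)
  qed
  then show ?thesis by (intro countable_subset[of "coweights A" "range h"]) auto
next
  case (PGSp4 e f)
  define h where "h = (\<lambda>(c1::int, c2::int). of_int c1 *\<^sub>R e + of_int c2 *\<^sub>R f)"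
  have "x \<in> range h" if x: "x \<in> coweights A" for x
  proof -
    obtain c1 c2 :: int where "x = of_int c1 *\<^sub>R e + of_int c2 *\<^sub>R f"
      using x unfolding PGSp4 by auto
    then have "x = h (c1, c2)" by (simp add: h_def)
    then show ?thesis by (rule range_eqI)
  qed
  then show ?thesis by (intro countable_subset[of "coweights A" "range h"]) auto
qed

lemma weights_subset_coweights: "weights A \<rho> \<subseteq> coweights A"
proof (cases A)
  case (PGL3 a b c)
  have "a = of_int 1 *\<^sub>R a + of_int 0 *\<^sub>R b + of_int 0 *\<^sub>R c"
    "b = of_int 0 *\<^sub>R a + of_int 1 *\<^sub>R b + of_int 0 *\<^sub>R c"
    "c = of_int 0 *\<^sub>R a + of_int 0 *\<^sub>R b + of_int 1 *\<^sub>R c" by simp_all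
  then have m: "a \<in> coweights A" "b \<in> coweights A" "c \<in> coweights A"
    unfolding PGL3 coweights.simps by blast+
  show ?thesis using m m[THEN coweights_minus]
    unfolding PGL3 by (cases \<rho>) (simp_all del: coweights.simps)
next
  case (PGSp4 e f)
  have "e = of_int 1 *\<^sub>R e + of_int 0 *\<^sub>R f" "f = of_int 0 *\<^sub>R e + of_int 1 *\<^sub>R f" by simp_all
  then have m: "e \<in> coweights A" "f \<in> coweights A" unfolding PGSp4 coweights.simps by blast+
  note n = m[THEN coweights_minus]
  show ?thesis using m n m(1)[THEN coweights_add, OF m(2)] m(1)[THEN coweights_diff, OF m(2)]
      n(1)[THEN coweights_add, OF m(2)] n(1)[THEN coweights_diff, OF m(2)]
    unfolding PGSp4 by (cases \<rho>) (simp_all del: coweights.simps)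
qed

text \<open>The reflection in the line spanned by \<open>a\<close>.\<close>

definition reflection :: "'v::euclidean_space \<Rightarrow> 'v \<Rightarrow> 'v" where
  "reflection a x = - x + (2 * (x \<bullet> a) / (a \<bullet> a)) *\<^sub>R a"

lemma linear_reflection: "linear (reflection a)"
  by (rule linearI) (simp_all add: reflection_def inner_add_left algebra_simps add_divide_distrib)

lemma weyl_PGL3_cases:
  assumes fr: "apartment_frame (PGL3 a b c)" and s: "s \<in> weyl (PGL3 a b c)"
  shows "(s a, s b, s c) \<in> {(a,b,c), (a,c,b), (b,a,c), (b,c,a), (c,a,b), (c,b,a)}"
proof -
  have im: "s ` {a, b, c} = {a, b, c}" using s by simp
  then have "inj_on s {a, b, c}" by (intro eq_card_imp_inj_on) auto
  then have "s a \<noteq> s b" "s b \<noteq> s c" "s a \<noteq> s c"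
    using PGL3_distinct[OF fr] by (auto simp: inj_on_def)
  moreover have "s a \<in> {a,b,c}" "s b \<in> {a,b,c}" "s c \<in> {a,b,c}" using im by blast+
  ultimately show ?thesis by (elim insertE emptyE) simp_all
qed

lemma weyl_PGSp4_cases:
  assumes fr: "apartment_frame (PGSp4 e f)" and s: "s \<in> weyl (PGSp4 e f)"
  shows "(s e, s f) \<in> {(e,f), (e,-f), (-e,f), (-e,-f), (f,e), (f,-e), (-f,e), (-f,-e)}"
proof -
  let ?F = "{e, - e, f, - f}"
  have im: "s ` ?F = ?F" and lin: "linear s" using s by simp_all
  then have "inj_on s ?F" by (intro eq_card_imp_inj_on) auto
  then have "s e \<noteq> s f" "s e \<noteq> s (- f)"
    using PGSp4_distinct[OF fr] by (auto simp: inj_on_def)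
  then have "s e \<noteq> s f" "s e \<noteq> - s f" using linear_neg[OF lin] by auto
  moreover have "s e \<in> ?F" "s f \<in> ?F" using im by blast+
  ultimately show ?thesis by (elim insertE emptyE) simp_all
qed

lemma weyl_linear: "s \<in> weyl A \<Longrightarrow> linear s"
  by (cases A) auto

text \<open>The first two vectors of the frame: a basis of the plane on which linear maps can be compared.\<close>

fun frame_basis :: "'v::euclidean_space apartment \<Rightarrow> 'v \<times> 'v" where
  "frame_basis (PGL3 a b c) = (a, b)"
| "frame_basis (PGSp4 e f) = (e, f)"

lemma frame_basis_decomposition:
  assumes "apartment_frame A" "frame_basis A = (u, v)"
  shows "\<exists>p q. x = p *\<^sub>R u + q *\<^sub>R v"
proof (cases A)
  case (PGL3 a b c)
  then show ?thesis using assms PGL3_decomposition[of a b c x]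
    by (metis frame_basis.simps(1) prod.inject)
next
  case (PGSp4 e f)
  then show ?thesis using assms PGSp4_decomposition[of e f x]
    by (metis frame_basis.simps(2) prod.inject)
qed

lemma linear_eq_on_frame_basis:
  assumes "apartment_frame A" "frame_basis A = (u, v)" "linear s" "linear t" "s u = t u" "s v = t v"
  shows "s = t"
proof
  fix x
  obtain p q where "x = p *\<^sub>R u + q *\<^sub>R v" using frame_basis_decomposition assms(1,2) by blast
  then show "s x = t x" using assms(3-6) by (simp add: linear_add linear_scale)
qed

lemma weyl_isometry:
  assumes fr: "apartment_frame A" and s: "s \<in> weyl A"
  shows "s x \<bullet> s y = x \<bullet> y"
proof -
  have lin: "linear s" using weyl_linear[OF s] .
  obtain u v where uv: "frame_basis A = (u, v)" by fastforce
  have i: "s u \<bullet> s u = u \<bullet> u \<and> s u \<bullet> s v = u \<bullet> v \<and> s v \<bullet> s v = v \<bullet> v"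
  proof (cases A)
    case (PGL3 a b c)
    show ?thesis using weyl_PGL3_cases[of a b c s] PGL3_inner(1-9)[of a b c] fr s uv
      by (auto simp: PGL3 simp del: apartment_frame.simps weyl.simps)
  next
    case (PGSp4 e f)
    show ?thesis using weyl_PGSp4_cases[of e f s] PGSp4_inner[of e f] fr s uv
      by (auto simp: PGSp4 simp del: apartment_frame.simps weyl.simps)
  qed
  obtain p q where x: "x = p *\<^sub>R u + q *\<^sub>R v" using frame_basis_decomposition[OF fr uv] by blast
  obtain p' q' where y: "y = p' *\<^sub>R u + q' *\<^sub>R v" using frame_basis_decomposition[OF fr uv] by blast
  have "s v \<bullet> s u = v \<bullet> u" using i by (metis inner_commute)
  then show ?thesis unfolding x y using i
    by (simp add: linear_add[OF lin] linear_scale[OF lin] inner_add_left inner_add_right)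
qed

lemma weyl_inj: "apartment_frame A \<Longrightarrow> s \<in> weyl A \<Longrightarrow> inj s"
  using weyl_isometry[of A s] linear_injective_0[OF weyl_linear[of s A]]
  by (metis inner_eq_zero_iff)

lemma id_in_weyl: "id \<in> weyl A"
  by (cases A) (auto simp: id_def linear_id[unfolded id_def])

lemma weyl_comp: "s \<in> weyl A \<Longrightarrow> t \<in> weyl A \<Longrightarrow> s \<circ> t \<in> weyl A"
  by (cases A) (simp_all only: weyl.simps mem_Collect_eq linear_compose image_comp[symmetric] simp_thms)

lemma weyl_funpow: "s \<in> weyl A \<Longrightarrow> s ^^ n \<in> weyl A"
  by (induction n) (simp_all add: id_in_weyl weyl_comp)

lemma finite_weyl:
  assumes fr: "apartment_frame A"
  shows "finite (weyl A)"
proof -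
  obtain u v where uv: "frame_basis A = (u, v)" by fastforce
  have "inj_on (\<lambda>s. (s u, s v)) (weyl A)"
    by (rule inj_onI) (use linear_eq_on_frame_basis[OF fr uv] weyl_linear in blast)
  moreover have "\<exists>F. finite F \<and> (\<forall>s\<in>weyl A. s u \<in> F \<and> s v \<in> F)"
  proof (cases A)
    case (PGL3 a b c)
    show ?thesis using uv by (intro exI[of _ "{a, b, c}"]) (auto simp: PGL3)
  next
    case (PGSp4 e f)
    show ?thesis using uv by (intro exI[of _ "{e, - e, f, - f}"]) (auto simp: PGSp4)
  qed
  then obtain F where "finite F" "\<forall>s\<in>weyl A. s u \<in> F \<and> s v \<in> F" by blast
  then have "(\<lambda>s. (s u, s v)) ` weyl A \<subseteq> F \<times> F" "finite (F \<times> F)" by blast+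
  then have "finite ((\<lambda>s. (s u, s v)) ` weyl A)" by (rule finite_subset)
  ultimately show ?thesis using finite_imageD by blast
qed

lemma weyl_order:
  assumes fr: "apartment_frame A" and s: "s \<in> weyl A"
  shows "\<exists>n>0. s ^^ n = id"
proof -
  have "\<not> inj (\<lambda>n. s ^^ n)"
    using finite_weyl[OF fr] weyl_funpow[OF s]
    by (metis finite_imageD finite_subset image_subsetI infinite_UNIV_nat)
  then obtain i j where ij: "s ^^ i = s ^^ j" "i < j" by (metis injI linorder_neqE_nat)
  have "s ^^ i \<circ> s ^^ (j - i) = s ^^ i \<circ> id"
    using ij(1) funpow_add[of i "j - i" s] ij(2) by simp
  moreover have "inj (s ^^ i)" using weyl_inj[OF fr weyl_funpow[OF s]] .
  ultimately have "s ^^ (j - i) = id" by (metis fun.inj_map_strong inj_def fun_eq_iff comp_apply)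
  then show ?thesis using ij(2) by (intro exI[of _ "j - i"]) auto
qed

lemma weyl_inverse:
  assumes fr: "apartment_frame A" and s: "s \<in> weyl A"
  obtains t where "t \<in> weyl A" "t \<circ> s = id" "s \<circ> t = id"
proof -
  obtain n where n: "n > 0" "s ^^ n = id" using weyl_order[OF assms] by blast
  obtain m where m: "n = Suc m" using n(1) by (cases n) auto
  have "s \<circ> s ^^ m = id" using n m by simp
  moreover have "s ^^ m \<circ> s = id" using n m by (simp add: funpow_Suc_right del: funpow.simps)
  ultimately show ?thesis using that[of "s ^^ m"] weyl_funpow[OF s] by blast
qed

lemma weyl_weights:
  assumes fr: "apartment_frame A" and s: "s \<in> weyl A" and d: "d \<in> weights A \<rho>"
  shows "s d \<in> weights A \<rho>"
proof -
  have lin: "linear s" using weyl_linear[OF s] .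
  note l = linear_neg[OF lin] linear_add[OF lin] linear_diff[OF lin]
  show ?thesis
  proof (cases A)
    case (PGL3 a b c)
    show ?thesis using weyl_PGL3_cases[of a b c s] fr s d l
      by (cases \<rho>) (auto simp: PGL3 simp del: apartment_frame.simps weyl.simps)
  next
    case (PGSp4 e f)
    show ?thesis using weyl_PGSp4_cases[of e f s] fr s d l
      by (cases \<rho>) (auto simp: PGSp4 simp del: apartment_frame.simps weyl.simps)
  qed
qed

text \<open>
  The Weyl group acts trivially on the quotient of the two lattices: \<open>\<Gamma>\<close> preserves the types of
  vertices.
\<close>

lemma weyl_coweights_diff:
  assumes fr: "apartment_frame A" and s: "s \<in> weyl A" and x: "x \<in> coweights A"
  shows "s x - x \<in> coroots A"
proof -
  have lin: "linear s" using weyl_linear[OF s] .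
  note l = linear_neg[OF lin] linear_add[OF lin] linear_scale[OF lin]
  show ?thesis
  proof (cases A)
    case (PGL3 a b c)
    obtain c1 c2 c3 :: int where x: "x = of_int c1 *\<^sub>R a + of_int c2 *\<^sub>R b + of_int c3 *\<^sub>R c"
      using x PGL3 by auto
    have mem: "of_int i *\<^sub>R a + of_int j *\<^sub>R b + of_int k *\<^sub>R c \<in> coroots A"
      if "i + j + k = 0" for i j k :: int
      unfolding PGL3 using that by (intro coroots_PGL3I) simp
    have "\<exists>i j k. s x - x = of_int i *\<^sub>R a + of_int j *\<^sub>R b + of_int k *\<^sub>R c \<and> i + j + k = 0"
    proof -
      have "(s a, s b, s c) \<in> {(a,b,c), (a,c,b), (b,a,c), (b,c,a), (c,a,b), (c,b,a)}"
        using weyl_PGL3_cases[of a b c s] fr s PGL3 by blast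
      then show ?thesis
      proof (elim insertE)
        assume "(s a, s b, s c) = (a, b, c)"
        then show ?thesis by (intro exI[of _ 0]) (simp add: x l)
      next
        assume "(s a, s b, s c) = (a, c, b)"
        then show ?thesis by (intro exI[of _ 0] exI[of _ "c3 - c2"] exI[of _ "c2 - c3"])
            (simp add: x l algebra_simps)
      next
        assume "(s a, s b, s c) = (b, a, c)"
        then show ?thesis by (intro exI[of _ 0] exI[of _ "c2 - c1"] exI[of _ "c1 - c2"])
            (simp add: x l algebra_simps)
      next
        assume "(s a, s b, s c) = (b, c, a)"
        then show ?thesis by (intro exI[of _ "c3 - c1"] exI[of _ "c1 - c2"] exI[of _ "c2 - c3"])
            (simp add: x l algebra_simps)
      next
        assume "(s a, s b, s c) = (c, a, b)"
        then show ?thesis by (intro exI[of _ "c2 - c1"] exI[of _ "c3 - c2"] exI[of _ "c1 - c3"])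
            (simp add: x l algebra_simps)
      next
        assume "(s a, s b, s c) = (c, b, a)"
        then show ?thesis by (intro exI[of _ "c3 - c1"] exI[of _ 0] exI[of _ "c1 - c3"])
            (simp add: x l algebra_simps)
      qed simp
    qed
    then show ?thesis using mem by auto
  next
    case (PGSp4 e f)
    obtain c1 c2 :: int where x: "x = of_int c1 *\<^sub>R e + of_int c2 *\<^sub>R f"
      using x PGSp4 by auto
    have img: "\<exists>p q. y = of_int p *\<^sub>R e + of_int q *\<^sub>R f \<and> odd (p + q)"
      if "y = e \<or> y = - e \<or> y = f \<or> y = - f" for y
      using that
    proof (elim disjE)
      assume "y = e" then show ?thesis by (intro exI[of _ 1] exI[of _ 0]) simp
    next
      assume "y = - e" then show ?thesis by (intro exI[of _ "- 1"] exI[of _ 0]) simp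
    next
      assume "y = f" then show ?thesis by (intro exI[of _ 0] exI[of _ 1]) simp
    next
      assume "y = - f" then show ?thesis by (intro exI[of _ 0] exI[of _ "- 1"]) simp
    qed
    have "s e \<in> {e, - e, f, - f}" "s f \<in> {e, - e, f, - f}" using s unfolding PGSp4 by auto
    then obtain p q r t where
      "s e = of_int p *\<^sub>R e + of_int q *\<^sub>R f" "odd (p + q)"
      "s f = of_int r *\<^sub>R e + of_int t *\<^sub>R f" "odd (r + t)"
      using img[of "s e"] img[of "s f"] by blast
    then have "s x - x = of_int (c1 * p + c2 * r - c1) *\<^sub>R e + of_int (c1 * q + c2 * t - c2) *\<^sub>R f"
      by (simp add: x l algebra_simps)
    moreover have "(c1 * p + c2 * r - c1) + (c1 * q + c2 * t - c2) = c1 * (p + q - 1) + c2 * (r + t - 1)"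
      by (simp add: algebra_simps)
    then have "even ((c1 * p + c2 * r - c1) + (c1 * q + c2 * t - c2))"
      using \<open>odd (p + q)\<close> \<open>odd (r + t)\<close> by simp
    ultimately have "\<exists>i j. s x - x = of_int i *\<^sub>R e + of_int j *\<^sub>R f \<and> even (i + j)" by blast
    then show ?thesis by (auto simp: PGSp4)
  qed
qed

lemma eq_minus_self_iff: "(x :: 'a::real_vector) = - x \<longleftrightarrow> x = 0" "- x = x \<longleftrightarrow> x = 0"
proof -
  have "x + x = 2 *\<^sub>R x" by (simp add: scaleR_2)
  then show "x = - x \<longleftrightarrow> x = 0" "- x = x \<longleftrightarrow> x = 0"
    by (auto simp: eq_neg_iff_add_eq_0 neg_eq_iff_add_eq_0)
qed

lemma PGSp4_sum_nonzero:
  assumes "apartment_frame (PGSp4 e f)"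
  shows "e + f \<noteq> 0" "e - f \<noteq> 0" "f - e \<noteq> 0" "- e - f \<noteq> 0"
proof -
  note i = PGSp4_inner[OF assms]
  have "(e + f) \<bullet> e = 1" "(e - f) \<bullet> e = 1" "(f - e) \<bullet> f = 1" "(- e - f) \<bullet> e = - 1"
    using i by (simp_all add: inner_add_left inner_diff_left)
  then show "e + f \<noteq> 0" "e - f \<noteq> 0" "f - e \<noteq> 0" "- e - f \<noteq> 0" by auto
qed

lemma weyl_coroots:
  assumes "apartment_frame A" "s \<in> weyl A" "x \<in> coroots A"
  shows "s x \<in> coroots A"
proof -
  have "s x - x \<in> coroots A" using weyl_coweights_diff assms coroots_subset by blast
  then show ?thesis using coroots_add[OF _ assms(3)] by fastforce
qed

text \<open>
  The elements of the Weyl group with a nonzero fixed vector are the identity and the reflections in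
  lines spanned by a weight; the others are nontrivial rotations.
\<close>

lemma weyl_trichotomy:
  assumes fr: "apartment_frame A" and s: "s \<in> weyl A"
  shows "s = id \<or> (\<exists>a\<in>(\<Union>\<rho>. weights A \<rho>). s = reflection a) \<or> (\<forall>x. s x = x \<longrightarrow> x = 0)"
proof -
  have lin: "linear s" using weyl_linear[OF s] .
  note l = linear_neg[OF lin] linear_add[OF lin] linear_scale[OF lin] linear_diff[OF lin]
  show ?thesis
  proof (cases A)
    case (PGL3 a b c)
    note fr' = fr[unfolded PGL3]
    note i = PGL3_inner[OF fr']
    have fb: "frame_basis A = (a, b)" using PGL3 by simp
    have cyc: "\<forall>x. s x = x \<longrightarrow> x = 0" if h: "s (s a) + s a + a = 0" "s (s b) + s b + b = 0"
    proof (intro allI impI)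
      fix x assume sx: "s x = x"
      obtain p q where x: "x = p *\<^sub>R a + q *\<^sub>R b" using PGL3_decomposition[OF fr'] by blast
      have "s (s x) + s x + x = p *\<^sub>R (s (s a) + s a + a) + q *\<^sub>R (s (s b) + s b + b)"
        unfolding x by (simp add: l algebra_simps)
      then have "3 *\<^sub>R x = 0" using h sx using scaleR_left_distrib[of 2 1 x] by (simp add: scaleR_2)
      then show "x = 0" by simp
    qed
    have refl: "s = reflection w" if "s a = reflection w a" "s b = reflection w b" for w
      using linear_eq_on_frame_basis[OF fr fb lin linear_reflection] that by blast
    have w: "a \<in> (\<Union>\<rho>. weights A \<rho>)" "b \<in> (\<Union>\<rho>. weights A \<rho>)" "c \<in> (\<Union>\<rho>. weights A \<rho>)"
      unfolding PGL3 by (auto intro: exI[of _ Pi1])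
    have "(s a, s b, s c) \<in> {(a,b,c), (a,c,b), (b,a,c), (b,c,a), (c,a,b), (c,b,a)}"
      using weyl_PGL3_cases[OF fr'] s PGL3 by blast
    then show ?thesis
    proof (elim insertE emptyE)
      assume "(s a, s b, s c) = (a, b, c)"
      then have "s = id" using linear_eq_on_frame_basis[OF fr fb lin linear_id] by simp
      then show ?thesis by blast
    next
      assume "(s a, s b, s c) = (a, c, b)"
      then have "s = reflection a" using i by (intro refl) (simp_all add: reflection_def scaleR_2)
      then show ?thesis using w by blast
    next
      assume "(s a, s b, s c) = (b, a, c)"
      moreover have "a \<bullet> c / (a \<bullet> a) = - 1/2" "b \<bullet> c / (a \<bullet> a) = - 1/2" using i by (simp_all add: divide_simps)
      ultimately have "s = reflection c" using i by (intro refl) (simp_all add: reflection_def)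
      then show ?thesis using w by blast
    next
      assume "(s a, s b, s c) = (c, b, a)"
      then have "s = reflection b" using i by (intro refl) (simp_all add: reflection_def scaleR_2)
      then show ?thesis using w by blast
    next
      assume "(s a, s b, s c) = (b, c, a)"
      then have "\<forall>x. s x = x \<longrightarrow> x = 0" using i(10) by (intro cyc) auto
      then show ?thesis by blast
    next
      assume "(s a, s b, s c) = (c, a, b)"
      then have "\<forall>x. s x = x \<longrightarrow> x = 0" using i(10) by (intro cyc) auto
      then show ?thesis by blast
    qed
  next
    case (PGSp4 e f)
    note fr' = fr[unfolded PGSp4]
    note i = PGSp4_inner[OF fr']
    have fb: "frame_basis A = (e, f)" using PGSp4 by simp
    have refl: "s = reflection w" if "s e = reflection w e" "s f = reflection w f" for w
      using linear_eq_on_frame_basis[OF fr fb lin linear_reflection] that by blast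
    have w: "e \<in> (\<Union>\<rho>. weights A \<rho>)" "f \<in> (\<Union>\<rho>. weights A \<rho>)"
      "e + f \<in> (\<Union>\<rho>. weights A \<rho>)" "e - f \<in> (\<Union>\<rho>. weights A \<rho>)"
      unfolding PGSp4 by (auto intro: exI[of _ Spin] exI[of _ St])
    have rot: "\<forall>x. s x = x \<longrightarrow> x = 0" if h: "s (s e) = - e" "s (s f) = - f"
    proof (intro allI impI)
      fix x assume sx: "s x = x"
      obtain p q where x: "x = p *\<^sub>R e + q *\<^sub>R f" using PGSp4_decomposition[OF fr'] by blast
      have "s (s x) = - x" unfolding x by (simp add: l h)
      then show "x = 0" using sx eq_minus_self_iff[of x] by simp
    qed
    have "(s e, s f) \<in> {(e,f), (e,-f), (-e,f), (-e,-f), (f,e), (f,-e), (-f,e), (-f,-e)}"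
      using weyl_PGSp4_cases[OF fr'] s PGSp4 by blast
    then show ?thesis
    proof (elim insertE emptyE)
      assume "(s e, s f) = (e, f)"
      then have "s = id" using linear_eq_on_frame_basis[OF fr fb lin linear_id] by simp
      then show ?thesis by blast
    next
      assume "(s e, s f) = (e, - f)"
      then have "s = reflection e" using i by (intro refl) (simp_all add: reflection_def scaleR_2)
      then show ?thesis using w by blast
    next
      assume "(s e, s f) = (- e, f)"
      then have "s = reflection f" using i by (intro refl) (simp_all add: reflection_def scaleR_2)
      then show ?thesis using w by blast
    next
      assume "(s e, s f) = (f, e)"
      then have "s = reflection (e + f)"
        using i by (intro refl) (simp_all add: reflection_def inner_add_left inner_add_right)
      then show ?thesis using w by blast
    next
      assume "(s e, s f) = (- f, - e)"
      then have "s = reflection (e - f)"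
        using i by (intro refl) (simp_all add: reflection_def inner_diff_left inner_diff_right)
      then show ?thesis using w by blast
    next
      assume h: "(s e, s f) = (- e, - f)"
      have "x = 0" if sx: "s x = x" for x
      proof -
        obtain p q where x: "x = p *\<^sub>R e + q *\<^sub>R f" using PGSp4_decomposition[OF fr'] by blast
        have "s x = - x" unfolding x using h by (simp add: l)
        then show "x = 0" using sx eq_minus_self_iff[of x] by simp
      qed
      then show ?thesis by blast
    next
      assume "(s e, s f) = (f, - e)"
      then have "\<forall>x. s x = x \<longrightarrow> x = 0" by (intro rot) (simp_all add: l)
      then show ?thesis by blast
    next
      assume "(s e, s f) = (- f, e)"
      then have "\<forall>x. s x = x \<longrightarrow> x = 0" by (intro rot) (simp_all add: l)
      then show ?thesis by blast
    qed
  qed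
qed

lemma weight_projection_integral:
  assumes fr: "apartment_frame A" and a: "a \<in> weights A \<rho>" and v: "v \<in> coweights A"
  shows "2 * (v \<bullet> a) / (a \<bullet> a) \<in> \<int>"
proof (cases A)
  case (PGL3 a1 a2 a3)
  note fr' = fr[unfolded PGL3]
  note i = PGL3_inner[OF fr']
  obtain c1 c2 c3 :: int where v: "v = of_int c1 *\<^sub>R a1 + of_int c2 *\<^sub>R a2 + of_int c3 *\<^sub>R a3"
    using v PGL3 by auto
  have nz: "a1 \<bullet> a1 \<noteq> 0" using i(1) by linarith
  note j = i(2-9)
  have f: "2 * (v \<bullet> a1) / (a1 \<bullet> a1) = of_int (2 * c1 - c2 - c3)"
    "2 * (v \<bullet> a2) / (a1 \<bullet> a1) = of_int (2 * c2 - c1 - c3)"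
    "2 * (v \<bullet> a3) / (a1 \<bullet> a1) = of_int (2 * c3 - c1 - c2)"
    unfolding v using nz by (simp_all add: inner_add_left j field_simps)
  have g: "2 * (v \<bullet> x) / (x \<bullet> x) \<in> \<int>" if "x \<in> {a1, a2, a3}" for x
    using that f by (auto simp: j simp del: of_int_diff of_int_mult)
  from a PGL3 obtain x where "x \<in> {a1, a2, a3}" "a = x \<or> a = - x"
    by (cases \<rho>) auto
  then show ?thesis using g[of x] by auto
next
  case (PGSp4 e f)
  note i = PGSp4_inner[OF fr[unfolded PGSp4]]
  obtain c1 c2 :: int where v: "v = of_int c1 *\<^sub>R e + of_int c2 *\<^sub>R f"
    using v PGSp4 by auto
  show ?thesis using a unfolding PGSp4 v
    by (cases \<rho>) (auto simp: i inner_add_left inner_add_right inner_diff_left inner_diff_right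
        add_divide_distrib diff_divide_distrib)
qed

section \<open>Dual pairs of representations\<close>

text \<open>
  The pairs \<open>{\<pi>, \<pi>'}\<close> under comparison, with the condition that \<open>A\<close> is an apartment.
\<close>

definition dual_reps :: "'v::euclidean_space apartment \<Rightarrow> rep \<Rightarrow> rep \<Rightarrow> bool" where
  "dual_reps A \<pi> \<pi>' \<longleftrightarrow> apartment_frame A \<and>
     ((is_PGL3 A \<and> {\<pi>, \<pi>'} = {Pi1, Pi2}) \<or> (is_PGSp4 A \<and> {\<pi>, \<pi>'} = {Spin, St}))"

lemma dual_reps_cases:
  assumes "dual_reps A \<pi> \<pi>'"
  obtains (A2) a b c where "A = PGL3 a b c" "apartment_frame (PGL3 a b c)"
      "weights A \<pi> = {a, b, c}" "weights A \<pi>' = {- a, - b, - c}" "n_rep \<pi>' = 1" "\<pi> = Pi1" "\<pi>' = Pi2"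
  | (A2') a b c where "A = PGL3 a b c" "apartment_frame (PGL3 a b c)"
      "weights A \<pi> = {- a, - b, - c}" "weights A \<pi>' = {a, b, c}" "n_rep \<pi>' = 1" "\<pi> = Pi2" "\<pi>' = Pi1"
  | (Spin) e f where "A = PGSp4 e f" "apartment_frame (PGSp4 e f)"
      "weights A \<pi> = {e, - e, f, - f}" "weights A \<pi>' = {e + f, e - f, - e + f, - e - f}"
      "n_rep \<pi>' = 1" "\<pi> = rep.Spin" "\<pi>' = St"
  | (St) e f where "A = PGSp4 e f" "apartment_frame (PGSp4 e f)"
      "weights A \<pi> = {e + f, e - f, - e + f, - e - f}" "weights A \<pi>' = {e, - e, f, - f}"
      "n_rep \<pi>' = 2" "\<pi> = rep.St" "\<pi>' = rep.Spin"
  using assms unfolding dual_reps_def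
  by (cases A) (auto simp: doubleton_eq_iff simp del: apartment_frame.simps)

text \<open>
  Two weights that may follow each other as central edges of a geodesic gallery. In type affine
  \<open>A\<^sub>2\<close> opposites of weights of \<open>\<pi>\<close> are not weights of \<open>\<pi>\<close>, and the last condition is void.
\<close>

definition adjacent :: "'v::euclidean_space apartment \<Rightarrow> rep \<Rightarrow> 'v \<Rightarrow> 'v \<Rightarrow> bool" where
  "adjacent A \<pi> d d' \<longleftrightarrow> d \<in> weights A \<pi> \<and> d' \<in> weights A \<pi> \<and> d' \<noteq> d \<and> d' \<noteq> - d"

text \<open>
  For adjacent weights, a linear form, represented by a vector, with value \<open>1\<close> on \<open>d\<close> and \<open>-1\<close> on
  \<open>d'\<close>. It vanishes on \<open>d + d'\<close>, and its integer levels are the walls with that direction.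
\<close>

definition edge_form :: "'v::euclidean_space \<Rightarrow> 'v \<Rightarrow> 'v" where
  "edge_form d d' = (1 / ((d - d') \<bullet> d)) *\<^sub>R (d - d')"

lemma adjacent_inner:
  assumes du: "dual_reps A \<pi> \<pi>'" and ad: "adjacent A \<pi> d d'"
  shows "d \<bullet> d > 0" "d' \<bullet> d' = d \<bullet> d"
    "(is_PGL3 A \<and> n_rep \<pi>' = 1 \<and> d \<bullet> d' = - (d \<bullet> d) / 2 \<and> weights A \<pi> = {d, d', - d - d'}) \<or>
     (is_PGSp4 A \<and> d \<bullet> d = n_rep \<pi>' \<and> n_rep \<pi>' \<in> {1, 2} \<and> d \<bullet> d' = 0 \<and> weights A \<pi> = {d, d', - d, - d'})"
proof -
  have "d \<bullet> d > 0 \<and> d' \<bullet> d' = d \<bullet> d \<and> ((is_PGL3 A \<and> n_rep \<pi>' = 1 \<and> d \<bullet> d' = - (d \<bullet> d) / 2 \<and> weights A \<pi> = {d, d', - d - d'}) \<or>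
     (is_PGSp4 A \<and> d \<bullet> d = n_rep \<pi>' \<and> n_rep \<pi>' \<in> {1, 2} \<and> d \<bullet> d' = 0 \<and> weights A \<pi> = {d, d', - d, - d'}))"
    using du
  proof (cases rule: dual_reps_cases)
    case (A2 a b c)
    note i = PGL3_inner(1-9)[OF A2(2)]
    have c: "- a - b = c" "- b - a = c" "- a - c = b" "- c - a = b" "- b - c = a" "- c - b = a"
      using PGL3_inner(10)[OF A2(2)] by simp_all
    have "(d, d') \<in> {(a,b),(b,a),(a,c),(c,a),(b,c),(c,b)}"
      using ad A2(3) unfolding adjacent_def by auto
    then show ?thesis using A2(1,5) i(1)
      by (elim insertE emptyE) (simp_all add: i A2(3)[unfolded A2(1)] c insert_commute)
  next
    case (A2' a b c)
    note i = PGL3_inner(1-9)[OF A2'(2)]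
    have c: "a + b = - c" "b + a = - c" "a + c = - b" "c + a = - b" "b + c = - a" "c + b = - a"
      using PGL3_inner(10)[OF A2'(2)] by simp_all
    have "(d, d') \<in> {(-a,-b),(-b,-a),(-a,-c),(-c,-a),(-b,-c),(-c,-b)}"
      using ad A2'(3) unfolding adjacent_def by auto
    then show ?thesis using A2'(1,5) i(1)
      by (elim insertE emptyE) (simp_all add: i A2'(3)[unfolded A2'(1)] c insert_commute)
  next
    case (Spin e f)
    note i = PGSp4_inner[OF Spin(2)]
    have "(d, d') \<in> {(e,f),(e,-f),(-e,f),(-e,-f),(f,e),(f,-e),(-f,e),(-f,-e)}"
      using ad Spin(3) unfolding adjacent_def by auto
    then show ?thesis using i Spin by auto
  next
    case (St e f)
    note i = PGSp4_inner[OF St(2)]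
    have "(d, d') \<in> {(e+f,e-f),(e+f,-e+f),(-e-f,e-f),(-e-f,-e+f),(e-f,e+f),(e-f,-e-f),(-e+f,e+f),(-e+f,-e-f)}"
      using ad St(3) unfolding adjacent_def by auto
    then have "d \<bullet> d = 2 \<and> d' \<bullet> d' = 2 \<and> d \<bullet> d' = 0 \<and> {e + f, e - f, - e + f, - e - f} = {d, d', - d, - d'}"
      by (elim insertE emptyE)
        (simp_all add: i inner_add_left inner_add_right inner_diff_left inner_diff_right insert_commute
          add.commute[of f e])
    then show ?thesis using St(1,5) unfolding St(3) by simp
  qed
  then show "d \<bullet> d > 0" "d' \<bullet> d' = d \<bullet> d"
    "(is_PGL3 A \<and> n_rep \<pi>' = 1 \<and> d \<bullet> d' = - (d \<bullet> d) / 2 \<and> weights A \<pi> = {d, d', - d - d'}) \<or>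
     (is_PGSp4 A \<and> d \<bullet> d = n_rep \<pi>' \<and> n_rep \<pi>' \<in> {1, 2} \<and> d \<bullet> d' = 0 \<and> weights A \<pi> = {d, d', - d, - d'})"
    by blast+
qed

lemma edge_form_inner:
  assumes du: "dual_reps A \<pi> \<pi>'" and ad: "adjacent A \<pi> d d'"
  shows "edge_form d d' \<bullet> d = 1" "edge_form d d' \<bullet> d' = - 1"
proof -
  note i = adjacent_inner[OF assms]
  have "d \<bullet> d' \<le> 0" using i(1) i(3) by (elim disjE conjE) linarith+
  moreover have "(d - d') \<bullet> d = d \<bullet> d - d \<bullet> d'" by (simp add: inner_diff_left inner_commute[of d' d])
  ultimately have nz: "(d - d') \<bullet> d \<noteq> 0" using i(1) by linarith
  then show "edge_form d d' \<bullet> d = 1" by (simp add: edge_form_def)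
  have "(d - d') \<bullet> d' = - ((d - d') \<bullet> d)"
    using i(2) by (simp add: inner_diff_left inner_commute[of d' d])
  then show "edge_form d d' \<bullet> d' = - 1" using nz by (simp add: edge_form_def)
qed

lemma adjacent_sum_dual_weight:
  assumes du: "dual_reps A \<pi> \<pi>'" and ad: "adjacent A \<pi> d d'"
  shows "\<exists>D\<in>weights A \<pi>'. of_nat (n_rep \<pi>') *\<^sub>R D = d + d'"
  using du
proof (cases rule: dual_reps_cases)
  case (A2 a b c)
  have c: "a + b = - c" "b + a = - c" "a + c = - b" "c + a = - b" "b + c = - a" "c + b = - a"
    using PGL3_inner(10)[OF A2(2)] by simp_all
  have "(d, d') \<in> {(a,b),(b,a),(a,c),(c,a),(b,c),(c,b)}"
    using ad A2(3) unfolding adjacent_def by auto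
  then show ?thesis using A2(4,5) c by auto
next
  case (A2' a b c)
  have m: "- a + - b = c" "- b + - a = c" "- a + - c = b" "- c + - a = b" "- b + - c = a" "- c + - b = a"
    using PGL3_inner(10)[OF A2'(2)] by simp_all
  have "(d, d') \<in> {(-a,-b),(-b,-a),(-a,-c),(-c,-a),(-b,-c),(-c,-b)}"
    using ad A2'(3) unfolding adjacent_def by auto
  then have "d + d' \<in> weights A \<pi>'" unfolding A2'(4) using m by (elim insertE emptyE) simp_all
  then show ?thesis using A2'(5) by auto
next
  case (Spin e f)
  have "(d, d') \<in> {(e,f),(e,-f),(-e,f),(-e,-f),(f,e),(f,-e),(-f,e),(-f,-e)}"
    using ad Spin(3) unfolding adjacent_def by auto
  then have "d + d' \<in> weights A \<pi>'" unfolding Spin(4) by (auto simp: algebra_simps)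
  then show ?thesis using Spin(5) by auto
next
  case (St e f)
  have "d \<in> {e+f,-e-f} \<and> d' \<in> {e-f,-e+f} \<or> d' \<in> {e+f,-e-f} \<and> d \<in> {e-f,-e+f}"
    using ad St(3) unfolding adjacent_def by auto
  then have "d + d' \<in> {2 *\<^sub>R e, 2 *\<^sub>R (- e), 2 *\<^sub>R f, 2 *\<^sub>R (- f)}"
    by (auto simp: scaleR_2)
  then show ?thesis using St(4,5) by auto
qed

lemma dual_weight_adjacent_sum:
  assumes du: "dual_reps A \<pi> \<pi>'" and D: "D \<in> weights A \<pi>'"
  shows "\<exists>d d'. adjacent A \<pi> d d' \<and> of_nat (n_rep \<pi>') *\<^sub>R D = d + d'"
  using du
proof (cases rule: dual_reps_cases)
  case (A2 a b c)
  note dis = PGL3_distinct[OF A2(2)]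
  have ad: "adjacent A \<pi> b c" "adjacent A \<pi> a c" "adjacent A \<pi> a b"
    using dis unfolding adjacent_def A2(3) by (auto simp: minus_equation_iff equation_minus_iff)
  have "- a = b + c" "- b = a + c" "- c = a + b"
    using PGL3_inner(10)[OF A2(2)] by simp_all
  then show ?thesis using D ad unfolding A2(4,5) by auto
next
  case (A2' a b c)
  note dis = PGL3_distinct[OF A2'(2)]
  have ad: "adjacent A \<pi> (- b) (- c)" "adjacent A \<pi> (- a) (- c)" "adjacent A \<pi> (- a) (- b)"
    using dis unfolding adjacent_def A2'(3) by (auto simp: minus_equation_iff equation_minus_iff)
  have "a = - b + - c" "b = - a + - c" "c = - a + - b"
    using PGL3_inner(10)[OF A2'(2)] by simp_all
  then show ?thesis using D ad unfolding A2'(4,5)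
    by (elim insertE emptyE) (metis of_nat_1 scaleR_one)+
next
  case (Spin e f)
  note dis = PGSp4_distinct[OF Spin(2)]
  have "adjacent A \<pi> e f" "adjacent A \<pi> e (- f)" "adjacent A \<pi> (- e) f" "adjacent A \<pi> (- e) (- f)"
    using dis unfolding adjacent_def Spin(3) by (auto simp: minus_equation_iff equation_minus_iff)
  moreover have "e - f = e + - f" "- e - f = - e + - f" by simp_all
  ultimately show ?thesis using D unfolding Spin(4,5) of_nat_1 scaleR_one
    by (elim insertE emptyE) blast+
next
  case (St e f)
  have nz: "e \<noteq> 0" "f \<noteq> 0" using PGSp4_inner[OF St(2)] by auto
  have "adjacent A \<pi> (e + f) (e - f)" "adjacent A \<pi> (- e + f) (- e - f)"
    "adjacent A \<pi> (e + f) (- e + f)" "adjacent A \<pi> (e - f) (- e - f)"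
    using nz unfolding adjacent_def St(3) by (auto simp: algebra_simps eq_neg_iff_add_eq_0 scaleR_2[symmetric] eq_minus_self_iff)
  moreover have "2 *\<^sub>R e = (e + f) + (e - f)" "2 *\<^sub>R (- e) = (- e + f) + (- e - f)"
    "2 *\<^sub>R f = (e + f) + (- e + f)" "2 *\<^sub>R (- f) = (e - f) + (- e - f)"
    by (simp_all add: scaleR_2)
  ultimately show ?thesis using D unfolding St(4,5) of_nat_numeral
    by (elim insertE emptyE) blast+
qed

lemma adjacent_pair_unique:
  assumes du: "dual_reps A \<pi> \<pi>'" and ad: "adjacent A \<pi> d d'" and ad': "adjacent A \<pi> c c'"
    and sum: "c + c' = d + d'"
  shows "(c = d \<and> c' = d') \<or> (c = d' \<and> c' = d)"
proof -
  note i = adjacent_inner[OF du ad]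
  have c'e: "c' = d + d' - c" using sum by (simp add: algebra_simps)
  have cW: "c \<in> weights A \<pi>" "c' \<in> weights A \<pi>" using ad' unfolding adjacent_def by blast+
  have all: "x \<bullet> x = d \<bullet> d" if "x \<in> weights A \<pi>" for x
    using that i(2,3) by (auto simp: inner_add_left inner_add_right inner_diff_left inner_diff_right inner_commute[of d' d])
  have nc: "(d + d' - c) \<bullet> (d + d' - c) = d \<bullet> d" using all[OF cW(2)] unfolding c'e .
  have dd: "d' \<bullet> d = d \<bullet> d'" by (rule inner_commute)
  have "c = d \<or> c = d'" using i(3)
  proof (elim disjE conjE)
    assume h: "d \<bullet> d' = - (d \<bullet> d) / 2" "weights A \<pi> = {d, d', - d - d'}"
    have "c \<noteq> - d - d'"
    proof
      assume "c = - d - d'"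
      then have "(d + d' - c) \<bullet> (d + d' - c) = 4 * (d \<bullet> d)"
        using h(1) i(2) by (simp add: inner_add_left inner_add_right inner_diff_left inner_diff_right dd)
      then show False using nc i(1) by linarith
    qed
    then show ?thesis using cW(1) h(2) by blast
  next
    assume h: "d \<bullet> d' = 0" "weights A \<pi> = {d, d', - d, - d'}"
    have "c \<noteq> - d" "c \<noteq> - d'"
    proof -
      have "(d + d' - c) \<bullet> (d + d' - c) = 5 * (d \<bullet> d)" if "c = - d \<or> c = - d'"
        using that h(1) i(2)
        by (auto simp: inner_add_left inner_add_right inner_diff_left inner_diff_right dd)
      then show "c \<noteq> - d" "c \<noteq> - d'" using nc i(1) by linarith+
    qed
    then show ?thesis using cW(1) h(2) by blast
  qed
  then show ?thesis using sum by auto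
qed

lemma Union_weights:
  "(\<Union>\<rho>. weights (PGL3 a b c) \<rho>) = {a, b, c, - a, - b, - c}"
  "(\<Union>\<rho>. weights (PGSp4 e f) \<rho>) = {e, - e, f, - f, e + f, e - f, - e + f, - e - f}"
proof -
  have U: "UNIV = {Pi1, Pi2, Spin, St}" by (auto intro: rep.exhaust)
  show "(\<Union>\<rho>. weights (PGL3 a b c) \<rho>) = {a, b, c, - a, - b, - c}"
    "(\<Union>\<rho>. weights (PGSp4 e f) \<rho>) = {e, - e, f, - f, e + f, e - f, - e + f, - e - f}"
    unfolding U by auto
qed

lemma weights_parallel:
  assumes fr: "apartment_frame A" and a: "a \<in> (\<Union>\<rho>. weights A \<rho>)" and D: "D \<in> (\<Union>\<rho>. weights A \<rho>)"
    and par: "D = r *\<^sub>R a"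
  shows "D = a \<or> D = - a"
proof -
  have sq: "(D \<bullet> a) * (D \<bullet> a) = (D \<bullet> D) * (a \<bullet> a)" using par by simp
  show ?thesis
  proof (cases A)
    case (PGL3 a1 a2 a3)
    note i = PGL3_inner(1-9)[OF fr[unfolded PGL3]]
    obtain y where y: "y \<in> {a1, a2, a3}" "a = y \<or> a = - y"
      using a unfolding PGL3 Union_weights by auto
    obtain x where x: "x \<in> {a1, a2, a3}" "D = x \<or> D = - x"
      using D unfolding PGL3 Union_weights by auto
    have "(x \<bullet> y) * (x \<bullet> y) = (x \<bullet> x) * (y \<bullet> y)" using sq x(2) y(2) by auto
    then have "x = y" using x(1) y(1) i(1)
      by (elim insertE emptyE) (simp_all add: i(2-9))
    then show ?thesis using x(2) y(2) by auto
  next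
    case (PGSp4 e f)
    note i = PGSp4_inner[OF fr[unfolded PGSp4]]
    have "a \<in> {e, f, e + f, e - f} \<union> uminus ` {e, f, e + f, e - f}"
      using a unfolding PGSp4 Union_weights by auto
    then obtain y where y: "y \<in> {e, f, e + f, e - f}" "a = y \<or> a = - y" by blast
    have "D \<in> {e, f, e + f, e - f} \<union> uminus ` {e, f, e + f, e - f}"
      using D unfolding PGSp4 Union_weights by auto
    then obtain x where x: "x \<in> {e, f, e + f, e - f}" "D = x \<or> D = - x" by blast
    have "(x \<bullet> y) * (x \<bullet> y) = (x \<bullet> x) * (y \<bullet> y)" using sq x(2) y(2) by auto
    then have "x = y" using x(1) y(1)
      by (elim insertE emptyE)
        (simp_all add: i inner_add_left inner_add_right inner_diff_left inner_diff_right)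
    then show ?thesis using x(2) y(2) by auto
  qed
qed

lemma weights_nonzero: "apartment_frame A \<Longrightarrow> a \<in> (\<Union>\<rho>. weights A \<rho>) \<Longrightarrow> a \<bullet> a > 0"
proof (induction A)
  case (PGL3 a1 a2 a3)
  then show ?case using PGL3_inner(1-9)[OF PGL3(1)] unfolding Union_weights by auto
next
  case (PGSp4 e f)
  then show ?case using PGSp4_inner[OF PGSp4(1)] PGSp4_sum_nonzero[OF PGSp4(1)] unfolding Union_weights
    by (auto simp: inner_add_left inner_add_right inner_diff_left inner_diff_right)
qed

lemma card_parallel_dual_weights:
  assumes du: "dual_reps A \<pi> \<pi>'" and a: "a \<in> (\<Union>\<rho>. weights A \<rho>)"
  shows "card ({a, - a} \<inter> weights A \<pi>') = delta A \<pi> a"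
proof -
  have fr: "apartment_frame A" using du unfolding dual_reps_def by blast
  have "a \<noteq> - a" using weights_nonzero[OF fr a] eq_minus_self_iff[of a] by auto
  show ?thesis using du
  proof (cases rule: dual_reps_cases)
    case (A2 a1 a2 a3)
    have neg: "x \<noteq> - y" if "x \<in> {a1, a2, a3}" "y \<in> {a1, a2, a3}" for x y
      using that PGL3_distinct(4-6)[OF A2(2)] PGL3_inner(1-3)[OF A2(2)]
      by (auto simp: minus_equation_iff equation_minus_iff eq_minus_self_iff)
    obtain y where y: "y \<in> {a1, a2, a3}" "a = y \<or> a = - y"
      using a unfolding A2(1) Union_weights by auto
    then have "{a, - a} \<inter> weights A \<pi>' = {- y}" unfolding A2(4) using neg[OF y(1)] by auto
    then show ?thesis using A2(1) by simp
  next
    case (A2' a1 a2 a3)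
    have neg: "x \<noteq> - y" if "x \<in> {a1, a2, a3}" "y \<in> {a1, a2, a3}" for x y
      using that PGL3_distinct(4-6)[OF A2'(2)] PGL3_inner(1-3)[OF A2'(2)]
      by (auto simp: minus_equation_iff equation_minus_iff eq_minus_self_iff)
    obtain y where y: "y \<in> {a1, a2, a3}" "a = y \<or> a = - y"
      using a unfolding A2'(1) Union_weights by auto
    then have "{a, - a} \<inter> weights A \<pi>' = {y}" unfolding A2'(4) using neg[OF _ y(1)] by auto
    then show ?thesis using A2'(1) by simp
  next
    case (Spin e f)
    note i = PGSp4_inner[OF Spin(2)]
    have sq: "x \<bullet> x = 1" if "x \<in> weights A \<pi>" for x using that i unfolding Spin(3) by auto
    have sq': "x \<bullet> x = 2" if "x \<in> weights A \<pi>'" for x using that i unfolding Spin(4)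
      by (auto simp: inner_add_left inner_add_right inner_diff_left inner_diff_right)
    have "a \<in> weights A \<pi> \<or> a \<in> weights A \<pi>'"
      using a unfolding Spin(3,4) unfolding Spin(1) Union_weights by blast
    then show ?thesis
    proof
      assume h: "a \<in> weights A \<pi>"
      then have "{a, - a} \<inter> weights A \<pi>' = {}" using sq[OF h] sq' by force
      then show ?thesis using h Spin(1) by simp
    next
      assume h: "a \<in> weights A \<pi>'"
      then have "- a \<in> weights A \<pi>'" unfolding Spin(4) by auto
      then have "{a, - a} \<inter> weights A \<pi>' = {a, - a}" using h by blast
      moreover have "a \<notin> weights A \<pi>" using sq sq'[OF h] by force
      ultimately show ?thesis using \<open>a \<noteq> - a\<close> Spin(1) by simp
    qed
  next
    case (St e f)
    note i = PGSp4_inner[OF St(2)]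
    have sq: "x \<bullet> x = 2" if "x \<in> weights A \<pi>" for x using that i unfolding St(3)
      by (auto simp: inner_add_left inner_add_right inner_diff_left inner_diff_right)
    have sq': "x \<bullet> x = 1" if "x \<in> weights A \<pi>'" for x using that i unfolding St(4) by auto
    have "a \<in> weights A \<pi> \<or> a \<in> weights A \<pi>'"
      using a unfolding St(3,4) unfolding St(1) Union_weights by blast
    then show ?thesis
    proof
      assume h: "a \<in> weights A \<pi>"
      then have "{a, - a} \<inter> weights A \<pi>' = {}" using sq[OF h] sq' by force
      then show ?thesis using h St(1) by simp
    next
      assume h: "a \<in> weights A \<pi>'"
      then have "- a \<in> weights A \<pi>'" unfolding St(4) by auto
      then have "{a, - a} \<inter> weights A \<pi>' = {a, - a}" using h by blast
      moreover have "a \<notin> weights A \<pi>" using sq sq'[OF h] by force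
      ultimately show ?thesis using \<open>a \<noteq> - a\<close> St(1) by simp
    qed
  qed
qed

text \<open>
  If \<open>n_rep \<pi>' = 2\<close>, then a gallery for \<open>\<pi>\<close> keeps to vertices of one type, while a step along a weight of
  \<open>\<pi>'\<close> changes the type.
\<close>

lemma coroot_parity:
  assumes du: "dual_reps A \<pi> \<pi>'" and n: "n_rep \<pi>' = 2"
  shows "weights A \<pi> \<subseteq> coroots A"
    and "D \<in> weights A \<pi>' \<Longrightarrow> of_int m *\<^sub>R D \<in> coroots A \<longleftrightarrow> even m"
proof -
  obtain e f where St: "A = PGSp4 e f" "apartment_frame (PGSp4 e f)"
      "weights A \<pi> = {e + f, e - f, - e + f, - e - f}" "weights A \<pi>' = {e, - e, f, - f}"
    using du n by (cases rule: dual_reps_cases) auto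
  note i = PGSp4_inner[OF St(2)]
  have mem: "of_int x *\<^sub>R e + of_int y *\<^sub>R f \<in> coroots A \<longleftrightarrow> even (x + y)" for x y :: int
  proof
    assume "of_int x *\<^sub>R e + of_int y *\<^sub>R f \<in> coroots A"
    then obtain x' y' :: int where h: "of_int x *\<^sub>R e + of_int y *\<^sub>R f = of_int x' *\<^sub>R e + of_int y' *\<^sub>R f"
      "even (x' + y')" using St(1) by auto
    have "x = x'" using arg_cong[OF h(1), of "\<lambda>z. z \<bullet> e"] i by (simp add: inner_add_left)
    moreover have "y = y'" using arg_cong[OF h(1), of "\<lambda>z. z \<bullet> f"] i by (simp add: inner_add_left)
    ultimately show "even (x + y)" using h(2) by simp
  qed (auto simp: St(1))
  show "weights A \<pi> \<subseteq> coroots A"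
    using mem[of 1 1] mem[of 1 "-1"] mem[of "-1" 1] mem[of "-1" "-1"] unfolding St(3) by simp
  show "of_int m *\<^sub>R D \<in> coroots A \<longleftrightarrow> even m" if "D \<in> weights A \<pi>'"
    using that mem[of m 0] mem[of "-m" 0] mem[of 0 m] mem[of 0 "-m"] unfolding St(4) by auto
qed

lemma coweights_dual:
  assumes du: "dual_reps A \<pi> \<pi>'" and ad: "adjacent A \<pi> d d'"
    and D: "D \<in> weights A \<pi>'" "of_nat (n_rep \<pi>') *\<^sub>R D = d + d'"
  shows "x \<in> coweights A \<longleftrightarrow> (\<exists>m j :: int. x = of_int m *\<^sub>R D + of_int j *\<^sub>R d)"
proof
  assume "\<exists>m j :: int. x = of_int m *\<^sub>R D + of_int j *\<^sub>R d"
  moreover have "D \<in> coweights A" "d \<in> coweights A"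
    using weights_subset_coweights D(1) ad unfolding adjacent_def by blast+
  ultimately show "x \<in> coweights A" using coweights_add coweights_scale by blast
next
  assume x: "x \<in> coweights A"
  define M where "M = {of_int m *\<^sub>R D + of_int j *\<^sub>R d | m j :: int. True}"
  have add: "u + v \<in> M" if uv: "u \<in> M" "v \<in> M" for u v
  proof -
    obtain m j m' j' :: int where "u = of_int m *\<^sub>R D + of_int j *\<^sub>R d" "v = of_int m' *\<^sub>R D + of_int j' *\<^sub>R d"
      using uv unfolding M_def by blast
    then have "u + v = of_int (m + m') *\<^sub>R D + of_int (j + j') *\<^sub>R d" by (simp add: algebra_simps)
    then show ?thesis unfolding M_def by blast
  qed
  have scale: "of_int n *\<^sub>R u \<in> M" if u: "u \<in> M" for u n
  proof -
    obtain m j :: int where "u = of_int m *\<^sub>R D + of_int j *\<^sub>R d" using u unfolding M_def by blast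
    then have "of_int n *\<^sub>R u = of_int (n * m) *\<^sub>R D + of_int (n * j) *\<^sub>R d" by (simp add: algebra_simps)
    then show ?thesis unfolding M_def by blast
  qed
  have minus: "- u \<in> M" if "u \<in> M" for u using scale[OF that, of "- 1"] by simp
  have dM: "d \<in> M" unfolding M_def by (rule CollectI, rule exI[of _ 0], rule exI[of _ 1]) simp
  have DM: "D \<in> M" unfolding M_def by (rule CollectI, rule exI[of _ 1], rule exI[of _ 0]) simp
  have "of_int (int (n_rep \<pi>')) *\<^sub>R D + - d \<in> M" using add scale minus dM DM by blast
  then have d'M: "d' \<in> M" using D(2) by simp
  have W: "weights A \<pi> \<subseteq> M"
    using adjacent_inner(3)[OF du ad] dM d'M minus[OF dM] minus[OF d'M]
      add[OF minus[OF dM] minus[OF d'M]] by auto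
  have "x \<in> M" using du
  proof (cases rule: dual_reps_cases)
    case (A2 a b c)
    then have "a \<in> M" "b \<in> M" "c \<in> M" using W by auto
    then show ?thesis using x A2(1) add scale by auto
  next
    case (A2' a b c)
    then have "- a \<in> M" "- b \<in> M" "- c \<in> M" using W by auto
    then have "a \<in> M" "b \<in> M" "c \<in> M" using minus[of "- a"] minus[of "- b"] minus[of "- c"] by auto
    then show ?thesis using x A2'(1) add scale by auto
  next
    case (Spin e f)
    then have "e \<in> M" "f \<in> M" using W by auto
    then show ?thesis using x Spin(1) add scale by auto
  next
    case (St e f)
    have ef: "e + f \<in> M" using W St(3) by auto
    have "e \<in> M \<or> f \<in> M" using DM minus[OF DM] D(1) St(4) by auto
    then have "e \<in> M" "f \<in> M"
      using add[OF ef minus[of e]] add[OF ef minus[of f]] by auto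
    then show ?thesis using x St(1) add scale by auto
  qed
  then show "\<exists>m j :: int. x = of_int m *\<^sub>R D + of_int j *\<^sub>R d" unfolding M_def by blast
qed

section \<open>Rational and semi-rational lines\<close>

lemma edge_form_swap: "x \<bullet> x = y \<bullet> y \<Longrightarrow> edge_form y x = - edge_form x y"
proof -
  assume h: "x \<bullet> x = y \<bullet> y"
  have "(y - x) \<bullet> y = (x - y) \<bullet> x" using h by (simp add: inner_diff_left inner_commute[of y x])
  then show ?thesis unfolding edge_form_def by (simp flip: scaleR_minus_right)
qed

lemma edge_form_minus: "edge_form (- x) (- y) = - edge_form x y"
proof -
  have "(- x - - y) \<bullet> - x = (x - y) \<bullet> x" by (simp add: inner_diff_left)
  moreover have "- x - - y = - (x - y)" by simp
  ultimately show ?thesis unfolding edge_form_def by (metis scaleR_minus_right)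
qed

lemma skeleton_PGL3:
  assumes fr: "apartment_frame (PGL3 a b c)"
  shows "x \<in> skeleton (PGL3 a b c) \<longleftrightarrow>
    edge_form a b \<bullet> x \<in> \<int> \<or> edge_form b c \<bullet> x \<in> \<int> \<or> edge_form a c \<bullet> x \<in> \<int>"
proof -
  note i = PGL3_inner[OF fr]
  have nz: "a \<bullet> a \<noteq> 0" using i(1) by linarith
  have ed: "edge_form a b \<bullet> (c1 *\<^sub>R a + c2 *\<^sub>R b + c3 *\<^sub>R c) = c1 - c2"
    "edge_form b c \<bullet> (c1 *\<^sub>R a + c2 *\<^sub>R b + c3 *\<^sub>R c) = c2 - c3"
    "edge_form a c \<bullet> (c1 *\<^sub>R a + c2 *\<^sub>R b + c3 *\<^sub>R c) = c1 - c3" for c1 c2 c3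
    unfolding edge_form_def using nz
    by (simp_all add: inner_add_right inner_diff_left i(2-9) field_simps)
  obtain p q where x: "x = p *\<^sub>R a + q *\<^sub>R b + 0 *\<^sub>R c" using PGL3_decomposition[OF fr, of x] by auto
  have s1: "{c1 *\<^sub>R a + c2 *\<^sub>R b + c3 *\<^sub>R c | c1 c2 c3. c1 - c2 = of_int k} = {x. edge_form a b \<bullet> x = of_int k}"
    and s2: "{c1 *\<^sub>R a + c2 *\<^sub>R b + c3 *\<^sub>R c | c1 c2 c3. c2 - c3 = of_int k} = {x. edge_form b c \<bullet> x = of_int k}"
    and s3: "{c1 *\<^sub>R a + c2 *\<^sub>R b + c3 *\<^sub>R c | c1 c2 c3. c1 - c3 = of_int k} = {x. edge_form a c \<bullet> x = of_int k}"
    for k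
  proof -
    have ex: "\<exists>c1 c2 c3. x = c1 *\<^sub>R a + c2 *\<^sub>R b + c3 *\<^sub>R c" for x
      using PGL3_decomposition[OF fr, of x] by (metis add.right_neutral scaleR_zero_left)
    show "{c1 *\<^sub>R a + c2 *\<^sub>R b + c3 *\<^sub>R c | c1 c2 c3. c1 - c2 = of_int k} = {x. edge_form a b \<bullet> x = of_int k}"
      using ed(1) ex by (auto, metis)
    show "{c1 *\<^sub>R a + c2 *\<^sub>R b + c3 *\<^sub>R c | c1 c2 c3. c2 - c3 = of_int k} = {x. edge_form b c \<bullet> x = of_int k}"
      using ed(2) ex by (auto, metis)
    show "{c1 *\<^sub>R a + c2 *\<^sub>R b + c3 *\<^sub>R c | c1 c2 c3. c1 - c3 = of_int k} = {x. edge_form a c \<bullet> x = of_int k}"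
      using ed(3) ex by (auto, metis)
  qed
  show ?thesis unfolding skeleton_def walls.simps s1 s2 s3 by (auto elim!: Ints_cases)
qed

lemma skeleton_PGSp4:
  assumes fr: "apartment_frame (PGSp4 e f)"
  shows "x \<in> skeleton (PGSp4 e f) \<longleftrightarrow>
    e \<bullet> x \<in> \<int> \<or> f \<bullet> x \<in> \<int> \<or> e \<bullet> x + f \<bullet> x \<in> \<int> \<or> e \<bullet> x - f \<bullet> x \<in> \<int>"
proof -
  note i = PGSp4_inner[OF fr]
  have ex: "x = (e \<bullet> x) *\<^sub>R e + (f \<bullet> x) *\<^sub>R f" for x
  proof -
    obtain p q where "x = p *\<^sub>R e + q *\<^sub>R f" using PGSp4_decomposition[OF fr] by blast
    then show ?thesis using i by (simp add: inner_add_right)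
  qed
  have mem: "(\<exists>x1 x2. x = x1 *\<^sub>R e + x2 *\<^sub>R f \<and> P x1 x2) \<longleftrightarrow> P (e \<bullet> x) (f \<bullet> x)" for x P
  proof
    assume "\<exists>x1 x2. x = x1 *\<^sub>R e + x2 *\<^sub>R f \<and> P x1 x2"
    then show "P (e \<bullet> x) (f \<bullet> x)" using i by (auto simp: inner_add_right)
  qed (use ex in blast)
  have s: "{x1 *\<^sub>R e + x2 *\<^sub>R f | x1 x2. P x1 x2} = {x. P (e \<bullet> x) (f \<bullet> x)}" for P
    using mem by blast
  show ?thesis unfolding skeleton_def walls.simps s[of "\<lambda>p q. p = of_int k" for k]
      s[of "\<lambda>p q. q = of_int k" for k] s[of "\<lambda>p q. p + q = of_int k" for k]
      s[of "\<lambda>p q. p - q = of_int k" for k]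
    by (auto elim!: Ints_cases)
qed

text \<open>
  Linear forms cutting out the walls, expressed through two adjacent weights.
\<close>

definition wall_forms :: "'v::euclidean_space apartment \<Rightarrow> 'v \<Rightarrow> 'v \<Rightarrow> 'v set" where
  "wall_forms A d d' =
     (if is_PGL3 A then {edge_form d d', edge_form d (- d - d'), edge_form d' (- d - d')}
      else {edge_form d d', edge_form d (- d'), d, d'})"

lemma skeleton_wall_forms:
  assumes du: "dual_reps A \<pi> \<pi>'" and ad: "adjacent A \<pi> d d'"
  shows "x \<in> skeleton A \<longleftrightarrow> (\<exists>r\<in>wall_forms A d d'. r \<bullet> x \<in> \<int>)"
  using du
proof (cases rule: dual_reps_cases)
  case (A2 a b c)
  note i = PGL3_inner(1-9)[OF A2(2)]
  have c: "- a - b = c" "- b - a = c" "- a - c = b" "- c - a = b" "- b - c = a" "- c - b = a"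
    using PGL3_inner(10)[OF A2(2)] by simp_all
  have sw: "edge_form b a = - edge_form a b" "edge_form c a = - edge_form a c" "edge_form c b = - edge_form b c"
    by (rule edge_form_swap, simp add: i)+
  have "(d, d') \<in> {(a,b),(b,a),(a,c),(c,a),(b,c),(c,b)}"
    using ad A2(3) unfolding adjacent_def by auto
  then show ?thesis unfolding A2(1) skeleton_PGL3[OF A2(2)]
    by (elim insertE emptyE) (auto simp: wall_forms_def c sw minus_in_Ints_iff)
next
  case (A2' a b c)
  note i = PGL3_inner(1-9)[OF A2'(2)]
  have c: "a + b = - c" "b + a = - c" "a + c = - b" "c + a = - b" "b + c = - a" "c + b = - a"
    using PGL3_inner(10)[OF A2'(2)] by simp_all
  have sw: "edge_form b a = - edge_form a b" "edge_form c a = - edge_form a c" "edge_form c b = - edge_form b c"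
    by (rule edge_form_swap, simp add: i)+
  have "(d, d') \<in> {(-a,-b),(-b,-a),(-a,-c),(-c,-a),(-b,-c),(-c,-b)}"
    using ad A2'(3) unfolding adjacent_def by auto
  then show ?thesis unfolding A2'(1) skeleton_PGL3[OF A2'(2)]
    by (elim insertE emptyE)
      (simp_all add: wall_forms_def c sw edge_form_minus minus_in_Ints_iff disj_commute disj_left_commute)
next
  case (Spin e f)
  note j = adjacent_inner[OF du ad]
  have N: "d \<bullet> d = 1" "d \<bullet> d' = 0" "d' \<bullet> d = 0" using j Spin(1,5) by (auto simp: inner_commute)
  have ed: "edge_form d d' = d - d'" "edge_form d (- d') = d + d'"
    unfolding edge_form_def by (simp_all add: N inner_diff_left inner_add_left)
  have "(d, d') \<in> {(e,f),(e,-f),(-e,f),(-e,-f),(f,e),(f,-e),(-f,e),(-f,-e)}"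
    using ad Spin(3) unfolding adjacent_def by auto
  moreover have "- p - q \<in> \<int> \<longleftrightarrow> p + q \<in> \<int>" "q - p \<in> \<int> \<longleftrightarrow> p - q \<in> \<int>" for p q :: real
    using minus_in_Ints_iff[of "p + q"] minus_in_Ints_iff[of "p - q"] by simp_all
  ultimately show ?thesis unfolding Spin(1) skeleton_PGSp4[OF Spin(2)] wall_forms_def ed
    by (elim insertE emptyE)
      (auto simp: inner_add_left inner_diff_left add.commute[of "f \<bullet> x" "e \<bullet> x"])
next
  case (St e f)
  note j = adjacent_inner[OF du ad]
  have N: "d \<bullet> d = 2" "d \<bullet> d' = 0" "d' \<bullet> d = 0" using j St(1,5) by (auto simp: inner_commute)
  have ed: "edge_form d d' = (1/2) *\<^sub>R (d - d')" "edge_form d (- d') = (1/2) *\<^sub>R (d + d')"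
    unfolding edge_form_def by (simp_all add: N inner_diff_left inner_add_left)
  have "(d, d') \<in> {(e+f,e-f),(e+f,-e+f),(-e-f,e-f),(-e-f,-e+f),(e-f,e+f),(e-f,-e-f),(-e+f,e+f),(-e+f,-e-f)}"
    using ad St(3) unfolding adjacent_def by auto
  moreover have "- p - q \<in> \<int> \<longleftrightarrow> p + q \<in> \<int>" "q - p \<in> \<int> \<longleftrightarrow> p - q \<in> \<int>" for p q :: real
    using minus_in_Ints_iff[of "p + q"] minus_in_Ints_iff[of "p - q"] by simp_all
  ultimately show ?thesis unfolding St(1) skeleton_PGSp4[OF St(2)] wall_forms_def ed
    by (elim insertE emptyE)
      (auto simp: inner_add_left inner_diff_left add.commute[of "f \<bullet> x" "e \<bullet> x"])
qed

lemma wall_forms_parallel: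
  assumes du: "dual_reps A \<pi> \<pi>'" and ad: "adjacent A \<pi> d d'"
    and r: "r \<in> wall_forms A d d'" "r \<bullet> (d + d') = 0"
  shows "r = edge_form d d'"
proof -
  note i = adjacent_inner[OF du ad]
  have dd: "d' \<bullet> d = d \<bullet> d'" by (rule inner_commute)
  from i(3) show ?thesis
  proof (elim disjE conjE)
    assume h: "is_PGL3 A" "d \<bullet> d' = - (d \<bullet> d) / 2"
    have "edge_form d (- d - d') \<bullet> (d + d') \<noteq> 0" "edge_form d' (- d - d') \<bullet> (d + d') \<noteq> 0"
      unfolding edge_form_def using i(1,2) h(2)
      by (simp_all add: inner_add_left inner_add_right inner_diff_left inner_diff_right dd)
    then show ?thesis using r h(1) unfolding wall_forms_def by auto
  next
    assume h: "is_PGSp4 A" "d \<bullet> d' = 0"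
    have "edge_form d (- d') \<bullet> (d + d') \<noteq> 0" "d \<bullet> (d + d') \<noteq> 0" "d' \<bullet> (d + d') \<noteq> 0"
      unfolding edge_form_def using i(1,2) h(2)
      by (simp_all add: inner_add_left inner_add_right inner_diff_left inner_diff_right dd)
    moreover have "\<not> is_PGL3 A" using h(1) by (cases A) auto
    ultimately show ?thesis using r unfolding wall_forms_def by auto
  qed
qed

lemma rational_line_iff:
  assumes du: "dual_reps A \<pi> \<pi>'" and ad: "adjacent A \<pi> d d'"
    and D: "of_nat (n_rep \<pi>') *\<^sub>R D = d + d'"
  shows "rational_line A (line_through v D) \<longleftrightarrow> edge_form d d' \<bullet> v \<in> \<int>"
proof -
  have n: "n_rep \<pi>' \<noteq> 0" by (cases \<pi>') auto
  have ch0: "edge_form d d' \<bullet> (d + d') = 0" using edge_form_inner[OF du ad] by (simp add: inner_add_right)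
  have chD: "edge_form d d' \<bullet> D = 0"
    using ch0 n unfolding D[symmetric] by simp
  show ?thesis
  proof
    assume "rational_line A (line_through v D)"
    then have "\<And>t. v + t *\<^sub>R D \<in> skeleton A"
      unfolding rational_line_def line_through_def by blast
    then have sk: "\<exists>r\<in>wall_forms A d d'. r \<bullet> (v + t *\<^sub>R D) \<in> \<int>" for t
      unfolding skeleton_wall_forms[OF du ad] .
    have "\<exists>rk\<in>wall_forms A d d' \<times> UNIV. fst rk \<bullet> v - of_int (snd rk) + t *\<^sub>R (fst rk \<bullet> D) = 0" for t
    proof -
      obtain r k where "r \<in> wall_forms A d d'" "r \<bullet> (v + t *\<^sub>R D) = of_int k"
        using sk[of t] by (auto elim: Ints_cases)
      then show ?thesis by (intro bexI[of _ "(r, k)"]) (simp_all add: inner_add_right)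
    qed
    moreover have "countable (wall_forms A d d' \<times> (UNIV :: int set))"
      unfolding wall_forms_def by (intro countable_SIGMA) auto
    ultimately obtain rk where rk: "rk \<in> wall_forms A d d' \<times> (UNIV :: int set)"
      "fst rk \<bullet> v - of_int (snd rk) = 0" "fst rk \<bullet> D = 0"
      using countable_affine_cover[where p = "\<lambda>rk. fst rk \<bullet> v - of_int (snd rk)" and q = "\<lambda>rk. fst rk \<bullet> D"]
      by blast
    have "fst rk \<bullet> (d + d') = 0" unfolding D[symmetric] using rk(3) by simp
    then have "fst rk = edge_form d d'" using wall_forms_parallel[OF du ad] rk(1) by auto
    then show "edge_form d d' \<bullet> v \<in> \<int>" using rk(2) by (metis Ints_of_int eq_iff_diff_eq_0)
  next
    assume "edge_form d d' \<bullet> v \<in> \<int>"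
    then have "edge_form d d' \<bullet> (v + t *\<^sub>R D) \<in> \<int>" for t using chD by (simp add: inner_add_right)
    moreover have "edge_form d d' \<in> wall_forms A d d'" unfolding wall_forms_def by auto
    ultimately show "rational_line A (line_through v D)"
      unfolding rational_line_def line_through_def
      using skeleton_wall_forms[OF du ad] by blast
  qed
qed

lemma line_through_translate: "(\<lambda>y. y + c) ` line_through v D = line_through (v + c) D"
  unfolding line_through_def by (auto simp: image_image algebra_simps)

lemma line_through_shift: "line_through (v + s *\<^sub>R D) D = line_through v D"
proof -
  have "v + t *\<^sub>R D = (v + s *\<^sub>R D) + (t - s) *\<^sub>R D" "(v + s *\<^sub>R D) + t *\<^sub>R D = v + (t + s) *\<^sub>R D" for t
    by (simp_all add: algebra_simps)
  then show ?thesis unfolding line_through_def by (metis (no_types, lifting) UNIV_I image_eqI image_subsetI subset_antisym)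
qed

lemma edge_form_coweights:
  assumes du: "dual_reps A \<pi> \<pi>'" and ad: "adjacent A \<pi> d d'" and x: "x \<in> coweights A"
  shows "edge_form d d' \<bullet> x \<in> \<int>"
proof -
  obtain D where D: "D \<in> weights A \<pi>'" "of_nat (n_rep \<pi>') *\<^sub>R D = d + d'"
    using adjacent_sum_dual_weight[OF du ad] by blast
  have n: "n_rep \<pi>' \<noteq> 0" by (cases \<pi>') auto
  have "edge_form d d' \<bullet> (d + d') = 0" using edge_form_inner[OF du ad] by (simp add: inner_add_right)
  then have "edge_form d d' \<bullet> D = 0" using n unfolding D(2)[symmetric] by simp
  then show ?thesis using coweights_dual[OF du ad D] x edge_form_inner[OF du ad]
    by (auto simp: inner_add_right)
qed

text \<open>
  Half a coweight changes the value of the form by a multiple of \<open>1/2\<close>, and \<open>1/2\<close> itself is attained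
  at \<open>d / 2\<close>.
\<close>

lemma semirational_line_iff:
  assumes du: "dual_reps A \<pi> \<pi>'" and ad: "adjacent A \<pi> d d'"
    and D: "of_nat (n_rep \<pi>') *\<^sub>R D = d + d'"
  shows "semirational_line A (line_through v D) \<longleftrightarrow> edge_form d d' \<bullet> v - 1/2 \<in> \<int>"
proof -
  note rat = rational_line_iff[OF du ad D]
  have eq: "semirational_line A (line_through v D) \<longleftrightarrow>
    edge_form d d' \<bullet> v \<notin> \<int> \<and> (\<exists>x\<in>coweights A. edge_form d d' \<bullet> v + (edge_form d d' \<bullet> x) / 2 \<in> \<int>)"
    unfolding semirational_line_def line_through_translate rat by (simp add: inner_add_right)
  show ?thesis unfolding eq
  proof
    assume h: "edge_form d d' \<bullet> v - 1/2 \<in> \<int>"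
    have "edge_form d d' \<bullet> v \<notin> \<int>"
    proof
      assume "edge_form d d' \<bullet> v \<in> \<int>"
      then have "edge_form d d' \<bullet> v - (edge_form d d' \<bullet> v - 1/2) \<in> \<int>" using h by (rule Ints_diff)
      then have "(1/2 :: real) \<in> \<int>" by simp
      then obtain k :: int where "(1/2 :: real) = of_int k" by (auto elim: Ints_cases)
      then have "(1::real) = of_int (2 * k)" by simp
      then have "1 = 2 * k" by linarith
      then show False by presburger
    qed
    moreover have "d \<in> coweights A" using ad weights_subset_coweights unfolding adjacent_def by blast
    moreover have "edge_form d d' \<bullet> v + (edge_form d d' \<bullet> d) / 2 \<in> \<int>"
      using Ints_add[OF h Ints_1] edge_form_inner[OF du ad] by (simp add: add.commute)
    ultimately show "edge_form d d' \<bullet> v \<notin> \<int> \<and>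
        (\<exists>x\<in>coweights A. edge_form d d' \<bullet> v + (edge_form d d' \<bullet> x) / 2 \<in> \<int>)" by blast
  next
    assume "edge_form d d' \<bullet> v \<notin> \<int> \<and> (\<exists>x\<in>coweights A. edge_form d d' \<bullet> v + (edge_form d d' \<bullet> x) / 2 \<in> \<int>)"
    then obtain x where nr: "edge_form d d' \<bullet> v \<notin> \<int>" and x: "x \<in> coweights A"
      "edge_form d d' \<bullet> v + (edge_form d d' \<bullet> x) / 2 \<in> \<int>" by blast
    obtain j where j: "edge_form d d' \<bullet> x = of_int j"
      using edge_form_coweights[OF du ad x(1)] by (auto elim: Ints_cases)
    have "odd j"
    proof
      assume "even j"
      then obtain m where "j = 2 * m" by blast
      then have "edge_form d d' \<bullet> v + of_int m \<in> \<int>" using x(2) j by simp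
      then show False using nr by (metis Ints_diff Ints_of_int add_diff_cancel_right')
    qed
    then obtain m where "j = 2 * m + 1" by (elim oddE)
    then have "edge_form d d' \<bullet> v - 1/2 = (edge_form d d' \<bullet> v + (edge_form d d' \<bullet> x) / 2) - of_int (m + 1)"
      using j by (simp add: field_simps)
    then show "edge_form d d' \<bullet> v - 1/2 \<in> \<int>" using x(2) by (metis Ints_diff Ints_of_int)
  qed
qed

section \<open>Torsion-free groups of finite index\<close>

lemma affine_weyl_carrier:
  "g \<in> carrier (affine_weyl A) \<longleftrightarrow> (\<exists>s\<in>weyl A. \<exists>v\<in>coroots A. g = (\<lambda>x. s x + v))"
  unfolding affine_weyl_def by auto

lemma affine_weyl_simps: "mult (affine_weyl A) = (\<circ>)" "one (affine_weyl A) = id"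
  unfolding affine_weyl_def by simp_all

lemma group_affine_weyl:
  assumes fr: "apartment_frame A"
  shows "group (affine_weyl A)"
proof (rule groupI)
  fix g h assume "g \<in> carrier (affine_weyl A)" "h \<in> carrier (affine_weyl A)"
  then obtain s v t w where st: "s \<in> weyl A" "v \<in> coroots A" "g = (\<lambda>x. s x + v)"
    "t \<in> weyl A" "w \<in> coroots A" "h = (\<lambda>x. t x + w)" unfolding affine_weyl_carrier by blast
  have "g \<circ> h = (\<lambda>x. (s \<circ> t) x + (s w + v))"
    unfolding st(3,6) using linear_add[OF weyl_linear[OF st(1)]] by (auto simp: add.assoc)
  moreover have "s w + v \<in> coroots A" using coroots_add weyl_coroots fr st by blast
  ultimately show "g \<otimes>\<^bsub>affine_weyl A\<^esub> h \<in> carrier (affine_weyl A)"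
    unfolding affine_weyl_simps affine_weyl_carrier using weyl_comp st by blast
next
  have "id = (\<lambda>x. id x + (0 :: 'a))" by auto
  then show "\<one>\<^bsub>affine_weyl A\<^esub> \<in> carrier (affine_weyl A)"
    unfolding affine_weyl_simps affine_weyl_carrier using id_in_weyl coroots_0 by blast
next
  fix g assume "g \<in> carrier (affine_weyl A)"
  then obtain s v where st: "s \<in> weyl A" "v \<in> coroots A" "g = (\<lambda>x. s x + v)"
    unfolding affine_weyl_carrier by blast
  obtain t where t: "t \<in> weyl A" "t \<circ> s = id" using weyl_inverse[OF fr st(1)] by blast
  have "(\<lambda>x. t x + (- t v)) \<circ> g = id"
  proof
    fix x
    have "t (s x) = x" using fun_cong[OF t(2), of x] by simp
    then show "((\<lambda>x. t x + (- t v)) \<circ> g) x = id x"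
      unfolding st(3) using linear_add[OF weyl_linear[OF t(1)]] by simp
  qed
  moreover have "- t v \<in> coroots A" using coroots_minus weyl_coroots fr st t by blast
  then have "(\<lambda>x. t x + (- t v)) \<in> carrier (affine_weyl A)"
    unfolding affine_weyl_carrier using t(1) by blast
  ultimately show "\<exists>h\<in>carrier (affine_weyl A). h \<otimes>\<^bsub>affine_weyl A\<^esub> g = \<one>\<^bsub>affine_weyl A\<^esub>"
    unfolding affine_weyl_simps by (rule bexI)
qed (auto simp: affine_weyl_simps)

text \<open>
  The linear part of an affine map.
\<close>

definition linear_part :: "('v \<Rightarrow> 'v) \<Rightarrow> 'v::ab_group_add \<Rightarrow> 'v" where
  "linear_part g x = g x - g 0"

text \<open>
  A torsion-free subgroup of finite index in the affine Weyl group, acting on the apartment, and the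
  two representations to be compared: \<open>\<pi>\<close> for galleries, \<open>\<pi>'\<close> for geodesics.
\<close>

locale quotient_apartment =
  fixes A :: "'v::euclidean_space apartment" and \<pi> \<pi>' :: rep and \<Gamma> :: "('v \<Rightarrow> 'v) set"
  assumes dual: "dual_reps A \<pi> \<pi>'"
    and subgroup_\<Gamma>: "subgroup \<Gamma> (affine_weyl A)"
    and finite_index: "finite (rcosets\<^bsub>affine_weyl A\<^esub> \<Gamma>)"
    and torsion_free_\<Gamma>: "torsion_free \<Gamma>"
begin

lemma frame: "apartment_frame A" using dual unfolding dual_reps_def by blast

lemma elem:
  assumes "g \<in> \<Gamma>"
  shows "linear_part g \<in> weyl A" "g 0 \<in> coroots A" "g (x + y) = g x + linear_part g y"
proof -
  have "g \<in> carrier (affine_weyl A)" using assms subgroup.subset[OF subgroup_\<Gamma>] by blast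
  then obtain s v where sv: "s \<in> weyl A" "v \<in> coroots A" "g = (\<lambda>x. s x + v)"
    unfolding affine_weyl_carrier by blast
  have lin: "linear s" using weyl_linear sv(1) .
  have "linear_part g = s" "g 0 = v" unfolding sv(3) linear_part_def using linear_0[OF lin] by auto
  then show "linear_part g \<in> weyl A" "g 0 \<in> coroots A" "g (x + y) = g x + linear_part g y"
    using sv linear_add[OF lin] by auto
qed

lemma id_mem: "id \<in> \<Gamma>"
  using subgroup.one_closed[OF subgroup_\<Gamma>] by (simp add: affine_weyl_simps)

lemma comp_mem: "g \<in> \<Gamma> \<Longrightarrow> h \<in> \<Gamma> \<Longrightarrow> g \<circ> h \<in> \<Gamma>"
  using subgroup.m_closed[OF subgroup_\<Gamma>] by (simp add: affine_weyl_simps)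

lemma inverse_mem:
  assumes "g \<in> \<Gamma>"
  obtains h where "h \<in> \<Gamma>" "h \<circ> g = id" "g \<circ> h = id" "h = inv\<^bsub>affine_weyl A\<^esub> g"
proof -
  interpret G: group "affine_weyl A" using group_affine_weyl[OF frame] .
  have "g \<in> carrier (affine_weyl A)" using assms subgroup.subset[OF subgroup_\<Gamma>] by blast
  then show ?thesis using that[of "inv\<^bsub>affine_weyl A\<^esub> g"] G.l_inv[of g] G.r_inv[of g]
      subgroup.m_inv_closed[OF subgroup_\<Gamma> assms] by (simp add: affine_weyl_simps)
qed

lemma elem_eq: "g \<in> \<Gamma> \<Longrightarrow> g x = linear_part g x + g 0"
  by (simp add: linear_part_def)

lemma linear_linear_part: "g \<in> \<Gamma> \<Longrightarrow> linear (linear_part g)"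
  using elem(1) weyl_linear by blast

lemma linear_part_comp: "g \<in> \<Gamma> \<Longrightarrow> h \<in> \<Gamma> \<Longrightarrow> linear_part (g \<circ> h) = linear_part g \<circ> linear_part h"
  using elem(3)[of g "h 0"] by (auto simp: linear_part_def fun_eq_iff elem(3)[of g]) (metis add_diff_cancel_left' diff_add_cancel elem(3) linear_part_def)

lemma isometry: "g \<in> \<Gamma> \<Longrightarrow> linear_part g x \<bullet> linear_part g y = x \<bullet> y"
  using weyl_isometry[OF frame elem(1)] .

lemma linear_part_weights: "g \<in> \<Gamma> \<Longrightarrow> d \<in> weights A \<rho> \<Longrightarrow> linear_part g d \<in> weights A \<rho>"
  using weyl_weights[OF frame elem(1)] .

lemma maps_coweights:
  assumes "g \<in> \<Gamma>" "x \<in> coweights A"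
  shows "g x - x \<in> coroots A" "g x \<in> coweights A"
proof -
  have "linear_part g x - x \<in> coroots A" using weyl_coweights_diff[OF frame elem(1)] assms by blast
  then have "(linear_part g x - x) + g 0 \<in> coroots A" using coroots_add elem(2)[OF assms(1)] by blast
  then show 1: "g x - x \<in> coroots A" by (simp add: linear_part_def)
  then show "g x \<in> coweights A"
    using coweights_add[of "g x - x" A x] coroots_subset assms(2) by auto
qed

text \<open>Torsion-freeness makes the action free, the linear part of an element having finite order.\<close>

lemma free_action:
  assumes g: "g \<in> \<Gamma>" and fix_p: "g p = p"
  shows "g = id"
proof -
  have step: "g (p + y) = p + linear_part g y" for y using elem(3)[OF g, of p y] fix_p by simp
  have pow: "(g ^^ n) (p + y) = p + (linear_part g ^^ n) y" for n y
    by (induction n) (simp_all add: step)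
  obtain n where n: "n > 0" "linear_part g ^^ n = id" using weyl_order[OF frame elem(1)[OF g]] by blast
  have "(g ^^ n) x = x" for x using pow[of n "x - p"] n(2) by simp
  then have "g ^^ n = id" by auto
  then show ?thesis using torsion_free_\<Gamma> g n(1) unfolding torsion_free_def by blast
qed

text \<open>
  The translations in \<open>\<Gamma>\<close>, identified with vectors.
\<close>

definition translation_lattice :: "'v set" where
  "translation_lattice = {v. (\<lambda>x. x + v) \<in> \<Gamma>}"

lemma translation_lattice_coroots: "v \<in> translation_lattice \<Longrightarrow> v \<in> coroots A"
  using elem(2)[of "\<lambda>x. x + v"] unfolding translation_lattice_def by simp

lemma translation_lattice_add: "v \<in> translation_lattice \<Longrightarrow> w \<in> translation_lattice \<Longrightarrow> v + w \<in> translation_lattice"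
  using comp_mem[of "\<lambda>x. x + w" "\<lambda>x. x + v"] unfolding translation_lattice_def by (simp add: comp_def add.assoc)

lemma translation_lattice_0: "0 \<in> translation_lattice"
  using id_mem unfolding translation_lattice_def by (simp add: id_def)

lemma translation_lattice_minus:
  assumes "v \<in> translation_lattice" shows "- v \<in> translation_lattice"
proof -
  obtain h where h: "h \<in> \<Gamma>" "h \<circ> (\<lambda>x. x + v) = id"
    using inverse_mem assms unfolding translation_lattice_def by blast
  have "h = (\<lambda>x. x + (- v))"
  proof
    fix x show "h x = x + (- v)" using fun_cong[OF h(2), of "x - v"] by simp
  qed
  then show ?thesis using h(1) unfolding translation_lattice_def by simp
qed

lemma translation_lattice_scale_nat: "v \<in> translation_lattice \<Longrightarrow> of_nat n *\<^sub>R v \<in> translation_lattice"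
  by (induction n) (simp_all add: translation_lattice_0 translation_lattice_add scaleR_left_distrib)

lemma translation_lattice_scale: "v \<in> translation_lattice \<Longrightarrow> of_int n *\<^sub>R v \<in> translation_lattice"
  using translation_lattice_scale_nat[of v "nat n"] translation_lattice_minus[of "of_nat (nat (- n)) *\<^sub>R v"]
    translation_lattice_scale_nat[of v "nat (- n)"]
  by (cases "n \<ge> 0") simp_all

lemma linear_part_id:
  assumes g: "g \<in> \<Gamma>" "linear_part g = id"
  shows "g 0 \<in> translation_lattice" "g = (\<lambda>x. x + g 0)"
proof -
  show 1: "g = (\<lambda>x. x + g 0)"
  proof
    fix x show "g x = x + g 0" using elem_eq[OF g(1), of x] unfolding g(2) by simp
  qed
  show "g 0 \<in> translation_lattice" unfolding translation_lattice_def using g(1) 1 by simp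
qed

text \<open>
  The translation lattice has full rank: among the cosets of the multiples of \<open>6 x\<close> two coincide, the
  index being finite.
\<close>

lemma translation_multiple:
  assumes x: "x \<in> coweights A"
  shows "\<exists>n>0. of_nat n *\<^sub>R x \<in> translation_lattice"
proof -
  have x6: "6 *\<^sub>R x \<in> coroots A" using coweights_multiple_coroot[OF x] .
  interpret G: group "affine_weyl A" using group_affine_weyl[OF frame] .
  define T where "T = (\<lambda>n::nat. \<lambda>y. y + of_nat n *\<^sub>R (6 *\<^sub>R x))"
  have car: "T n \<in> carrier (affine_weyl A)" for n
  proof -
    have "of_int (int n) *\<^sub>R (6 *\<^sub>R x) \<in> coroots A" using coroots_scale[OF x6] .
    then show ?thesis unfolding affine_weyl_carrier T_def
      by (intro bexI[of _ id] bexI[of _ "of_nat n *\<^sub>R (6 *\<^sub>R x)"]) (simp_all add: id_in_weyl)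
  qed
  have "\<not> inj (\<lambda>n. \<Gamma> #>\<^bsub>affine_weyl A\<^esub> T n)"
  proof
    assume "inj (\<lambda>n. \<Gamma> #>\<^bsub>affine_weyl A\<^esub> T n)"
    moreover have "range (\<lambda>n. \<Gamma> #>\<^bsub>affine_weyl A\<^esub> T n) \<subseteq> rcosets\<^bsub>affine_weyl A\<^esub> \<Gamma>"
      unfolding RCOSETS_def using car by blast
    ultimately have "finite (UNIV :: nat set)" using finite_imageD finite_subset finite_index by blast
    then show False by simp
  qed
  then obtain i j where "i \<noteq> j" "\<Gamma> #>\<^bsub>affine_weyl A\<^esub> T i = \<Gamma> #>\<^bsub>affine_weyl A\<^esub> T j"
    unfolding inj_def by blast
  then obtain i j where ij: "i < j" "\<Gamma> #>\<^bsub>affine_weyl A\<^esub> T i = \<Gamma> #>\<^bsub>affine_weyl A\<^esub> T j"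
    by (cases i j rule: linorder_cases) auto
  have "T j \<in> \<Gamma> #>\<^bsub>affine_weyl A\<^esub> T i"
    using G.rcos_self[OF car subgroup_\<Gamma>, of j] ij(2) by simp
  then obtain g where g: "g \<in> \<Gamma>" "T j = g \<circ> T i"
    unfolding r_coset_def by (auto simp: affine_weyl_simps)
  have "g y = y + of_nat (6 * (j - i)) *\<^sub>R x" for y
  proof -
    have "g (T i (y - of_nat i *\<^sub>R (6 *\<^sub>R x))) = T j (y - of_nat i *\<^sub>R (6 *\<^sub>R x))"
      using g(2) by simp
    then have "g y = y + (of_nat j - of_nat i) *\<^sub>R (6 *\<^sub>R x)" by (simp add: T_def algebra_simps)
    also have "\<dots> = y + of_nat (6 * (j - i)) *\<^sub>R x" using ij(1) by (simp add: of_nat_diff algebra_simps)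
    finally show ?thesis .
  qed
  then have "g = (\<lambda>y. y + of_nat (6 * (j - i)) *\<^sub>R x)" by auto
  then have "of_nat (6 * (j - i)) *\<^sub>R x \<in> translation_lattice" using g(1) unfolding translation_lattice_def by simp
  moreover have "6 * (j - i) > 0" using ij(1) by simp
  ultimately show ?thesis by blast
qed

lemma countable_\<Gamma>: "countable \<Gamma>"
proof -
  have "inj_on (\<lambda>g. (linear_part g, g 0)) \<Gamma>"
    by (rule inj_onI) (auto simp: linear_part_def fun_eq_iff)
  moreover have "(\<lambda>g. (linear_part g, g 0)) ` \<Gamma> \<subseteq> weyl A \<times> coroots A" using elem by auto
  moreover have "countable (weyl A \<times> coroots A)"
    using finite_weyl[OF frame] countable_subset[OF coroots_subset countable_coweights]
    by (intro countable_SIGMA) (auto simp: countable_finite)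
  ultimately show ?thesis by (meson countable_image_inj_on countable_subset)
qed

lemma orbit_of_image:
  assumes g: "g \<in> \<Gamma>"
  shows "orbit_of \<Gamma> (g x) = orbit_of \<Gamma> x"
proof -
  obtain h where h: "h \<in> \<Gamma>" "h \<circ> g = id" using inverse_mem[OF g] by blast
  have "k x \<in> orbit_of \<Gamma> (g x)" if "k \<in> \<Gamma>" for k
  proof -
    have "k x = (k \<circ> h) (g x)" using fun_cong[OF h(2), of x] by simp
    then show ?thesis unfolding orbit_of_def using comp_mem[OF that h(1)] by blast
  qed
  moreover have "k (g x) \<in> orbit_of \<Gamma> x" if "k \<in> \<Gamma>" for k
    unfolding orbit_of_def using image_eqI[where f = "\<lambda>g. g x", OF _ comp_mem[OF that g]] by simp
  ultimately show ?thesis unfolding orbit_of_def by blast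
qed

text \<open>
  A parametrised line in the quotient determines its lift up to \<open>\<Gamma>\<close>: each point of one lift is the
  image of the corresponding point of the other under one of countably many elements, so a single
  element works for all points.
\<close>

lemma line_lift_unique:
  assumes "\<And>t. orbit_of \<Gamma> (v' + t *\<^sub>R d') = orbit_of \<Gamma> (v + t *\<^sub>R d)"
  shows "\<exists>g\<in>\<Gamma>. g v = v' \<and> linear_part g d = d'"
proof -
  have "\<exists>g\<in>\<Gamma>. (v' - g v) + t *\<^sub>R (d' - linear_part g d) = 0" for t
  proof -
    have "v' + t *\<^sub>R d' \<in> orbit_of \<Gamma> (v' + t *\<^sub>R d')"
      unfolding orbit_of_def using image_eqI[where f = "\<lambda>g. g (v' + t *\<^sub>R d')", OF _ id_mem] by simp
    then have "v' + t *\<^sub>R d' \<in> orbit_of \<Gamma> (v + t *\<^sub>R d)" using assms[of t] by simp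
    then obtain g where g: "g \<in> \<Gamma>" "v' + t *\<^sub>R d' = g (v + t *\<^sub>R d)"
      unfolding orbit_of_def by blast
    have "g (v + t *\<^sub>R d) = g v + t *\<^sub>R linear_part g d"
      using elem(3)[OF g(1)] linear_scale[OF linear_linear_part[OF g(1)]] by simp
    then show ?thesis using g by (intro bexI[of _ g]) (simp_all add: algebra_simps)
  qed
  then obtain g where "g \<in> \<Gamma>" "v' - g v = 0" "d' - linear_part g d = 0"
    using countable_affine_cover[OF countable_\<Gamma>, of "\<lambda>g. v' - g v" "\<lambda>g. d' - linear_part g d"]
    by blast
  then show ?thesis by (intro bexI[of _ g]) simp_all
qed

lemma elem_line: "g \<in> \<Gamma> \<Longrightarrow> g (v + t *\<^sub>R d) = g v + t *\<^sub>R linear_part g d"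
  using elem(3)[of g v "t *\<^sub>R d"] linear_scale[OF linear_linear_part[of g]] by simp

lemma dual_weight_nonzero: "d \<in> weights A \<rho> \<Longrightarrow> d \<bullet> d > 0"
  using weights_nonzero[OF frame] by blast


section \<open>Representatives of closed geodesics\<close>

text \<open>
  An element of \<open>\<Gamma>\<close> that maps an oriented line to itself fixes its direction vector, being an
  isometry.
\<close>

lemma closed_geodesics_iff:
  "(l, c) \<in> closed_geodesics A \<Gamma> \<rho> R \<longleftrightarrow>
    (\<exists>v d. c = (\<lambda>t. orbit_of \<Gamma> (v + t *\<^sub>R d)) \<and> d \<in> weights A \<rho> \<and> R (line_through v d) \<and> l > 0 \<and>
      (\<exists>g\<in>\<Gamma>. linear_part g d = d \<and> g v = v + l *\<^sub>R d))"
proof -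
  have K: "(g ` line_through v d = line_through v d \<and> (\<exists>r>0. g (v + d) - g v = r *\<^sub>R d) \<and> g v = v + l *\<^sub>R d)
      \<longleftrightarrow> (linear_part g d = d \<and> g v = v + l *\<^sub>R d)"
    if g: "g \<in> \<Gamma>" and d: "d \<in> weights A \<rho>" for g v d
  proof
    assume h: "g ` line_through v d = line_through v d \<and> (\<exists>r>0. g (v + d) - g v = r *\<^sub>R d) \<and> g v = v + l *\<^sub>R d"
    then obtain r where r: "r > 0" "linear_part g d = r *\<^sub>R d"
      using elem(3)[OF g, of v d] by auto
    have "(r * r) * (d \<bullet> d) = 1 * (d \<bullet> d)" using isometry[OF g, of d d] unfolding r(2) by simp
    then have "r * r = 1" using dual_weight_nonzero[OF d] by simp
    then have "r = 1" using r(1) by (simp add: square_eq_1_iff)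
    then show "linear_part g d = d \<and> g v = v + l *\<^sub>R d" using r h by simp
  next
    assume h: "linear_part g d = d \<and> g v = v + l *\<^sub>R d"
    have "g ` line_through v d = line_through (v + l *\<^sub>R d) d"
      unfolding line_through_def image_image using elem_line[OF g, of v _ d] h by simp
    then show "g ` line_through v d = line_through v d \<and> (\<exists>r>0. g (v + d) - g v = r *\<^sub>R d) \<and> g v = v + l *\<^sub>R d"
      using h elem(3)[OF g, of v d] unfolding line_through_shift[of v l d]
      by (intro conjI exI[of _ 1]) simp_all
  qed
  show ?thesis
  proof
    assume "(l, c) \<in> closed_geodesics A \<Gamma> \<rho> R"
    then obtain v d g where "c = (\<lambda>t. orbit_of \<Gamma> (v + t *\<^sub>R d))" "d \<in> weights A \<rho>"
      "R (line_through v d)" "l > 0" "g \<in> \<Gamma>" "g ` line_through v d = line_through v d"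
      "\<exists>r>0. g (v + d) - g v = r *\<^sub>R d" "g v = v + l *\<^sub>R d"
      unfolding closed_geodesics_def by blast
    moreover from this have "linear_part g d = d" using K[of g d v] by blast
    ultimately show "\<exists>v d. c = (\<lambda>t. orbit_of \<Gamma> (v + t *\<^sub>R d)) \<and> d \<in> weights A \<rho> \<and>
        R (line_through v d) \<and> l > 0 \<and> (\<exists>g\<in>\<Gamma>. linear_part g d = d \<and> g v = v + l *\<^sub>R d)"
      by blast
  next
    assume "\<exists>v d. c = (\<lambda>t. orbit_of \<Gamma> (v + t *\<^sub>R d)) \<and> d \<in> weights A \<rho> \<and>
        R (line_through v d) \<and> l > 0 \<and> (\<exists>g\<in>\<Gamma>. linear_part g d = d \<and> g v = v + l *\<^sub>R d)"
    then obtain v d g where h: "c = (\<lambda>t. orbit_of \<Gamma> (v + t *\<^sub>R d))" "d \<in> weights A \<rho>"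
      "R (line_through v d)" "l > 0" "g \<in> \<Gamma>" "linear_part g d = d" "g v = v + l *\<^sub>R d"
      by blast
    then have "g ` line_through v d = line_through v d \<and> (\<exists>r>0. g (v + d) - g v = r *\<^sub>R d) \<and> g v = v + l *\<^sub>R d"
      using K[of g d v] by blast
    then show "(l, c) \<in> closed_geodesics A \<Gamma> \<rho> R"
      unfolding closed_geodesics_def h(1) using h(2-5) by blast
  qed
qed

text \<open>
  Representatives, indexed by \<open>I\<close>, of the oriented lines with property \<open>R\<close> and the direction of a
  weight of \<open>\<pi>'\<close>, up to \<open>\<Gamma>\<close>. The line \<open>i\<close> passes through \<open>V i\<close> with direction vector \<open>D i\<close>, and
  the translation lengths of its stabiliser, in units of \<open>D i\<close>, are the multiples of \<open>len i\<close>.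
\<close>

definition line_reps ::
    "('v set \<Rightarrow> bool) \<Rightarrow> 'i set \<Rightarrow> ('i \<Rightarrow> 'v) \<Rightarrow> ('i \<Rightarrow> 'v) \<Rightarrow> ('i \<Rightarrow> real) \<Rightarrow> bool" where
  "line_reps R I V D len \<longleftrightarrow> finite I \<and>
     (\<forall>i\<in>I. D i \<in> weights A \<pi>' \<and> R (line_through (V i) (D i)) \<and> len i > 0 \<and>
        (\<exists>g\<in>\<Gamma>. linear_part g (D i) = D i \<and> g (V i) = V i + len i *\<^sub>R D i)) \<and>
     (\<forall>i\<in>I. \<forall>g\<in>\<Gamma>. \<forall>l>0. linear_part g (D i) = D i \<and> g (V i) = V i + l *\<^sub>R D i \<longrightarrow>
        (\<exists>n::nat. l = of_nat n * len i)) \<and>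
     (\<forall>v d. d \<in> weights A \<pi>' \<and> R (line_through v d) \<longrightarrow>
        (\<exists>i\<in>I. \<exists>g\<in>\<Gamma>. \<exists>s. linear_part g (D i) = d \<and> g (V i) = v + s *\<^sub>R d)) \<and>
     (\<forall>i\<in>I. \<forall>j\<in>I. \<forall>g\<in>\<Gamma>. \<forall>s. linear_part g (D i) = D j \<and> g (V i) = V j + s *\<^sub>R D j \<longrightarrow> i = j)"

lemma conjugate_closing:
  assumes h: "h \<in> \<Gamma>" "h v = w" "linear_part h d = d'"
    and g: "g \<in> \<Gamma>" "linear_part g d' = d'" "g w = w + l *\<^sub>R d'"
  obtains k where "k \<in> \<Gamma>" "linear_part k d = d" "k v = v + l *\<^sub>R d" "h \<circ> k = g \<circ> h"
proof -
  obtain h' where h': "h' \<in> \<Gamma>" "h' \<circ> h = id" "h \<circ> h' = id" using inverse_mem[OF h(1)] by blast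
  have "linear_part (h' \<circ> h) d = d" unfolding h'(2) by (simp add: linear_part_def)
  then have l': "linear_part h' d' = d" using linear_part_comp[OF h'(1) h(1)] h(3) by simp
  have w': "h' w = v" using fun_cong[OF h'(2), of v] h(2) by simp
  let ?k = "h' \<circ> (g \<circ> h)"
  have "linear_part ?k d = d"
    using linear_part_comp[OF h'(1) comp_mem[OF g(1) h(1)]] linear_part_comp[OF g(1) h(1)] h(3) g(2) l'
    by simp
  moreover have "?k v = v + l *\<^sub>R d" using h(2) g(3) elem_line[OF h'(1)] l' w' by simp
  moreover have "h \<circ> ?k = g \<circ> h" using h'(3) by (metis comp_assoc id_comp)
  ultimately show ?thesis using that comp_mem h'(1) g(1) h(1) by blast
qed

lemma euler_product_line_reps:
  assumes reps: "line_reps R I V D len"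
  shows "euler_product (closed_geodesics A \<Gamma> \<pi>' R) p = (\<Prod>i\<in>I. inverse (1 - p (len i)))"
proof (rule euler_product_representatives[where P = "\<lambda>i t. orbit_of \<Gamma> (V i + t *\<^sub>R D i)"])
  have fin: "finite I"
    and r1: "\<And>i. i \<in> I \<Longrightarrow> D i \<in> weights A \<pi>' \<and> R (line_through (V i) (D i)) \<and> len i > 0 \<and>
        (\<exists>g\<in>\<Gamma>. linear_part g (D i) = D i \<and> g (V i) = V i + len i *\<^sub>R D i)"
    and r2: "\<And>i g l. i \<in> I \<Longrightarrow> g \<in> \<Gamma> \<Longrightarrow> l > 0 \<Longrightarrow> linear_part g (D i) = D i \<Longrightarrow>
        g (V i) = V i + l *\<^sub>R D i \<Longrightarrow> \<exists>n::nat. l = of_nat n * len i"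
    and r3: "\<And>v d. d \<in> weights A \<pi>' \<Longrightarrow> R (line_through v d) \<Longrightarrow>
        \<exists>i\<in>I. \<exists>g\<in>\<Gamma>. \<exists>s. linear_part g (D i) = d \<and> g (V i) = v + s *\<^sub>R d"
    and r4: "\<And>i j g s. i \<in> I \<Longrightarrow> j \<in> I \<Longrightarrow> g \<in> \<Gamma> \<Longrightarrow> linear_part g (D i) = D j \<Longrightarrow>
        g (V i) = V j + s *\<^sub>R D j \<Longrightarrow> i = j"
    using reps unfolding line_reps_def by meson+
  show "finite I" by (rule fin)
  show "(len i, \<lambda>t. orbit_of \<Gamma> (V i + t *\<^sub>R D i)) \<in> closed_geodesics A \<Gamma> \<pi>' R" if "i \<in> I" for i
    unfolding closed_geodesics_iff using r1[OF that] by blast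
  show "len i > 0" if "i \<in> I" for i using r1[OF that] by blast
  show "\<exists>n>0. l = of_nat n * len i"
    if i: "i \<in> I" and l: "(l, \<lambda>t. orbit_of \<Gamma> (V i + t *\<^sub>R D i)) \<in> closed_geodesics A \<Gamma> \<pi>' R" for i l
  proof -
    obtain v d g where vd: "(\<lambda>t. orbit_of \<Gamma> (V i + t *\<^sub>R D i)) = (\<lambda>t. orbit_of \<Gamma> (v + t *\<^sub>R d))"
      "l > 0" "g \<in> \<Gamma>" "linear_part g d = d" "g v = v + l *\<^sub>R d"
      using l unfolding closed_geodesics_iff by blast
    obtain h where h: "h \<in> \<Gamma>" "h (V i) = v" "linear_part h (D i) = d"
      using line_lift_unique[of v d "V i" "D i", OF fun_cong[OF vd(1), symmetric]] by blast
    obtain k where "k \<in> \<Gamma>" "linear_part k (D i) = D i" "k (V i) = V i + l *\<^sub>R D i"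
      using conjugate_closing[OF h vd(3-5)] by blast
    then obtain n :: nat where "l = of_nat n * len i" using r2 i vd(2) by blast
    then show ?thesis using vd(2) by (cases "n = 0") auto
  qed
  show "\<exists>i\<in>I. \<exists>s. c = (\<lambda>t. orbit_of \<Gamma> (V i + (t + s) *\<^sub>R D i))"
    if "(l, c) \<in> closed_geodesics A \<Gamma> \<pi>' R" for l c
  proof -
    obtain v d where c: "c = (\<lambda>t. orbit_of \<Gamma> (v + t *\<^sub>R d))" "d \<in> weights A \<pi>'" "R (line_through v d)"
      using \<open>(l, c) \<in> _\<close> unfolding closed_geodesics_iff by blast
    then obtain i g s where i: "i \<in> I" "g \<in> \<Gamma>" "linear_part g (D i) = d" "g (V i) = v + s *\<^sub>R d"
      using r3 by blast
    have "c t = orbit_of \<Gamma> (V i + (t + (- s)) *\<^sub>R D i)" for t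
    proof -
      have "g (V i + (t + (- s)) *\<^sub>R D i) = v + t *\<^sub>R d"
        unfolding elem_line[OF i(2)] i(3,4) by (simp add: algebra_simps)
      then show ?thesis using orbit_of_image[OF i(2)] c(1) by metis
    qed
    then show ?thesis using i(1) by blast
  qed
  show "(l, \<lambda>t. c (t + s)) \<in> closed_geodesics A \<Gamma> \<pi>' R"
    if lc: "(l, c) \<in> closed_geodesics A \<Gamma> \<pi>' R" for l c s
  proof -
    obtain v d g where c: "c = (\<lambda>t. orbit_of \<Gamma> (v + t *\<^sub>R d))" "d \<in> weights A \<pi>'" "R (line_through v d)"
      "l > 0" "g \<in> \<Gamma>" "linear_part g d = d" "g v = v + l *\<^sub>R d"
      using lc unfolding closed_geodesics_iff by blast
    have "(\<lambda>t. c (t + s)) = (\<lambda>t. orbit_of \<Gamma> ((v + s *\<^sub>R d) + t *\<^sub>R d))"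
      unfolding c(1) by (simp add: algebra_simps)
    moreover have "g (v + s *\<^sub>R d) = (v + s *\<^sub>R d) + l *\<^sub>R d"
      using elem_line[OF c(5)] c(6,7) by (simp add: algebra_simps)
    moreover have "R (line_through (v + s *\<^sub>R d) d)" using c(3) line_through_shift by metis
    ultimately show ?thesis unfolding closed_geodesics_iff using c by blast
  qed
  show "i = j" if ij: "i \<in> I" "j \<in> I"
    and e: "(\<lambda>t. orbit_of \<Gamma> (V j + t *\<^sub>R D j)) = (\<lambda>t. orbit_of \<Gamma> (V i + (t + s) *\<^sub>R D i))" for i j s
  proof -
    have "orbit_of \<Gamma> (V j + t *\<^sub>R D j) = orbit_of \<Gamma> ((V i + s *\<^sub>R D i) + t *\<^sub>R D i)" for t
      using fun_cong[OF e, of t] by (simp add: algebra_simps)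
    then obtain g where g: "g \<in> \<Gamma>" "g (V i + s *\<^sub>R D i) = V j" "linear_part g (D i) = D j"
      using line_lift_unique[of "V j" "D j" "V i + s *\<^sub>R D i" "D i"] by blast
    have "g (V i) = V j + (- s) *\<^sub>R D j" using g(2,3) elem_line[OF g(1)] by (simp add: algebra_simps)
    then show ?thesis using r4 ij g(1,3) by blast
  qed
qed

end

section \<open>Chambers and the shape of pi-chambers\<close>

lemma closure_open_strips:
  fixes \<Psi> :: "'v::euclidean_space set" and l :: "'v \<Rightarrow> real"
  assumes fin: "finite \<Psi>" and p: "\<And>r. r \<in> \<Psi> \<Longrightarrow> l r < r \<bullet> p \<and> r \<bullet> p < l r + 1"
  shows "closure {x. \<forall>r\<in>\<Psi>. l r < r \<bullet> x \<and> r \<bullet> x < l r + 1} = {x. \<forall>r\<in>\<Psi>. l r \<le> r \<bullet> x \<and> r \<bullet> x \<le> l r + 1}"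
    (is "closure ?O = ?K")
proof
  have "?K = (\<Inter>r\<in>\<Psi>. {x. l r \<le> r \<bullet> x} \<inter> {x. r \<bullet> x \<le> l r + 1})" by auto
  moreover have "closed ({x. l r \<le> r \<bullet> x} \<inter> {x. r \<bullet> x \<le> l r + 1})" for r
    by (intro closed_Int closed_Collect_le continuous_intros)
  ultimately have "closed ?K" by auto
  then show "closure ?O \<subseteq> ?K" by (intro closure_minimal) (auto simp: less_imp_le)
  show "?K \<subseteq> closure ?O"
  proof
    fix y assume y: "y \<in> ?K"
    have "\<exists>x\<in>?O. dist x y < e" if e: "e > 0" for e
    proof -
      define t where "t = min 1 (e / (2 * (1 + norm (p - y))))"
      have n: "1 + norm (p - y) > 0" by (simp add: add_pos_nonneg)
      have t: "0 < t" "t \<le> 1" using e n unfolding t_def by simp_all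
      have "t * norm (p - y) \<le> e / (2 * (1 + norm (p - y))) * norm (p - y)"
        unfolding t_def by (intro mult_right_mono) auto
      also have "\<dots> < e" using e n by (simp add: field_simps) (smt (verit) mult_nonneg_nonneg norm_ge_zero)
      finally have d: "dist (y + t *\<^sub>R (p - y)) y < e" using t by (simp add: dist_norm)
      have "y + t *\<^sub>R (p - y) \<in> ?O"
      proof (intro CollectI ballI conjI)
        fix r assume r: "r \<in> \<Psi>"
        have eq: "r \<bullet> (y + t *\<^sub>R (p - y)) = (1 - t) * (r \<bullet> y) + t * (r \<bullet> p)"
          by (simp add: inner_add_right inner_diff_right algebra_simps)
        have "(1 - t) * l r \<le> (1 - t) * (r \<bullet> y)" "(1 - t) * (r \<bullet> y) \<le> (1 - t) * (l r + 1)"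
          using y r t by (auto intro!: mult_left_mono)
        moreover have "t * l r < t * (r \<bullet> p)" "t * (r \<bullet> p) < t * (l r + 1)" using p[OF r] t by auto
        ultimately have "(1 - t) * l r + t * l r < (1 - t) * (r \<bullet> y) + t * (r \<bullet> p)"
          "(1 - t) * (r \<bullet> y) + t * (r \<bullet> p) < (1 - t) * (l r + 1) + t * (l r + 1)" by linarith+
        then show "l r < r \<bullet> (y + t *\<^sub>R (p - y))" "r \<bullet> (y + t *\<^sub>R (p - y)) < l r + 1"
          unfolding eq by (simp_all add: algebra_simps)
      qed
      then show ?thesis using d by blast
    qed
    then show "y \<in> closure ?O" unfolding closure_approachable by blast
  qed
qed

text \<open>The closed cell of a point off the walls, cut out by the integer parts of the wall forms.\<close>

definition closed_cell :: "'v::euclidean_space set \<Rightarrow> 'v \<Rightarrow> 'v set" where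
  "closed_cell \<Psi> p = {x. \<forall>r\<in>\<Psi>. of_int \<lfloor>r \<bullet> p\<rfloor> \<le> r \<bullet> x \<and> r \<bullet> x \<le> of_int \<lfloor>r \<bullet> p\<rfloor> + 1}"

lemma floor_strict: "y \<notin> \<int> \<Longrightarrow> of_int \<lfloor>y\<rfloor> < (y :: real) \<and> y < of_int \<lfloor>y\<rfloor> + 1"
proof -
  assume "y \<notin> \<int>"
  then have "of_int \<lfloor>y\<rfloor> \<noteq> y" by (metis Ints_of_int)
  moreover have "of_int \<lfloor>y\<rfloor> \<le> y" "y < of_int \<lfloor>y\<rfloor> + 1" by linarith+
  ultimately show ?thesis by (meson order_le_imp_less_or_eq)
qed

text \<open>
  The components of the complement of the walls are the sets on which all the forms keep their
  integer parts.
\<close>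

lemma closure_component_complement:
  fixes \<Psi> :: "'v::euclidean_space set"
  assumes fin: "finite \<Psi>" and S: "S = {x. \<exists>r\<in>\<Psi>. r \<bullet> x \<in> \<int>}" and p: "p \<notin> S"
  shows "closure (connected_component_set (- S) p) = closed_cell \<Psi> p"
proof -
  define Q where "Q = {x. \<forall>r\<in>\<Psi>. of_int \<lfloor>r \<bullet> p\<rfloor> < r \<bullet> x \<and> r \<bullet> x < of_int \<lfloor>r \<bullet> p\<rfloor> + 1}"
  have pQ: "of_int \<lfloor>r \<bullet> p\<rfloor> < r \<bullet> p \<and> r \<bullet> p < of_int \<lfloor>r \<bullet> p\<rfloor> + 1" if "r \<in> \<Psi>" for r
    using floor_strict p S that by blast
  have "connected_component_set (- S) p = Q"
  proof
    have "Q = (\<Inter>r\<in>\<Psi>. {x. r \<bullet> x > of_int \<lfloor>r \<bullet> p\<rfloor>} \<inter> {x. r \<bullet> x < of_int \<lfloor>r \<bullet> p\<rfloor> + 1})"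
      unfolding Q_def by auto
    moreover have "convex ({x. r \<bullet> x > of_int \<lfloor>r \<bullet> p\<rfloor>} \<inter> {x. r \<bullet> x < of_int \<lfloor>r \<bullet> p\<rfloor> + 1})" for r :: 'v
      by (intro convex_Int convex_halfspace_gt convex_halfspace_lt)
    ultimately have "convex Q" by (auto intro: convex_INT)
    moreover have "Q \<subseteq> - S"
    proof
      fix x assume x: "x \<in> Q"
      have "r \<bullet> x \<notin> \<int>" if r: "r \<in> \<Psi>" for r
      proof
        assume "r \<bullet> x \<in> \<int>"
        then obtain k :: int where "r \<bullet> x = of_int k" by (auto elim: Ints_cases)
        then have "of_int \<lfloor>r \<bullet> p\<rfloor> < (of_int k :: real)" "of_int k < (of_int \<lfloor>r \<bullet> p\<rfloor> + 1 :: real)"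
          using x r unfolding Q_def by auto
        then have "\<lfloor>r \<bullet> p\<rfloor> < k" "of_int k < (of_int (\<lfloor>r \<bullet> p\<rfloor> + 1) :: real)" by simp_all
        then show False unfolding of_int_less_iff by simp
      qed
      then show "x \<in> - S" unfolding S by blast
    qed
    moreover have "p \<in> Q" using pQ unfolding Q_def by blast
    ultimately show "Q \<subseteq> connected_component_set (- S) p"
      using connected_component_maximal convex_connected by blast
    show "connected_component_set (- S) p \<subseteq> Q"
    proof
      fix y assume y: "y \<in> connected_component_set (- S) p"
      let ?C = "connected_component_set (- S) p"
      have pC: "p \<in> ?C" using p by simp
      show "y \<in> Q" unfolding Q_def
      proof (intro CollectI ballI)
        fix r assume r: "r \<in> \<Psi>"
        have con: "connected ((\<lambda>x. r \<bullet> x) ` ?C)"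
          by (intro connected_continuous_image continuous_intros connected_connected_component)
        have no: "of_int k \<notin> (\<lambda>x. r \<bullet> x) ` ?C" for k
        proof
          assume "of_int k \<in> (\<lambda>x. r \<bullet> x) ` ?C"
          then obtain z where "z \<in> ?C" "r \<bullet> z = of_int k" by auto
          moreover have "?C \<subseteq> - S" by (rule connected_component_subset)
          ultimately have "z \<notin> S" "r \<bullet> z \<in> \<int>" by auto
          then show False unfolding S using r by blast
        qed
        have "\<not> r \<bullet> y \<le> of_int \<lfloor>r \<bullet> p\<rfloor>"
          using connected_contains_Icc[OF con, of "r \<bullet> y" "r \<bullet> p"] y pC pQ[OF r] no[of "\<lfloor>r \<bullet> p\<rfloor>"]
          by (auto simp: subset_eq)
        moreover have "\<not> of_int \<lfloor>r \<bullet> p\<rfloor> + 1 \<le> r \<bullet> y"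
          using connected_contains_Icc[OF con, of "r \<bullet> p" "r \<bullet> y"] y pC pQ[OF r] no[of "\<lfloor>r \<bullet> p\<rfloor> + 1"]
          by (auto simp: subset_eq)
        ultimately show "of_int \<lfloor>r \<bullet> p\<rfloor> < r \<bullet> y \<and> r \<bullet> y < of_int \<lfloor>r \<bullet> p\<rfloor> + 1" by linarith
      qed
    qed
  qed
  then show ?thesis
    unfolding Q_def closed_cell_def
    using closure_open_strips[OF fin, of "\<lambda>r. of_int \<lfloor>r \<bullet> p\<rfloor>" p] pQ by simp
qed

text \<open>
  The walls have measure zero.
\<close>

lemma generic_point:
  fixes \<Psi> :: "'v::euclidean_space set"
  assumes fin: "finite \<Psi>" and nz: "0 \<notin> \<Psi>" and U: "open U" "U \<noteq> {}"
  shows "\<exists>p\<in>U. \<forall>r\<in>\<Psi>. r \<bullet> p \<notin> \<int>"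
proof (rule ccontr)
  assume "\<not> ?thesis"
  then have neg: "\<forall>p\<in>U. \<exists>r\<in>\<Psi>. r \<bullet> p \<in> \<int>" by blast
  have "U \<subseteq> (\<Union>r\<in>\<Psi>. \<Union>k::int. {x. r \<bullet> x = of_int k})"
  proof
    fix x assume "x \<in> U"
    then obtain r k where "r \<in> \<Psi>" "r \<bullet> x = of_int k" using neg by (metis Ints_cases)
    then show "x \<in> (\<Union>r\<in>\<Psi>. \<Union>k::int. {x. r \<bullet> x = of_int k})" by blast
  qed
  moreover have "negligible (\<Union>k::int. {x. r \<bullet> x = of_int k})" if "r \<in> \<Psi>" for r
    using that nz by (intro negligible_countable_Union) (auto intro!: negligible_hyperplane)
  then have "negligible (\<Union>r\<in>\<Psi>. \<Union>k::int. {x. r \<bullet> x = of_int k})"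
    using fin by (intro negligible_Union) auto
  ultimately have "negligible U" by (rule negligible_subset[rotated])
  then show False using open_not_negligible U by blast
qed

text \<open>
  For adjacent \<open>d\<close> and \<open>d'\<close>, the other weight adjacent to \<open>d\<close>.
\<close>

definition other_neighbour :: "'v::euclidean_space apartment \<Rightarrow> 'v \<Rightarrow> 'v \<Rightarrow> 'v" where
  "other_neighbour A d d' = (if is_PGL3 A then - d - d' else - d')"

lemma adjacent_sym: "adjacent A \<pi> d d' \<Longrightarrow> adjacent A \<pi> d' d"
  unfolding adjacent_def by (metis minus_minus)

lemma not_both_types: "is_PGSp4 A \<longleftrightarrow> \<not> is_PGL3 A"
  by (cases A) auto

lemma adjacent_other_neighbour:
  assumes du: "dual_reps A \<pi> \<pi>'" and ad: "adjacent A \<pi> d d'"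
  shows "adjacent A \<pi> d (other_neighbour A d d')"
proof -
  note i = adjacent_inner[OF du ad]
  from i(3) show ?thesis
  proof (elim disjE conjE)
    assume h: "is_PGL3 A" "d \<bullet> d' = - (d \<bullet> d) / 2" "weights A \<pi> = {d, d', - d - d'}"
    have "(- d - d') \<bullet> d = - (d \<bullet> d) / 2" using h(2) by (simp add: inner_diff_left inner_commute[of d' d])
    then have "- d - d' \<noteq> d" "- d - d' \<noteq> - d" using i(1) by (force, force)
    then show ?thesis unfolding adjacent_def other_neighbour_def using h by simp
  next
    assume h: "is_PGSp4 A" "weights A \<pi> = {d, d', - d, - d'}"
    then show ?thesis using ad
      unfolding adjacent_def other_neighbour_def not_both_types by (auto simp: minus_equation_iff)
  qed
qed

lemma edge_form_explicit:
  assumes du: "dual_reps A \<pi> \<pi>'" and ad: "adjacent A \<pi> d d'"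
  shows "is_PGL3 A \<Longrightarrow> edge_form d d' = (2 / (3 * (d \<bullet> d))) *\<^sub>R (d - d')"
    "is_PGL3 A \<Longrightarrow> edge_form d (other_neighbour A d d') = (2 / (3 * (d \<bullet> d))) *\<^sub>R (2 *\<^sub>R d + d')"
    "\<not> is_PGL3 A \<Longrightarrow> edge_form d d' = (1 / (d \<bullet> d)) *\<^sub>R (d - d')"
    "\<not> is_PGL3 A \<Longrightarrow> edge_form d (other_neighbour A d d') = (1 / (d \<bullet> d)) *\<^sub>R (d + d')"
proof -
  note i = adjacent_inner[OF du ad]
  have dd: "d' \<bullet> d = d \<bullet> d'" by (rule inner_commute)
  { assume A2: "is_PGL3 A"
    then have "d \<bullet> d' = - (d \<bullet> d) / 2" using i(3) not_both_types by blast
    then have e1: "(d - d') \<bullet> d = 3 * (d \<bullet> d) / 2" and e2: "(2 *\<^sub>R d + d') \<bullet> d = 3 * (d \<bullet> d) / 2"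
      by (simp_all add: inner_diff_left inner_add_left dd)
    have e3: "d - (- d - d') = 2 *\<^sub>R d + d'" by (simp add: scaleR_2)
    show "edge_form d d' = (2 / (3 * (d \<bullet> d))) *\<^sub>R (d - d')"
      unfolding edge_form_def e1 by simp
    have "edge_form d (- d - d') = (2 / (3 * (d \<bullet> d))) *\<^sub>R (2 *\<^sub>R d + d')"
      unfolding edge_form_def e3 e2 by simp
    then show "edge_form d (other_neighbour A d d') = (2 / (3 * (d \<bullet> d))) *\<^sub>R (2 *\<^sub>R d + d')"
      unfolding other_neighbour_def using A2 by simp }
  { assume C2: "\<not> is_PGL3 A"
    then have "d \<bullet> d' = 0" using i(3) by blast
    then show "edge_form d d' = (1 / (d \<bullet> d)) *\<^sub>R (d - d')"
      "edge_form d (other_neighbour A d d') = (1 / (d \<bullet> d)) *\<^sub>R (d + d')"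
      unfolding edge_form_def other_neighbour_def using C2
      by (simp_all add: inner_diff_left inner_add_left dd) }
qed

lemma edge_form_other:
  assumes du: "dual_reps A \<pi> \<pi>'" and ad: "adjacent A \<pi> d d'"
  shows "edge_form d' (other_neighbour A d' d) =
    edge_form d (other_neighbour A d d') - of_bool (is_PGL3 A) *\<^sub>R edge_form d d'"
proof -
  note i = adjacent_inner[OF du ad]
  note e = edge_form_explicit[OF du ad] and e' = edge_form_explicit[OF du adjacent_sym[OF ad]]
  show ?thesis
  proof (cases "is_PGL3 A")
    case True
    show ?thesis using e e' True i(2) by (simp add: scaleR_right_diff_distrib[symmetric] scaleR_2)
  next
    case False
    show ?thesis using e e' False i(2) by (simp add: add.commute)
  qed
qed

lemma coweight_wall_forms:
  assumes du: "dual_reps A \<pi> \<pi>'" and ad: "adjacent A \<pi> d d'"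
    and r: "r \<in> wall_forms A d d'" and x: "x \<in> coweights A"
  shows "r \<bullet> x \<in> \<int>"
proof (cases "is_PGL3 A")
  case True
  have "- d - d' = other_neighbour A d d'" "- d - d' = other_neighbour A d' d"
    using True unfolding other_neighbour_def by simp_all
  then show ?thesis
    using r edge_form_coweights[OF du ad x] edge_form_coweights[OF du adjacent_other_neighbour[OF du ad] x]
      edge_form_coweights[OF du adjacent_other_neighbour[OF du adjacent_sym[OF ad]] x] True
    unfolding wall_forms_def by auto
next
  case False
  have o: "- d' = other_neighbour A d d'" using False unfolding other_neighbour_def by simp
  have i: "d \<bullet> d = n_rep \<pi>'" "d \<bullet> d' = 0" "d' \<bullet> d' = n_rep \<pi>'" "n_rep \<pi>' \<noteq> 0"
    using adjacent_inner[OF du ad] False by auto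
  obtain D where D: "D \<in> weights A \<pi>'" "of_nat (n_rep \<pi>') *\<^sub>R D = d + d'"
    using adjacent_sum_dual_weight[OF du ad] by blast
  have "of_nat (n_rep \<pi>') * (d \<bullet> D) = of_nat (n_rep \<pi>')" "of_nat (n_rep \<pi>') * (d' \<bullet> D) = of_nat (n_rep \<pi>')"
    using arg_cong[OF D(2), of "\<lambda>z. d \<bullet> z"] arg_cong[OF D(2), of "\<lambda>z. d' \<bullet> z"] i
    by (simp_all add: inner_add_right inner_commute[of d' d])
  then have dD: "d \<bullet> D = 1" "d' \<bullet> D = 1" using i(4) by simp_all
  have "d \<bullet> x \<in> \<int>" "d' \<bullet> x \<in> \<int>"
    using coweights_dual[OF du ad D] x i dD by (auto simp: inner_add_right inner_commute[of d' d])
  then show ?thesis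
    using r edge_form_coweights[OF du ad x] edge_form_coweights[OF du adjacent_other_neighbour[OF du ad] x] False o
    unfolding wall_forms_def by auto
qed

lemma floor_near_integer:
  assumes "k \<in> \<int>" "\<bar>y - k\<bar> < (1::real)"
  shows "of_int \<lfloor>y\<rfloor> \<le> k \<and> k \<le> of_int \<lfloor>y\<rfloor> + 1"
proof -
  obtain m :: int where m: "k = of_int m" using assms(1) by (auto elim: Ints_cases)
  have "\<lfloor>y\<rfloor> \<le> m" "m \<le> \<lfloor>y\<rfloor> + 1" using assms(2) unfolding m by linarith+
  then show ?thesis unfolding m by linarith
qed

lemma floor_half_integer:
  assumes "k \<in> \<int>" "0 < y - k" "y - k < (1::real)" "0 \<le> t" "t \<le> 1"
  shows "of_int \<lfloor>y\<rfloor> \<le> k + t \<and> k + t \<le> of_int \<lfloor>y\<rfloor> + 1"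
proof -
  obtain m :: int where m: "k = of_int m" using assms(1) by (auto elim: Ints_cases)
  have "\<lfloor>y\<rfloor> = m" using assms(2,3) unfolding m by linarith
  then show ?thesis unfolding m using assms by linarith
qed

lemma unit_square_bounds:
  fixes a b c d :: real
  assumes "0 < a - b" "a - b < 1" "0 < c - d" "c - d < 1"
  shows "\<bar>1 / 2 * (c - a) - 1 / 2 * (d - b)\<bar> < 1" "\<bar>2 / 2 * (c - a) - 2 / 2 * (d - b)\<bar> < 1"
    "\<bar>2 / 2 * (a + c) - (2 / 2 * (b + d) + 1)\<bar> < 1"
    "0 < 1 / 2 * (a + c) - 1 / 2 * (b + d)" "1 / 2 * (a + c) - 1 / 2 * (b + d) < 1"
  unfolding abs_less_iff using assms by (auto simp: field_simps)

text \<open>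
  In the coordinates given by the two edge forms of \<open>d\<close>, which both have value \<open>1\<close> on \<open>d\<close>, the
  \<open>\<pi>\<close>-chamber is a unit square with diagonal \<open>d\<close>, in all four cases. A chamber that meets the open
  diagonal stays in the square because both forms are non-integral on the diagonal; conversely
  every point of the square lies in a chamber that contains the midpoint of the diagonal.
\<close>

lemma body_pi_chamber:
  assumes du: "dual_reps A \<pi> \<pi>'" and ad: "adjacent A \<pi> d d'" and v: "v \<in> coweights A"
  defines "\<phi> \<equiv> edge_form d d'" and "\<psi> \<equiv> edge_form d (other_neighbour A d d')"
  shows "body (pi_chamber A d v) =
    {x. 0 \<le> \<phi> \<bullet> (x - v) \<and> \<phi> \<bullet> (x - v) \<le> 1 \<and> 0 \<le> \<psi> \<bullet> (x - v) \<and> \<psi> \<bullet> (x - v) \<le> 1}"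
proof -
  note i = adjacent_inner[OF du ad]
  let ?F = "wall_forms A d d'"
  have F: "\<phi> \<in> ?F" "\<psi> \<in> ?F" unfolding wall_forms_def \<phi>_def \<psi>_def other_neighbour_def by auto
  have fin: "finite ?F" unfolding wall_forms_def by simp
  have one: "\<phi> \<bullet> d = 1" "\<psi> \<bullet> d = 1"
    using edge_form_inner(1)[OF du ad] edge_form_inner(1)[OF du adjacent_other_neighbour[OF du ad]]
    unfolding \<phi>_def \<psi>_def by simp_all
  have int: "r \<bullet> v \<in> \<int>" if "r \<in> ?F" for r using coweight_wall_forms[OF du ad that v] .
  have nz: "0 \<notin> ?F"
  proof -
    have eq: "- d' - d = - d - d'" by simp
    have "edge_form d' (- d - d') \<noteq> 0" if "is_PGL3 A"
      using edge_form_inner(1)[OF du adjacent_other_neighbour[OF du adjacent_sym[OF ad]]] that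
      unfolding other_neighbour_def eq by auto
    moreover have "d \<noteq> 0" "d' \<noteq> 0" using i by auto
    moreover have "edge_form d (- d - d') \<noteq> 0" if "is_PGL3 A"
      using one(2) that unfolding \<psi>_def other_neighbour_def by auto
    moreover have "edge_form d (- d') \<noteq> 0" if "\<not> is_PGL3 A"
      using one(2) that unfolding \<psi>_def other_neighbour_def by auto
    ultimately show ?thesis using one(1) unfolding wall_forms_def \<phi>_def by auto
  qed
  have sk: "skeleton A = {x. \<exists>r\<in>?F. r \<bullet> x \<in> \<int>}" using skeleton_wall_forms[OF du ad] by blast
  have ch: "chambers A = closed_cell ?F ` (- skeleton A)"
    unfolding chambers_def components_def skeleton_def[symmetric] image_image
    using closure_component_complement[OF fin sk] by (intro image_cong) auto
  have body: "x \<in> body (pi_chamber A d v) \<longleftrightarrow>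
      (\<exists>p. p \<notin> skeleton A \<and> x \<in> closed_cell ?F p \<and> (\<exists>t. 0 < t \<and> t < 1 \<and> v + t *\<^sub>R d \<in> closed_cell ?F p))" for x
  proof -
    have "open_segment v (v + d) = {v + t *\<^sub>R d | t. 0 < t \<and> t < 1}"
    proof -
      have "d \<noteq> 0" using i by auto
      moreover have "(1 - u) *\<^sub>R v + u *\<^sub>R (v + d) = v + u *\<^sub>R d" for u by (simp add: algebra_simps)
      ultimately show ?thesis unfolding in_segment set_eq_iff by auto
    qed
    then show ?thesis unfolding body_def pi_chamber_def ch by auto
  qed
  show ?thesis
  proof (rule Set.set_eqI, rule iffI)
    fix x assume "x \<in> body (pi_chamber A d v)"
    then obtain p t where p: "p \<notin> skeleton A" "x \<in> closed_cell ?F p" "0 < t" "t < 1" "v + t *\<^sub>R d \<in> closed_cell ?F p"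
      unfolding body by blast
    have key: "0 \<le> r \<bullet> (x - v) \<and> r \<bullet> (x - v) \<le> 1" if r: "r \<in> ?F" "r \<bullet> d = 1" for r
    proof -
      obtain k :: int where k: "r \<bullet> v = of_int k" using int[OF r(1)] by (auto elim: Ints_cases)
      have "of_int \<lfloor>r \<bullet> p\<rfloor> \<le> of_int k + t" "of_int k + t \<le> of_int \<lfloor>r \<bullet> p\<rfloor> + 1"
        using p(5) r k unfolding closed_cell_def by (auto simp: inner_add_right)
      then have "\<lfloor>r \<bullet> p\<rfloor> = k" using p(3,4) by linarith
      then show ?thesis using p(2) r(1) k unfolding closed_cell_def by (auto simp: inner_diff_right)
    qed
    show "x \<in> {x. 0 \<le> \<phi> \<bullet> (x - v) \<and> \<phi> \<bullet> (x - v) \<le> 1 \<and> 0 \<le> \<psi> \<bullet> (x - v) \<and> \<psi> \<bullet> (x - v) \<le> 1}"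
      using key[OF F(1) one(1)] key[OF F(2) one(2)] by blast
  next
    fix x assume x: "x \<in> {x. 0 \<le> \<phi> \<bullet> (x - v) \<and> \<phi> \<bullet> (x - v) \<le> 1 \<and> 0 \<le> \<psi> \<bullet> (x - v) \<and> \<psi> \<bullet> (x - v) \<le> 1}"
    define Q where "Q = {p. \<forall>r\<in>{\<phi>, \<psi>}. r \<bullet> v < r \<bullet> p \<and> r \<bullet> p < r \<bullet> v + 1}"
    define U where "U = (\<Inter>r\<in>?F. {p. r \<bullet> p > of_int \<lceil>r \<bullet> x\<rceil> - 1} \<inter> {p. r \<bullet> p < of_int \<lfloor>r \<bullet> x\<rfloor> + 1})"
    have "Q = ({p. \<phi> \<bullet> p > \<phi> \<bullet> v} \<inter> {p. \<phi> \<bullet> p < \<phi> \<bullet> v + 1}) \<inter> ({p. \<psi> \<bullet> p > \<psi> \<bullet> v} \<inter> {p. \<psi> \<bullet> p < \<psi> \<bullet> v + 1})"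
      unfolding Q_def by auto
    then have oQ: "open Q" by (simp add: open_halfspace_gt open_halfspace_lt open_Int)
    have oU: "open U" unfolding U_def using fin
      by (intro open_INT ballI open_Int open_halfspace_gt open_halfspace_lt)
    have "r \<bullet> x > of_int \<lceil>r \<bullet> x\<rceil> - 1" "r \<bullet> x < of_int \<lfloor>r \<bullet> x\<rfloor> + 1" for r by linarith+
    then have xU: "x \<in> U" unfolding U_def by blast
    have "closure Q = {x. \<forall>r\<in>{\<phi>, \<psi>}. r \<bullet> v \<le> r \<bullet> x \<and> r \<bullet> x \<le> r \<bullet> v + 1}"
      unfolding Q_def
      by (rule closure_open_strips[where p = "v + (1/2) *\<^sub>R d"]) (auto simp: inner_add_right one)
    then have "x \<in> closure Q" using x by (auto simp: inner_diff_right)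
    then have "U \<inter> Q \<noteq> {}" using open_Int_closure_eq_empty[OF oU, of Q] xU by blast
    then obtain p where p: "p \<in> U" "p \<in> Q" "\<forall>r\<in>?F. r \<bullet> p \<notin> \<int>"
      using generic_point[OF fin nz open_Int[OF oU oQ]] by blast
    have "p \<notin> skeleton A" using p(3) sk by blast
    moreover have "x \<in> closed_cell ?F p"
    proof -
      have "of_int \<lfloor>r \<bullet> p\<rfloor> \<le> r \<bullet> x \<and> r \<bullet> x \<le> of_int \<lfloor>r \<bullet> p\<rfloor> + 1" if "r \<in> ?F" for r
      proof -
        have "r \<bullet> p > of_int \<lceil>r \<bullet> x\<rceil> - 1" "r \<bullet> p < of_int \<lfloor>r \<bullet> x\<rfloor> + 1" using p(1) that unfolding U_def by blast+
        then have "\<lfloor>r \<bullet> p\<rfloor> \<le> \<lfloor>r \<bullet> x\<rfloor>" "\<lceil>r \<bullet> x\<rceil> \<le> \<lfloor>r \<bullet> p\<rfloor> + 1" by linarith+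
        then show ?thesis by linarith
      qed
      then show ?thesis unfolding closed_cell_def by blast
    qed
    moreover have "v + (1/2) *\<^sub>R d \<in> closed_cell ?F p"
    proof -
      have pq: "0 < \<phi> \<bullet> p - \<phi> \<bullet> v" "\<phi> \<bullet> p - \<phi> \<bullet> v < 1" "0 < \<psi> \<bullet> p - \<psi> \<bullet> v" "\<psi> \<bullet> p - \<psi> \<bullet> v < 1"
        using p(2) unfolding Q_def by auto
      have c1: "of_int \<lfloor>\<phi> \<bullet> p\<rfloor> \<le> \<phi> \<bullet> (v + (1/2) *\<^sub>R d) \<and> \<phi> \<bullet> (v + (1/2) *\<^sub>R d) \<le> of_int \<lfloor>\<phi> \<bullet> p\<rfloor> + 1"
        "of_int \<lfloor>\<psi> \<bullet> p\<rfloor> \<le> \<psi> \<bullet> (v + (1/2) *\<^sub>R d) \<and> \<psi> \<bullet> (v + (1/2) *\<^sub>R d) \<le> of_int \<lfloor>\<psi> \<bullet> p\<rfloor> + 1"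
        using floor_half_integer[OF int[OF F(1)] pq(1,2), of "1/2"]
          floor_half_integer[OF int[OF F(2)] pq(3,4), of "1/2"] by (simp_all add: inner_add_right one)
      show ?thesis
      proof (cases "is_PGL3 A")
        case True
        let ?r = "edge_form d' (- d - d')"
        have eq: "- d' - d = - d - d'" by simp
        have r: "?r = \<psi> - \<phi>" using edge_form_other[OF du ad] True
          unfolding \<phi>_def \<psi>_def other_neighbour_def eq by simp
        have rF: "?r \<in> ?F" using True unfolding wall_forms_def by simp
        have "\<bar>?r \<bullet> p - ?r \<bullet> v\<bar> < 1" unfolding r using pq by (simp add: inner_diff_left)
        moreover have "?r \<bullet> (v + (1/2) *\<^sub>R d) = ?r \<bullet> v" unfolding r using one
          by (simp add: inner_diff_left inner_add_right)
        ultimately have "of_int \<lfloor>?r \<bullet> p\<rfloor> \<le> ?r \<bullet> (v + (1/2) *\<^sub>R d) \<and> ?r \<bullet> (v + (1/2) *\<^sub>R d) \<le> of_int \<lfloor>?r \<bullet> p\<rfloor> + 1"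
          using floor_near_integer[OF int[OF rF]] by simp
        moreover have "?F = {\<phi>, \<psi>, ?r}" using True
          unfolding wall_forms_def \<phi>_def \<psi>_def other_neighbour_def by simp
        ultimately show ?thesis using c1 unfolding closed_cell_def mem_Collect_eq by (metis empty_iff insert_iff)
      next
        case False
        have N: "d \<bullet> d = 1 \<or> d \<bullet> d = 2" "d \<bullet> d' = 0" using i(3) False by auto
        have phi: "\<phi> = (1 / (d \<bullet> d)) *\<^sub>R (d - d')" and psi: "\<psi> = (1 / (d \<bullet> d)) *\<^sub>R (d + d')"
          using edge_form_explicit[OF du ad] False unfolding \<phi>_def \<psi>_def by simp_all
        have dx: "d \<bullet> x = (d \<bullet> d) / 2 * (\<phi> \<bullet> x + \<psi> \<bullet> x)" "d' \<bullet> x = (d \<bullet> d) / 2 * (\<psi> \<bullet> x - \<phi> \<bullet> x)" for x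
          unfolding phi psi using N(1) by (auto simp: inner_add_left inner_diff_left field_simps)
        have dF: "d \<in> ?F" "d' \<in> ?F" using False unfolding wall_forms_def by simp_all
        have "\<bar>d' \<bullet> p - d' \<bullet> v\<bar> < 1" using N(1)
        proof
          assume h: "d \<bullet> d = 1"
          show ?thesis unfolding dx[of p] dx[of v] h by (rule unit_square_bounds[OF pq])
        next
          assume h: "d \<bullet> d = 2"
          show ?thesis unfolding dx[of p] dx[of v] h by (rule unit_square_bounds[OF pq])
        qed
        moreover have "d' \<bullet> (v + (1/2) *\<^sub>R d) = d' \<bullet> v" using N(2)
          by (simp add: inner_add_right inner_commute[of d' d])
        ultimately have c3: "of_int \<lfloor>d' \<bullet> p\<rfloor> \<le> d' \<bullet> (v + (1/2) *\<^sub>R d) \<and> d' \<bullet> (v + (1/2) *\<^sub>R d) \<le> of_int \<lfloor>d' \<bullet> p\<rfloor> + 1"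
          using floor_near_integer[OF int[OF dF(2)]] by simp
        have c4: "of_int \<lfloor>d \<bullet> p\<rfloor> \<le> d \<bullet> (v + (1/2) *\<^sub>R d) \<and> d \<bullet> (v + (1/2) *\<^sub>R d) \<le> of_int \<lfloor>d \<bullet> p\<rfloor> + 1"
        proof (cases "d \<bullet> d = 1")
          case True
          have "0 < d \<bullet> p - d \<bullet> v" "d \<bullet> p - d \<bullet> v < 1" unfolding dx[of p] dx[of v] True by (rule unit_square_bounds[OF pq])+
          then show ?thesis using floor_half_integer[OF int[OF dF(1)], of "d \<bullet> p" "1/2"] True
            by (simp add: inner_add_right)
        next
          case False
          then have two: "d \<bullet> d = 2" using N by blast
          have "\<bar>d \<bullet> p - (d \<bullet> v + 1)\<bar> < 1" unfolding dx[of p] dx[of v] two by (rule unit_square_bounds[OF pq])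
          moreover have "d \<bullet> v + 1 \<in> \<int>" using int[OF dF(1)] by simp
          ultimately show ?thesis using floor_near_integer[of "d \<bullet> v + 1" "d \<bullet> p"] two
            by (simp add: inner_add_right)
        qed
        have "?F = {\<phi>, \<psi>, d, d'}" using False
          unfolding wall_forms_def \<phi>_def \<psi>_def other_neighbour_def by simp
        then show ?thesis using c1 c3 c4 unfolding closed_cell_def mem_Collect_eq by (metis empty_iff insert_iff)
      qed
    qed
    ultimately show "x \<in> body (pi_chamber A d v)" unfolding body
      by (intro exI[of _ p] conjI exI[of _ "1/2"]) auto
  qed
qed

section \<open>Geodesic galleries\<close>

text \<open>
  The \<open>i\<close>-th central edge of a gallery alternating between \<open>d\<close> and \<open>d'\<close>.
\<close>

definition gallery_step :: "'v \<Rightarrow> 'v \<Rightarrow> int \<Rightarrow> 'v" where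
  "gallery_step d d' i = (if even i then d else d')"

text \<open>
  The initial vertex of the \<open>i\<close>-th central edge of the alternating gallery starting at \<open>v\<close>.
\<close>

definition gallery_vertex :: "'v::real_vector \<Rightarrow> 'v \<Rightarrow> 'v \<Rightarrow> int \<Rightarrow> 'v" where
  "gallery_vertex v d d' i = v + of_int (i div 2) *\<^sub>R (d + d') + (if even i then 0 else d)"

text \<open>The gallery whose central edges start at \<open>v\<close> and alternate between \<open>d\<close> and \<open>d'\<close>.\<close>

definition straight_gallery ::
    "'v::euclidean_space apartment \<Rightarrow> 'v \<Rightarrow> 'v \<Rightarrow> 'v \<Rightarrow> int \<Rightarrow> 'v set \<times> 'v \<times> 'v" where
  "straight_gallery A v d d' i = pi_chamber A (gallery_step d d' i) (gallery_vertex v d d' i)"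

lemma pi_chamber_simps [simp]:
  "initial (pi_chamber A d v) = v" "terminal (pi_chamber A d v) = v + d"
  unfolding initial_def terminal_def pi_chamber_def by simp_all

lemma pi_chamber_eq_iff: "pi_chamber A d v = pi_chamber A e w \<longleftrightarrow> d = e \<and> v = w"
  unfolding pi_chamber_def by auto

lemma int_parity_cases:
  obtains (even) m where "i = 2 * m" | (odd) m where "i = 2 * m + (1::int)"
  by (cases "even i") (auto elim: evenE oddE)

lemma gallery_vertex_even: "gallery_vertex v d d' (2 * m) = v + of_int m *\<^sub>R (d + d')"
  and gallery_vertex_odd: "gallery_vertex v d d' (2 * m + 1) = v + of_int m *\<^sub>R (d + d') + d"
  and gallery_step_even: "gallery_step d d' (2 * m) = d"
  and gallery_step_odd: "gallery_step d d' (2 * m + 1) = d'"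
  unfolding gallery_vertex_def gallery_step_def by simp_all

lemma gallery_vertex_Suc: "gallery_vertex v d d' (i + 1) = gallery_vertex v d d' i + gallery_step d d' i"
proof (cases i rule: int_parity_cases)
  case (even m)
  then show ?thesis
    unfolding even by (simp only: gallery_vertex_even gallery_vertex_odd gallery_step_even)
next
  case (odd m)
  have "i + 1 = 2 * (m + 1)" using odd by simp
  then show ?thesis unfolding odd
    by (simp only: gallery_vertex_even gallery_vertex_odd gallery_step_odd) (simp add: algebra_simps)
qed

lemma gallery_step_add_Suc: "gallery_step d d' i + gallery_step d d' (i + 1) = (d :: 'v::ab_group_add) + d'"
  unfolding gallery_step_def by auto

lemma gallery_midpoint:
  "gallery_vertex v d d' n + (1/2) *\<^sub>R gallery_step d d' n = v + (1/2) *\<^sub>R d + (of_int n / 2) *\<^sub>R (d + d')"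
proof (cases n rule: int_parity_cases)
  case (even m)
  then show ?thesis unfolding even gallery_vertex_even gallery_step_even by simp
next
  case (odd m)
  have e: "of_int (2 * m + 1) / 2 = of_int m + (1/2 :: real)" by simp
  have h: "d + (1/2) *\<^sub>R d' = (1/2) *\<^sub>R d + (1/2) *\<^sub>R (d + d')"
    by (metis (no_types) add.assoc scaleR_half_double scaleR_right_distrib)
  have "v + of_int m *\<^sub>R (d + d') + d + (1/2) *\<^sub>R d' = v + of_int m *\<^sub>R (d + d') + ((1/2) *\<^sub>R d + (1/2) *\<^sub>R (d + d'))"
    by (simp only: add.assoc h)
  also have "\<dots> = v + (1/2) *\<^sub>R d + (of_int m + 1/2) *\<^sub>R (d + d')"
    by (simp only: scaleR_left_distrib ac_simps)
  finally show ?thesis unfolding odd gallery_vertex_odd gallery_step_odd e .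
qed

lemma straight_gallery_shift:
  "straight_gallery A v d d' (i + n) =
    straight_gallery A (gallery_vertex v d d' n) (gallery_step d d' n) (gallery_step d d' (n + 1)) i"
proof -
  have s: "gallery_step d d' (i + n) = gallery_step (gallery_step d d' n) (gallery_step d d' (n + 1)) i"
    unfolding gallery_step_def by auto
  have "gallery_vertex v d d' (i + n) =
      gallery_vertex (gallery_vertex v d d' n) (gallery_step d d' n) (gallery_step d d' (n + 1)) i"
  proof (cases i rule: int_parity_cases)
    case (even m)
    show ?thesis unfolding even gallery_vertex_even gallery_step_add_Suc
      unfolding gallery_vertex_def by (simp add: algebra_simps)
  next
    case (odd m)
    have "2 * m + 1 + n = (2 * m + n) + 1" by simp
    then have "gallery_vertex v d d' (2 * m + 1 + n) = gallery_vertex v d d' (2 * m + n) + gallery_step d d' (2 * m + n)"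
      by (simp only: gallery_vertex_Suc)
    moreover have "gallery_step d d' (2 * m + n) = gallery_step d d' n" unfolding gallery_step_def by simp
    moreover have "gallery_vertex v d d' (2 * m + n) = gallery_vertex v d d' n + of_int m *\<^sub>R (d + d')"
      unfolding gallery_vertex_def by (simp add: algebra_simps)
    ultimately show ?thesis unfolding odd gallery_vertex_odd gallery_step_add_Suc by simp
  qed
  then show ?thesis unfolding straight_gallery_def s by simp
qed

lemma straight_gallery_eq_iff:
  "straight_gallery A v d d' = straight_gallery A w c c' \<longleftrightarrow> v = w \<and> d = c \<and> d' = c'"
proof
  assume e: "straight_gallery A v d d' = straight_gallery A w c c'"
  show "v = w \<and> d = c \<and> d' = c'" using fun_cong[OF e, of 0] fun_cong[OF e, of 1]
    unfolding straight_gallery_def pi_chamber_eq_iff gallery_step_def gallery_vertex_def by simp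
qed simp

text \<open>
  Sets of points lying above a monotone family of affine graphs: the hull of two of them is filled
  by those in between, because each vertical segment is.
\<close>

lemma hull_of_bands:
  fixes s p :: "'v::real_vector \<Rightarrow> real" and a b :: "int \<Rightarrow> real" and e :: 'v
  assumes s: "\<And>x y u v. u + v = 1 \<Longrightarrow> s (u *\<^sub>R x + v *\<^sub>R y) = u * s x + v * s y"
    and p: "\<And>x y u v. u + v = 1 \<Longrightarrow> p (u *\<^sub>R x + v *\<^sub>R y) = u * p x + v * p y"
    and e: "\<And>x t. s (x + t *\<^sub>R e) = s x" "\<And>x t. p (x + t *\<^sub>R e) = p x + t"
    and step: "\<And>k y. 0 \<le> y \<Longrightarrow> y \<le> 1 \<Longrightarrow> a k + b k * y \<le> a (k + 1) + b (k + 1) * y"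
      "\<And>k y. 0 \<le> y \<Longrightarrow> y \<le> 1 \<Longrightarrow> a (k + 1) + b (k + 1) * y \<le> a k + b k * y + 1"
    and K: "\<And>k. K k = {x. 0 \<le> s x \<and> s x \<le> 1 \<and> a k + b k * s x \<le> p x \<and> p x \<le> a k + b k * s x + 1}"
    and ij: "i \<le> j"
  shows "convex hull (K i \<union> K j) = (\<Union>k\<in>{i..j}. K k)"
proof -
  have mono: "a k + b k * y \<le> a l + b l * y" if "k \<le> l" "0 \<le> y" "y \<le> 1" for k l y
    using that(1)
  proof (induction l rule: int_ge_induct)
    case (step l)
    then show ?case using assms(5)[OF that(2,3), of l] by linarith
  qed simp
  define U where "U = {x. 0 \<le> s x \<and> s x \<le> 1 \<and> a i + b i * s x \<le> p x \<and> p x \<le> a j + b j * s x + 1}"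
  have fill: "\<exists>k\<in>{i..l}. a k + b k * y \<le> q \<and> q \<le> a k + b k * y + 1"
    if y: "0 \<le> y" "y \<le> 1" "a i + b i * y \<le> q" "q \<le> a l + b l * y + 1" and "i \<le> l" for l y q
    using \<open>i \<le> l\<close> y(4)
  proof (induction l rule: int_ge_induct)
    case base
    then show ?case using y(3) by auto
  next
    case (step l)
    show ?case
    proof (cases "q \<le> a l + b l * y + 1")
      case True
      then obtain k where "k \<in> {i..l}" "a k + b k * y \<le> q \<and> q \<le> a k + b k * y + 1" using step by blast
      then show ?thesis by (intro bexI[of _ k]) auto
    next
      case False
      then have "a (l + 1) + b (l + 1) * y \<le> q" using assms(6)[OF y(1,2), of l] by linarith
      then show ?thesis using step by (intro bexI[of _ "l + 1"]) auto
    qed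
  qed
  have UK: "(\<Union>k\<in>{i..j}. K k) = U"
  proof
    show "(\<Union>k\<in>{i..j}. K k) \<subseteq> U"
    proof
      fix x assume "x \<in> (\<Union>k\<in>{i..j}. K k)"
      then obtain k where k: "i \<le> k" "k \<le> j" "x \<in> K k" by auto
      then have "0 \<le> s x" "s x \<le> 1" unfolding K by auto
      then show "x \<in> U" using mono[OF k(1), of "s x"] mono[OF k(2), of "s x"] k(3) unfolding U_def K by auto
    qed
    show "U \<subseteq> (\<Union>k\<in>{i..j}. K k)"
      using fill[OF _ _ _ _ ij] unfolding U_def K by auto
  qed
  have "convex U"
  proof (rule convexI)
    fix x y and u v :: real
    assume x: "x \<in> U" and y: "y \<in> U" and uv: "0 \<le> u" "0 \<le> v" "u + v = 1"
    have lin: "u * c + v * c = c" for c using uv(3) by (metis distrib_right mult_1)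
    have m: "u * l \<le> u * s x" "u * s x \<le> u * h" if "l \<le> s x" "s x \<le> h" for l h
      using that uv by (auto intro: mult_left_mono)
    have 1: "0 \<le> u * s x + v * s y" using x y uv unfolding U_def by auto
    have "u * s x + v * s y \<le> u * 1 + v * 1"
      using x y uv unfolding U_def by (intro add_mono mult_left_mono) auto
    then have 2: "u * s x + v * s y \<le> 1" using uv by simp
    have "u * (a i + b i * s x) + v * (a i + b i * s y) \<le> u * p x + v * p y"
      using x y uv unfolding U_def by (intro add_mono mult_left_mono) auto
    moreover have "u * (a i + b i * s x) + v * (a i + b i * s y) = a i + b i * (u * s x + v * s y)"
      using lin[of "a i"] by (simp add: algebra_simps)
    ultimately have 3: "a i + b i * (u * s x + v * s y) \<le> u * p x + v * p y" by simp
    have "u * p x + v * p y \<le> u * (a j + b j * s x + 1) + v * (a j + b j * s y + 1)"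
      using x y uv unfolding U_def by (intro add_mono mult_left_mono) auto
    moreover have "u * (a j + b j * s x + 1) + v * (a j + b j * s y + 1) = a j + b j * (u * s x + v * s y) + 1"
      using lin[of "a j"] uv(3) by (simp add: algebra_simps)
    ultimately have 4: "u * p x + v * p y \<le> a j + b j * (u * s x + v * s y) + 1" by simp
    show "u *\<^sub>R x + v *\<^sub>R y \<in> U" unfolding U_def using 1 2 3 4 s[OF uv(3)] p[OF uv(3)] by simp
  qed
  moreover have "K i \<union> K j \<subseteq> U" using UK ij by fastforce
  ultimately have "convex hull (K i \<union> K j) \<subseteq> U" by (intro hull_minimal) auto
  moreover have "U \<subseteq> convex hull (K i \<union> K j)"
  proof
    fix x assume x: "x \<in> U"
    define \<alpha> \<beta> where "\<alpha> = p x - (a i + b i * s x)" and "\<beta> = a j + b j * s x + 1 - p x"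
    have ab: "\<alpha> \<ge> 0" "\<beta> \<ge> 0" using x unfolding U_def \<alpha>_def \<beta>_def by auto
    have x1: "x + (- \<alpha>) *\<^sub>R e \<in> K i" using x unfolding K U_def \<alpha>_def by (simp add: e)
    have x2: "x + \<beta> *\<^sub>R e \<in> K j" using x unfolding K U_def \<beta>_def by (simp add: e)
    have pos: "\<alpha> + \<beta> > 0" using mono[OF ij, of "s x"] x unfolding U_def \<alpha>_def \<beta>_def by auto
    have sum1: "\<beta> / (\<alpha> + \<beta>) + \<alpha> / (\<alpha> + \<beta>) = 1" using pos by (simp add: add_divide_distrib[symmetric] add.commute)
    have "(\<beta> / (\<alpha> + \<beta>)) *\<^sub>R (x + (- \<alpha>) *\<^sub>R e) + (\<alpha> / (\<alpha> + \<beta>)) *\<^sub>R (x + \<beta> *\<^sub>R e) \<in> convex hull (K i \<union> K j)"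
      using x1 x2 ab pos sum1 by (intro convexD[OF convex_convex_hull]) (auto intro: hull_inc)
    moreover have "(\<beta> / (\<alpha> + \<beta>)) *\<^sub>R (x + (- \<alpha>) *\<^sub>R e) + (\<alpha> / (\<alpha> + \<beta>)) *\<^sub>R (x + \<beta> *\<^sub>R e) =
        (\<beta> / (\<alpha> + \<beta>) + \<alpha> / (\<alpha> + \<beta>)) *\<^sub>R x + (\<alpha> * \<beta> / (\<alpha> + \<beta>) - \<alpha> * \<beta> / (\<alpha> + \<beta>)) *\<^sub>R e"
      by (simp add: scaleR_left_distrib scaleR_right_distrib scaleR_right_diff_distrib mult.commute)
    ultimately show "x \<in> convex hull (K i \<union> K j)" unfolding sum1 by simp
  qed
  ultimately show ?thesis using UK by blast
qed

text \<open>
  A straight gallery in the coordinates of its first chamber: even chambers are squares, odd ones are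
  parallelograms over the same interval, slanted by \<open>\<kappa> = 1\<close> in type affine \<open>A\<^sub>2\<close> and by
  \<open>\<kappa> = 0\<close> in type affine \<open>C\<^sub>2\<close>. This is the shape required by \<open>hull_of_bands\<close>.
\<close>

lemma body_straight_gallery:
  assumes du: "dual_reps A \<pi> \<pi>'" and ad: "adjacent A \<pi> d d'" and v: "v \<in> coweights A"
  defines "\<phi> \<equiv> edge_form d d'" and "\<psi> \<equiv> edge_form d (other_neighbour A d d')"
    and "\<kappa> \<equiv> of_bool (is_PGL3 A) :: real"
  shows "body (straight_gallery A v d d' k) =
    {x. 0 \<le> \<phi> \<bullet> (x - v) \<and> \<phi> \<bullet> (x - v) \<le> 1 \<and>
      (of_int (k div 2) * (2 - \<kappa>) + (if even k then 0 else 1 - \<kappa>)) + (if even k then 0 else \<kappa>) * (\<phi> \<bullet> (x - v)) \<le> \<psi> \<bullet> (x - v) \<and>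
      \<psi> \<bullet> (x - v) \<le> (of_int (k div 2) * (2 - \<kappa>) + (if even k then 0 else 1 - \<kappa>)) + (if even k then 0 else \<kappa>) * (\<phi> \<bullet> (x - v)) + 1}"
    and "\<phi> \<bullet> d = 1" "\<phi> \<bullet> d' = - 1" "\<psi> \<bullet> d = 1" "\<psi> \<bullet> d' = 1 - \<kappa>"
proof -
  note ad' = adjacent_sym[OF ad]
  show d: "\<phi> \<bullet> d = 1" "\<phi> \<bullet> d' = - 1" "\<psi> \<bullet> d = 1"
    using edge_form_inner[OF du ad] edge_form_inner(1)[OF du adjacent_other_neighbour[OF du ad]]
    unfolding \<phi>_def \<psi>_def by simp_all
  have i2: "d' \<bullet> d' = d \<bullet> d" using adjacent_inner[OF du ad] by blast
  have psi': "edge_form d' (other_neighbour A d' d) = \<psi> - \<kappa> *\<^sub>R \<phi>"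
    using edge_form_other[OF du ad] unfolding \<phi>_def \<psi>_def \<kappa>_def .
  have phi': "edge_form d' d = - \<phi>" using edge_form_swap[OF i2[symmetric]] unfolding \<phi>_def .
  have "(\<psi> - \<kappa> *\<^sub>R \<phi>) \<bullet> d' = 1"
    using edge_form_inner(1)[OF du adjacent_other_neighbour[OF du ad']] unfolding psi' .
  then show d4: "\<psi> \<bullet> d' = 1 - \<kappa>" using d by (simp add: inner_diff_left)
  have mem: "d \<in> coweights A" "d' \<in> coweights A"
    using ad weights_subset_coweights unfolding adjacent_def by blast+
  show "body (straight_gallery A v d d' k) =
    {x. 0 \<le> \<phi> \<bullet> (x - v) \<and> \<phi> \<bullet> (x - v) \<le> 1 \<and>
      (of_int (k div 2) * (2 - \<kappa>) + (if even k then 0 else 1 - \<kappa>)) + (if even k then 0 else \<kappa>) * (\<phi> \<bullet> (x - v)) \<le> \<psi> \<bullet> (x - v) \<and>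
      \<psi> \<bullet> (x - v) \<le> (of_int (k div 2) * (2 - \<kappa>) + (if even k then 0 else 1 - \<kappa>)) + (if even k then 0 else \<kappa>) * (\<phi> \<bullet> (x - v)) + 1}"
  proof (cases k rule: int_parity_cases)
    case (even m)
    have w: "v + of_int m *\<^sub>R (d + d') \<in> coweights A" using v mem coweights_add coweights_scale by blast
    have "\<phi> \<bullet> (x - (v + of_int m *\<^sub>R (d + d'))) = \<phi> \<bullet> (x - v)"
      "\<psi> \<bullet> (x - (v + of_int m *\<^sub>R (d + d'))) = \<psi> \<bullet> (x - v) - of_int m * (2 - \<kappa>)" for x
      by (simp_all add: inner_diff_right inner_add_right d d4 algebra_simps)
    then show ?thesis
      unfolding straight_gallery_def even gallery_step_even gallery_vertex_even
        body_pi_chamber[OF du ad w] \<phi>_def[symmetric] \<psi>_def[symmetric] by auto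
  next
    case (odd m)
    have w: "v + of_int m *\<^sub>R (d + d') + d \<in> coweights A" using v mem coweights_add coweights_scale by blast
    have "(- \<phi>) \<bullet> (x - (v + of_int m *\<^sub>R (d + d') + d)) = 1 - \<phi> \<bullet> (x - v)"
      "(\<psi> - \<kappa> *\<^sub>R \<phi>) \<bullet> (x - (v + of_int m *\<^sub>R (d + d') + d)) =
        \<psi> \<bullet> (x - v) - \<kappa> * (\<phi> \<bullet> (x - v)) - of_int m * (2 - \<kappa>) - (1 - \<kappa>)" for x
      by (simp_all add: inner_diff_right inner_add_right inner_diff_left d d4 algebra_simps)
    then show ?thesis
      unfolding straight_gallery_def odd gallery_step_odd gallery_vertex_odd
        body_pi_chamber[OF du ad' w] phi' psi' by auto
  qed
qed

lemma geodesic_straight_gallery: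
  assumes du: "dual_reps A \<pi> \<pi>'" and ad: "adjacent A \<pi> d d'" and v: "v \<in> coweights A"
  shows "geodesic_gallery A \<pi> (straight_gallery A v d d')"
  unfolding geodesic_gallery_def
proof (intro conjI allI impI)
  have mem: "d \<in> coweights A" "d' \<in> coweights A" and W: "d \<in> weights A \<pi>" "d' \<in> weights A \<pi>"
    and nz: "d' \<noteq> - d"
    using ad weights_subset_coweights unfolding adjacent_def by blast+
  fix i :: int
  have "gallery_vertex v d d' i \<in> coweights A"
    unfolding gallery_vertex_def using v mem by (auto intro!: coweights_add coweights_scale)
  moreover have "gallery_step d d' i \<in> weights A \<pi>" unfolding gallery_step_def using W by simp
  ultimately show "straight_gallery A v d d' i \<in> pi_chambers A \<pi>"
    unfolding pi_chambers_def straight_gallery_def by blast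
  show "terminal (straight_gallery A v d d' i) = initial (straight_gallery A v d d' (i + 1))"
    unfolding straight_gallery_def by (simp add: gallery_vertex_Suc)
  have "gallery_step d d' i + gallery_step d d' (i + 1) \<noteq> 0"
    unfolding gallery_step_add_Suc using nz by (metis add_eq_0_iff)
  then show "terminal (straight_gallery A v d d' (i + 1)) \<noteq> initial (straight_gallery A v d d' i)"
    unfolding straight_gallery_def by (simp add: gallery_vertex_Suc add.assoc)
  fix j :: int assume "i < j"
  define \<phi> \<psi> where "\<phi> = edge_form d d'" and "\<psi> = edge_form d (other_neighbour A d d')"
  define \<kappa> where "\<kappa> = (of_bool (is_PGL3 A) :: real)"
  note b = body_straight_gallery[OF du ad v, folded \<phi>_def \<psi>_def \<kappa>_def]
  have k01: "\<kappa> = 0 \<or> \<kappa> = 1" unfolding \<kappa>_def by simp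
  let ?a = "\<lambda>k::int. of_int (k div 2) * (2 - \<kappa>) + (if even k then 0 else 1 - \<kappa>)"
  let ?b = "\<lambda>k::int. (if even k then 0 else \<kappa>)"
  show "convex hull (body (straight_gallery A v d d' i) \<union> body (straight_gallery A v d d' j)) =
      (\<Union>k\<in>{i..j}. body (straight_gallery A v d d' k))"
  proof (rule hull_of_bands[where s = "\<lambda>x. \<phi> \<bullet> (x - v)" and p = "\<lambda>x. \<psi> \<bullet> (x - v)"
        and a = ?a and b = ?b and e = "(1 / (2 - \<kappa>)) *\<^sub>R (d + d')"])
    fix x y :: 'a and u w :: real assume uw: "u + w = 1"
    have lin: "u * c + w * c = c" for c using uw by (metis distrib_right mult_1)
    show "\<phi> \<bullet> (u *\<^sub>R x + w *\<^sub>R y - v) = u * (\<phi> \<bullet> (x - v)) + w * (\<phi> \<bullet> (y - v))"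
      using lin[of "\<phi> \<bullet> v"] by (simp add: inner_diff_right inner_add_right algebra_simps)
    show "\<psi> \<bullet> (u *\<^sub>R x + w *\<^sub>R y - v) = u * (\<psi> \<bullet> (x - v)) + w * (\<psi> \<bullet> (y - v))"
      using lin[of "\<psi> \<bullet> v"] by (simp add: inner_diff_right inner_add_right algebra_simps)
  next
    fix x :: 'a and t :: real
    show "\<phi> \<bullet> (x + t *\<^sub>R (1 / (2 - \<kappa>)) *\<^sub>R (d + d') - v) = \<phi> \<bullet> (x - v)"
      using b(2,3) by (simp add: inner_diff_right inner_add_right)
    have "\<psi> \<bullet> (d + d') = 2 - \<kappa>" using b(4,5) by (simp add: inner_add_right)
    moreover have "2 - \<kappa> \<noteq> 0" using k01 by auto
    ultimately show "\<psi> \<bullet> (x + t *\<^sub>R (1 / (2 - \<kappa>)) *\<^sub>R (d + d') - v) = \<psi> \<bullet> (x - v) + t"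
      by (simp add: inner_diff_right inner_add_right[of _ x])
  next
    fix k :: int and y :: real assume y: "0 \<le> y" "y \<le> 1"
    have "?a k + ?b k * y \<le> ?a (k + 1) + ?b (k + 1) * y \<and> ?a (k + 1) + ?b (k + 1) * y \<le> ?a k + ?b k * y + 1"
    proof (cases k rule: int_parity_cases)
      case (even m)
      then show ?thesis using k01 y by auto
    next
      case (odd m)
      have "k + 1 = 2 * (m + 1)" using odd by simp
      then have "(k + 1) div 2 = m + 1" "even (k + 1)" by simp_all
      then show ?thesis using odd k01 y by (auto simp: algebra_simps)
    qed
    then show "?a k + ?b k * y \<le> ?a (k + 1) + ?b (k + 1) * y"
      "?a (k + 1) + ?b (k + 1) * y \<le> ?a k + ?b k * y + 1" by blast+
  next
    show "i \<le> j" using \<open>i < j\<close> by simp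
  qed (rule b(1))
qed

lemma exists_adjacent:
  assumes du: "dual_reps A \<pi> \<pi>'" and d: "d \<in> weights A \<pi>"
  shows "\<exists>d'. adjacent A \<pi> d d'"
proof -
  obtain D where "D \<in> weights A \<pi>'"
    using du by (cases rule: dual_reps_cases) auto
  then obtain c c' where cc: "adjacent A \<pi> c c'" using dual_weight_adjacent_sum[OF du] by blast
  note i = adjacent_inner(3)[OF du cc]
  have o: "adjacent A \<pi> (other_neighbour A c c') c"
    using adjacent_sym[OF adjacent_other_neighbour[OF du cc]] .
  from i show ?thesis
  proof (elim disjE conjE)
    assume h: "is_PGL3 A" "weights A \<pi> = {c, c', - c - c'}"
    then have "d = c \<or> d = c' \<or> d = other_neighbour A c c'" using d unfolding other_neighbour_def by simp
    then show ?thesis using cc adjacent_sym[OF cc] o by blast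
  next
    assume h: "is_PGSp4 A" "weights A \<pi> = {c, c', - c, - c'}"
    then have "d = c \<or> d = c' \<or> d = other_neighbour A c c' \<or> d = - c"
      using d not_both_types[of A] unfolding other_neighbour_def by auto
    moreover have "adjacent A \<pi> (- c) c'" using cc h(2) unfolding adjacent_def by simp
    ultimately show ?thesis using cc adjacent_sym[OF cc] o by blast
  qed
qed

text \<open>
  Convexity applied to two consecutive chambers excludes a repeated central edge, and applied to three
  consecutive ones it excludes a turn in which the third edge differs from the first.
\<close>

lemma geodesic_gallery_straight:
  assumes du: "dual_reps A \<pi> \<pi>'" and C: "geodesic_gallery A \<pi> C"
  shows "\<exists>v d d'. v \<in> coweights A \<and> adjacent A \<pi> d d' \<and> C = straight_gallery A v d d'"
proof -
  have "\<forall>i. \<exists>d v. C i = pi_chamber A d v \<and> d \<in> weights A \<pi> \<and> v \<in> coweights A"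
    using C unfolding geodesic_gallery_def pi_chambers_def by blast
  then obtain E V where EV: "\<And>i. C i = pi_chamber A (E i) (V i)" "\<And>i. E i \<in> weights A \<pi>" "\<And>i. V i \<in> coweights A"
    by metis
  have hull: "convex hull (body (C i) \<union> body (C j)) = (\<Union>k\<in>{i..j}. body (C k))" if "i < j" for i j
    using C that unfolding geodesic_gallery_def by blast
  have V: "V (i + 1) = V i + E i" for i using C EV(1) unfolding geodesic_gallery_def by (metis pi_chamber_simps)
  have nb: "E (i + 1) \<noteq> - E i" for i
  proof
    assume "E (i + 1) = - E i"
    then have "terminal (C (i + 1)) = initial (C i)" unfolding EV(1) using V[of i] by simp
    then show False using C unfolding geodesic_gallery_def by blast
  qed
  have ns: "E (i + 1) \<noteq> E i" for i
  proof
    assume same: "E (i + 1) = E i"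
    obtain d' where ad: "adjacent A \<pi> (E i) d'" using exists_adjacent[OF du EV(2)] by blast
    define \<phi> \<psi> where "\<phi> = edge_form (E i) d'" and "\<psi> = edge_form (E i) (other_neighbour A (E i) d')"
    define \<kappa> where "\<kappa> = (of_bool (is_PGL3 A) :: real)"
    note b = body_straight_gallery(2-5)[OF du ad EV(3), folded \<phi>_def \<psi>_def \<kappa>_def]
    have k01: "\<kappa> = 0 \<or> \<kappa> = 1" unfolding \<kappa>_def by simp
    \<comment> \<open>the corner with coordinates 1 and 0 of the first square; the midpoint between this corner and its
      translate in the second square has coordinates 3/2 and 1/2 and lies in neither of them\<close>
    define p where "p = ((1 - \<kappa>) / (2 - \<kappa>)) *\<^sub>R E i - (1 / (2 - \<kappa>)) *\<^sub>R d'"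
    have p: "\<phi> \<bullet> p = 1" "\<psi> \<bullet> p = 0" unfolding p_def using b k01 by (auto simp: inner_diff_right)
    have B: "body (C i) = {x. 0 \<le> \<phi> \<bullet> (x - V i) \<and> \<phi> \<bullet> (x - V i) \<le> 1 \<and> 0 \<le> \<psi> \<bullet> (x - V i) \<and> \<psi> \<bullet> (x - V i) \<le> 1}"
      "body (C (i + 1)) = {x. 0 \<le> \<phi> \<bullet> (x - (V i + E i)) \<and> \<phi> \<bullet> (x - (V i + E i)) \<le> 1 \<and>
          0 \<le> \<psi> \<bullet> (x - (V i + E i)) \<and> \<psi> \<bullet> (x - (V i + E i)) \<le> 1}"
      using body_pi_chamber[OF du ad EV(3)[of i]] body_pi_chamber[OF du ad EV(3)[of "i + 1"]]
      unfolding EV(1) same V \<phi>_def \<psi>_def by simp_all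
    have "V i + p \<in> body (C i)" "V i + E i + p \<in> body (C (i + 1))" unfolding B using p by simp_all
    then have "(1/2) *\<^sub>R (V i + p) + (1/2) *\<^sub>R (V i + E i + p) \<in> convex hull (body (C i) \<union> body (C (i + 1)))"
      by (intro convexD[OF convex_convex_hull]) (auto intro: hull_inc)
    then have "(1/2) *\<^sub>R (V i + p) + (1/2) *\<^sub>R (V i + E i + p) \<in> body (C i) \<union> body (C (i + 1))"
      using hull[of i "i + 1"] by (auto simp: simp_from_to)
    moreover have "(1/2) *\<^sub>R (V i + p) + (1/2) *\<^sub>R (V i + E i + p) = V i + p + (1/2) *\<^sub>R E i"
      by (simp add: algebra_simps flip: scaleR_left_distrib)
    ultimately show False unfolding B using p b by (auto simp: inner_add_right inner_diff_right)
  qed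
  have ad: "adjacent A \<pi> (E i) (E (i + 1))" for i
    unfolding adjacent_def using EV(2) ns nb by blast
  have per: "E (i + 2) = E i" for i
  proof (rule ccontr)
    assume ne: "E (i + 2) \<noteq> E i"
    have ad12: "adjacent A \<pi> (E (i + 1)) (E (i + 2))" using ad[of "i + 1"] by (simp add: add.assoc)
    define \<phi> \<psi> where "\<phi> = edge_form (E i) (E (i + 1))" and "\<psi> = edge_form (E i) (other_neighbour A (E i) (E (i + 1)))"
    define \<kappa> where "\<kappa> = (of_bool (is_PGL3 A) :: real)"
    note b = body_straight_gallery(2-5)[OF du ad EV(3), of i, folded \<phi>_def \<psi>_def \<kappa>_def]
    have k01: "\<kappa> = 0 \<or> \<kappa> = 1" unfolding \<kappa>_def by simp
    note n = adjacent_inner[OF du ad[of i]]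
    have third: "E (i + 2) = other_neighbour A (E (i + 1)) (E i)" "other_neighbour A (E (i + 1)) (E (i + 2)) = E i"
    proof -
      have "E (i + 2) \<in> weights A \<pi>" "E (i + 2) \<noteq> E (i + 1)" "E (i + 2) \<noteq> - E (i + 1)"
        using ad12 unfolding adjacent_def by blast+
      then have "E (i + 2) = (if is_PGL3 A then - E i - E (i + 1) else - E i)"
        using n(3) ne not_both_types by auto
      then show "E (i + 2) = other_neighbour A (E (i + 1)) (E i)" "other_neighbour A (E (i + 1)) (E (i + 2)) = E i"
        unfolding other_neighbour_def by (simp_all add: algebra_simps)
    qed
    have n12: "E (i + 2) \<bullet> E (i + 2) = E (i + 1) \<bullet> E (i + 1)" using adjacent_inner(2)[OF du ad12] .
    have f1: "edge_form (E (i + 1)) (E i) = - \<phi>" unfolding \<phi>_def using n(2) by (intro edge_form_swap) simp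
    have f2: "edge_form (E (i + 1)) (E (i + 2)) = \<psi> - \<kappa> *\<^sub>R \<phi>"
      unfolding third(1) \<phi>_def \<psi>_def \<kappa>_def using edge_form_other[OF du ad[of i]] .
    have f3: "edge_form (E (i + 2)) (E (i + 1)) = - (\<psi> - \<kappa> *\<^sub>R \<phi>)"
      unfolding f2[symmetric] using n12 by (intro edge_form_swap) simp
    have f4: "edge_form (E (i + 2)) (other_neighbour A (E (i + 2)) (E (i + 1))) = - \<phi> - \<kappa> *\<^sub>R (\<psi> - \<kappa> *\<^sub>R \<phi>)"
      using edge_form_other[OF du ad12] unfolding third(2) f1 f2 \<kappa>_def[symmetric] .
    have V2: "V (i + 2) = V i + (E i + E (i + 1))" using V[of i] V[of "i + 1"] by (simp add: add.assoc)
    have B0: "body (C i) = {x. 0 \<le> \<phi> \<bullet> (x - V i) \<and> \<phi> \<bullet> (x - V i) \<le> 1 \<and> 0 \<le> \<psi> \<bullet> (x - V i) \<and> \<psi> \<bullet> (x - V i) \<le> 1}"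
      using body_pi_chamber[OF du ad EV(3)[of i]] unfolding EV(1) \<phi>_def \<psi>_def .
    have B1: "body (C (i + 1)) = {x. 0 \<le> (- \<phi>) \<bullet> (x - (V i + E i)) \<and> (- \<phi>) \<bullet> (x - (V i + E i)) \<le> 1 \<and>
        0 \<le> (\<psi> - \<kappa> *\<^sub>R \<phi>) \<bullet> (x - (V i + E i)) \<and> (\<psi> - \<kappa> *\<^sub>R \<phi>) \<bullet> (x - (V i + E i)) \<le> 1}"
      using body_pi_chamber[OF du adjacent_sym[OF ad[of i]] EV(3)[of "i + 1"]]
      unfolding EV(1) V f1 third(1)[symmetric] f2 .
    have B2: "body (C (i + 2)) = {x. 0 \<le> (- (\<psi> - \<kappa> *\<^sub>R \<phi>)) \<bullet> (x - V (i + 2)) \<and> (- (\<psi> - \<kappa> *\<^sub>R \<phi>)) \<bullet> (x - V (i + 2)) \<le> 1 \<and>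
        0 \<le> (- \<phi> - \<kappa> *\<^sub>R (\<psi> - \<kappa> *\<^sub>R \<phi>)) \<bullet> (x - V (i + 2)) \<and> (- \<phi> - \<kappa> *\<^sub>R (\<psi> - \<kappa> *\<^sub>R \<phi>)) \<bullet> (x - V (i + 2)) \<le> 1}"
      using body_pi_chamber[OF du adjacent_sym[OF ad12] EV(3)[of "i + 2"]] unfolding EV(1)[symmetric] f3 f4 .
    let ?H = "{x. (\<phi> + \<psi>) \<bullet> x \<le> (\<phi> + \<psi>) \<bullet> V i + 2}"
    have "body (C i) \<subseteq> ?H" unfolding B0 by (auto simp: inner_add_left inner_diff_right)
    moreover have "body (C (i + 2)) \<subseteq> ?H"
    proof
      fix x assume "x \<in> body (C (i + 2))"
      then have "(\<phi> + \<psi>) \<bullet> (x - V (i + 2)) \<le> \<kappa>"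
        unfolding B2 using k01 by (auto simp: inner_add_left inner_diff_left)
      moreover have "(\<phi> + \<psi>) \<bullet> (V (i + 2)) = (\<phi> + \<psi>) \<bullet> V i + (2 - \<kappa>)"
        unfolding V2 using b by (simp add: inner_add_left inner_add_right)
      ultimately show "x \<in> ?H" by (simp add: inner_diff_right)
    qed
    ultimately have "convex hull (body (C i) \<union> body (C (i + 2))) \<subseteq> ?H"
      by (intro hull_minimal) (auto intro: convex_halfspace_le)
    \<comment> \<open>the far corner of the middle square lies beyond both neighbours\<close>
    define q where "q = V i + E i + (1 / (2 - \<kappa>)) *\<^sub>R (E i + E (i + 1))"
    have s: "\<phi> \<bullet> (E i + E (i + 1)) = 0" "\<psi> \<bullet> (E i + E (i + 1)) = 2 - \<kappa>" using b by (simp_all add: inner_add_right)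
    have q: "\<phi> \<bullet> (q - (V i + E i)) = 0" "\<psi> \<bullet> (q - (V i + E i)) = 1"
      unfolding q_def using s k01 by auto
    have "q \<in> body (C (i + 1))" unfolding B1 using q by (simp add: inner_diff_left)
    then have "q \<in> (\<Union>k\<in>{i..i + 2}. body (C k))" by force
    then have "q \<in> convex hull (body (C i) \<union> body (C (i + 2)))" using hull[of i "i + 2"] by simp
    then have "q \<in> ?H" using \<open>convex hull _ \<subseteq> ?H\<close> by blast
    moreover have "(\<phi> + \<psi>) \<bullet> q = (\<phi> + \<psi>) \<bullet> V i + 3"
      using q b by (simp add: inner_add_left inner_add_right inner_diff_right)
    ultimately show False by simp
  qed
  have E: "E i = gallery_step (E 0) (E 1) i" for i
  proof -
    have "E (2 * m) = E 0" for m
    proof (induction m rule: int_induct[of _ 0])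
      case (step1 i)
      then show ?case using per[of "2 * i"] by (simp add: algebra_simps)
    next
      case (step2 i)
      then show ?case using per[of "2 * i - 2"] by (simp add: algebra_simps)
    qed simp
    moreover have "E (2 * m + 1) = E 1" for m
    proof (induction m rule: int_induct[of _ 0])
      case (step1 i)
      then show ?case using per[of "2 * i + 1"] by (simp add: algebra_simps)
    next
      case (step2 i)
      then show ?case using per[of "2 * i - 1"] by (simp add: algebra_simps)
    qed simp
    ultimately show ?thesis by (cases i rule: int_parity_cases) (simp_all only: gallery_step_even gallery_step_odd)
  qed
  have "V i = gallery_vertex (V 0) (E 0) (E 1) i" for i
  proof (induction i rule: int_induct[of _ 0])
    case base
    show ?case unfolding gallery_vertex_def by simp
  next
    case (step1 i)
    then show ?case using V[of i] gallery_vertex_Suc[of "V 0" "E 0" "E 1" i] E[of i] by simp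
  next
    case (step2 i)
    then show ?case using V[of "i - 1"] gallery_vertex_Suc[of "V 0" "E 0" "E 1" "i - 1"] E[of "i - 1"] by simp
  qed
  then have "C = straight_gallery A (V 0) (E 0) (E 1)"
    unfolding straight_gallery_def using E EV(1) by (metis ext)
  then show ?thesis using EV(3) ad[of 0] by auto
qed

section \<open>Closed galleries and semi-rational geodesics\<close>

context quotient_apartment
begin

lemma n_rep_pos: "of_nat (n_rep \<pi>') > (0 :: real)"
  by (cases \<pi>') auto

lemma adjacent_image:
  assumes g: "g \<in> \<Gamma>" and ad: "adjacent A \<pi> d d'"
  shows "adjacent A \<pi> (linear_part g d) (linear_part g d')"
proof -
  note lin = linear_linear_part[OF g]
  have "inj (linear_part g)" using weyl_inj[OF frame elem(1)[OF g]] .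
  then have "linear_part g d' \<noteq> linear_part g d" "linear_part g d' \<noteq> linear_part g (- d)"
    using ad unfolding adjacent_def by (auto dest: injD)
  then show ?thesis
    using ad linear_part_weights[OF g] unfolding adjacent_def linear_neg[OF lin] by blast
qed

lemma act_pi_chamber:
  assumes g: "g \<in> \<Gamma>" and d: "d \<in> weights A \<pi>" and v: "v \<in> coweights A"
  shows "act g (pi_chamber A d v) = pi_chamber A (linear_part g d) (g v)"
proof -
  note lin = linear_linear_part[OF g]
  obtain d' where ad: "adjacent A \<pi> d d'" using exists_adjacent[OF dual d] by blast
  note ad' = adjacent_image[OF g ad]
  have gv: "g v \<in> coweights A" using maps_coweights[OF g v] by blast
  obtain h where h: "h \<in> \<Gamma>" "h \<circ> g = id" "g \<circ> h = id" using inverse_mem[OF g] by blast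
  have o: "other_neighbour A (linear_part g d) (linear_part g d') = linear_part g (other_neighbour A d d')"
    unfolding other_neighbour_def by (simp add: linear_neg[OF lin] linear_diff[OF lin])
  have ef: "edge_form (linear_part g x) (linear_part g y) = linear_part g (edge_form x y)" for x y
    unfolding edge_form_def linear_diff[OF lin, symmetric] isometry[OF g] linear_scale[OF lin] ..
  have diff: "g x - g v = linear_part g (x - v)" for x
    using elem(3)[OF g, of v "x - v"] by simp
  have "g ` body (pi_chamber A d v) = body (pi_chamber A (linear_part g d) (g v))"
  proof
    show "g ` body (pi_chamber A d v) \<subseteq> body (pi_chamber A (linear_part g d) (g v))"
      unfolding body_pi_chamber[OF dual ad v] body_pi_chamber[OF dual ad' gv] o ef
      by (auto simp: diff isometry[OF g])
    show "body (pi_chamber A (linear_part g d) (g v)) \<subseteq> g ` body (pi_chamber A d v)"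
    proof
      fix y assume y: "y \<in> body (pi_chamber A (linear_part g d) (g v))"
      have gy: "g (h y) = y" using fun_cong[OF h(3), of y] by simp
      have yv: "y - g v = linear_part g (h y - v)" using diff[of "h y"] gy by simp
      have "h y \<in> body (pi_chamber A d v)"
        using y unfolding body_pi_chamber[OF dual ad v] body_pi_chamber[OF dual ad' gv] o ef
        by (simp add: yv isometry[OF g])
      then show "y \<in> g ` body (pi_chamber A d v)" using gy by (metis imageI)
    qed
  qed
  moreover have "g (v + d) = g v + linear_part g d" using elem(3)[OF g] .
  ultimately show ?thesis
    unfolding act_def by (simp add: body_def initial_def terminal_def pi_chamber_def)
qed

lemma act_straight_gallery:
  assumes g: "g \<in> \<Gamma>" and ad: "adjacent A \<pi> d d'" and v: "v \<in> coweights A"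
  shows "act g (straight_gallery A v d d' i) =
    straight_gallery A (g v) (linear_part g d) (linear_part g d') i"
proof -
  note lin = linear_linear_part[OF g]
  have W: "d \<in> weights A \<pi>" "d' \<in> weights A \<pi>" and L: "d \<in> coweights A" "d' \<in> coweights A"
    using ad weights_subset_coweights unfolding adjacent_def by blast+
  have w: "gallery_vertex v d d' i \<in> coweights A"
    unfolding gallery_vertex_def using v L by (auto intro!: coweights_add coweights_scale)
  have e: "gallery_step d d' i \<in> weights A \<pi>" unfolding gallery_step_def using W by simp
  have "linear_part g (gallery_step d d' i) = gallery_step (linear_part g d) (linear_part g d') i"
    unfolding gallery_step_def by simp
  moreover have "g (gallery_vertex v d d' i) = gallery_vertex (g v) (linear_part g d) (linear_part g d') i"
  proof -
    have "gallery_vertex v d d' i = v + (of_int (i div 2) *\<^sub>R (d + d') + (if even i then 0 else d))"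
      unfolding gallery_vertex_def by (simp add: add.assoc)
    then show ?thesis
      unfolding gallery_vertex_def
      by (simp add: elem(3)[OF g] linear_add[OF lin] linear_scale[OF lin] linear_0[OF lin] add.assoc)
  qed
  ultimately show ?thesis unfolding straight_gallery_def act_pi_chamber[OF g e w] by simp
qed

text \<open>
  An element that carries a gallery to a shift of another one by \<open>n\<close> carries midlines to midlines,
  advancing by \<open>n\<close> half-steps \<open>n_rep \<pi>' / 2\<close>.
\<close>

lemma straight_gallery_closing:
  assumes g: "g \<in> \<Gamma>" and ad: "adjacent A \<pi> d d'" and v: "v \<in> coweights A"
    and D: "of_nat (n_rep \<pi>') *\<^sub>R D = d + d'"
    and cl: "\<And>i. straight_gallery A v d d' (i + n) = act g (straight_gallery A w c c' i)"
    and adc: "adjacent A \<pi> c c'" and w: "w \<in> coweights A" and C: "of_nat (n_rep \<pi>') *\<^sub>R C = c + c'"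
  shows "linear_part g C = D"
    "g (w + (1/2) *\<^sub>R c) = v + (1/2) *\<^sub>R d + (of_int n * of_nat (n_rep \<pi>') / 2) *\<^sub>R D"
    "g w = gallery_vertex v d d' n" "linear_part g c = gallery_step d d' n"
    "linear_part g c' = gallery_step d d' (n + 1)"
proof -
  note lin = linear_linear_part[OF g]
  have "straight_gallery A (gallery_vertex v d d' n) (gallery_step d d' n) (gallery_step d d' (n + 1)) =
      straight_gallery A (g w) (linear_part g c) (linear_part g c')"
  proof
    fix i
    show "straight_gallery A (gallery_vertex v d d' n) (gallery_step d d' n) (gallery_step d d' (n + 1)) i =
      straight_gallery A (g w) (linear_part g c) (linear_part g c') i"
      using cl[of i] unfolding act_straight_gallery[OF g adc w] straight_gallery_shift .
  qed
  then show e: "g w = gallery_vertex v d d' n" "linear_part g c = gallery_step d d' n"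
    "linear_part g c' = gallery_step d d' (n + 1)" unfolding straight_gallery_eq_iff by simp_all
  have "of_nat (n_rep \<pi>') *\<^sub>R linear_part g C = of_nat (n_rep \<pi>') *\<^sub>R D"
    unfolding linear_scale[OF lin, symmetric] C D linear_add[OF lin] e gallery_step_add_Suc ..
  then show "linear_part g C = D" using n_rep_pos by simp
  have "g (w + (1/2) *\<^sub>R c) = gallery_vertex v d d' n + (1/2) *\<^sub>R gallery_step d d' n"
    unfolding elem_line[OF g] e ..
  also have "\<dots> = v + (1/2) *\<^sub>R d + (of_int n / 2) *\<^sub>R (d + d')" by (rule gallery_midpoint)
  finally show "g (w + (1/2) *\<^sub>R c) = v + (1/2) *\<^sub>R d + (of_int n * of_nat (n_rep \<pi>') / 2) *\<^sub>R D"
    unfolding D[symmetric] by simp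
qed

lemma n_rep_cases: "n_rep \<pi>' = 1 \<or> n_rep \<pi>' = 2"
  by (cases \<pi>') auto

text \<open>
  Two galleries on the same oriented line agree up to a shift, provided that for \<open>n_rep \<pi>' = 2\<close>
  their vertices are of the same type.
\<close>

lemma straight_galleries_on_line:
  assumes ad: "adjacent A \<pi> d d'" and v: "v \<in> coweights A"
    and adc: "adjacent A \<pi> c c'" and w: "w \<in> coweights A"
    and D: "D \<in> weights A \<pi>'" "of_nat (n_rep \<pi>') *\<^sub>R D = d + d'" "of_nat (n_rep \<pi>') *\<^sub>R D = c + c'"
    and line: "w + (1/2) *\<^sub>R c = v + (1/2) *\<^sub>R d + l *\<^sub>R D"
    and type: "n_rep \<pi>' = 1 \<or> w - v \<in> coroots A"
  shows "\<exists>n::int. l = of_int n * of_nat (n_rep \<pi>') / 2 \<and>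
    (\<forall>i. straight_gallery A w c c' i = straight_gallery A v d d' (i + n))"
proof -
  let ?N = "of_nat (n_rep \<pi>') :: real"
  note fi = edge_form_inner[OF dual ad]
  have Dnz: "D \<noteq> 0" using dual_weight_nonzero[OF D(1)] by auto
  have dW: "d \<in> weights A \<pi>" "d' \<in> weights A \<pi>" and dL: "d \<in> coweights A"
    using ad weights_subset_coweights unfolding adjacent_def by blast+
  have "edge_form d d' \<bullet> (d + d') = 0" using fi by (simp add: inner_add_right)
  then have fD: "edge_form d d' \<bullet> D = 0" unfolding D(2)[symmetric] using n_rep_pos by simp
  have key: "\<exists>q::int. r = of_int q * ?N" if r: "r *\<^sub>R D \<in> coweights A" "n_rep \<pi>' = 1 \<or> r *\<^sub>R D \<in> coroots A" for r
  proof -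
    obtain m j :: int where mj: "r *\<^sub>R D = of_int m *\<^sub>R D + of_int j *\<^sub>R d"
      using r(1) coweights_dual[OF dual ad D(1,2)] by blast
    have "j = 0" using arg_cong[OF mj, of "\<lambda>x. edge_form d d' \<bullet> x"] fD fi by (simp add: inner_add_right)
    then have rm: "r = of_int m" using mj Dnz by simp
    show ?thesis
    proof (cases "n_rep \<pi>' = 1")
      case True
      then show ?thesis using rm by (intro exI[of _ m]) simp
    next
      case False
      then have two: "n_rep \<pi>' = 2" using n_rep_cases by blast
      then have "even m" using r(2) False coroot_parity(2)[OF dual two D(1)] rm by simp
      then obtain q where "m = 2 * q" by blast
      then show ?thesis using rm two by (intro exI[of _ q]) simp
    qed
  qed
  from adjacent_pair_unique[OF dual ad adc] D(2,3) have "(c = d \<and> c' = d') \<or> (c = d' \<and> c' = d)" by simp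
  then show ?thesis
  proof
    assume cd: "c = d \<and> c' = d'"
    then have wv: "w = v + l *\<^sub>R D" using line by simp
    then have "w - v = l *\<^sub>R D" by simp
    then have "l *\<^sub>R D \<in> coweights A" "n_rep \<pi>' = 1 \<or> l *\<^sub>R D \<in> coroots A"
      using coweights_diff[OF w v] type by simp_all
    then obtain q :: int where q: "l = of_int q * ?N" using key by blast
    have "straight_gallery A v d d' (i + 2 * q) = straight_gallery A w c c' i" for i
      unfolding straight_gallery_shift gallery_vertex_even gallery_step_even gallery_step_odd
      using cd wv q D(2) by (metis scaleR_scaleR)
    then show ?thesis using q by (intro exI[of _ "2 * q"]) simp
  next
    assume cd: "c = d' \<and> c' = d"
    have half: "(1/2) *\<^sub>R d + (1/2) *\<^sub>R d = d" by (metis scaleR_half_double scaleR_right_distrib)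
    have "(?N / 2) *\<^sub>R D = (1/2) *\<^sub>R (?N *\<^sub>R D)" by simp
    then have hN: "(?N / 2) *\<^sub>R D = (1/2) *\<^sub>R d + (1/2) *\<^sub>R d'" unfolding D(2) by (simp add: scaleR_right_distrib)
    have "w - v = (1/2) *\<^sub>R d - (1/2) *\<^sub>R d' + l *\<^sub>R D" using line cd by (simp add: algebra_simps)
    also have "\<dots> = ((1/2) *\<^sub>R d + (1/2) *\<^sub>R d) + (l *\<^sub>R D - (?N / 2) *\<^sub>R D)" unfolding hN by (simp add: algebra_simps)
    finally have wv: "w - v = d + (l - ?N / 2) *\<^sub>R D" unfolding half by (simp add: scaleR_left_diff_distrib)
    then have r: "(l - ?N / 2) *\<^sub>R D = (w - v) - d" by simp
    have "(l - ?N / 2) *\<^sub>R D \<in> coweights A" unfolding r using coweights_diff v w dL by blast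
    moreover have "n_rep \<pi>' = 1 \<or> (l - ?N / 2) *\<^sub>R D \<in> coroots A"
    proof (cases "n_rep \<pi>' = 1")
      case False
      then have two: "n_rep \<pi>' = 2" using n_rep_cases by blast
      then have "d \<in> coroots A" using coroot_parity(1)[OF dual two] dW by blast
      then show ?thesis unfolding r using type False coroots_diff by blast
    qed simp
    ultimately obtain q :: int where q: "l - ?N / 2 = of_int q * ?N" using key by blast
    have wq: "w = v + of_int q *\<^sub>R (d + d') + d" using wv unfolding q D(2)[symmetric]
      by (simp add: algebra_simps)
    have s: "gallery_step d d' (2 * q + 1 + 1) = d" unfolding gallery_step_def by simp
    have "straight_gallery A v d d' (i + (2 * q + 1)) = straight_gallery A w c c' i" for i
      unfolding straight_gallery_shift gallery_vertex_odd gallery_step_odd s using cd wq by simp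
    moreover have "l = of_int (2 * q + 1) * ?N / 2" using q by (simp add: algebra_simps add_divide_distrib)
    ultimately show ?thesis by (intro exI[of _ "2 * q + 1"]) simp
  qed
qed

lemma act_comp: "act g (act h X) = act (g \<circ> h) X"
  unfolding act_def body_def initial_def terminal_def by (simp add: image_comp)

lemma act_id: "act id X = X"
  unfolding act_def body_def initial_def terminal_def by simp

text \<open>
  The image of a \<open>\<pi>\<close>-chamber, together with its central edge, in the quotient.
\<close>

definition chamber_orbit :: "'v set \<times> 'v \<times> 'v \<Rightarrow> ('v set \<times> 'v \<times> 'v) set" where
  "chamber_orbit X = (\<lambda>g. act g X) ` \<Gamma>"

lemma chamber_orbit_self: "X \<in> chamber_orbit X"
  unfolding chamber_orbit_def by (rule image_eqI[OF _ id_mem]) (simp only: act_id)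

lemma chamber_orbit_act:
  assumes g: "g \<in> \<Gamma>"
  shows "chamber_orbit (act g X) = chamber_orbit X"
proof -
  obtain h where h: "h \<in> \<Gamma>" "h \<circ> g = id" using inverse_mem[OF g] by blast
  have "act k X \<in> chamber_orbit (act g X)" if "k \<in> \<Gamma>" for k
  proof -
    have "act k X = act (k \<circ> h) (act g X)" unfolding act_comp comp_assoc h(2) by simp
    then show ?thesis unfolding chamber_orbit_def using comp_mem[OF that h(1)] by blast
  qed
  moreover have "act k (act g X) \<in> chamber_orbit X" if "k \<in> \<Gamma>" for k
    unfolding chamber_orbit_def act_comp using comp_mem[OF that g] by blast
  ultimately show ?thesis unfolding chamber_orbit_def[of X] chamber_orbit_def[of "act g X"] by blast
qed

text \<open>Galleries lift uniquely: an element identifying their first vertices is determined.\<close>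

lemma gallery_lift_unique:
  assumes ad: "adjacent A \<pi> d d'" and v: "v \<in> coweights A"
    and adc: "adjacent A \<pi> c c'" and w: "w \<in> coweights A"
    and orb: "\<And>i. chamber_orbit (straight_gallery A w c c' i) = chamber_orbit (straight_gallery A v d d' i)"
  shows "\<exists>g\<in>\<Gamma>. \<forall>i. straight_gallery A w c c' i = act g (straight_gallery A v d d' i)"
proof -
  obtain g where g: "g \<in> \<Gamma>" "straight_gallery A w c c' 0 = act g (straight_gallery A v d d' 0)"
    using chamber_orbit_self[of "straight_gallery A w c c' 0"] orb[of 0] unfolding chamber_orbit_def by auto
  have e0: "w = g v" "c = linear_part g d"
    using g(2) unfolding act_straight_gallery[OF g(1) ad v]
    by (simp_all add: straight_gallery_def pi_chamber_eq_iff gallery_step_def gallery_vertex_def)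
  have "straight_gallery A w c c' 1 \<in> chamber_orbit (act g (straight_gallery A v d d' 1))"
    using chamber_orbit_self[of "straight_gallery A w c c' 1"] orb[of 1] chamber_orbit_act[OF g(1)] by auto
  then obtain h where h: "h \<in> \<Gamma>" "straight_gallery A w c c' 1 = act h (act g (straight_gallery A v d d' 1))"
    unfolding chamber_orbit_def by auto
  note adg = adjacent_image[OF g(1) ad]
  have gv: "g v \<in> coweights A" using maps_coweights[OF g(1) v] by blast
  have "w + c = h (g v) + linear_part h (linear_part g d)" and c': "c' = linear_part h (linear_part g d')"
    using h(2) unfolding act_straight_gallery[OF g(1) ad v] act_straight_gallery[OF h(1) adg gv]
    by (simp_all add: straight_gallery_def pi_chamber_eq_iff gallery_step_def gallery_vertex_def)
  then have "h (w + c) = w + c" unfolding e0 elem(3)[OF h(1)] by simp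
  then have "h = id" using free_action[OF h(1)] by blast
  then have "c' = linear_part g d'" using c' by (simp add: linear_part_def)
  then show ?thesis
    by (intro bexI[OF _ g(1)] allI) (simp only: e0 act_straight_gallery[OF g(1) ad v])
qed

lemma closed_galleries_iff:
  "(n, P) \<in> closed_galleries A \<Gamma> \<pi> \<longleftrightarrow> n > 0 \<and>
    (\<exists>v d d'. v \<in> coweights A \<and> adjacent A \<pi> d d' \<and>
      P = (\<lambda>i. chamber_orbit (straight_gallery A v d d' i)) \<and>
      (\<exists>g\<in>\<Gamma>. \<forall>i. straight_gallery A v d d' (i + int n) = act g (straight_gallery A v d d' i)))"
  unfolding closed_galleries_def chamber_orbit_def
  using geodesic_gallery_straight[OF dual] geodesic_straight_gallery[OF dual] by blast

text \<open>
  The midpoint of a central edge has level \<open>1/2\<close> above a vertex, where the level is an integer.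
\<close>

lemma semirational_midline:
  assumes ad: "adjacent A \<pi> d d'" and v: "v \<in> coweights A"
    and D: "of_nat (n_rep \<pi>') *\<^sub>R D = d + d'"
  shows "semirational_line A (line_through (v + (1/2) *\<^sub>R d) D)"
  unfolding semirational_line_iff[OF dual ad D]
  using edge_form_coweights[OF dual ad v] edge_form_inner[OF dual ad] by (simp add: inner_add_right)

lemma semirational_line_gallery:
  assumes D: "D \<in> weights A \<pi>'" and semi: "semirational_line A (line_through x D)"
  shows "\<exists>v d d' s. v \<in> coweights A \<and> adjacent A \<pi> d d' \<and> of_nat (n_rep \<pi>') *\<^sub>R D = d + d' \<and>
    x = v + (1/2) *\<^sub>R d + s *\<^sub>R D"
proof -
  obtain d d' where ad: "adjacent A \<pi> d d'" "of_nat (n_rep \<pi>') *\<^sub>R D = d + d'"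
    using dual_weight_adjacent_sum[OF dual D] by blast
  note fi = edge_form_inner[OF dual ad(1)]
  obtain j :: int where j: "edge_form d d' \<bullet> x - 1/2 = of_int j"
    using semi unfolding semirational_line_iff[OF dual ad] by (auto elim: Ints_cases)
  define v where "v = of_int j *\<^sub>R d"
  have v: "v \<in> coweights A" unfolding v_def
    using ad(1) weights_subset_coweights coweights_scale unfolding adjacent_def by blast
  have "edge_form d d' \<bullet> (d + d') = 0" using fi by (simp add: inner_add_right)
  then have fD: "edge_form d d' \<bullet> D = 0" unfolding ad(2)[symmetric] using n_rep_pos by simp
  have nz: "edge_form d d' \<noteq> 0" "D \<noteq> 0" using fi dual_weight_nonzero[OF D] by auto
  have fD': "D \<bullet> edge_form d d' = 0" using fD by (simp only: inner_commute)
  have "edge_form d d' \<bullet> (x - (v + (1/2) *\<^sub>R d)) = 0"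
    using j fi unfolding v_def by (simp add: inner_diff_right inner_add_right)
  then have "x - (v + (1/2) *\<^sub>R d) = ((x - (v + (1/2) *\<^sub>R d)) \<bullet> D / (D \<bullet> D)) *\<^sub>R D"
    by (rule orthogonal_imp_multiple[OF apartment_DIM[OF frame] nz(2,1) fD'])
  then have "x = v + (1/2) *\<^sub>R d + ((x - (v + (1/2) *\<^sub>R d)) \<bullet> D / (D \<bullet> D)) *\<^sub>R D"
    by (metis add.commute diff_add_cancel)
  then show ?thesis using v ad by blast
qed

text \<open>
  Type preservation makes \<open>straight_galleries_on_line\<close> applicable: an element preserving the midline
  carries the gallery to a shift of itself.
\<close>

lemma straight_gallery_closes:
  assumes ad: "adjacent A \<pi> d d'" and v: "v \<in> coweights A"
    and D: "D \<in> weights A \<pi>'" "of_nat (n_rep \<pi>') *\<^sub>R D = d + d'"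
    and g: "g \<in> \<Gamma>" "linear_part g D = D" "g (v + (1/2) *\<^sub>R d) = v + (1/2) *\<^sub>R d + l *\<^sub>R D"
  shows "\<exists>n::int. l = of_int n * of_nat (n_rep \<pi>') / 2 \<and>
    (\<forall>i. straight_gallery A v d d' (i + n) = act g (straight_gallery A v d d' i))"
proof -
  note lin = linear_linear_part[OF g(1)]
  have "of_nat (n_rep \<pi>') *\<^sub>R D = linear_part g d + linear_part g d'"
    unfolding linear_add[OF lin, symmetric] D(2)[symmetric] linear_scale[OF lin] g(2) ..
  moreover have "g v + (1/2) *\<^sub>R linear_part g d = v + (1/2) *\<^sub>R d + l *\<^sub>R D"
    using g(3) unfolding elem_line[OF g(1)] .
  ultimately show ?thesis
    using straight_galleries_on_line[OF ad v adjacent_image[OF g(1) ad] maps_coweights(2)[OF g(1) v] D]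
      maps_coweights(1)[OF g(1) v] act_straight_gallery[OF g(1) ad v] by metis
qed

text \<open>
  Through the midpoints of its central edges every gallery determines a semi-rational line, \<open>n\<close>
  steps being \<open>n * n_rep \<pi>' / 2\<close> in length, and each such line carries exactly \<open>n_rep \<pi>'\<close> galleries
  up to shift: for the representative \<open>i\<close> they start at \<open>b0 i + j D i\<close> with \<open>j < n_rep \<pi>'\<close>.
\<close>

lemma euler_product_galleries:
  assumes reps: "line_reps (semirational_line A) I V D len"
  shows "euler_product (closed_galleries A \<Gamma> \<pi>) (\<lambda>n. exp w ^ n) =
    (\<Prod>i\<in>I. inverse (1 - exp (of_real (len i) * (2 / of_nat (n_rep \<pi>') * w)))) ^ n_rep \<pi>'"
proof -
  let ?N = "n_rep \<pi>'"
  have fin: "finite I"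
    and r1: "\<And>i. i \<in> I \<Longrightarrow> D i \<in> weights A \<pi>' \<and> semirational_line A (line_through (V i) (D i)) \<and> len i > 0 \<and>
        (\<exists>g\<in>\<Gamma>. linear_part g (D i) = D i \<and> g (V i) = V i + len i *\<^sub>R D i)"
    and r2: "\<And>i g l. i \<in> I \<Longrightarrow> g \<in> \<Gamma> \<Longrightarrow> l > 0 \<Longrightarrow> linear_part g (D i) = D i \<Longrightarrow>
        g (V i) = V i + l *\<^sub>R D i \<Longrightarrow> \<exists>n::nat. l = of_nat n * len i"
    and r3: "\<And>v d. d \<in> weights A \<pi>' \<Longrightarrow> semirational_line A (line_through v d) \<Longrightarrow>
        \<exists>i\<in>I. \<exists>g\<in>\<Gamma>. \<exists>s. linear_part g (D i) = d \<and> g (V i) = v + s *\<^sub>R d"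
    and r4: "\<And>i j g s. i \<in> I \<Longrightarrow> j \<in> I \<Longrightarrow> g \<in> \<Gamma> \<Longrightarrow> linear_part g (D i) = D j \<Longrightarrow>
        g (V i) = V j + s *\<^sub>R D j \<Longrightarrow> i = j"
    using reps unfolding line_reps_def by meson+
  have "\<forall>i\<in>I. \<exists>b d d' s. b \<in> coweights A \<and> adjacent A \<pi> d d' \<and> of_nat ?N *\<^sub>R D i = d + d' \<and>
      V i = b + (1/2) *\<^sub>R d + s *\<^sub>R D i"
    using semirational_line_gallery r1 by blast
  then obtain b0 d d' s where G: "\<And>i. i \<in> I \<Longrightarrow> b0 i \<in> coweights A" "\<And>i. i \<in> I \<Longrightarrow> adjacent A \<pi> (d i) (d' i)"
    "\<And>i. i \<in> I \<Longrightarrow> of_nat ?N *\<^sub>R D i = d i + d' i" "\<And>i. i \<in> I \<Longrightarrow> V i = b0 i + (1/2) *\<^sub>R d i + s i *\<^sub>R D i"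
    by metis
  define b where "b = (\<lambda>ij. b0 (fst ij) + of_nat (snd ij) *\<^sub>R D (fst ij))"
  define G' where "G' = (\<lambda>ij. straight_gallery A (b ij) (d (fst ij)) (d' (fst ij)))"
  have bL: "b ij \<in> coweights A" if "fst ij \<in> I" for ij
  proof -
    have "D (fst ij) \<in> coweights A" using r1[OF that] weights_subset_coweights by blast
    then show ?thesis unfolding b_def
      using coweights_add[OF G(1)[OF that]] coweights_scale[of "D (fst ij)" A "int (snd ij)"] by simp
  qed
  have mid: "b ij + (1/2) *\<^sub>R d (fst ij) = V (fst ij) + (of_nat (snd ij) - s (fst ij)) *\<^sub>R D (fst ij)"
    if "fst ij \<in> I" for ij
    unfolding b_def G(4)[OF that] by (simp add: algebra_simps)
  have along: "g (b ij + (1/2) *\<^sub>R d (fst ij)) = b ij + (1/2) *\<^sub>R d (fst ij) + l *\<^sub>R D (fst ij) \<longleftrightarrow>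
      g (V (fst ij)) = V (fst ij) + l *\<^sub>R D (fst ij)"
    if "fst ij \<in> I" "g \<in> \<Gamma>" "linear_part g (D (fst ij)) = D (fst ij)" for ij g l
    unfolding mid[OF that(1)] elem_line[OF that(2)] that(3) by (auto simp: algebra_simps)
  \<comment> \<open>the translation length of a semi-rational line is a number of gallery steps\<close>
  have "\<forall>i\<in>I. \<exists>m>0. len i = of_nat m * of_nat ?N / 2"
  proof
    fix i assume i: "i \<in> I"
    obtain g where g: "g \<in> \<Gamma>" "linear_part g (D i) = D i" "g (V i) = V i + len i *\<^sub>R D i" "len i > 0"
      using r1[OF i] by blast
    have "g (b (i, 0) + (1/2) *\<^sub>R d i) = b (i, 0) + (1/2) *\<^sub>R d i + len i *\<^sub>R D i"
      using along[of "(i, 0)" g "len i"] i g by simp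
    then obtain n :: int where n: "len i = of_int n * of_nat ?N / 2"
      using straight_gallery_closes[OF G(2)[OF i] bL[of "(i, 0)"] _ G(3)[OF i] g(1,2)] r1[OF i] i by auto
    have "0 < of_int n * (of_nat ?N :: real)" using n g(4) by simp
    then have "n > 0" using n_rep_pos by (metis of_int_0_less_iff zero_less_mult_pos2)
    then show "\<exists>m>0. len i = of_nat m * of_nat ?N / 2" using n by (intro exI[of _ "nat n"]) simp
  qed
  then obtain m where m: "\<And>i. i \<in> I \<Longrightarrow> m i > 0" "\<And>i. i \<in> I \<Longrightarrow> len i = of_nat (m i) * of_nat ?N / 2"
    by metis
  let ?P = "\<lambda>ij x. chamber_orbit (G' ij x)"
  have "euler_product (closed_galleries A \<Gamma> \<pi>) (\<lambda>n. exp w ^ n) =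
      (\<Prod>ij\<in>I \<times> {..<?N}. inverse (1 - exp w ^ m (fst ij)))"
  proof (rule euler_product_representatives[where P = ?P and len = "\<lambda>ij. m (fst ij)"])
    show "finite (I \<times> {..<?N})" using fin by simp
  next
    fix ij assume ij: "ij \<in> I \<times> {..<?N}"
    then have i: "fst ij \<in> I" by auto
    show "m (fst ij) > 0" using m i by blast
    obtain g where g: "g \<in> \<Gamma>" "linear_part g (D (fst ij)) = D (fst ij)"
      "g (V (fst ij)) = V (fst ij) + len (fst ij) *\<^sub>R D (fst ij)"
      using r1[OF i] by blast
    obtain n :: int where n: "len (fst ij) = of_int n * of_nat ?N / 2"
      "\<forall>x. G' ij (x + n) = act g (G' ij x)"
      unfolding G'_def
      using straight_gallery_closes[OF G(2)[OF i] bL[OF i] _ G(3)[OF i] g(1,2)] r1[OF i]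
        along[OF i g(1,2)] g(3) by metis
    have "of_int n = (of_nat (m (fst ij)) :: real)" using n(1) m(2)[OF i] n_rep_pos by simp
    then have "n = int (m (fst ij))" by linarith
    then show "(m (fst ij), ?P ij) \<in> closed_galleries A \<Gamma> \<pi>"
      unfolding closed_galleries_iff using n(2) g(1) m(1)[OF i] bL[OF i] G(2)[OF i]
      unfolding G'_def by blast
  next
    fix ij l assume ij: "ij \<in> I \<times> {..<?N}" and l: "(l, ?P ij) \<in> closed_galleries A \<Gamma> \<pi>"
    then have i: "fst ij \<in> I" by auto
    obtain v c c' g where v: "v \<in> coweights A" "adjacent A \<pi> c c'"
      "?P ij = (\<lambda>x. chamber_orbit (straight_gallery A v c c' x))" "g \<in> \<Gamma>"
      "\<And>x. straight_gallery A v c c' (x + int l) = act g (straight_gallery A v c c' x)" and "l > 0"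
      using l unfolding closed_galleries_iff by blast
    have "\<exists>h\<in>\<Gamma>. \<forall>x. straight_gallery A v c c' x = act h (G' ij x)"
      unfolding G'_def
      by (rule gallery_lift_unique[OF G(2)[OF i] bL[OF i] v(2,1)])
        (use fun_cong[OF v(3)] in \<open>simp add: G'_def\<close>)
    then obtain h where h: "h \<in> \<Gamma>" "\<And>x. straight_gallery A v c c' x = act h (G' ij x)" by blast
    obtain h' where h': "h' \<in> \<Gamma>" "h' \<circ> h = id" using inverse_mem[OF h(1)] by blast
    let ?k = "h' \<circ> (g \<circ> h)"
    have k: "?k \<in> \<Gamma>" using comp_mem h h' v(4) by blast
    have kG: "G' ij (x + int l) = act ?k (G' ij x)" for x
    proof -
      have "act h' (act h (G' ij (x + int l))) = act h' (act g (act h (G' ij x)))"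
        using v(5)[of x] unfolding h(2) by simp
      then show ?thesis unfolding act_comp h'(2) act_id comp_assoc .
    qed
    note c = straight_gallery_closing[OF k G(2)[OF i] bL[OF i] G(3)[OF i] kG[unfolded G'_def]
        G(2)[OF i] bL[OF i] G(3)[OF i]]
    have "?k (V (fst ij)) = V (fst ij) + (of_int (int l) * of_nat ?N / 2) *\<^sub>R D (fst ij)"
      using along[OF i k c(1)] c(2) by blast
    moreover have "of_int (int l) * of_nat ?N / 2 > (0::real)" using \<open>l > 0\<close> n_rep_pos by simp
    ultimately obtain n :: nat where "of_int (int l) * of_nat ?N / 2 = of_nat n * len (fst ij)"
      using r2[OF i k _ c(1)] by blast
    then have "of_nat l = (of_nat (n * m (fst ij)) :: real)"
      unfolding m(2)[OF i] using n_rep_pos by (simp add: field_simps)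
    then have "l = n * m (fst ij)" by linarith
    then show "\<exists>n>0. l = of_nat n * m (fst ij)" using \<open>l > 0\<close> by (intro exI[of _ n]) auto
  next
    fix l P assume "(l, P) \<in> closed_galleries A \<Gamma> \<pi>"
    then obtain v c c' where v: "v \<in> coweights A" "adjacent A \<pi> c c'"
      "P = (\<lambda>x. chamber_orbit (straight_gallery A v c c' x))"
      unfolding closed_galleries_iff by blast
    obtain E where E: "E \<in> weights A \<pi>'" "of_nat ?N *\<^sub>R E = c + c'"
      using adjacent_sum_dual_weight[OF dual v(2)] by blast
    obtain i g t where i: "i \<in> I" and g: "g \<in> \<Gamma>" "linear_part g (D i) = E"
      "g (V i) = v + (1/2) *\<^sub>R c + t *\<^sub>R E"
      using r3[OF E(1) semirational_midline[OF v(2,1) E(2)]] by blast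
    note lin = linear_linear_part[OF g(1)]
    \<comment> \<open>the choice of \<open>j\<close> adjusts the type of the vertices\<close>
    have "\<exists>j<?N. ?N = 1 \<or> v - g (b (i, j)) \<in> coroots A"
    proof (cases "?N = 1")
      case False
      then have two: "?N = 2" using n_rep_cases by blast
      have "v - g (b (i, 0)) \<in> coweights A"
        by (intro coweights_diff v(1) maps_coweights(2)[OF g(1) bL]) (simp add: i)
      then obtain p q :: int where pq: "v - g (b (i, 0)) = of_int p *\<^sub>R E + of_int q *\<^sub>R c"
        using coweights_dual[OF dual v(2) E] by blast
      have cr: "of_int q *\<^sub>R c \<in> coroots A"
        using coroot_parity(1)[OF dual two] v(2) coroots_scale unfolding adjacent_def by blast
      have b1: "g (b (i, 1)) = g (b (i, 0)) + E"
        using elem_line[OF g(1), of "b (i, 0)" 1 "D i"] g(2) unfolding b_def by simp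
      show ?thesis
      proof (cases "even p")
        case True
        then have "of_int p *\<^sub>R E \<in> coroots A" using coroot_parity(2)[OF dual two E(1)] by blast
        then have "v - g (b (i, 0)) \<in> coroots A" unfolding pq using cr coroots_add by blast
        then show ?thesis using two by (intro exI[of _ 0]) simp
      next
        case False
        then have "of_int (p - 1) *\<^sub>R E \<in> coroots A"
          using coroot_parity(2)[OF dual two E(1), of "p - 1"] by (simp del: of_int_diff)
        then have "of_int (p - 1) *\<^sub>R E + of_int q *\<^sub>R c \<in> coroots A" using cr coroots_add by blast
        moreover have "v - g (b (i, 1)) = of_int (p - 1) *\<^sub>R E + of_int q *\<^sub>R c"
          using pq unfolding b1 by (simp add: algebra_simps)
        ultimately show ?thesis using two by (intro exI[of _ 1]) simp
      qed
    qed auto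
    then obtain j where j: "j < ?N" "?N = 1 \<or> v - g (b (i, j)) \<in> coroots A" by blast
    have fi: "fst (i, j) \<in> I" using i by simp
    have "g (b (i, j)) + (1/2) *\<^sub>R linear_part g (d i) = v + (1/2) *\<^sub>R c + (t + (of_nat j - s i)) *\<^sub>R E"
      using mid[OF fi] elem_line[OF g(1)] g(2,3) by (metis fst_conv snd_conv add.assoc scaleR_left_distrib)
    then have "v + (1/2) *\<^sub>R c = g (b (i, j)) + (1/2) *\<^sub>R linear_part g (d i) + (- (t + (of_nat j - s i))) *\<^sub>R E"
      by (simp add: algebra_simps)
    moreover have "of_nat ?N *\<^sub>R E = linear_part g (d i) + linear_part g (d' i)"
      unfolding linear_add[OF lin, symmetric] G(3)[OF i, symmetric] linear_scale[OF lin] g(2) ..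
    ultimately obtain n :: int where
      "\<forall>x. straight_gallery A v c c' x = straight_gallery A (g (b (i, j))) (linear_part g (d i)) (linear_part g (d' i)) (x + n)"
      using straight_galleries_on_line[OF adjacent_image[OF g(1) G(2)[OF i]] maps_coweights(2)[OF g(1) bL[OF fi]] v(2,1) E(1) _ E(2) _ j(2)]
      by blast
    then have "straight_gallery A v c c' x = act g (G' (i, j) (x + n))" for x
      unfolding G'_def using act_straight_gallery[OF g(1) G(2)[OF i] bL[OF fi]] by simp
    then have "P = (\<lambda>x. ?P (i, j) (x + n))" unfolding v(3) using chamber_orbit_act[OF g(1)] by simp
    then show "\<exists>ij\<in>I \<times> {..<?N}. \<exists>n. P = (\<lambda>x. ?P ij (x + n))" using i j(1) by blast
  next
    fix l P and n :: int assume "(l, P) \<in> closed_galleries A \<Gamma> \<pi>"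
    then obtain v c c' g where v: "v \<in> coweights A" "adjacent A \<pi> c c'"
      "P = (\<lambda>x. chamber_orbit (straight_gallery A v c c' x))" "g \<in> \<Gamma>"
      "\<And>x. straight_gallery A v c c' (x + int l) = act g (straight_gallery A v c c' x)" and "l > 0"
      unfolding closed_galleries_iff by blast
    have cL: "c \<in> coweights A" "c' \<in> coweights A"
      using v(2) weights_subset_coweights unfolding adjacent_def by blast+
    have "gallery_vertex v c c' n \<in> coweights A"
      unfolding gallery_vertex_def using v(1) cL by (auto intro!: coweights_add coweights_scale)
    moreover have "adjacent A \<pi> (gallery_step c c' n) (gallery_step c c' (n + 1))"
      unfolding gallery_step_def using v(2) adjacent_sym by auto
    moreover have "straight_gallery A v c c' (x + int l + n) = act g (straight_gallery A v c c' (x + n))" for x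
      using v(5)[of "x + n"] by (simp add: algebra_simps)
    ultimately show "(l, \<lambda>x. P (x + n)) \<in> closed_galleries A \<Gamma> \<pi>"
      unfolding closed_galleries_iff v(3) straight_gallery_shift using \<open>l > 0\<close> v(4) by blast
  next
    fix ij ij' and n :: int assume ij: "ij \<in> I \<times> {..<?N}" "ij' \<in> I \<times> {..<?N}"
      and e: "?P ij' = (\<lambda>x. ?P ij (x + n))"
    then have i: "fst ij \<in> I" "fst ij' \<in> I" by auto
    let ?d = "d (fst ij)" and ?d' = "d' (fst ij)"
    have dL: "?d \<in> coweights A" "?d' \<in> coweights A"
      using G(2)[OF i(1)] weights_subset_coweights unfolding adjacent_def by blast+
    let ?w = "gallery_vertex (b ij) ?d ?d' n"
    have w: "?w \<in> coweights A"
      unfolding gallery_vertex_def using bL[OF i(1)] dL by (auto intro!: coweights_add coweights_scale)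
    have adw: "adjacent A \<pi> (gallery_step ?d ?d' n) (gallery_step ?d ?d' (n + 1))"
      unfolding gallery_step_def using G(2)[OF i(1)] adjacent_sym by auto
    have "chamber_orbit (G' ij' x) = chamber_orbit (straight_gallery A ?w (gallery_step ?d ?d' n) (gallery_step ?d ?d' (n + 1)) x)" for x
      using fun_cong[OF e, of x] unfolding G'_def straight_gallery_shift .
    then obtain g where g: "g \<in> \<Gamma>"
      "\<And>x. G' ij' x = act g (straight_gallery A ?w (gallery_step ?d ?d' n) (gallery_step ?d ?d' (n + 1)) x)"
      using gallery_lift_unique[OF adw w G(2)[OF i(2)] bL[OF i(2)]] unfolding G'_def by blast
    have sum: "of_nat ?N *\<^sub>R D (fst ij) = gallery_step ?d ?d' n + gallery_step ?d ?d' (n + 1)"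
      unfolding gallery_step_add_Suc G(3)[OF i(1)] ..
    have "straight_gallery A (b ij') (d (fst ij')) (d' (fst ij')) (x + 0) =
        act g (straight_gallery A ?w (gallery_step ?d ?d' n) (gallery_step ?d ?d' (n + 1)) x)" for x
      using g(2)[of x] unfolding G'_def by simp
    note c = straight_gallery_closing[OF g(1) G(2)[OF i(2)] bL[OF i(2)] G(3)[OF i(2)] this adw w sum]
    have "g (?w + (1/2) *\<^sub>R gallery_step ?d ?d' n) = b ij' + (1/2) *\<^sub>R d (fst ij')" using c(2) by simp
    then have "g (V (fst ij) + (of_nat (snd ij) - s (fst ij)) *\<^sub>R D (fst ij) + (of_int n * of_nat ?N / 2) *\<^sub>R D (fst ij)) =
        V (fst ij') + (of_nat (snd ij') - s (fst ij')) *\<^sub>R D (fst ij')"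
      unfolding gallery_midpoint G(3)[OF i(1), symmetric] mid[OF i(1)] mid[OF i(2)] by simp
    then have "g (V (fst ij)) = V (fst ij') + ((of_nat (snd ij') - s (fst ij')) -
        (of_nat (snd ij) - s (fst ij)) - of_int n * of_nat ?N / 2) *\<^sub>R D (fst ij')"
      unfolding elem_line[OF g(1)] c(1) by (simp add: algebra_simps)
    then have ii: "fst ij = fst ij'" using r4[OF i g(1) c(1)] by blast
    moreover have "snd ij = snd ij'"
    proof (cases "?N = 1")
      case True
      then show ?thesis using ij by auto
    next
      case False
      then have two: "?N = 2" using n_rep_cases by blast
      have dr: "?d \<in> coroots A" "?d' \<in> coroots A"
        using coroot_parity(1)[OF dual two] G(2)[OF i(1)] unfolding adjacent_def by blast+
      have "?w - b ij = of_int (n div 2) *\<^sub>R (?d + ?d') + (if even n then 0 else ?d)"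
        unfolding gallery_vertex_def by simp
      then have "?w - b ij \<in> coroots A" using dr coroots_0 by (auto intro!: coroots_add coroots_scale)
      moreover have "b ij' - ?w \<in> coroots A" using maps_coweights(1)[OF g(1) w] c(3)
        unfolding gallery_vertex_def[of "b ij'"] by simp
      ultimately have "(?w - b ij) + (b ij' - ?w) \<in> coroots A" using coroots_add by blast
      moreover have "(?w - b ij) + (b ij' - ?w) = of_int (int (snd ij') - int (snd ij)) *\<^sub>R D (fst ij)"
        unfolding b_def ii by (simp add: algebra_simps)
      ultimately have "even (int (snd ij') - int (snd ij))"
        using coroot_parity(2)[OF dual two] r1[OF i(1)] by metis
      moreover have "snd ij < 2" "snd ij' < 2" using ij two by auto
      ultimately show ?thesis by presburger
    qed
    ultimately show "ij = ij'" by (simp add: prod_eq_iff)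
  qed
  also have "\<dots> = (\<Prod>i\<in>I. \<Prod>j<?N. inverse (1 - exp w ^ m i))"
    unfolding prod.cartesian_product by (simp add: case_prod_unfold)
  also have "\<dots> = (\<Prod>i\<in>I. inverse (1 - exp w ^ m i)) ^ ?N"
    by (simp add: prod_power_distrib)
  also have "(\<Prod>i\<in>I. inverse (1 - exp w ^ m i)) =
      (\<Prod>i\<in>I. inverse (1 - exp (of_real (len i) * (2 / of_nat ?N * w))))"
  proof (rule prod.cong[OF refl])
    fix i assume i: "i \<in> I"
    have "of_real (len i) * (2 / of_nat ?N * w) = of_nat (m i) * w"
      unfolding m(2)[OF i] using n_rep_cases by auto
    then show "inverse (1 - exp w ^ m i) = inverse (1 - exp (of_real (len i) * (2 / of_nat ?N * w)))"
      by (simp add: exp_of_nat_mult)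
  qed
  finally show ?thesis .
qed

end

section \<open>Representatives of lines by direction\<close>

lemma int_subgroup_generator:
  fixes S :: "int set"
  assumes diff: "\<And>x y. x \<in> S \<Longrightarrow> y \<in> S \<Longrightarrow> x - y \<in> S" and nz: "x \<in> S" "x \<noteq> 0"
  shows "\<exists>\<tau>>0. \<tau> \<in> S \<and> (\<forall>y\<in>S. \<tau> dvd y)"
proof -
  have zero: "0 \<in> S" using diff[OF nz(1) nz(1)] by simp
  have minus: "- y \<in> S" if "y \<in> S" for y using diff[OF zero that] by simp
  have add: "y + z \<in> S" if "y \<in> S" "z \<in> S" for y z using diff[OF that(1) minus[OF that(2)]] by simp
  have ex: "\<exists>n. n > 0 \<and> int n \<in> S"
    using nz minus[OF nz(1)] by (intro exI[of _ "nat \<bar>x\<bar>"]) (auto simp: abs_if)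
  define m where "m = (LEAST n. n > 0 \<and> int n \<in> S)"
  have m: "m > 0" "int m \<in> S" using LeastI_ex[OF ex] unfolding m_def by auto
  have least: "m \<le> n" if "n > 0" "int n \<in> S" for n
    unfolding m_def using that by (intro Least_le) simp
  have mult: "q * int m \<in> S" for q
  proof (induction q rule: int_induct[of _ 0])
    case (step1 i)
    then show ?case using add[OF _ m(2)] by (simp add: distrib_right)
  next
    case (step2 i)
    then show ?case using diff[OF _ m(2)] by (simp add: left_diff_distrib)
  qed (simp add: zero)
  have "int m dvd y" if y: "y \<in> S" for y
  proof (rule ccontr)
    assume "\<not> int m dvd y"
    then have "y mod int m \<noteq> 0" by (simp add: dvd_eq_mod_eq_0)
    moreover have "0 \<le> y mod int m" "y mod int m < int m" using m(1) by simp_all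
    ultimately have r: "0 < y mod int m" "y mod int m < int m" by linarith+
    have "y mod int m = y - (y div int m) * int m" by (simp add: minus_div_mult_eq_mod)
    then have "y mod int m \<in> S" using diff[OF y mult] by simp
    then have "m \<le> nat (y mod int m)" using r(1) by (intro least) simp_all
    then show False using r by linarith
  qed
  then show ?thesis using m by (intro exI[of _ "int m"]) simp
qed

context quotient_apartment
begin

text \<open>
  The form \<open>\<phi>\<close> distinguishes the lines of direction \<open>D\<close> by their level: it is constant on each of
  them, an integer on rational lines and half an odd integer on semi-rational ones. The coweight \<open>x\<close>
  satisfies \<open>\<phi> x = 1\<close>. Both signs of \<open>\<phi>\<close> occur, depending on the order of the two weights.
\<close>

definition is_line_form :: "'v \<Rightarrow> 'v \<Rightarrow> 'v \<Rightarrow> bool" where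
  "is_line_form D \<phi> x \<longleftrightarrow> D \<in> weights A \<pi>' \<and>
     (\<exists>x'. adjacent A \<pi> x x' \<and> of_nat (n_rep \<pi>') *\<^sub>R D = x + x' \<and> \<phi> = edge_form x x')"

lemma line_form_exists: "D \<in> weights A \<pi>' \<Longrightarrow> \<exists>\<phi> x. is_line_form D \<phi> x"
  unfolding is_line_form_def using dual_weight_adjacent_sum[OF dual] by blast

lemma line_form_minus:
  assumes "is_line_form D \<phi> x"
  shows "\<exists>x'. is_line_form D (- \<phi>) x'"
proof -
  obtain x' where x': "D \<in> weights A \<pi>'" "adjacent A \<pi> x x'" "of_nat (n_rep \<pi>') *\<^sub>R D = x + x'" "\<phi> = edge_form x x'"
    using assms unfolding is_line_form_def by blast
  have "edge_form x' x = - \<phi>" unfolding x'(4)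
    using adjacent_inner(2)[OF dual x'(2)] by (intro edge_form_swap) simp
  then show ?thesis unfolding is_line_form_def
    using x' adjacent_sym[OF x'(2)] by (intro exI[of _ x'] conjI exI[of _ x]) (simp_all add: add.commute)
qed

lemma line_form:
  assumes "is_line_form D \<phi> x"
  shows "\<phi> \<bullet> D = 0" "\<phi> \<bullet> x = 1" "x \<in> coweights A" "D \<noteq> 0"
    "y \<in> coweights A \<Longrightarrow> \<phi> \<bullet> y \<in> \<int>"
    "y \<in> coweights A \<Longrightarrow> \<phi> \<bullet> y = 0 \<Longrightarrow> \<exists>m::int. y = of_int m *\<^sub>R D"
    "\<phi> \<bullet> z = 0 \<Longrightarrow> \<exists>s. z = s *\<^sub>R D"
    "rational_line A (line_through v D) \<longleftrightarrow> \<phi> \<bullet> v \<in> \<int>"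
    "semirational_line A (line_through v D) \<longleftrightarrow> \<phi> \<bullet> v - 1/2 \<in> \<int>"
proof -
  obtain x' where x': "D \<in> weights A \<pi>'" "adjacent A \<pi> x x'" "of_nat (n_rep \<pi>') *\<^sub>R D = x + x'" "\<phi> = edge_form x x'"
    using assms unfolding is_line_form_def by blast
  note fi = edge_form_inner[OF dual x'(2), folded x'(4)]
  have "\<phi> \<bullet> (x + x') = 0" using fi by (simp add: inner_add_right)
  then show fD: "\<phi> \<bullet> D = 0" unfolding x'(3)[symmetric] using n_rep_pos by simp
  show "\<phi> \<bullet> x = 1" using fi by simp
  show "x \<in> coweights A" using x'(2) weights_subset_coweights unfolding adjacent_def by blast
  show Dnz: "D \<noteq> 0" using dual_weight_nonzero[OF x'(1)] by auto
  show "\<phi> \<bullet> y \<in> \<int>" if "y \<in> coweights A" using edge_form_coweights[OF dual x'(2) that] x'(4) by simp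
  show "\<exists>m::int. y = of_int m *\<^sub>R D" if y: "y \<in> coweights A" "\<phi> \<bullet> y = 0"
  proof -
    obtain m j :: int where mj: "y = of_int m *\<^sub>R D + of_int j *\<^sub>R x"
      using coweights_dual[OF dual x'(2,1,3)] y(1) by blast
    then have "j = 0" using y(2) fD fi by (simp add: inner_add_right)
    then show ?thesis using mj by auto
  qed
  show "\<exists>s. z = s *\<^sub>R D" if z: "\<phi> \<bullet> z = 0"
  proof -
    have nz: "\<phi> \<noteq> 0" using fi by auto
    have "D \<bullet> \<phi> = 0" using fD by (simp only: inner_commute)
    then show ?thesis using orthogonal_imp_multiple[OF apartment_DIM[OF frame] Dnz nz _ z] by blast
  qed
  show "rational_line A (line_through v D) \<longleftrightarrow> \<phi> \<bullet> v \<in> \<int>"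
    using rational_line_iff[OF dual x'(2,3)] x'(4) by simp
  show "semirational_line A (line_through v D) \<longleftrightarrow> \<phi> \<bullet> v - 1/2 \<in> \<int>"
    using semirational_line_iff[OF dual x'(2,3)] x'(4) by simp
qed

lemma line_form_image:
  assumes g: "g \<in> \<Gamma>" and f: "is_line_form D \<phi> x"
  shows "is_line_form (linear_part g D) (linear_part g \<phi>) (linear_part g x)"
proof -
  note lin = linear_linear_part[OF g]
  obtain x' where x': "D \<in> weights A \<pi>'" "adjacent A \<pi> x x'" "of_nat (n_rep \<pi>') *\<^sub>R D = x + x'" "\<phi> = edge_form x x'"
    using f unfolding is_line_form_def by blast
  have "edge_form (linear_part g x) (linear_part g x') = linear_part g \<phi>"
    unfolding x'(4) edge_form_def linear_diff[OF lin, symmetric] isometry[OF g] linear_scale[OF lin] ..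
  moreover have "of_nat (n_rep \<pi>') *\<^sub>R linear_part g D = linear_part g x + linear_part g x'"
    unfolding linear_scale[OF lin, symmetric] x'(3) linear_add[OF lin] ..
  ultimately show ?thesis
    unfolding is_line_form_def using linear_part_weights[OF g x'(1)] adjacent_image[OF g x'(2)] by metis
qed

text \<open>\<open>R\<close> selects the lines of level \<open>\<epsilon>\<close> modulo 1: \<open>\<epsilon> = 0\<close> for rational, \<open>1/2\<close> for semi-rational.\<close>

definition level_lines :: "('v set \<Rightarrow> bool) \<Rightarrow> real \<Rightarrow> bool" where
  "level_lines R \<epsilon> \<longleftrightarrow>
     (\<forall>D \<phi> x v. is_line_form D \<phi> x \<longrightarrow> (R (line_through v D) \<longleftrightarrow> \<phi> \<bullet> v - \<epsilon> \<in> \<int>))"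

lemma level_lines_rational: "level_lines (rational_line A) 0"
  unfolding level_lines_def using line_form(8) by simp

lemma level_lines_semirational: "level_lines (semirational_line A) (1/2)"
  unfolding level_lines_def using line_form(9) by blast

lemma level_lines_image:
  assumes lev: "level_lines R \<epsilon>" and g: "g \<in> \<Gamma>" and D: "D \<in> weights A \<pi>'" and R: "R (line_through v D)"
  shows "R (line_through (g v) (linear_part g D))"
proof -
  obtain \<phi> x where f: "is_line_form D \<phi> x" using line_form_exists[OF D] by blast
  note f' = line_form_image[OF g f]
  have "linear_part g \<phi> \<bullet> g v = linear_part g \<phi> \<bullet> linear_part g v + linear_part g \<phi> \<bullet> g 0"
    using elem_eq[OF g, of v] by (simp add: inner_add_right)
  also have "\<dots> = \<phi> \<bullet> v + linear_part g \<phi> \<bullet> g 0" unfolding isometry[OF g] ..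
  finally have e: "linear_part g \<phi> \<bullet> g v - \<epsilon> = (\<phi> \<bullet> v - \<epsilon>) + linear_part g \<phi> \<bullet> g 0" by simp
  have "g 0 \<in> coweights A" using elem(2)[OF g] coroots_subset by blast
  then have "linear_part g \<phi> \<bullet> g 0 \<in> \<int>" using line_form(5)[OF f'] by blast
  moreover have "\<phi> \<bullet> v - \<epsilon> \<in> \<int>" using R f lev unfolding level_lines_def by blast
  ultimately have "linear_part g \<phi> \<bullet> g v - \<epsilon> \<in> \<int>" unfolding e by (intro Ints_add)
  then show ?thesis using f' lev unfolding level_lines_def by blast
qed

text \<open>The analogue of \<open>line_reps\<close> for the lines whose direction lies in \<open>H\<close>.\<close>

definition line_reps_on ::
    "('v set \<Rightarrow> bool) \<Rightarrow> 'v set \<Rightarrow> 'i set \<Rightarrow> ('i \<Rightarrow> 'v) \<Rightarrow> ('i \<Rightarrow> 'v) \<Rightarrow> ('i \<Rightarrow> real) \<Rightarrow> bool" where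
  "line_reps_on R H I V D len \<longleftrightarrow> finite I \<and>
     (\<forall>i\<in>I. D i \<in> H \<and> R (line_through (V i) (D i)) \<and> len i > 0 \<and>
        (\<exists>g\<in>\<Gamma>. linear_part g (D i) = D i \<and> g (V i) = V i + len i *\<^sub>R D i)) \<and>
     (\<forall>i\<in>I. \<forall>g\<in>\<Gamma>. \<forall>l>0. linear_part g (D i) = D i \<and> g (V i) = V i + l *\<^sub>R D i \<longrightarrow>
        (\<exists>n::nat. l = of_nat n * len i)) \<and>
     (\<forall>v d. d \<in> H \<and> R (line_through v d) \<longrightarrow>
        (\<exists>i\<in>I. \<exists>g\<in>\<Gamma>. \<exists>s. linear_part g (D i) = d \<and> g (V i) = v + s *\<^sub>R d)) \<and>
     (\<forall>i\<in>I. \<forall>j\<in>I. \<forall>g\<in>\<Gamma>. \<forall>s. linear_part g (D i) = D j \<and> g (V i) = V j + s *\<^sub>R D j \<longrightarrow> i = j)"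

lemma line_reps_combine:
  assumes r1: "line_reps_on R H1 I1 V D len" and r2: "line_reps_on R H2 I2 V D len"
    and lev: "level_lines R \<epsilon>"
    and H: "H1 \<subseteq> weights A \<pi>'" "H2 \<subseteq> weights A \<pi>'"
    and sep: "\<And>g d. g \<in> \<Gamma> \<Longrightarrow> d \<in> H1 \<Longrightarrow> linear_part g d \<notin> H2"
      "\<And>g d. g \<in> \<Gamma> \<Longrightarrow> d \<in> H2 \<Longrightarrow> linear_part g d \<notin> H1"
    and cov: "\<And>d. d \<in> weights A \<pi>' \<Longrightarrow> \<exists>g\<in>\<Gamma>. linear_part g d \<in> H1 \<union> H2"
  shows "line_reps R (I1 \<union> I2) V D len"
  unfolding line_reps_def
proof (intro conjI)
  have f1: "finite I1" "\<And>i. i \<in> I1 \<Longrightarrow> D i \<in> H1 \<and> R (line_through (V i) (D i)) \<and> len i > 0 \<and>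
        (\<exists>g\<in>\<Gamma>. linear_part g (D i) = D i \<and> g (V i) = V i + len i *\<^sub>R D i)"
    "\<forall>i\<in>I1. \<forall>g\<in>\<Gamma>. \<forall>l>0. linear_part g (D i) = D i \<and> g (V i) = V i + l *\<^sub>R D i \<longrightarrow>
        (\<exists>n::nat. l = of_nat n * len i)"
    and c1: "\<And>v d. d \<in> H1 \<Longrightarrow> R (line_through v d) \<Longrightarrow>
        (\<exists>i\<in>I1. \<exists>g\<in>\<Gamma>. \<exists>s. linear_part g (D i) = d \<and> g (V i) = v + s *\<^sub>R d)"
    and d1: "\<And>i j g s. i \<in> I1 \<Longrightarrow> j \<in> I1 \<Longrightarrow> g \<in> \<Gamma> \<Longrightarrow> linear_part g (D i) = D j \<Longrightarrow> g (V i) = V j + s *\<^sub>R D j \<Longrightarrow> i = j"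
    using r1 unfolding line_reps_on_def by meson+
  have f2: "finite I2" "\<And>i. i \<in> I2 \<Longrightarrow> D i \<in> H2 \<and> R (line_through (V i) (D i)) \<and> len i > 0 \<and>
        (\<exists>g\<in>\<Gamma>. linear_part g (D i) = D i \<and> g (V i) = V i + len i *\<^sub>R D i)"
    "\<forall>i\<in>I2. \<forall>g\<in>\<Gamma>. \<forall>l>0. linear_part g (D i) = D i \<and> g (V i) = V i + l *\<^sub>R D i \<longrightarrow>
        (\<exists>n::nat. l = of_nat n * len i)"
    and c2: "\<And>v d. d \<in> H2 \<Longrightarrow> R (line_through v d) \<Longrightarrow>
        (\<exists>i\<in>I2. \<exists>g\<in>\<Gamma>. \<exists>s. linear_part g (D i) = d \<and> g (V i) = v + s *\<^sub>R d)"
    and d2: "\<And>i j g s. i \<in> I2 \<Longrightarrow> j \<in> I2 \<Longrightarrow> g \<in> \<Gamma> \<Longrightarrow> linear_part g (D i) = D j \<Longrightarrow> g (V i) = V j + s *\<^sub>R D j \<Longrightarrow> i = j"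
    using r2 unfolding line_reps_on_def by meson+
  show "finite (I1 \<union> I2)" using f1 f2 by blast
  show "\<forall>i\<in>I1 \<union> I2. D i \<in> weights A \<pi>' \<and> R (line_through (V i) (D i)) \<and> len i > 0 \<and>
        (\<exists>g\<in>\<Gamma>. linear_part g (D i) = D i \<and> g (V i) = V i + len i *\<^sub>R D i)"
    using f1(2) f2(2) H by blast
  show "\<forall>i\<in>I1 \<union> I2. \<forall>g\<in>\<Gamma>. \<forall>l>0. linear_part g (D i) = D i \<and> g (V i) = V i + l *\<^sub>R D i \<longrightarrow>
        (\<exists>n::nat. l = of_nat n * len i)"
    using f1(3) f2(3) by blast
  show "\<forall>v d. d \<in> weights A \<pi>' \<and> R (line_through v d) \<longrightarrow>
      (\<exists>i\<in>I1 \<union> I2. \<exists>g\<in>\<Gamma>. \<exists>s. linear_part g (D i) = d \<and> g (V i) = v + s *\<^sub>R d)"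
  proof (intro allI impI)
    fix v d assume vd: "d \<in> weights A \<pi>' \<and> R (line_through v d)"
    obtain g where g: "g \<in> \<Gamma>" "linear_part g d \<in> H1 \<union> H2" using cov vd by blast
    have "R (line_through (g v) (linear_part g d))" using level_lines_image[OF lev g(1)] vd by blast
    then obtain i h s where i: "i \<in> I1 \<union> I2" and h: "h \<in> \<Gamma>" "linear_part h (D i) = linear_part g d"
      "h (V i) = g v + s *\<^sub>R linear_part g d"
      using g(2) c1 c2 by (metis UnCI UnE)
    obtain g' where g': "g' \<in> \<Gamma>" "g' \<circ> g = id" using inverse_mem[OF g(1)] by blast
    have "linear_part (g' \<circ> g) d = d" unfolding g'(2) by (simp add: linear_part_def)
    then have gd: "linear_part g' (linear_part g d) = d" using linear_part_comp[OF g'(1) g(1)] by simp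
    have gv: "g' (g v) = v" using fun_cong[OF g'(2), of v] by simp
    have "linear_part (g' \<circ> h) (D i) = d" using linear_part_comp[OF g'(1) h(1)] h(2) gd by simp
    moreover have "(g' \<circ> h) (V i) = v + s *\<^sub>R d" using h(3) elem_line[OF g'(1)] gd gv by simp
    ultimately show "\<exists>i\<in>I1 \<union> I2. \<exists>g\<in>\<Gamma>. \<exists>s. linear_part g (D i) = d \<and> g (V i) = v + s *\<^sub>R d"
      using i comp_mem[OF g'(1) h(1)] by blast
  qed
  show "\<forall>i\<in>I1 \<union> I2. \<forall>j\<in>I1 \<union> I2. \<forall>g\<in>\<Gamma>. \<forall>s. linear_part g (D i) = D j \<and> g (V i) = V j + s *\<^sub>R D j \<longrightarrow> i = j"
  proof (intro ballI allI impI)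
    fix i j g s assume ij: "i \<in> I1 \<union> I2" "j \<in> I1 \<union> I2" and g: "g \<in> \<Gamma>"
      and e: "linear_part g (D i) = D j \<and> g (V i) = V j + s *\<^sub>R D j"
    have "(i \<in> I1 \<and> j \<in> I1) \<or> (i \<in> I2 \<and> j \<in> I2)"
      using ij f1(2) f2(2) sep[OF g] e by (metis UnE)
    then show "i = j" using d1 d2 g e by blast
  qed
qed

lemma finite_weights: "finite (weights A \<rho>)"
  by (cases A; cases \<rho>) auto

text \<open>
  If only translations in \<open>\<Gamma>\<close> map directions in \<open>H\<close> to directions in \<open>H\<close>, the levels of a direction
  \<open>d\<close> are identified modulo some integer \<open>\<tau> d\<close>, and \<open>j + \<epsilon>\<close> with \<open>0 \<le> j < \<tau> d\<close> represent them.
  Neither the index set nor the lengths depend on \<open>\<epsilon>\<close>, hence they are the same for rational and for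
  semi-rational lines.
\<close>

lemma line_reps_on_translations:
  assumes H: "H \<subseteq> weights A \<pi>'"
    and only: "\<And>g d. g \<in> \<Gamma> \<Longrightarrow> d \<in> H \<Longrightarrow> linear_part g d \<in> H \<Longrightarrow> linear_part g = id"
    and forms: "\<And>d. d \<in> H \<Longrightarrow> is_line_form d (\<Phi> d) (X d)"
  shows "\<exists>(I :: ('v \<times> int) set) len. fst ` I \<subseteq> H \<and>
    (\<forall>R \<epsilon>. level_lines R \<epsilon> \<longrightarrow>
      line_reps_on R H I (\<lambda>i. (of_int (snd i) + \<epsilon>) *\<^sub>R X (fst i)) fst len)"
proof -
  have tau: "\<exists>\<tau>>0. (\<exists>u\<in>translation_lattice. \<Phi> d \<bullet> u = of_int \<tau>) \<and>
      (\<forall>u\<in>translation_lattice. \<exists>m::int. \<Phi> d \<bullet> u = of_int (m * \<tau>))" if d: "d \<in> H" for d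
  proof -
    note f = line_form[OF forms[OF d]]
    define S where "S = {n::int. \<exists>u\<in>translation_lattice. \<Phi> d \<bullet> u = of_int n}"
    obtain n where n: "n > 0" "of_nat n *\<^sub>R X d \<in> translation_lattice"
      using translation_multiple[OF f(3)] by blast
    have "int n \<in> S" unfolding S_def using n(2) f(2) by (auto intro!: bexI[of _ "of_nat n *\<^sub>R X d"])
    moreover have "x - y \<in> S" if xy: "x \<in> S" "y \<in> S" for x y
    proof -
      obtain u u' where "u \<in> translation_lattice" "\<Phi> d \<bullet> u = of_int x"
        "u' \<in> translation_lattice" "\<Phi> d \<bullet> u' = of_int y" using xy unfolding S_def by blast
      then have "u - u' \<in> translation_lattice" "\<Phi> d \<bullet> (u - u') = of_int (x - y)"
        using translation_lattice_add[of u "- u'"] translation_lattice_minus[of u']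
        by (simp_all add: inner_diff_right)
      then show ?thesis unfolding S_def by blast
    qed
    ultimately obtain \<tau> where t: "\<tau> > 0" "\<tau> \<in> S" "\<forall>y\<in>S. \<tau> dvd y"
      using int_subgroup_generator[of S "int n"] n(1) by auto
    have "\<exists>m::int. \<Phi> d \<bullet> u = of_int (m * \<tau>)" if u: "u \<in> translation_lattice" for u
    proof -
      have "u \<in> coweights A" using translation_lattice_coroots[OF u] coroots_subset by blast
      then obtain y where y: "\<Phi> d \<bullet> u = of_int y" using f(5) by (auto elim: Ints_cases)
      then have "\<tau> dvd y" using t(3) u unfolding S_def by blast
      then show ?thesis using y by (metis dvd_def mult.commute)
    qed
    then show ?thesis using t(1,2) unfolding S_def by blast
  qed
  then obtain \<tau> where \<tau>: "\<And>d. d \<in> H \<Longrightarrow> \<tau> d > 0"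
    "\<And>d. d \<in> H \<Longrightarrow> \<exists>u\<in>translation_lattice. \<Phi> d \<bullet> u = of_int (\<tau> d)"
    "\<And>d u. d \<in> H \<Longrightarrow> u \<in> translation_lattice \<Longrightarrow> \<exists>m::int. \<Phi> d \<bullet> u = of_int (m * \<tau> d)"
    by metis
  have ell: "\<exists>l::int. l > 0 \<and> of_int l *\<^sub>R d \<in> translation_lattice \<and>
      (\<forall>r. r *\<^sub>R d \<in> translation_lattice \<longrightarrow> (\<exists>m::int. r = of_int (m * l)))" if d: "d \<in> H" for d
  proof -
    note f = line_form[OF forms[OF d]]
    define S where "S = {n::int. of_int n *\<^sub>R d \<in> translation_lattice}"
    have "d \<in> coweights A" using H d weights_subset_coweights by blast
    then obtain n where n: "n > 0" "of_nat n *\<^sub>R d \<in> translation_lattice"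
      using translation_multiple by blast
    have "int n \<in> S" unfolding S_def using n(2) by simp
    moreover have "x - y \<in> S" if xy: "x \<in> S" "y \<in> S" for x y
      using xy translation_lattice_add[of "of_int x *\<^sub>R d" "- (of_int y *\<^sub>R d)"] translation_lattice_minus[of "of_int y *\<^sub>R d"]
      unfolding S_def by (simp add: scaleR_left_diff_distrib)
    ultimately obtain l where t: "l > 0" "l \<in> S" "\<forall>y\<in>S. l dvd y"
      using int_subgroup_generator[of S "int n"] n(1) by auto
    have "\<exists>m::int. r = of_int (m * l)" if r: "r *\<^sub>R d \<in> translation_lattice" for r
    proof -
      have "r *\<^sub>R d \<in> coweights A" using translation_lattice_coroots[OF r] coroots_subset by blast
      moreover have "\<Phi> d \<bullet> (r *\<^sub>R d) = 0" using f(1) by simp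
      ultimately obtain m :: int where "r *\<^sub>R d = of_int m *\<^sub>R d" using f(6) by blast
      then have m: "r = of_int m" using f(4) by simp
      then have "l dvd m" using t(3) r unfolding S_def by blast
      then show ?thesis using m by (metis dvd_def mult.commute)
    qed
    then show ?thesis using t(1,2) unfolding S_def by blast
  qed
  then obtain per :: "'v \<Rightarrow> int" where ell: "\<And>d. d \<in> H \<Longrightarrow> per d > 0"
    "\<And>d. d \<in> H \<Longrightarrow> of_int (per d) *\<^sub>R d \<in> translation_lattice"
    "\<And>d r. d \<in> H \<Longrightarrow> r *\<^sub>R d \<in> translation_lattice \<Longrightarrow> \<exists>m::int. r = of_int (m * per d)"
    by metis
  define I where "I = (SIGMA d:H. {0..<\<tau> d})"
  have "line_reps_on R H I (\<lambda>i. (of_int (snd i) + \<epsilon>) *\<^sub>R X (fst i)) fst (\<lambda>i. of_int (per (fst i)))"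
    if lev: "level_lines R \<epsilon>" for R \<epsilon>
    unfolding line_reps_on_def
  proof (intro conjI ballI allI impI)
    show "finite I" unfolding I_def using finite_subset[OF H finite_weights] by simp
  next
    fix i assume "i \<in> I"
    then have i: "fst i \<in> H" unfolding I_def by auto
    note f = line_form[OF forms[OF i]]
    show "fst i \<in> H" by fact
    have "\<Phi> (fst i) \<bullet> ((of_int (snd i) + \<epsilon>) *\<^sub>R X (fst i)) - \<epsilon> = of_int (snd i)" using f(2) by simp
    then show "R (line_through ((of_int (snd i) + \<epsilon>) *\<^sub>R X (fst i)) (fst i))"
      using lev forms[OF i] unfolding level_lines_def by (metis Ints_of_int)
    show "of_int (per (fst i)) > (0::real)" using ell(1)[OF i] by simp
    have "(\<lambda>x. x + of_int (per (fst i)) *\<^sub>R fst i) \<in> \<Gamma>"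
      using ell(2)[OF i] unfolding translation_lattice_def by simp
    then show "\<exists>g\<in>\<Gamma>. linear_part g (fst i) = fst i \<and>
        g ((of_int (snd i) + \<epsilon>) *\<^sub>R X (fst i)) = (of_int (snd i) + \<epsilon>) *\<^sub>R X (fst i) + of_int (per (fst i)) *\<^sub>R fst i"
      by (intro bexI) (auto simp: linear_part_def)
  next
    fix i g and l :: real assume "i \<in> I" and g: "g \<in> \<Gamma>" "0 < l"
      and e: "linear_part g (fst i) = fst i \<and>
        g ((of_int (snd i) + \<epsilon>) *\<^sub>R X (fst i)) = (of_int (snd i) + \<epsilon>) *\<^sub>R X (fst i) + l *\<^sub>R fst i"
    then have i: "fst i \<in> H" unfolding I_def by auto
    have "linear_part g = id" using only[OF g(1) i] e i by simp
    note t = linear_part_id[OF g(1) this]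
    have "g 0 = l *\<^sub>R fst i" using fun_cong[OF t(2), of "(of_int (snd i) + \<epsilon>) *\<^sub>R X (fst i)"] e by simp
    then obtain m :: int where m: "l = of_int (m * per (fst i))" using ell(3)[OF i] t(1) by metis
    then have "(0 :: real) < of_int (m * per (fst i))" using g(2) by simp
    then have "0 < m * per (fst i)" unfolding of_int_0_less_iff .
    then have "m > 0" using ell(1)[OF i] by (simp add: zero_less_mult_iff)
    then show "\<exists>n::nat. l = of_nat n * of_int (per (fst i))" using m by (intro exI[of _ "nat m"]) simp
  next
    fix v d assume vd: "d \<in> H \<and> R (line_through v d)"
    then have d: "d \<in> H" by blast
    note f = line_form[OF forms[OF d]]
    have "\<Phi> d \<bullet> v - \<epsilon> \<in> \<int>" using vd lev forms[OF d] unfolding level_lines_def by blast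
    then obtain k :: int where k: "\<Phi> d \<bullet> v - \<epsilon> = of_int k" by (auto elim: Ints_cases)
    obtain u where u: "u \<in> translation_lattice" "\<Phi> d \<bullet> u = of_int (\<tau> d)" using \<tau>(2)[OF d] by blast
    define j where "j = k mod \<tau> d"
    have j: "(d, j) \<in> I" unfolding I_def j_def using d \<tau>(1)[OF d] by simp
    define y where "y = of_int (k div \<tau> d) *\<^sub>R u"
    have g: "(\<lambda>x. x + y) \<in> \<Gamma>"
      using translation_lattice_scale[OF u(1)] unfolding y_def translation_lattice_def by simp
    have "of_int (k div \<tau> d * \<tau> d + j) = (of_int k :: real)" unfolding j_def by simp
    then have "\<Phi> d \<bullet> ((of_int j + \<epsilon>) *\<^sub>R X d + y - v) = 0"
      using k u(2) f(2) unfolding y_def by (simp add: inner_add_right inner_diff_right)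
    then obtain s where "(of_int j + \<epsilon>) *\<^sub>R X d + y - v = s *\<^sub>R d" using f(7) by blast
    then have "(of_int j + \<epsilon>) *\<^sub>R X d + y = v + s *\<^sub>R d" by (simp add: algebra_simps)
    then show "\<exists>i\<in>I. \<exists>g\<in>\<Gamma>. \<exists>s. linear_part g (fst i) = d \<and> g ((of_int (snd i) + \<epsilon>) *\<^sub>R X (fst i)) = v + s *\<^sub>R d"
      using j g by (intro bexI[of _ "(d, j)"] bexI[of _ "\<lambda>x. x + y"] exI[of _ s]) (auto simp: linear_part_def)
  next
    fix i j g s assume ij: "i \<in> I" "j \<in> I" and g: "g \<in> \<Gamma>"
      and e: "linear_part g (fst i) = fst j \<and>
        g ((of_int (snd i) + \<epsilon>) *\<^sub>R X (fst i)) = (of_int (snd j) + \<epsilon>) *\<^sub>R X (fst j) + s *\<^sub>R fst j"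
    have i: "fst i \<in> H" "fst j \<in> H" and b: "0 \<le> snd i" "snd i < \<tau> (fst i)" "0 \<le> snd j" "snd j < \<tau> (fst j)"
      using ij unfolding I_def by auto
    have id: "linear_part g = id" using only[OF g i(1)] e i by simp
    note t = linear_part_id[OF g id]
    have dd: "fst i = fst j" using e id by simp
    note f = line_form[OF forms[OF i(2)]]
    have "(of_int (snd i) + \<epsilon>) *\<^sub>R X (fst j) + g 0 = (of_int (snd j) + \<epsilon>) *\<^sub>R X (fst j) + s *\<^sub>R fst j"
      using e fun_cong[OF t(2), of "(of_int (snd i) + \<epsilon>) *\<^sub>R X (fst i)"] unfolding dd by simp
    then have "\<Phi> (fst j) \<bullet> ((of_int (snd i) + \<epsilon>) *\<^sub>R X (fst j) + g 0) =
        \<Phi> (fst j) \<bullet> ((of_int (snd j) + \<epsilon>) *\<^sub>R X (fst j) + s *\<^sub>R fst j)" by (rule arg_cong)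
    then have "of_int (snd i) + \<Phi> (fst j) \<bullet> g 0 = of_int (snd j)"
      using f(1,2) by (simp add: inner_add_right)
    moreover obtain m :: int where "\<Phi> (fst j) \<bullet> g 0 = of_int (m * \<tau> (fst j))" using \<tau>(3)[OF i(2) t(1)] by blast
    ultimately have "snd i + m * \<tau> (fst j) = snd j" by linarith
    then have "snd j mod \<tau> (fst j) = snd i mod \<tau> (fst j)" by (metis mod_mult_self2 mult.commute)
    then have "snd i = snd j" using b dd by simp
    then show "i = j" using dd by (simp add: prod_eq_iff)
  qed
  moreover have "fst ` I \<subseteq> H" unfolding I_def by auto
  ultimately show ?thesis by blast
qed

end

section \<open>Klein bottle groups\<close>

context quotient_apartment
begin

lemma translation_lattice_iff: "v \<in> translation_lattice \<longleftrightarrow> (\<lambda>x. x + v) \<in> \<Gamma>"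
  unfolding translation_lattice_def by simp

lemma linear_part_translation: "linear_part (\<lambda>x. x + v) = id"
  by (auto simp: linear_part_def)

lemma reflection_axis: "a \<bullet> a > 0 \<Longrightarrow> reflection a a = a"
  unfolding reflection_def by (simp add: scaleR_2)

lemma reflection_perp: "x \<bullet> a = 0 \<Longrightarrow> reflection a x = - x"
  unfolding reflection_def by simp

lemma not_all_parallel:
  shows "\<exists>d\<in>weights A \<pi>. \<not> (\<exists>r. d = r *\<^sub>R a)"
proof (rule ccontr)
  assume "\<not> ?thesis"
  then have par: "\<And>d. d \<in> weights A \<pi> \<Longrightarrow> \<exists>r. d = r *\<^sub>R a" by blast
  obtain D where "D \<in> weights A \<pi>'"
    using dual by (cases rule: dual_reps_cases) auto
  then obtain d d' where ad: "adjacent A \<pi> d d'" using dual_weight_adjacent_sum[OF dual] by blast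
  then have W: "d \<in> weights A \<pi>" "d' \<in> weights A \<pi>" unfolding adjacent_def by blast+
  obtain r r' where r: "d = r *\<^sub>R a" "d' = r' *\<^sub>R a" using par W by blast
  have "d \<noteq> 0" using dual_weight_nonzero[OF W(1)] by auto
  then have "d' = (r' / r) *\<^sub>R d" using r by auto
  then have "d' = d \<or> d' = - d" using weights_parallel[OF frame] W by blast
  then show False using ad unfolding adjacent_def by blast
qed

text \<open>
  The translation \<open>t\<close> is perpendicular to the axis, and every element of \<open>\<Gamma>\<close> is the product of a
  translation generated by \<open>t\<close> and \<open>\<sigma>\<^sup>2\<close> with the identity or \<open>\<sigma>\<close>.
\<close>

lemma klein_structure:
  assumes kl: "klein_choice A \<Gamma> t \<sigma> a k"
  obtains c where "t = (\<lambda>x. x + c)" "c \<in> translation_lattice" "\<sigma> \<in> \<Gamma>" "linear_part \<sigma> = reflection a"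
    "\<And>x. \<sigma> (\<sigma> x) = x + of_nat k *\<^sub>R a" "c \<bullet> a = 0" "c \<noteq> 0" "k > 0" "a \<in> (\<Union>\<rho>. weights A \<rho>)"
    "\<And>g. g \<in> \<Gamma> \<Longrightarrow> \<exists>i j :: int. g = (\<lambda>x. x + (of_int i *\<^sub>R c + of_int j *\<^sub>R of_nat k *\<^sub>R a)) \<or>
      g = (\<lambda>x. \<sigma> x + (of_int i *\<^sub>R c + of_int j *\<^sub>R of_nat k *\<^sub>R a))"
proof -
  have gen: "generate (affine_weyl A) {t, \<sigma>} = \<Gamma>" and tr: "t \<in> coroot_translations A"
    and com: "t \<otimes>\<^bsub>affine_weyl A\<^esub> \<sigma> = \<sigma> \<otimes>\<^bsub>affine_weyl A\<^esub> inv\<^bsub>affine_weyl A\<^esub> t"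
    and a: "a \<in> (\<Union>\<rho>. weights A \<rho>)"
    and sl: "\<And>x. \<sigma> x - \<sigma> 0 = - x + (2 * (x \<bullet> a) / (a \<bullet> a)) *\<^sub>R a"
    and k: "k > 0" and ss: "\<And>x. \<sigma> (\<sigma> x) = x + of_nat k *\<^sub>R a"
    using kl unfolding klein_choice_def by blast+
  obtain c where c: "t = (\<lambda>x. x + c)" using tr unfolding coroot_translations_def by blast
  have tG: "t \<in> \<Gamma>" and sG: "\<sigma> \<in> \<Gamma>" unfolding gen[symmetric] by (auto intro: generate.incl)
  have cT: "c \<in> translation_lattice" using tG unfolding c translation_lattice_iff .
  have ls: "linear_part \<sigma> = reflection a" using sl by (auto simp: linear_part_def reflection_def)
  have aa: "a \<bullet> a > 0" using weights_nonzero[OF frame a] .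
  have inv_t: "inv\<^bsub>affine_weyl A\<^esub> t = (\<lambda>x. x - c)"
  proof -
    obtain h where h: "h \<circ> t = id" "h = inv\<^bsub>affine_weyl A\<^esub> t" using inverse_mem[OF tG] by blast
    have "h x = x - c" for x using fun_cong[OF h(1), of "x - c"] unfolding c by simp
    then show ?thesis using h(2) by auto
  qed
  have sx: "\<sigma> (x + y) = \<sigma> x + reflection a y" for x y using elem(3)[OF sG] unfolding ls .
  have inv_s: "inv\<^bsub>affine_weyl A\<^esub> \<sigma> = (\<lambda>x. \<sigma> x - of_nat k *\<^sub>R a)"
  proof -
    obtain h where h: "h \<circ> \<sigma> = id" "h = inv\<^bsub>affine_weyl A\<^esub> \<sigma>" using inverse_mem[OF sG] by blast
    have "h x = \<sigma> x - of_nat k *\<^sub>R a" for x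
    proof -
      have "\<sigma> (x + (- of_nat k) *\<^sub>R a) = \<sigma> x + (- of_nat k) *\<^sub>R a"
        using elem_line[OF sG, of x "- of_nat k" a] unfolding ls reflection_axis[OF aa] .
      moreover have "\<sigma> (\<sigma> (x + (- of_nat k) *\<^sub>R a)) = x" unfolding ss by simp
      ultimately have "h x = h (\<sigma> (\<sigma> x + (- of_nat k) *\<^sub>R a))" by simp
      then show ?thesis using fun_cong[OF h(1), of "\<sigma> x + (- of_nat k) *\<^sub>R a"] by simp
    qed
    then show ?thesis using h(2) by auto
  qed
  have "\<sigma> x + c = \<sigma> (x - c)" for x
    using fun_cong[OF com[unfolded inv_t affine_weyl_simps], of x] c by simp
  then have "\<sigma> x + c = \<sigma> x - reflection a c" for x
    using sx[of x "- c"] linear_neg[OF linear_reflection, of a c] by simp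
  then have "reflection a c = - c" by (metis add_diff_cancel_left' diff_minus_eq_add add.inverse_inverse diff_0 add_left_cancel uminus_add_conv_diff add.commute)
  then have "(2 * (c \<bullet> a) / (a \<bullet> a)) *\<^sub>R a = 0" unfolding reflection_def by simp
  then have ca: "c \<bullet> a = 0" using aa by auto
  define vec where "vec = (\<lambda>i j :: int. of_int i *\<^sub>R c + of_int j *\<^sub>R of_nat k *\<^sub>R a)"
  have vadd: "vec i j + vec i' j' = vec (i + i') (j + j')" for i j i' j'
    unfolding vec_def by (simp add: algebra_simps)
  have vrefl: "reflection a (vec i j) = vec (- i) j" for i j
    unfolding vec_def linear_add[OF linear_reflection] linear_scale[OF linear_reflection]
      reflection_axis[OF aa] reflection_perp[OF ca] by simp
  have struct: "\<exists>i j. g = (\<lambda>x. x + vec i j) \<or> g = (\<lambda>x. \<sigma> x + vec i j)"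
    if "g \<in> generate (affine_weyl A) {t, \<sigma>}" for g
    using that
  proof (induction rule: generate.induct)
    case one
    show ?case unfolding affine_weyl_simps by (intro exI[of _ 0] disjI1) (auto simp: vec_def)
  next
    case (incl h)
    have "t = (\<lambda>x. x + vec 1 0)" "\<sigma> = (\<lambda>x. \<sigma> x + vec 0 0)" unfolding c vec_def by auto
    then show ?case using incl by blast
  next
    case (inv h)
    have "inv\<^bsub>affine_weyl A\<^esub> t = (\<lambda>x. x + vec (- 1) 0)" "inv\<^bsub>affine_weyl A\<^esub> \<sigma> = (\<lambda>x. \<sigma> x + vec 0 (- 1))"
      unfolding inv_t inv_s vec_def by auto
    then show ?case using inv by blast
  next
    case (eng h1 h2)
    then obtain i j i' j' where h: "h1 = (\<lambda>x. x + vec i j) \<or> h1 = (\<lambda>x. \<sigma> x + vec i j)"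
      "h2 = (\<lambda>x. x + vec i' j') \<or> h2 = (\<lambda>x. \<sigma> x + vec i' j')" by blast
    have ka: "of_nat k *\<^sub>R a = vec 0 1" unfolding vec_def by simp
    have e1: "(\<lambda>x. x + vec i j) \<circ> (\<lambda>x. x + vec i' j') = (\<lambda>x. x + vec (i' + i) (j' + j))"
      by (auto simp: vadd add.assoc)
    have e2: "(\<lambda>x. x + vec i j) \<circ> (\<lambda>x. \<sigma> x + vec i' j') = (\<lambda>x. \<sigma> x + vec (i' + i) (j' + j))"
      by (auto simp: vadd add.assoc)
    have e3: "(\<lambda>x. \<sigma> x + vec i j) \<circ> (\<lambda>x. x + vec i' j') = (\<lambda>x. \<sigma> x + vec (- i' + i) (j' + j))"
      by (auto simp: sx vrefl vadd add.assoc)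
    have e4: "(\<lambda>x. \<sigma> x + vec i j) \<circ> (\<lambda>x. \<sigma> x + vec i' j') = (\<lambda>x. x + vec (0 + (- i' + i)) (1 + (j' + j)))"
      by (simp add: comp_def sx vrefl ss ka add.assoc) (simp only: vadd flip: add.assoc, simp)
    show ?case unfolding affine_weyl_simps using h(1)
    proof
      assume a1: "h1 = (\<lambda>x. x + vec i j)"
      from h(2) show "\<exists>i j. h1 \<circ> h2 = (\<lambda>x. x + vec i j) \<or> h1 \<circ> h2 = (\<lambda>x. \<sigma> x + vec i j)"
        unfolding a1 using e1 e2 by blast
    next
      assume a1: "h1 = (\<lambda>x. \<sigma> x + vec i j)"
      from h(2) show "\<exists>i j. h1 \<circ> h2 = (\<lambda>x. x + vec i j) \<or> h1 \<circ> h2 = (\<lambda>x. \<sigma> x + vec i j)"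
        unfolding a1 using e3 e4 by blast
    qed
  qed
  have lnid: "linear_part (\<lambda>x. \<sigma> x + v) = reflection a" for v
    unfolding ls[symmetric] by (auto simp: linear_part_def)
  have cnz: "c \<noteq> 0"
  proof
    assume c0: "c = 0"
    obtain d where d: "d \<in> weights A \<pi>" "\<not> (\<exists>r. d = r *\<^sub>R a)" using not_all_parallel by blast
    then have "d \<in> coweights A" using weights_subset_coweights by blast
    then obtain n where n: "n > 0" "of_nat n *\<^sub>R d \<in> translation_lattice" using translation_multiple by blast
    then have "(\<lambda>x. x + of_nat n *\<^sub>R d) \<in> \<Gamma>" unfolding translation_lattice_iff by simp
    then obtain i j where ij: "(\<lambda>x. x + of_nat n *\<^sub>R d) = (\<lambda>x. x + vec i j) \<or> (\<lambda>x. x + of_nat n *\<^sub>R d) = (\<lambda>x. \<sigma> x + vec i j)"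
      using struct unfolding gen by blast
    have "reflection a \<noteq> id"
    proof
      assume "reflection a = id"
      then have "d = - d + (2 * (d \<bullet> a) / (a \<bullet> a)) *\<^sub>R a" unfolding reflection_def by (metis id_apply)
      then have "d + d = (2 * (d \<bullet> a) / (a \<bullet> a)) *\<^sub>R a" by (metis add.commute add_diff_cancel_left' diff_minus_eq_add)
      then have "2 *\<^sub>R d = (2 * (d \<bullet> a) / (a \<bullet> a)) *\<^sub>R a" by (simp add: scaleR_2)
      then have "d = ((1/2) * (2 * (d \<bullet> a) / (a \<bullet> a))) *\<^sub>R a"
        by (metis (no_types, lifting) scaleR_scaleR scaleR_one nonzero_eq_divide_eq zero_neq_numeral mult.commute)
      then show False using d(2) by blast
    qed
    then have "(\<lambda>x. x + of_nat n *\<^sub>R d) = (\<lambda>x. x + vec i j)"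
      using ij lnid linear_part_translation by metis
    then have "of_nat n *\<^sub>R d = vec i j" by (metis add_left_cancel)
    then have "of_nat n *\<^sub>R d = (of_int j * of_nat k) *\<^sub>R a" unfolding vec_def c0 by simp
    then have "(1 / of_nat n) *\<^sub>R of_nat n *\<^sub>R d = (1 / of_nat n) *\<^sub>R (of_int j * of_nat k) *\<^sub>R a" by simp
    then have "d = (1 / of_nat n * (of_int j * of_nat k)) *\<^sub>R a" using n(1) by simp
    then show False using d(2) by blast
  qed
  show ?thesis
    using that[OF c cT sG ls ss ca cnz k a] struct unfolding gen vec_def by blast
qed

lemma reflection_parallel:
  assumes "a = r *\<^sub>R a'" "r \<noteq> 0"
  shows "reflection a = reflection a'"
  unfolding reflection_def using assms by (auto simp: fun_eq_iff divide_simps)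

lemma reflection_involution: "a \<bullet> a > 0 \<Longrightarrow> reflection a (reflection a x) = x"
  unfolding reflection_def by (simp add: inner_add_left inner_diff_left algebra_simps)

text \<open>
  An element whose linear part is a nontrivial rotation has a fixed point, which contradicts
  freeness.
\<close>

lemma linear_part_fixes:
  assumes g: "g \<in> \<Gamma>"
  shows "linear_part g = id \<or> (\<exists>a\<in>(\<Union>\<rho>. weights A \<rho>). linear_part g = reflection a)"
proof -
  note lin = linear_linear_part[OF g]
  have "linear_part g = id" if h: "\<forall>x. linear_part g x = x \<longrightarrow> x = 0"
  proof -
    have l2: "linear (\<lambda>x. x - linear_part g x)" using lin by (intro linear_compose_sub linear_id[unfolded id_def])
    have "inj (\<lambda>x. x - linear_part g x)"
      unfolding linear_injective_0[OF l2] using h by (metis eq_iff_diff_eq_0)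
    then have "surj (\<lambda>x. x - linear_part g x)" using linear_injective_imp_surjective[OF l2] by blast
    then obtain p where "g 0 = p - linear_part g p" by (metis surjD)
    then have "g p = p" using elem_eq[OF g, of p] by simp
    then have "g = id" using free_action[OF g] by blast
    then show ?thesis by (auto simp: linear_part_def)
  qed
  then show ?thesis using weyl_trichotomy[OF frame elem(1)[OF g]] by blast
qed

text \<open>
  The product of the two elements has no nontrivial rotation as linear part, so that the two
  reflections coincide.
\<close>

lemma linear_part_unique_reflection:
  assumes g: "g \<in> \<Gamma>" "linear_part g = reflection a" "a \<in> (\<Union>\<rho>. weights A \<rho>)"
    and h: "h \<in> \<Gamma>" "linear_part h = reflection b" "b \<in> (\<Union>\<rho>. weights A \<rho>)"
  shows "reflection b = reflection a"
proof -
  have aa: "a \<bullet> a > 0" and bb: "b \<bullet> b > 0" using weights_nonzero[OF frame] g(3) h(3) by blast+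
  note comp = linear_part_comp[OF g(1) h(1)]
  have "\<exists>u. u \<noteq> 0 \<and> linear_part (g \<circ> h) u = u"
    using linear_part_fixes[OF comp_mem[OF g(1) h(1)]]
  proof
    assume "linear_part (g \<circ> h) = id"
    then show ?thesis using aa by (intro exI[of _ a]) auto
  next
    assume "\<exists>e\<in>(\<Union>\<rho>. weights A \<rho>). linear_part (g \<circ> h) = reflection e"
    then obtain e where e: "e \<in> (\<Union>\<rho>. weights A \<rho>)" "linear_part (g \<circ> h) = reflection e" by blast
    have "e \<bullet> e > 0" using weights_nonzero[OF frame e(1)] .
    then show ?thesis using reflection_axis e(2) by (intro exI[of _ e]) auto
  qed
  then obtain u where u: "u \<noteq> 0" "reflection a (reflection b u) = u" using comp g(2) h(2) by auto
  then have "reflection a u = reflection b u" using reflection_involution[OF aa] by metis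
  then have eq: "(2 * (u \<bullet> a) / (a \<bullet> a)) *\<^sub>R a = (2 * (u \<bullet> b) / (b \<bullet> b)) *\<^sub>R b" unfolding reflection_def by simp
  show ?thesis
  proof (cases "u \<bullet> b = 0")
    case True
    then have "u \<bullet> a = 0" using eq aa by auto
    moreover have "u \<noteq> 0" "a \<noteq> 0" using u aa by auto
    ultimately have "b = (b \<bullet> a / (a \<bullet> a)) *\<^sub>R a"
      using orthogonal_imp_multiple[OF apartment_DIM[OF frame], of a u b] True by (simp add: inner_commute)
    moreover have "b \<noteq> 0" using bb by auto
    ultimately show ?thesis using reflection_parallel[of b "b \<bullet> a / (a \<bullet> a)" a] by force
  next
    case False
    let ?q = "2 * (u \<bullet> b) / (b \<bullet> b)"
    have q: "?q \<noteq> 0" using False bb by auto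
    have "(1 / ?q) *\<^sub>R (?q *\<^sub>R b) = (1 / ?q) *\<^sub>R ((2 * (u \<bullet> a) / (a \<bullet> a)) *\<^sub>R a)" using eq by simp
    then have b: "b = ((1 / ?q) * (2 * (u \<bullet> a) / (a \<bullet> a))) *\<^sub>R a" using q by simp
    moreover have "b \<noteq> 0" using bb by auto
    ultimately have "(1 / ?q) * (2 * (u \<bullet> a) / (a \<bullet> a)) \<noteq> 0" by (metis scaleR_zero_left)
    then show ?thesis using reflection_parallel b by blast
  qed
qed

text \<open>
  If \<open>\<Gamma>\<close> contains an element that is not a translation, then it is generated by a translation and a
  glide reflection. The square of any glide reflection in \<open>\<Gamma>\<close> is an odd multiple of the shortest
  translation along the axis, since otherwise its product with a translation along the axis would be
  a reflection. Hence some glide reflection \<open>\<sigma>\<close> has the shortest translation as its square. For the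
  same reason the translation lattice is spanned by its vectors parallel and perpendicular
  to the axis.
\<close>

lemma klein_choice_exists:
  assumes nt: "\<not> \<Gamma> \<subseteq> coroot_translations A"
  shows "\<exists>t \<sigma> a k. klein_choice A \<Gamma> t \<sigma> a k"
proof -
  let ?T = "translation_lattice"
  obtain g0 where g0: "g0 \<in> \<Gamma>" "g0 \<notin> coroot_translations A" using nt by blast
  have "linear_part g0 \<noteq> id"
  proof
    assume h: "linear_part g0 = id"
    then have "g0 = (\<lambda>x. x + g0 0)" using linear_part_id(2)[OF g0(1)] by blast
    then show False using g0(2) elem(2)[OF g0(1)] unfolding coroot_translations_def by blast
  qed
  then obtain a where a: "a \<in> (\<Union>\<rho>. weights A \<rho>)" and lg0: "linear_part g0 = reflection a"
    using linear_part_fixes[OF g0(1)] by blast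
  have aa: "a \<bullet> a > 0" using weights_nonzero[OF frame a] .
  have aL: "a \<in> coweights A" using a weights_subset_coweights by blast
  have lin2: "linear_part g = id \<or> linear_part g = reflection a" if "g \<in> \<Gamma>" for g
    using linear_part_fixes[OF that]
  proof
    assume "\<exists>b\<in>(\<Union>\<rho>. weights A \<rho>). linear_part g = reflection b"
    then obtain b where b: "b \<in> (\<Union>\<rho>. weights A \<rho>)" "linear_part g = reflection b" by blast
    then show ?thesis using linear_part_unique_reflection[OF g0(1) lg0 a that b(2,1)] by simp
  qed simp
  have TG: "u \<in> ?T \<Longrightarrow> (\<lambda>x. x + u) \<in> \<Gamma>" for u unfolding translation_lattice_iff .
  \<comment> \<open>\<open>pr v\<close> is twice the coefficient of \<open>a\<close> in the orthogonal projection of \<open>v\<close>\<close>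
  define pr where "pr = (\<lambda>v. 2 * (v \<bullet> a) / (a \<bullet> a))"
  have prZ: "pr v \<in> \<int>" if "v \<in> coweights A" for v
    using a weight_projection_integral[OF frame _ that] unfolding pr_def by blast
  have pra: "pr (r *\<^sub>R a) = 2 * r" "pr (u + v) = pr u + pr v" for r u v
    unfolding pr_def using aa by (simp_all add: inner_add_left add_divide_distrib)
  have refl: "reflection a x = - x + pr x *\<^sub>R a" for x unfolding reflection_def pr_def ..
  have sq: "g (g x) = x + pr (g 0) *\<^sub>R a" if g: "g \<in> \<Gamma>" "linear_part g = reflection a" for g x
  proof -
    have gx: "g y = reflection a y + g 0" for y using elem_eq[OF g(1), of y] unfolding g(2) .
    have "g (g x) = reflection a (g x) + g 0" by (rule gx)
    also have "\<dots> = reflection a (reflection a x) + reflection a (g 0) + g 0"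
      unfolding gx[of x] linear_add[OF linear_reflection] ..
    finally show ?thesis unfolding reflection_involution[OF aa] refl[of "g 0"] by simp
  qed
  have sqT: "pr (g 0) *\<^sub>R a \<in> ?T" if g: "g \<in> \<Gamma>" "linear_part g = reflection a" for g
  proof -
    have "g \<circ> g = (\<lambda>x. x + pr (g 0) *\<^sub>R a)" by (rule ext) (simp only: comp_apply sq[OF g])
    then show ?thesis using comp_mem[OF g(1) g(1)] unfolding translation_lattice_iff by (simp only:)
  qed
  have glide_nz: "pr (g 0) \<noteq> 0" if g: "g \<in> \<Gamma>" "linear_part g = reflection a" for g
  proof
    assume "pr (g 0) = 0"
    then have "g (g x) = x" for x unfolding sq[OF g] by simp
    then have "g \<circ> g = id" by (intro ext) (simp only: comp_apply id_apply)
    then have "g ^^ 2 = id" by (simp add: numeral_2_eq_2)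
    then have "g = id" using torsion_free_\<Gamma> g(1) unfolding torsion_free_def by (metis zero_less_numeral)
    then have "linear_part g = id" by (auto simp: linear_part_def)
    then have "reflection a = id" using g(2) by simp
    then show False using lg0 \<open>linear_part g0 \<noteq> id\<close> by simp
  qed
  have addT: "(\<lambda>x. g x + u) \<in> \<Gamma> \<and> linear_part (\<lambda>x. g x + u) = linear_part g"
    if "g \<in> \<Gamma>" "u \<in> ?T" for g u
    using comp_mem[OF TG[OF that(2)] that(1)] by (auto simp: comp_def linear_part_def)
  \<comment> \<open>translations along the axis\<close>
  define S where "S = {n::int. (of_int n / 2) *\<^sub>R a \<in> ?T}"
  have Sdiff: "x - y \<in> S" if xy: "x \<in> S" "y \<in> S" for x y
    using xy translation_lattice_add[of "(of_int x / 2) *\<^sub>R a" "- ((of_int y / 2) *\<^sub>R a)"]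
      translation_lattice_minus[of "(of_int y / 2) *\<^sub>R a"]
    unfolding S_def by (simp add: scaleR_left_diff_distrib diff_divide_distrib)
  obtain n0 where n0: "n0 > 0" "of_nat n0 *\<^sub>R a \<in> ?T" using translation_multiple[OF aL] by blast
  have "2 * int n0 \<in> S" unfolding S_def using n0(2) by simp
  then obtain \<beta> where \<beta>: "\<beta> > 0" "\<beta> \<in> S" "\<And>y. y \<in> S \<Longrightarrow> \<beta> dvd y"
    using int_subgroup_generator[of S "2 * int n0"] Sdiff n0(1) by auto
  have \<beta>T: "(of_int \<beta> / 2) *\<^sub>R a \<in> ?T" using \<beta>(2) unfolding S_def by simp
  have odd_glide: "\<exists>m. odd m \<and> 2 * pr (g 0) = of_int (\<beta> * m)" if g: "g \<in> \<Gamma>" "linear_part g = reflection a" for g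
  proof -
    have "g 0 \<in> coweights A" using elem(2)[OF g(1)] coroots_subset by blast
    then obtain p :: int where p: "pr (g 0) = of_int p" using prZ by (auto elim: Ints_cases)
    have "2 * p \<in> S" unfolding S_def using sqT[OF g] p by simp
    then obtain m where m: "2 * p = \<beta> * m" using \<beta>(3) by blast
    have "odd m"
    proof
      assume "even m"
      then obtain q where q: "m = 2 * q" by blast
      then have pq: "p = \<beta> * q" using m by simp
      have "of_int (- q) *\<^sub>R ((of_int \<beta> / 2) *\<^sub>R a) \<in> ?T" using translation_lattice_scale[OF \<beta>T] .
      then have u: "(- (of_int p / 2)) *\<^sub>R a \<in> ?T" using pq by (simp add: mult.commute)
      have "pr ((\<lambda>x. g x + (- (of_int p / 2)) *\<^sub>R a) 0) = 0" unfolding pra using p by simp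
      then show False using glide_nz addT[OF g(1) u] g(2) by metis
    qed
    then show ?thesis using m p by (intro exI[of _ m]) (metis of_int_mult of_int_numeral)
  qed
  obtain m0 where m0: "odd m0" "2 * pr (g0 0) = of_int (\<beta> * m0)" using odd_glide[OF g0(1) lg0] by blast
  obtain q0 where q0: "m0 = 2 * q0 + 1" using m0(1) by (elim oddE)
  define \<sigma> where "\<sigma> = (\<lambda>x. g0 x + of_int (- q0) *\<^sub>R ((of_int \<beta> / 2) *\<^sub>R a))"
  have \<sigma>: "\<sigma> \<in> \<Gamma>" "linear_part \<sigma> = reflection a"
    using addT[OF g0(1) translation_lattice_scale[OF \<beta>T, of "- q0"]] unfolding \<sigma>_def[symmetric] lg0
    by blast+
  have pr\<sigma>: "pr (\<sigma> 0) = of_int \<beta> / 2"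
    unfolding \<sigma>_def pra scaleR_scaleR using m0(2) q0 by (simp add: algebra_simps)
  have "\<sigma> 0 \<in> coweights A" using elem(2)[OF \<sigma>(1)] coroots_subset by blast
  then obtain kk :: int where kk: "pr (\<sigma> 0) = of_int kk" using prZ by (auto elim: Ints_cases)
  have kpos: "kk > 0" using pr\<sigma> \<beta>(1) unfolding kk by simp
  have \<beta>k: "\<beta> = 2 * kk" using pr\<sigma> unfolding kk by linarith
  define k where "k = nat kk"
  have k: "k > 0" "of_nat k = (of_int kk :: real)" using kpos unfolding k_def by simp_all
  have ss: "\<sigma> (\<sigma> x) = x + of_nat k *\<^sub>R a" for x unfolding sq[OF \<sigma>] kk k(2) ..
  have axis: "\<exists>j::int. r = of_int j * of_int kk" if r: "r *\<^sub>R a \<in> ?T" for r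
  proof -
    have "r *\<^sub>R a \<in> coweights A" using translation_lattice_coroots[OF r] coroots_subset by blast
    then have "2 * r \<in> \<int>" using prZ[of "r *\<^sub>R a"] pra(1) by simp
    then obtain n :: int where n: "2 * r = of_int n" by (auto elim: Ints_cases)
    then have "n \<in> S" unfolding S_def using r by (simp flip: n)
    then obtain j where "n = \<beta> * j" using \<beta>(3) by blast
    then have "r = of_int j * of_int kk" using n \<beta>k by simp
    then show ?thesis by blast
  qed
  \<comment> \<open>translations perpendicular to the axis\<close>
  obtain b where b: "b \<noteq> 0" "a \<bullet> b = 0" using exists_orthogonal[OF apartment_DIM[OF frame]] aa by (metis inner_zero_left less_irrefl)
  obtain e where e: "e \<in> weights A \<pi>" "\<not> (\<exists>r. e = r *\<^sub>R a)" using not_all_parallel by blast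
  have anz: "a \<noteq> 0" using aa by auto
  have eb: "e \<bullet> b \<noteq> 0"
  proof
    assume "e \<bullet> b = 0"
    then have be: "b \<bullet> e = 0" by (simp only: inner_commute)
    have "e = (e \<bullet> a / (a \<bullet> a)) *\<^sub>R a"
      by (rule orthogonal_imp_multiple[OF apartment_DIM[OF frame] anz b be])
    then show False using e(2) by blast
  qed
  have perp: "u = (u \<bullet> b / (b \<bullet> b)) *\<^sub>R b" if u: "u \<bullet> a = 0" for u
  proof -
    have "b \<bullet> a = 0" "a \<bullet> u = 0" using b(2) u by (simp_all only: inner_commute)
    then show ?thesis by (rule orthogonal_imp_multiple[OF apartment_DIM[OF frame] b(1) anz])
  qed
  have ee: "e \<bullet> e > 0" using dual_weight_nonzero[OF e(1)] .
  define S' where "S' = {n::int. \<exists>u\<in>?T. u \<bullet> a = 0 \<and> 2 * (u \<bullet> e) / (e \<bullet> e) = of_int n}"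
  have S'I: "\<exists>n\<in>S'. 2 * (u \<bullet> e) / (e \<bullet> e) = of_int n" if u: "u \<in> ?T" "u \<bullet> a = 0" for u
  proof -
    have "u \<in> coweights A" using translation_lattice_coroots[OF u(1)] coroots_subset by blast
    then have "2 * (u \<bullet> e) / (e \<bullet> e) \<in> \<int>" using weight_projection_integral[OF frame e(1)] by blast
    then obtain n :: int where n: "2 * (u \<bullet> e) / (e \<bullet> e) = of_int n" by (rule Ints_cases)
    then have "n \<in> S'" unfolding S'_def using u by blast
    then show ?thesis using n by blast
  qed
  have S'diff: "x - y \<in> S'" if xy: "x \<in> S'" "y \<in> S'" for x y
  proof -
    obtain u u' where u: "u \<in> ?T" "u \<bullet> a = 0" "2 * (u \<bullet> e) / (e \<bullet> e) = of_int x"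
      "u' \<in> ?T" "u' \<bullet> a = 0" "2 * (u' \<bullet> e) / (e \<bullet> e) = of_int y" using xy unfolding S'_def by blast
    have "u - u' \<in> ?T" using translation_lattice_add[OF u(1) translation_lattice_minus[OF u(4)]] by simp
    moreover have "2 * ((u - u') \<bullet> e) / (e \<bullet> e) = of_int (x - y)"
      using u(3,6) by (simp add: inner_diff_left right_diff_distrib diff_divide_distrib)
    moreover have "(u - u') \<bullet> a = 0" using u(2,5) by (simp add: inner_diff_left)
    ultimately show ?thesis unfolding S'_def by blast
  qed
  have conj: "reflection a u \<in> ?T" if u: "u \<in> ?T" for u
  proof -
    obtain h where h: "h \<in> \<Gamma>" "h \<circ> \<sigma> = id" "\<sigma> \<circ> h = id" using inverse_mem[OF \<sigma>(1)] by blast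
    have "\<sigma> \<circ> ((\<lambda>x. x + u) \<circ> h) = (\<lambda>x. x + reflection a u)"
    proof
      fix x
      have "\<sigma> (h x + u) = \<sigma> (h x) + reflection a u" using elem(3)[OF \<sigma>(1)] \<sigma>(2) by simp
      then show "(\<sigma> \<circ> ((\<lambda>x. x + u) \<circ> h)) x = x + reflection a u" using fun_cong[OF h(3), of x] by simp
    qed
    then show ?thesis using comp_mem[OF \<sigma>(1) comp_mem[OF TG[OF u] h(1)]] unfolding translation_lattice_iff by simp
  qed
  have "e \<in> coweights A" using e(1) weights_subset_coweights by blast
  then obtain n1 where n1: "n1 > 0" "of_nat n1 *\<^sub>R e \<in> ?T" using translation_multiple by blast
  define u1 where "u1 = of_nat n1 *\<^sub>R e - reflection a (of_nat n1 *\<^sub>R e)"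
  have u1: "u1 \<in> ?T" unfolding u1_def
    using translation_lattice_add[OF n1(2) translation_lattice_minus[OF conj[OF n1(2)]]] by simp
  have u1a: "u1 \<bullet> a = 0" unfolding u1_def reflection_def using aa by (simp add: inner_diff_left inner_add_left)
  have "u1 \<bullet> b = 2 * of_nat n1 * (e \<bullet> b)" unfolding u1_def reflection_def using b(2)
    by (simp add: inner_diff_left inner_add_left)
  then have "u1 \<bullet> b \<noteq> 0" using n1(1) eb by simp
  then have "u1 \<bullet> e \<noteq> 0" using perp[OF u1a] eb b(1)
    by (metis inner_commute inner_eq_zero_iff inner_scaleR_left mult_eq_0_iff divide_eq_0_iff)
  then obtain n2 where n2: "n2 \<in> S'" "n2 \<noteq> 0" using S'I[OF u1 u1a] ee by force
  then obtain \<gamma> where \<gamma>: "\<gamma> > 0" "\<gamma> \<in> S'" "\<And>y. y \<in> S' \<Longrightarrow> \<gamma> dvd y"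
    using int_subgroup_generator[of S' n2] S'diff by blast
  obtain c where c: "c \<in> ?T" "c \<bullet> a = 0" "2 * (c \<bullet> e) / (e \<bullet> e) = of_int \<gamma>" using \<gamma>(2) unfolding S'_def by blast
  have perpT: "\<exists>i::int. u = of_int i *\<^sub>R c" if u: "u \<in> ?T" "u \<bullet> a = 0" for u
  proof -
    obtain n where n: "n \<in> S'" "2 * (u \<bullet> e) / (e \<bullet> e) = of_int n" using S'I[OF u] by blast
    obtain i where i: "n = \<gamma> * i" using \<gamma>(3)[OF n(1)] by blast
    have "2 * (u \<bullet> e) / (e \<bullet> e) = of_int i * (2 * (c \<bullet> e) / (e \<bullet> e))" unfolding n(2) c(3) i by simp
    then have "u \<bullet> e = of_int i * (c \<bullet> e)" using ee by (simp add: field_simps)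
    then have 1: "(u - of_int i *\<^sub>R c) \<bullet> e = 0" by (simp add: inner_diff_left)
    have 2: "(u - of_int i *\<^sub>R c) \<bullet> a = 0" using u(2) c(2) by (simp add: inner_diff_left)
    have "u - of_int i *\<^sub>R c = 0"
    proof (rule ccontr)
      assume "u - of_int i *\<^sub>R c \<noteq> 0"
      then have "(u - of_int i *\<^sub>R c) \<bullet> b / (b \<bullet> b) \<noteq> 0" using perp[OF 2] by (metis scaleR_zero_left)
      moreover have "((u - of_int i *\<^sub>R c) \<bullet> b / (b \<bullet> b)) * (b \<bullet> e) = 0" using perp[OF 2] 1 by (metis inner_scaleR_left)
      ultimately show False using eb by (simp add: inner_commute)
    qed
    then show ?thesis by (intro exI[of _ i]) simp
  qed
  have allT: "\<exists>i j :: int. u = of_int i *\<^sub>R c + of_int j *\<^sub>R of_nat k *\<^sub>R a" if u: "u \<in> ?T" for u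
  proof -
    have "u + reflection a u \<in> ?T" using translation_lattice_add[OF u conj[OF u]] .
    then have "pr u *\<^sub>R a \<in> ?T" unfolding refl by simp
    then obtain m :: int where m: "pr u = of_int m * of_int kk" using axis by blast
    have "even m"
    proof (rule ccontr)
      assume "odd m"
      then obtain q where q: "m = 2 * q + 1" by (elim oddE)
      define w where "w = - u + of_int q *\<^sub>R (of_nat k *\<^sub>R a)"
      have kT: "of_nat k *\<^sub>R a \<in> ?T" using sqT[OF \<sigma>] kk k(2) by simp
      have w: "w \<in> ?T" unfolding w_def
        using translation_lattice_add[OF translation_lattice_minus[OF u] translation_lattice_scale[OF kT]] .
      have "pr (- u) = - pr u" unfolding pr_def by simp
      then have "pr ((\<lambda>x. \<sigma> x + w) 0) = 0"
        unfolding pra w_def scaleR_scaleR kk k(2) using m q by (simp add: algebra_simps)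
      then show False using glide_nz addT[OF \<sigma>(1) w] \<sigma>(2) by metis
    qed
    then obtain q where q: "m = 2 * q" by blast
    have kT: "of_nat k *\<^sub>R a \<in> ?T" using sqT[OF \<sigma>] kk k(2) by simp
    have "u - of_int q *\<^sub>R (of_nat k *\<^sub>R a) \<in> ?T"
      using translation_lattice_add[OF u translation_lattice_minus[OF translation_lattice_scale[OF kT, of q]]] by simp
    moreover have "(u - of_int q *\<^sub>R (of_nat k *\<^sub>R a)) \<bullet> a = 0"
    proof -
      have "2 * (u \<bullet> a) = pr u * (a \<bullet> a)" unfolding pr_def using aa by simp
      then show ?thesis using m q k(2) by (simp add: inner_diff_left)
    qed
    ultimately obtain i :: int where "u - of_int q *\<^sub>R (of_nat k *\<^sub>R a) = of_int i *\<^sub>R c" using perpT by blast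
    then have "u = of_int i *\<^sub>R c + of_int q *\<^sub>R of_nat k *\<^sub>R a" by (simp add: algebra_simps)
    then show ?thesis by blast
  qed
  define t where "t = (\<lambda>x. x + c)"
  have tG: "t \<in> \<Gamma>" unfolding t_def using TG[OF c(1)] .
  interpret G: group "affine_weyl A" using group_affine_weyl[OF frame] .
  have sub: "{t, \<sigma>} \<subseteq> carrier (affine_weyl A)" using tG \<sigma>(1) subgroup.subset[OF subgroup_\<Gamma>] by blast
  interpret K: subgroup "generate (affine_weyl A) {t, \<sigma>}" "affine_weyl A" using G.generate_is_subgroup[OF sub] .
  let ?K = "generate (affine_weyl A) {t, \<sigma>}"
  have Kc: "g \<in> ?K \<Longrightarrow> h \<in> ?K \<Longrightarrow> g \<circ> h \<in> ?K" for g h using K.m_closed[of g h] unfolding affine_weyl_simps .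
  have inv_shift: "inv\<^bsub>affine_weyl A\<^esub> (\<lambda>x. x + v) = (\<lambda>x. x - v)" if v: "v \<in> ?T" for v
  proof -
    obtain h where h: "h \<circ> (\<lambda>x. x + v) = id" "h = inv\<^bsub>affine_weyl A\<^esub> (\<lambda>x. x + v)"
      using inverse_mem[OF TG[OF v]] by blast
    have "h x = x - v" for x using fun_cong[OF h(1), of "x - v"] by simp
    then show ?thesis using h(2) by auto
  qed
  have Kmult: "(\<lambda>x. x + of_int i *\<^sub>R v) \<in> ?K" if v: "(\<lambda>x. x + v) \<in> ?K" "v \<in> ?T" for v and i :: int
  proof (induction i rule: int_induct[of _ 0])
    case base
    show ?case using K.one_closed unfolding affine_weyl_simps by (simp add: id_def)
  next
    case (step1 i)
    then show ?case using Kc[OF step1(2) v(1)] by (simp add: comp_def algebra_simps)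
  next
    case (step2 i)
    have "(\<lambda>x. x - v) \<in> ?K" using K.m_inv_closed[OF v(1)] unfolding inv_shift[OF v(2)] .
    from Kc[OF step2(2) this] show ?case by (simp add: comp_def algebra_simps)
  qed
  have \<sigma>K: "\<sigma> \<in> ?K" and tK: "(\<lambda>x. x + c) \<in> ?K" unfolding t_def[symmetric] by (auto intro: generate.incl)
  have kT: "of_nat k *\<^sub>R a \<in> ?T" using sqT[OF \<sigma>] kk k(2) by simp
  have "\<sigma> \<circ> \<sigma> = (\<lambda>x. x + of_nat k *\<^sub>R a)" by (rule ext) (simp only: comp_apply ss)
  then have kK: "(\<lambda>x. x + of_nat k *\<^sub>R a) \<in> ?K" using Kc[OF \<sigma>K \<sigma>K] by simp
  have KT: "(\<lambda>x. x + u) \<in> ?K" if u: "u \<in> ?T" for u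
  proof -
    obtain i j :: int where ij: "u = of_int i *\<^sub>R c + of_int j *\<^sub>R of_nat k *\<^sub>R a" using allT[OF u] by blast
    have "(\<lambda>x. x + of_int j *\<^sub>R of_nat k *\<^sub>R a) \<circ> (\<lambda>x. x + of_int i *\<^sub>R c) \<in> ?K"
      by (intro Kc Kmult tK kK kT c(1))
    then show ?thesis unfolding ij by (simp add: comp_def add.assoc)
  qed
  have "\<Gamma> \<subseteq> ?K"
  proof
    fix g assume g: "g \<in> \<Gamma>"
    show "g \<in> ?K"
    proof (cases "linear_part g = id")
      case True
      then show ?thesis using linear_part_id[OF g True] KT by metis
    next
      case False
      then have lg: "linear_part g = reflection a" using lin2[OF g] by blast
      obtain h where h: "h \<in> \<Gamma>" "h \<circ> \<sigma> = id" "\<sigma> \<circ> h = id" using inverse_mem[OF \<sigma>(1)] by blast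
      have gh: "g \<circ> h \<in> \<Gamma>" using comp_mem[OF g h(1)] .
      have "linear_part (g \<circ> h) \<noteq> reflection a"
      proof
        assume "linear_part (g \<circ> h) = reflection a"
        then have "reflection a \<circ> linear_part h = reflection a" using linear_part_comp[OF g h(1)] lg by simp
        then have "linear_part h x = x" for x using reflection_involution[OF aa] by (metis comp_apply)
        then have "linear_part h = id" by auto
        moreover have "linear_part (h \<circ> \<sigma>) = id" unfolding h(2) by (auto simp: linear_part_def)
        ultimately have "reflection a = id" using linear_part_comp[OF h(1) \<sigma>(1)] \<sigma>(2) by simp
        then show False using lg0 \<open>linear_part g0 \<noteq> id\<close> by simp
      qed
      then have id: "linear_part (g \<circ> h) = id" using lin2[OF gh] by blast
      have "g \<circ> h \<in> ?K" using linear_part_id[OF gh id] KT by metis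
      then have "(g \<circ> h) \<circ> \<sigma> \<in> ?K" using Kc \<sigma>K by blast
      then show ?thesis unfolding comp_assoc h(2) by simp
    qed
  qed
  moreover have "?K \<subseteq> \<Gamma>"
    using G.generate_subgroup_incl[OF _ subgroup_\<Gamma>, of "{t, \<sigma>}"] tG \<sigma>(1) by blast
  ultimately have "?K = \<Gamma>" by blast
  moreover have "t \<in> coroot_translations A"
    unfolding coroot_translations_def t_def using translation_lattice_coroots[OF c(1)] by blast
  moreover have "t \<otimes>\<^bsub>affine_weyl A\<^esub> \<sigma> = \<sigma> \<otimes>\<^bsub>affine_weyl A\<^esub> inv\<^bsub>affine_weyl A\<^esub> t"
  proof -
    have "\<sigma> x + c = \<sigma> (x - c)" for x
      using elem(3)[OF \<sigma>(1), of x "- c"] \<sigma>(2) linear_neg[OF linear_reflection, of a c] reflection_perp[OF c(2)] by simp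
    then show ?thesis unfolding affine_weyl_simps t_def inv_shift[OF c(1)] by auto
  qed
  moreover have "\<forall>x. \<sigma> x - \<sigma> 0 = - x + (2 * (x \<bullet> a) / (a \<bullet> a)) *\<^sub>R a"
    using \<sigma>(2) by (auto simp: linear_part_def reflection_def fun_eq_iff)
  ultimately have "klein_choice A \<Gamma> t \<sigma> a k"
    unfolding klein_choice_def using a k(1) ss by blast
  then show ?thesis by blast
qed

end

section \<open>Counting lines along the axes of glide reflections\<close>

lemma int_interval_extend: "q < r \<Longrightarrow> {q<..<r + 1} = insert r {q<..<r :: int}"
  by auto

text \<open>
  The odd and the even numbers strictly between \<open>q\<close> and \<open>r\<close> alternate, so that their numbers
  differ by at most one, depending on the parities of \<open>q\<close> and \<open>r\<close>.
\<close>

lemma prod_parity_interior: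
  fixes q r :: int and g :: complex
  assumes "q < r" and g: "g \<noteq> 0"
  shows "(\<Prod>Y\<in>{Y\<in>{q<..<r}. odd Y}. g) =
    (\<Prod>Y\<in>{Y\<in>{q<..<r}. even Y}. g) * g powi (of_bool (even q) + of_bool (even r) - 1)"
  using assms(1)
proof (induction r rule: int_gr_induct)
  case base
  have "{q<..<q + 1} = {}" by auto
  then show ?case by simp
next
  case (step r)
  have f: "finite {Y\<in>{q<..<r}. odd Y}" "finite {Y\<in>{q<..<r}. even Y}"
    by (rule finite_subset[of _ "{q<..<r}"]; auto)+
  show ?case
  proof (cases "even r")
    case True
    have "{Y\<in>{q<..<r + 1}. odd Y} = {Y\<in>{q<..<r}. odd Y}"
      "{Y\<in>{q<..<r + 1}. even Y} = insert r {Y\<in>{q<..<r}. even Y}"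
      unfolding int_interval_extend[OF step(1)] using True by auto
    then show ?thesis using step(2) True f g
      by (cases "even q") (auto simp: power_int_minus field_simps)
  next
    case False
    have "{Y\<in>{q<..<r + 1}. odd Y} = insert r {Y\<in>{q<..<r}. odd Y}"
      "{Y\<in>{q<..<r + 1}. even Y} = {Y\<in>{q<..<r}. even Y}"
      unfolding int_interval_extend[OF step(1)] using False by auto
    then show ?thesis using step(2) False f g
      by (cases "even q") (auto simp: power_int_minus field_simps)
  qed
qed

text \<open>
  The two ends contribute \<open>1 / (1 - X)\<close> each instead of \<open>1 / (1 - X\<^sup>2)\<close>. Together with the surplus of
  the interior of the interval this becomes a power of \<open>(1 + X) / (1 - X)\<close>.
\<close>

lemma prod_parity:
  fixes q r :: int and X :: complex
  assumes "q < r" and X: "X \<noteq> 1" "X \<noteq> - 1"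
  defines "f \<equiv> \<lambda>Y. if Y = q \<or> Y = r then inverse (1 - X) else inverse (1 - X\<^sup>2)"
  shows "(\<Prod>Y\<in>{Y\<in>{q..r}. odd Y}. f Y) =
    (\<Prod>Y\<in>{Y\<in>{q..r}. even Y}. f Y) * ((1 + X) / (1 - X)) powi (1 - (of_bool (even q) + of_bool (even r)))"
proof -
  have nz: "1 - X \<noteq> 0" "1 + X \<noteq> 0" using X by (auto simp: add_eq_0_iff)
  have X2: "1 - X\<^sup>2 = (1 - X) * (1 + X)" by (simp add: power2_eq_square algebra_simps)
  have g: "inverse (1 - X\<^sup>2) \<noteq> 0" unfolding X2 using nz by simp
  have int: "(\<Prod>Y\<in>{Y\<in>{q<..<r}. P Y}. f Y) = (\<Prod>Y\<in>{Y\<in>{q<..<r}. P Y}. inverse (1 - X\<^sup>2))" for P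
    by (rule prod.cong) (auto simp: f_def)
  have f: "finite {Y\<in>{q<..<r}. P Y}" for P by (rule finite_subset[of _ "{q<..<r}"]) auto
  have fe: "f q = inverse (1 - X)" "f r = inverse (1 - X)" unfolding f_def by simp_all
  have iv: "{q..r} = insert q (insert r {q<..<r})" using assms(1) by auto
  have odd: "(\<Prod>Y\<in>{Y\<in>{q..r}. odd Y}. f Y) = (if odd q then inverse (1 - X) else 1) *
      (if odd r then inverse (1 - X) else 1) * (\<Prod>Y\<in>{Y\<in>{q<..<r}. odd Y}. inverse (1 - X\<^sup>2))"
  proof -
    have "{Y\<in>{q..r}. odd Y} = (if odd q then {q} else {}) \<union> (if odd r then {r} else {}) \<union> {Y\<in>{q<..<r}. odd Y}"
      unfolding iv by auto
    then show ?thesis unfolding int[symmetric] using assms(1) f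
      by (cases "even q"; cases "even r") (simp_all add: fe)
  qed
  have even: "(\<Prod>Y\<in>{Y\<in>{q..r}. even Y}. f Y) = (if even q then inverse (1 - X) else 1) *
      (if even r then inverse (1 - X) else 1) * (\<Prod>Y\<in>{Y\<in>{q<..<r}. even Y}. inverse (1 - X\<^sup>2))"
  proof -
    have "{Y\<in>{q..r}. even Y} = (if even q then {q} else {}) \<union> (if even r then {r} else {}) \<union> {Y\<in>{q<..<r}. even Y}"
      unfolding iv by auto
    then show ?thesis unfolding int[symmetric] using assms(1) f
      by (cases "even q"; cases "even r") (simp_all add: fe)
  qed
  define Ev Od where "Ev = (\<Prod>Y\<in>{Y\<in>{q<..<r}. even Y}. inverse (1 - X\<^sup>2))"
    and "Od = (\<Prod>Y\<in>{Y\<in>{q<..<r}. odd Y}. inverse (1 - X\<^sup>2))"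
  have "Od = Ev * inverse (1 - X\<^sup>2) powi (of_bool (even q) + of_bool (even r) - 1)"
    unfolding Ev_def Od_def by (rule prod_parity_interior[OF assms(1) g])
  then have OE: "Od = Ev * inverse ((1 - X) * (1 + X)) powi (of_bool (even q) + of_bool (even r) - 1)"
    unfolding X2 .
  show ?thesis unfolding odd even Ev_def[symmetric] Od_def[symmetric] OE
    using nz by (cases "even q"; cases "even r") (simp_all add: power_int_minus divide_simps)
qed

text \<open>
  The same identity, the elements of either parity being written as \<open>2 j + e\<close> with \<open>e = 1\<close> or
  \<open>e = 0\<close>: twice the levels of semi-rational and of rational lines.
\<close>

lemma prod_parity_half:
  fixes q r :: int and X :: complex
  assumes "q < r" and X: "X \<noteq> 1" "X \<noteq> - 1"
  defines "f \<equiv> \<lambda>Y. if Y = q \<or> Y = r then inverse (1 - X) else inverse (1 - X\<^sup>2)"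
  shows "(\<Prod>j\<in>{j. q \<le> 2 * j + 1 \<and> 2 * j + 1 \<le> r}. f (2 * j + 1)) =
    (\<Prod>j\<in>{j. q \<le> 2 * j + 0 \<and> 2 * j + 0 \<le> r}. f (2 * j + 0)) *
    ((1 + X) / (1 - X)) powi (1 - (of_bool (even q) + of_bool (even r)))"
proof -
  have "(\<Prod>Y\<in>{Y\<in>{q..r}. odd Y}. f Y) = (\<Prod>j\<in>{j. q \<le> 2 * j + 1 \<and> 2 * j + 1 \<le> r}. f (2 * j + 1))"
    by (rule prod.reindex_bij_witness[of _ "\<lambda>j. 2 * j + 1" "\<lambda>Y. (Y - 1) div 2"]) (auto elim!: oddE)
  moreover have "(\<Prod>Y\<in>{Y\<in>{q..r}. even Y}. f Y) = (\<Prod>j\<in>{j. q \<le> 2 * j + 0 \<and> 2 * j + 0 \<le> r}. f (2 * j + 0))"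
    by (rule prod.reindex_bij_witness[of _ "\<lambda>j. 2 * j + 0" "\<lambda>Y. Y div 2"]) auto
  ultimately show ?thesis using prod_parity[OF assms(1-3)] unfolding f_def by simp
qed

context quotient_apartment
begin

lemma line_reps_on_cong:
  assumes "line_reps_on R H I V D len" "\<And>i. i \<in> I \<Longrightarrow> len' i = len i"
  shows "line_reps_on R H I V D len'"
  using assms unfolding line_reps_on_def by simp

lemma line_reps_on_all: "line_reps_on R (weights A \<pi>') I V D len \<longleftrightarrow> line_reps R I V D len"
  unfolding line_reps_on_def line_reps_def ..

text \<open>
  In the axis direction of a Klein bottle group, lines of level \<open>y\<close> are identified by
  \<open>y \<mapsto> y + \<tau>\<close> and \<open>y \<mapsto> q - y\<close>, for which \<open>[q / 2, (q + \<tau>) / 2]\<close> is a fundamental domain; its ends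
  are the glide axes, where geodesics close up after \<open>k / 2\<close>. The level is \<open>y = j + e / 2\<close>, where
  \<open>e = 0\<close> for rational and \<open>e = 1\<close> for semi-rational lines.
\<close>

lemma line_reps_on_axis:
  assumes ts: "c \<in> translation_lattice" "\<sigma> \<in> \<Gamma>" "linear_part \<sigma> = reflection a"
    "\<And>x. \<sigma> (\<sigma> x) = x + of_nat k *\<^sub>R a" "c \<bullet> a = 0" "k > 0" "a \<in> (\<Union>\<rho>. weights A \<rho>)"
    and struct: "\<And>g. g \<in> \<Gamma> \<Longrightarrow> \<exists>i j :: int. g = (\<lambda>x. x + (of_int i *\<^sub>R c + of_int j *\<^sub>R of_nat k *\<^sub>R a)) \<or>
      g = (\<lambda>x. \<sigma> x + (of_int i *\<^sub>R c + of_int j *\<^sub>R of_nat k *\<^sub>R a))"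
    and F: "F \<subseteq> weights A \<pi>'" "\<And>d. d \<in> F \<Longrightarrow> d = a \<or> d = - a"
    and forms: "\<And>d. d \<in> F \<Longrightarrow> is_line_form d (\<Phi> d) (X d)"
    and q: "\<And>d. d \<in> F \<Longrightarrow> \<Phi> d \<bullet> \<sigma> 0 = of_int (q d)"
    and \<tau>: "\<And>d. d \<in> F \<Longrightarrow> \<Phi> d \<bullet> c = of_int (\<tau> d)" "\<And>d. d \<in> F \<Longrightarrow> \<tau> d > 0"
    and lev: "level_lines R (of_int e / 2)"
  shows "line_reps_on R F (SIGMA d:F. {j. q d \<le> 2 * j + e \<and> 2 * j + e \<le> q d + \<tau> d})
    (\<lambda>i. (of_int (snd i) + of_int e / 2) *\<^sub>R X (fst i)) fst
    (\<lambda>i. if 2 * snd i + e = q (fst i) \<or> 2 * snd i + e = q (fst i) + \<tau> (fst i) then of_nat k / 2 else of_nat k)"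
    (is "line_reps_on R F ?I ?V fst ?len")
    and "d \<in> F \<Longrightarrow> rational_line A (glide_axis (\<lambda>x. \<sigma> x + of_int i *\<^sub>R c) a) \<longleftrightarrow> even (q d + i * \<tau> d)"
proof -
  have aa: "a \<bullet> a > 0" using weights_nonzero[OF frame ts(7)] .
  have anz: "a \<noteq> 0" using aa by auto
  have sx: "\<sigma> (x + y) = \<sigma> x + reflection a y" for x y using elem(3)[OF ts(2)] unfolding ts(3) .
  have sa: "\<sigma> (x + r *\<^sub>R a) = \<sigma> x + r *\<^sub>R a" for x r
    unfolding sx linear_scale[OF linear_reflection] reflection_axis[OF aa] ..
  have kT: "of_nat k *\<^sub>R a \<in> translation_lattice"
  proof -
    have "\<sigma> \<circ> \<sigma> = (\<lambda>x. x + of_nat k *\<^sub>R a)" by (rule ext) (simp only: comp_apply ts(4))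
    then show ?thesis using comp_mem[OF ts(2) ts(2)] unfolding translation_lattice_iff by (simp only:)
  qed
  have vT: "of_int i *\<^sub>R c + of_int j *\<^sub>R of_nat k *\<^sub>R a \<in> translation_lattice" for i j
    using translation_lattice_add[OF translation_lattice_scale[OF ts(1)] translation_lattice_scale[OF kT]] .
  have sG: "(\<lambda>x. \<sigma> x + v) \<in> \<Gamma>" if "v \<in> translation_lattice" for v
    using comp_mem[OF that[unfolded translation_lattice_iff] ts(2)] by (simp add: comp_def)
  have slin: "linear_part (\<lambda>x. \<sigma> x + v) = reflection a" for v
    unfolding ts(3)[symmetric] by (auto simp: linear_part_def)
  have tlin: "linear_part (\<lambda>x. x + v) d = d" for v d by (simp add: linear_part_def)
  have dl: "\<exists>\<delta>::int. (\<delta> = 1 \<or> \<delta> = - 1) \<and> d = of_int \<delta> *\<^sub>R a" if "d \<in> F" for d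
    using F(2)[OF that] by (elim disjE) (intro exI[of _ 1], simp, intro exI[of _ "- 1"], simp)
  have rd: "reflection a d = d" if "d \<in> F" for d
    using dl[OF that] linear_scale[OF linear_reflection, of a _ a] reflection_axis[OF aa] by auto
  have fa: "\<Phi> d \<bullet> a = 0" if "d \<in> F" for d
    using line_form(1)[OF forms[OF that]] F(2)[OF that] by auto
  have fs: "\<Phi> d \<bullet> \<sigma> x = of_int (q d) - \<Phi> d \<bullet> x" if "d \<in> F" for d x
  proof -
    have "\<Phi> d \<bullet> reflection a x = - (\<Phi> d \<bullet> x)" unfolding reflection_def using fa[OF that] by (simp add: inner_add_right inner_diff_right)
    moreover have "\<sigma> x = \<sigma> 0 + reflection a x" using sx[of 0 x] by simp
    ultimately show ?thesis using q[OF that] by (simp add: inner_add_right)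
  qed
  have fX: "\<Phi> d \<bullet> ((of_int j + of_int e / 2) *\<^sub>R X d) = of_int (2 * j + e) / 2" if "d \<in> F" for d j
    using line_form(2)[OF forms[OF that]] by (simp add: add_divide_distrib)
  \<comment> \<open>a glide reflection moves the points of its own axis by \<open>(k / 2) a\<close>\<close>
  have half: "\<sigma> x + of_int i *\<^sub>R c = x + (of_nat k / 2) *\<^sub>R a"
    if d: "d \<in> F" and x: "2 * (\<Phi> d \<bullet> x) = of_int (q d + i * \<tau> d)" for d x i
  proof -
    have "\<Phi> d \<bullet> (\<sigma> x + of_int i *\<^sub>R c - x) = 0"
      using fs[OF d, of x] \<tau>(1)[OF d] x by (simp add: inner_diff_right inner_add_right)
    then obtain s where "\<sigma> x + of_int i *\<^sub>R c - x = s *\<^sub>R d" using line_form(7)[OF forms[OF d]] by blast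
    moreover obtain \<delta> :: int where "d = of_int \<delta> *\<^sub>R a" using dl[OF d] by blast
    ultimately obtain r where r: "\<sigma> x + of_int i *\<^sub>R c - x = r *\<^sub>R a" by (metis scaleR_scaleR)
    then have y: "\<sigma> x + of_int i *\<^sub>R c = x + r *\<^sub>R a" by (simp add: algebra_simps)
    then have sxe: "\<sigma> x = (x + r *\<^sub>R a) - of_int i *\<^sub>R c" by (metis add_diff_cancel_right')
    have "\<sigma> (\<sigma> x + of_int i *\<^sub>R c) = x + of_nat k *\<^sub>R a - of_int i *\<^sub>R c"
      unfolding sx ts(4) linear_scale[OF linear_reflection] reflection_perp[OF ts(5)] by simp
    moreover have "\<sigma> (x + r *\<^sub>R a) = (x + r *\<^sub>R a) - of_int i *\<^sub>R c + r *\<^sub>R a"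
      unfolding sa sxe by simp
    ultimately have "of_nat k *\<^sub>R a = r *\<^sub>R a + r *\<^sub>R a" unfolding y by (simp add: algebra_simps)
    then have "of_nat k *\<^sub>R a = (r + r) *\<^sub>R a" by (simp only: scaleR_left_distrib)
    then have "of_nat k = r + r" using anz by simp
    then show ?thesis using y by simp
  qed
  show "line_reps_on R F ?I ?V fst ?len"
    unfolding line_reps_on_def
  proof (intro conjI ballI allI impI)
    have "finite F" using F(1) finite_weights finite_subset by blast
    moreover have "finite {j. q d \<le> 2 * j + e \<and> 2 * j + e \<le> q d + \<tau> d}" for d
      by (rule finite_subset[of _ "{- \<bar>q d\<bar> - \<bar>e\<bar>..\<bar>q d\<bar> + \<bar>\<tau> d\<bar> + \<bar>e\<bar>}"]) auto
    ultimately show "finite ?I" by simp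
  next
    fix i assume i: "i \<in> ?I"
    then have d: "fst i \<in> F" by auto
    show "fst i \<in> F" by fact
    have "\<Phi> (fst i) \<bullet> ?V i - of_int e / 2 = of_int (snd i)" unfolding fX[OF d] by (simp add: add_divide_distrib)
    then show "R (line_through (?V i) (fst i))"
      using lev forms[OF d] unfolding level_lines_def by (metis Ints_of_int)
    show "?len i > 0" using ts(6) by simp
    obtain \<delta> :: int where dd: "\<delta> = 1 \<or> \<delta> = - 1" "fst i = of_int \<delta> *\<^sub>R a" using dl[OF d] by blast
    show "\<exists>g\<in>\<Gamma>. linear_part g (fst i) = fst i \<and> g (?V i) = ?V i + ?len i *\<^sub>R fst i"
    proof (cases "2 * snd i + e = q (fst i) \<or> 2 * snd i + e = q (fst i) + \<tau> (fst i)")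
      case True
      then obtain m where m: "2 * snd i + e = q (fst i) + m * \<tau> (fst i)"
        by (metis add.right_neutral mult_1 mult_zero_left)
      have "2 * (\<Phi> (fst i) \<bullet> ?V i) = of_int (q (fst i) + m * \<tau> (fst i))" unfolding fX[OF d] m[symmetric] by simp
      note h = half[OF d this]
      define j :: int where "j = (if \<delta> = 1 then 0 else - 1)"
      let ?g = "\<lambda>x. \<sigma> x + (of_int m *\<^sub>R c + of_int j *\<^sub>R of_nat k *\<^sub>R a)"
      have "?g (?V i) = ?V i + (of_nat k / 2) *\<^sub>R a + (of_int j * of_nat k) *\<^sub>R a"
        unfolding h[symmetric] by (simp add: add.assoc)
      also have "\<dots> = ?V i + (of_nat k / 2 + of_int j * of_nat k) *\<^sub>R a" by (simp add: scaleR_left_distrib add.assoc)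
      also have "of_nat k / 2 + of_int j * of_nat k = (of_nat k / 2) * (of_int \<delta> :: real)" using dd(1) unfolding j_def by auto
      finally have "?g (?V i) = ?V i + ?len i *\<^sub>R fst i" using True dd(2) by simp
      moreover have "linear_part ?g (fst i) = fst i" unfolding slin using rd[OF d] .
      ultimately show ?thesis using sG[OF vT] by blast
    next
      case False
      let ?g = "\<lambda>x. x + (of_int 0 *\<^sub>R c + of_int \<delta> *\<^sub>R of_nat k *\<^sub>R a)"
      have "?g (?V i) = ?V i + ?len i *\<^sub>R fst i" using False dd(2) by (simp add: mult.commute)
      moreover have "?g \<in> \<Gamma>" using vT unfolding translation_lattice_iff by blast
      ultimately show ?thesis using tlin by blast
    qed
  next
    fix i g and l :: real assume i: "i \<in> ?I" and g: "g \<in> \<Gamma>" "0 < l"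
      and cl: "linear_part g (fst i) = fst i \<and> g (?V i) = ?V i + l *\<^sub>R fst i"
    then have d: "fst i \<in> F" and rng: "q (fst i) \<le> 2 * snd i + e" "2 * snd i + e \<le> q (fst i) + \<tau> (fst i)" by auto
    obtain \<delta> :: int where dd: "\<delta> = 1 \<or> \<delta> = - 1" "fst i = of_int \<delta> *\<^sub>R a" using dl[OF d] by blast
    have f0: "\<Phi> (fst i) \<bullet> (fst i) = 0" using line_form(1)[OF forms[OF d]] .
    have \<delta>2: "of_int \<delta> * (of_int \<delta> :: real) = 1" using dd(1) by auto
    obtain m j :: int where "g = (\<lambda>x. x + (of_int m *\<^sub>R c + of_int j *\<^sub>R of_nat k *\<^sub>R a)) \<or>
      g = (\<lambda>x. \<sigma> x + (of_int m *\<^sub>R c + of_int j *\<^sub>R of_nat k *\<^sub>R a))" using struct[OF g(1)] by blast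
    then show "\<exists>n::nat. l = of_nat n * ?len i"
    proof
      assume "g = (\<lambda>x. x + (of_int m *\<^sub>R c + of_int j *\<^sub>R of_nat k *\<^sub>R a))"
      then have eq: "of_int m *\<^sub>R c + of_int j *\<^sub>R of_nat k *\<^sub>R a = l *\<^sub>R fst i" using cl by simp
      then have "\<Phi> (fst i) \<bullet> (of_int m *\<^sub>R c + of_int j *\<^sub>R of_nat k *\<^sub>R a) = 0" using f0 by simp
      then have "m = 0" using \<tau>[OF d] fa[OF d] by (simp add: inner_add_right)
      then have "(of_int j * of_nat k) *\<^sub>R a = (l * of_int \<delta>) *\<^sub>R a" using eq dd(2) by simp
      then have "of_int j * of_nat k = l * of_int \<delta>" using anz by simp
      then have "of_int j * of_nat k * of_int \<delta> = l * (of_int \<delta> * of_int \<delta>)" by simp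
      then have l: "l = of_int (j * \<delta>) * of_nat k" unfolding \<delta>2 by (simp add: mult_ac)
      have "of_nat k > (0::real)" using ts(6) by simp
      then have "of_int (j * \<delta>) > (0::real)" using g(2) unfolding l by (rule zero_less_mult_pos2[rotated])
      then have "j * \<delta> > 0" unfolding of_int_0_less_iff .
      then have "of_int (j * \<delta>) = (of_nat (nat (j * \<delta>)) :: real)" by simp
      then have l1: "l = of_nat (nat (j * \<delta>)) * of_nat k" and l2: "l = of_nat (2 * nat (j * \<delta>)) * (of_nat k / 2)"
        using l by simp_all
      show ?thesis
      proof (cases "2 * snd i + e = q (fst i) \<or> 2 * snd i + e = q (fst i) + \<tau> (fst i)")
        case True
        show ?thesis unfolding if_P[OF True] by (rule exI, rule l2)
      next
        case False
        show ?thesis unfolding if_not_P[OF False] by (rule exI, rule l1)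
      qed
    next
      assume "g = (\<lambda>x. \<sigma> x + (of_int m *\<^sub>R c + of_int j *\<^sub>R of_nat k *\<^sub>R a))"
      then have eq: "\<sigma> (?V i) + (of_int m *\<^sub>R c + of_int j *\<^sub>R of_nat k *\<^sub>R a) = ?V i + l *\<^sub>R fst i" using cl by simp
      have "\<Phi> (fst i) \<bullet> (\<sigma> (?V i) + (of_int m *\<^sub>R c + of_int j *\<^sub>R of_nat k *\<^sub>R a)) = \<Phi> (fst i) \<bullet> ?V i"
        unfolding eq using f0 by (simp add: inner_add_right)
      then have x: "2 * (\<Phi> (fst i) \<bullet> ?V i) = of_int (q (fst i) + m * \<tau> (fst i))"
        using fs[OF d, of "?V i"] \<tau>(1)[OF d] fa[OF d] by (simp add: inner_add_right)
      then have "(of_int (2 * snd i + e) :: real) = of_int (q (fst i) + m * \<tau> (fst i))" unfolding fX[OF d] by simp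
      then have Y: "2 * snd i + e = q (fst i) + m * \<tau> (fst i)" unfolding of_int_eq_iff .
      then have "0 \<le> m * \<tau> (fst i)" "m * \<tau> (fst i) \<le> 1 * \<tau> (fst i)" using rng by simp_all
      then have "0 \<le> m" "m \<le> 1" using \<tau>(2)[OF d] by (simp_all add: zero_le_mult_iff)
      then have "m = 0 \<or> m = 1" by linarith
      then have len: "?len i = of_nat k / 2" using Y by auto
      have "?V i + ((of_nat k / 2) *\<^sub>R a + (of_int j * of_nat k) *\<^sub>R a) = ?V i + l *\<^sub>R fst i"
        using eq half[OF d x] by (simp add: add.assoc[symmetric])
      then have "(of_nat k / 2 + of_int j * of_nat k) *\<^sub>R a = (l * of_int \<delta>) *\<^sub>R a" using dd(2) by (simp add: scaleR_left_distrib)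
      then have "of_nat k / 2 + of_int j * of_nat k = l * of_int \<delta>" using anz by simp
      then have "(of_nat k / 2 + of_int j * of_nat k) * of_int \<delta> = l * (of_int \<delta> * of_int \<delta>)" by simp
      then have l: "l = of_int ((1 + 2 * j) * \<delta>) * (of_nat k / 2)" unfolding \<delta>2 by (simp add: field_simps)
      have "of_nat k / 2 > (0::real)" using ts(6) by simp
      then have "of_int ((1 + 2 * j) * \<delta>) > (0::real)" using g(2) unfolding l by (rule zero_less_mult_pos2[rotated])
      then have "(1 + 2 * j) * \<delta> > 0" unfolding of_int_0_less_iff .
      then have "of_int ((1 + 2 * j) * \<delta>) = (of_nat (nat ((1 + 2 * j) * \<delta>)) :: real)" by simp
      then have "l = of_nat (nat ((1 + 2 * j) * \<delta>)) * (of_nat k / 2)" using l by (simp only:)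
      then show ?thesis unfolding len by (rule exI)
    qed
  next
    fix v d assume vd: "d \<in> F \<and> R (line_through v d)"
    then have d: "d \<in> F" by blast
    note f = line_form[OF forms[OF d]]
    have "\<Phi> d \<bullet> v - of_int e / 2 \<in> \<int>" using vd lev forms[OF d] unfolding level_lines_def by blast
    then obtain h :: int where h: "\<Phi> d \<bullet> v - of_int e / 2 = of_int h" by (auto elim: Ints_cases)
    define Y where "Y = 2 * h + e"
    have Yv: "2 * (\<Phi> d \<bullet> v) = of_int Y" unfolding Y_def using h by simp
    define r where "r = (Y - q d) mod (2 * \<tau> d)"
    define n where "n = (Y - q d) div (2 * \<tau> d)"
    have Yr: "Y = q d + r + 2 * \<tau> d * n" unfolding r_def n_def by simp
    have r: "0 \<le> r" "r < 2 * \<tau> d" unfolding r_def using \<tau>(2)[OF d] by simp_all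
    have witness: "\<exists>i\<in>?I. \<exists>g\<in>\<Gamma>. \<exists>s. linear_part g (fst i) = d \<and> g (?V i) = v + s *\<^sub>R d"
      if j: "(d, j) \<in> ?I" and g: "g \<in> \<Gamma>" "linear_part g d = d" "\<Phi> d \<bullet> g (?V (d, j)) = \<Phi> d \<bullet> v" for j g
    proof -
      have "\<Phi> d \<bullet> (g (?V (d, j)) - v) = 0" using g(3) by (simp add: inner_diff_right)
      then obtain s where "g (?V (d, j)) - v = s *\<^sub>R d" using f(7) by blast
      then have "g (?V (d, j)) = v + s *\<^sub>R d" by (simp add: algebra_simps)
      then show ?thesis using j g by (intro bexI[of _ "(d, j)"] bexI[of _ g] exI[of _ s]) simp_all
    qed
    show "\<exists>i\<in>?I. \<exists>g\<in>\<Gamma>. \<exists>s. linear_part g (fst i) = d \<and> g (?V i) = v + s *\<^sub>R d"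
    proof (cases "r \<le> \<tau> d")
      case True
      let ?j = "h - \<tau> d * n"
      let ?g = "\<lambda>x. x + (of_int n *\<^sub>R c + of_int 0 *\<^sub>R of_nat k *\<^sub>R a)"
      have Y': "2 * ?j + e = q d + r" using Yr unfolding Y_def by (simp add: algebra_simps)
      have "(d, ?j) \<in> ?I" using d True r Y' by simp
      moreover have "?g \<in> \<Gamma>" using vT unfolding translation_lattice_iff by blast
      moreover have "\<Phi> d \<bullet> ?g (?V (d, ?j)) = \<Phi> d \<bullet> v"
      proof -
        have "\<Phi> d \<bullet> ?g (?V (d, ?j)) = of_int (2 * ?j + e) / 2 + of_int n * of_int (\<tau> d)"
          using fX[OF d, of ?j] \<tau>(1)[OF d] by (simp add: inner_add_right)
        also have "\<dots> = of_int Y / 2" unfolding Y' Yr by simp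
        finally show ?thesis using Yv by simp
      qed
      ultimately show ?thesis using witness tlin by blast
    next
      case False
      let ?j = "q d - h - e + \<tau> d * (n + 1)"
      let ?g = "\<lambda>x. \<sigma> x + (of_int (n + 1) *\<^sub>R c + of_int 0 *\<^sub>R of_nat k *\<^sub>R a)"
      have Y': "2 * ?j + e = q d + 2 * \<tau> d - r" using Yr unfolding Y_def by (simp add: algebra_simps)
      have "(d, ?j) \<in> ?I" using d False r Y' by simp
      moreover have "?g \<in> \<Gamma>" using sG[OF vT] .
      moreover have "\<Phi> d \<bullet> ?g (?V (d, ?j)) = \<Phi> d \<bullet> v"
      proof -
        have "\<Phi> d \<bullet> ?g (?V (d, ?j)) = of_int (q d) - of_int (2 * ?j + e) / 2 + of_int (n + 1) * of_int (\<tau> d)"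
          using fX[OF d, of ?j] fs[OF d, of "?V (d, ?j)"] \<tau>(1)[OF d] by (simp add: inner_add_right)
        also have "\<dots> = of_int Y / 2" unfolding Y' Yr by (simp add: field_simps)
        finally show ?thesis using Yv by simp
      qed
      moreover have "linear_part ?g d = d" unfolding slin using rd[OF d] .
      ultimately show ?thesis using witness by blast
    qed
  next
    fix i j g s assume ij: "i \<in> ?I" "j \<in> ?I" and g: "g \<in> \<Gamma>"
      and cl: "linear_part g (fst i) = fst j \<and> g (?V i) = ?V j + s *\<^sub>R fst j"
    have d: "fst i \<in> F" "fst j \<in> F"
      and rng: "q (fst i) \<le> 2 * snd i + e" "2 * snd i + e \<le> q (fst i) + \<tau> (fst i)"
        "q (fst j) \<le> 2 * snd j + e" "2 * snd j + e \<le> q (fst j) + \<tau> (fst j)" using ij by auto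
    obtain m n :: int where gm: "g = (\<lambda>x. x + (of_int m *\<^sub>R c + of_int n *\<^sub>R of_nat k *\<^sub>R a)) \<or>
      g = (\<lambda>x. \<sigma> x + (of_int m *\<^sub>R c + of_int n *\<^sub>R of_nat k *\<^sub>R a))" using struct[OF g] by blast
    have dd: "fst i = fst j" using gm cl rd[OF d(1)] slin tlin by metis
    define Q T where "Q = q (fst j)" and "T = \<tau> (fst j)"
    have T: "T > 0" unfolding T_def using \<tau>(2)[OF d(2)] .
    define y where "y = ?V i"
    have "\<Phi> (fst j) \<bullet> g y = \<Phi> (fst j) \<bullet> ?V j"
      using cl line_form(1)[OF forms[OF d(2)]] unfolding y_def by (simp add: inner_add_right)
    then have gV: "\<Phi> (fst j) \<bullet> g y = of_int (2 * snd j + e) / 2" unfolding fX[OF d(2)] .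
    have Vi: "\<Phi> (fst j) \<bullet> y = of_int (2 * snd i + e) / 2" unfolding y_def dd by (rule fX[OF d(2)])
    have "snd i = snd j"
      using gm
    proof
      assume "g = (\<lambda>x. x + (of_int m *\<^sub>R c + of_int n *\<^sub>R of_nat k *\<^sub>R a))"
      then have "\<Phi> (fst j) \<bullet> g y = \<Phi> (fst j) \<bullet> y + of_int m * of_int T"
        using \<tau>(1)[OF d(2)] fa[OF d(2)] unfolding T_def by (simp add: inner_add_right)
      then have "of_int (2 * snd i + e) / 2 + of_int m * of_int T = (of_int (2 * snd j + e) / 2 :: real)"
        unfolding gV Vi ..
      then have "of_int (snd i + m * T) = (of_int (snd j) :: real)" by (simp add: field_simps)
      then have e1: "snd i + m * T = snd j" unfolding of_int_eq_iff .
      have b: "2 * (m * T) \<le> T" "- T \<le> 2 * (m * T)" using e1 rng unfolding dd Q_def[symmetric] T_def[symmetric] by linarith+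
      have "m < 1"
      proof (rule ccontr)
        assume "\<not> m < 1"
        then have "1 * T \<le> m * T" using T by (intro mult_right_mono) simp_all
        then show False using b T by linarith
      qed
      moreover have "m > - 1"
      proof (rule ccontr)
        assume "\<not> m > - 1"
        then have "m * T \<le> (- 1) * T" using T by (intro mult_right_mono) simp_all
        then show False using b T by linarith
      qed
      ultimately have "m = 0" by simp
      then show ?thesis using e1 by simp
    next
      assume "g = (\<lambda>x. \<sigma> x + (of_int m *\<^sub>R c + of_int n *\<^sub>R of_nat k *\<^sub>R a))"
      then have "\<Phi> (fst j) \<bullet> g y = of_int Q - \<Phi> (fst j) \<bullet> y + of_int m * of_int T"
        using fs[OF d(2), of y] \<tau>(1)[OF d(2)] fa[OF d(2)] unfolding T_def Q_def by (simp add: inner_add_right)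
      then have "of_int Q - of_int (2 * snd i + e) / 2 + of_int m * of_int T = (of_int (2 * snd j + e) / 2 :: real)"
        unfolding gV Vi ..
      then have "of_int ((2 * snd i + e) + (2 * snd j + e)) = (of_int (2 * Q + 2 * (m * T)) :: real)" by (simp add: field_simps)
      then have e1: "(2 * snd i + e) + (2 * snd j + e) = 2 * Q + 2 * (m * T)" unfolding of_int_eq_iff .
      have r': "Q \<le> 2 * snd i + e" "2 * snd i + e \<le> Q + T" "Q \<le> 2 * snd j + e" "2 * snd j + e \<le> Q + T"
        using rng unfolding dd Q_def T_def by simp_all
      have b: "0 \<le> m * T" "m * T \<le> 1 * T" using e1 r' by linarith+
      have "m * T \<le> 1 * T \<longleftrightarrow> m \<le> 1" using T by (rule mult_le_cancel_right_pos)
      then have "m \<le> 1" using b(2) by blast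
      moreover have "0 \<le> m" using b(1) T by (simp add: zero_le_mult_iff)
      ultimately have "m = 0 \<or> m = 1" by linarith
      then show ?thesis using e1 r' by auto
    qed
    then show "i = j" using dd by (simp add: prod_eq_iff)
  qed
  show "rational_line A (glide_axis (\<lambda>x. \<sigma> x + of_int i *\<^sub>R c) a) \<longleftrightarrow> even (q d + i * \<tau> d)" if d: "d \<in> F"
  proof -
    note f = line_form[OF forms[OF d]]
    define p where "p = (of_int (q d + i * \<tau> d) / 2) *\<^sub>R X d"
    have fp: "2 * (\<Phi> d \<bullet> p) = of_int (q d + i * \<tau> d)" unfolding p_def using f(2) by simp
    have pp: "\<Phi> d \<bullet> p = of_int (q d + i * \<tau> d) / 2" unfolding p_def using f(2) by simp
    have "glide_axis (\<lambda>x. \<sigma> x + of_int i *\<^sub>R c) a = line_through p d"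
    proof (rule Set.set_eqI, rule iffI)
      fix x assume "x \<in> glide_axis (\<lambda>x. \<sigma> x + of_int i *\<^sub>R c) a"
      then obtain r where "\<sigma> x + of_int i *\<^sub>R c = x + r *\<^sub>R a" unfolding glide_axis_def by blast
      then have "\<Phi> d \<bullet> (\<sigma> x + of_int i *\<^sub>R c) = \<Phi> d \<bullet> x" using fa[OF d] by (simp add: inner_add_right)
      then have "2 * (\<Phi> d \<bullet> x) = 2 * (\<Phi> d \<bullet> p)"
        using fs[OF d, of x] \<tau>(1)[OF d] unfolding fp by (simp add: inner_add_right)
      then have "\<Phi> d \<bullet> (x - p) = 0" by (simp add: inner_diff_right)
      then obtain s where "x - p = s *\<^sub>R d" using f(7) by blast
      then have "x = p + s *\<^sub>R d" by (simp add: algebra_simps)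
      then show "x \<in> line_through p d" unfolding line_through_def by blast
    next
      fix x assume "x \<in> line_through p d"
      then obtain s where x: "x = p + s *\<^sub>R d" unfolding line_through_def by blast
      have "2 * (\<Phi> d \<bullet> x) = of_int (q d + i * \<tau> d)" using fp f(1) unfolding x by (simp add: inner_add_right)
      then show "x \<in> glide_axis (\<lambda>x. \<sigma> x + of_int i *\<^sub>R c) a"
        using half[OF d] unfolding glide_axis_def by blast
    qed
    then have "rational_line A (glide_axis (\<lambda>x. \<sigma> x + of_int i *\<^sub>R c) a) \<longleftrightarrow> (of_int (q d + i * \<tau> d) / 2 :: real) \<in> \<int>"
      using f(8)[of p] unfolding pp by simp
    also have "\<dots> \<longleftrightarrow> even (q d + i * \<tau> d)"
    proof
      assume "(of_int (q d + i * \<tau> d) / 2 :: real) \<in> \<int>"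
      then obtain m :: int where "(of_int (q d + i * \<tau> d) / 2 :: real) = of_int m" by (auto elim: Ints_cases)
      then have "(of_int (q d + i * \<tau> d) :: real) = of_int (2 * m)" by simp
      then show "even (q d + i * \<tau> d)" unfolding of_int_eq_iff by simp
    next
      assume "even (q d + i * \<tau> d)"
      then obtain m where "q d + i * \<tau> d = 2 * m" by blast
      then have "(of_int (q d + i * \<tau> d) / 2 :: real) = of_int m" by simp
      then show "(of_int (q d + i * \<tau> d) / 2 :: real) \<in> \<int>" by simp
    qed
    finally show ?thesis .
  qed
qed

end

section \<open>Comparison of the zeta functions\<close>

context quotient_apartment
begin

lemma Z_semi_line_reps:
  assumes "line_reps (semirational_line A) I V D len"
  shows "Z_semi A \<Gamma> \<pi>' w = (\<Prod>i\<in>I. inverse (1 - exp (of_real (len i) * w)))"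
  unfolding Z_semi_def euler_product_line_reps[OF assms] ..

lemma Z_walk_line_reps:
  assumes "line_reps (rational_line A) I V D len"
  shows "Z_walk A \<Gamma> \<pi>' w = (\<Prod>i\<in>I. inverse (1 - exp (of_real (len i) * w)))"
  unfolding Z_walk_def euler_product_line_reps[OF assms] ..

lemma Z_gallery_line_reps:
  assumes "line_reps (semirational_line A) I V D len"
  shows "Z_gallery A \<Gamma> \<pi> (exp w) = Z_semi A \<Gamma> \<pi>' (2 / of_nat (n_rep \<pi>') * w) ^ n_rep \<pi>'"
  unfolding Z_gallery_def euler_product_galleries[OF assms] Z_semi_line_reps[OF assms] ..

lemma torus_zeta:
  assumes torus: "\<Gamma> \<subseteq> coroot_translations A"
  shows "Z_gallery A \<Gamma> \<pi> (exp w) = Z_semi A \<Gamma> \<pi>' (2 / of_nat (n_rep \<pi>') * w) ^ n_rep \<pi>'"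
    and "Z_semi A \<Gamma> \<pi>' z = Z_walk A \<Gamma> \<pi>' z"
proof -
  have id: "linear_part g = id" if "g \<in> \<Gamma>" for g
  proof -
    have "g \<in> coroot_translations A" using torus that by blast
    then obtain v where "g = (\<lambda>x. x + v)" unfolding coroot_translations_def by auto
    then show ?thesis using linear_part_translation by simp
  qed
  have "\<forall>d\<in>weights A \<pi>'. \<exists>\<phi> x. is_line_form d \<phi> x" using line_form_exists by blast
  then obtain \<Phi> X where forms: "\<And>d. d \<in> weights A \<pi>' \<Longrightarrow> is_line_form d (\<Phi> d) (X d)" by metis
  obtain I :: "('v \<times> int) set" and len where reps:
    "\<And>R \<epsilon>. level_lines R \<epsilon> \<Longrightarrow>
      line_reps_on R (weights A \<pi>') I (\<lambda>i. (of_int (snd i) + \<epsilon>) *\<^sub>R X (fst i)) fst len"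
    using line_reps_on_translations[of "weights A \<pi>'", OF order_refl id forms] by blast
  note semi = reps[OF level_lines_semirational, unfolded line_reps_on_all]
  note rat = reps[OF level_lines_rational, unfolded line_reps_on_all]
  show "Z_gallery A \<Gamma> \<pi> (exp w) = Z_semi A \<Gamma> \<pi>' (2 / of_nat (n_rep \<pi>') * w) ^ n_rep \<pi>'"
    by (rule Z_gallery_line_reps[OF semi])
  show "Z_semi A \<Gamma> \<pi>' z = Z_walk A \<Gamma> \<pi>' z"
    unfolding Z_semi_line_reps[OF semi] Z_walk_line_reps[OF rat] ..
qed

text \<open>
  The directions with \<open>c \<bullet> d > 0\<close> represent those that are not parallel to the axis, as \<open>\<sigma>\<close> changes the
  sign of \<open>c \<bullet> d\<close>; they contribute equally to both products. The correction comes from the weights in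
  \<open>{a, - a}\<close>, once for each.
\<close>

lemma klein_zeta:
  assumes kl: "klein_choice A \<Gamma> t \<sigma> a k"
  shows "Z_gallery A \<Gamma> \<pi> (exp w) = Z_semi A \<Gamma> \<pi>' (2 / of_nat (n_rep \<pi>') * w) ^ n_rep \<pi>'"
    and "norm (exp (of_nat k / 2 * z)) < 1 \<Longrightarrow> Z_semi A \<Gamma> \<pi>' z = Z_walk A \<Gamma> \<pi>' z *
      (((1 + exp (of_nat k / 2 * z)) / (1 - exp (of_nat k / 2 * z))) powi (1 - int (rational_axes A t \<sigma> a)))
        ^ delta A \<pi> a"
proof -
  obtain c where c: "t = (\<lambda>x. x + c)" "c \<in> translation_lattice" "\<sigma> \<in> \<Gamma>" "linear_part \<sigma> = reflection a"
    "\<And>x. \<sigma> (\<sigma> x) = x + of_nat k *\<^sub>R a" "c \<bullet> a = 0" "c \<noteq> 0" "k > 0" "a \<in> (\<Union>\<rho>. weights A \<rho>)"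
    and struct: "\<And>g. g \<in> \<Gamma> \<Longrightarrow> \<exists>i j :: int. g = (\<lambda>x. x + (of_int i *\<^sub>R c + of_int j *\<^sub>R of_nat k *\<^sub>R a)) \<or>
      g = (\<lambda>x. \<sigma> x + (of_int i *\<^sub>R c + of_int j *\<^sub>R of_nat k *\<^sub>R a))"
    using klein_structure[OF kl] by blast
  have aa: "a \<bullet> a > 0" using weights_nonzero[OF frame c(9)] .
  have anz: "a \<noteq> 0" using aa by auto
  have ac: "a \<bullet> c = 0" using c(6) by (simp only: inner_commute)
  have lin: "linear_part g = id \<or> linear_part g = reflection a" if "g \<in> \<Gamma>" for g
  proof -
    have "linear_part (\<lambda>x. \<sigma> x + v) = reflection a" for v
      unfolding c(4)[symmetric] by (auto simp: linear_part_def)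
    then show ?thesis using struct[OF that] linear_part_translation by metis
  qed
  have cr: "c \<bullet> reflection a x = - (c \<bullet> x)" for x
    unfolding reflection_def using c(6) by (simp add: inner_diff_right)
  define H F where "H = {d\<in>weights A \<pi>'. c \<bullet> d > 0}" and "F = {d\<in>weights A \<pi>'. c \<bullet> d = 0}"
  have HW: "H \<subseteq> weights A \<pi>'" and FW: "F \<subseteq> weights A \<pi>'" unfolding H_def F_def by blast+
  have Fa: "d = a \<or> d = - a" if "d \<in> F" for d
  proof -
    have "c \<bullet> d = 0" using that unfolding F_def by blast
    then have "d = (d \<bullet> a / (a \<bullet> a)) *\<^sub>R a"
      by (rule orthogonal_imp_multiple[OF apartment_DIM[OF frame] anz c(7) ac])
    moreover have "d \<in> (\<Union>\<rho>. weights A \<rho>)" using that FW by blast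
    ultimately show ?thesis using weights_parallel[OF frame c(9)] by blast
  qed
  have F: "F = {a, - a} \<inter> weights A \<pi>'" using Fa c(6) unfolding F_def by (auto simp: inner_commute)
  have "\<exists>\<phi> x. is_line_form d \<phi> x \<and> \<phi> \<bullet> c \<ge> 0" if d: "d \<in> weights A \<pi>'" for d
  proof -
    obtain \<phi> x where f: "is_line_form d \<phi> x" using line_form_exists[OF d] by blast
    show ?thesis
    proof (cases "\<phi> \<bullet> c \<ge> 0")
      case False
      obtain x' where "is_line_form d (- \<phi>) x'" using line_form_minus[OF f] by blast
      then show ?thesis using False by (intro exI[of _ "- \<phi>"] exI[of _ x']) simp
    qed (use f in blast)
  qed
  then have "\<forall>d\<in>weights A \<pi>'. \<exists>\<phi> x. is_line_form d \<phi> x \<and> \<phi> \<bullet> c \<ge> 0" by blast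
  then obtain \<Phi> X where forms: "\<And>d. d \<in> weights A \<pi>' \<Longrightarrow> is_line_form d (\<Phi> d) (X d)"
    "\<And>d. d \<in> weights A \<pi>' \<Longrightarrow> \<Phi> d \<bullet> c \<ge> 0" by metis
  have "\<exists>q \<tau> :: int. \<Phi> d \<bullet> \<sigma> 0 = of_int q \<and> \<Phi> d \<bullet> c = of_int \<tau> \<and> \<tau> > 0" if d: "d \<in> F" for d
  proof -
    have dW: "d \<in> weights A \<pi>'" using d FW by blast
    note f = line_form[OF forms(1)[OF dW]]
    have "\<sigma> 0 \<in> coweights A" "c \<in> coweights A"
      using elem(2)[OF c(3)] translation_lattice_coroots[OF c(2)] coroots_subset by blast+
    then obtain q \<tau> :: int where q: "\<Phi> d \<bullet> \<sigma> 0 = of_int q" "\<Phi> d \<bullet> c = of_int \<tau>"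
      using f(5) by (metis Ints_cases)
    have "\<Phi> d \<bullet> c \<noteq> 0"
    proof
      assume "\<Phi> d \<bullet> c = 0"
      then obtain s where s: "c = s *\<^sub>R d" using f(7) by blast
      then have "c \<bullet> c = s * (c \<bullet> d)" by (simp add: inner_commute)
      then show False using d c(7) unfolding F_def by simp
    qed
    then have "\<tau> > 0" using forms(2)[OF dW] q(2) by simp
    then show ?thesis using q by blast
  qed
  then have "\<forall>d\<in>F. \<exists>q \<tau> :: int. \<Phi> d \<bullet> \<sigma> 0 = of_int q \<and> \<Phi> d \<bullet> c = of_int \<tau> \<and> \<tau> > 0" by blast
  then obtain q \<tau> :: "'v \<Rightarrow> int" where q: "\<And>d. d \<in> F \<Longrightarrow> \<Phi> d \<bullet> \<sigma> 0 = of_int (q d)"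
    "\<And>d. d \<in> F \<Longrightarrow> \<Phi> d \<bullet> c = of_int (\<tau> d)" "\<And>d. d \<in> F \<Longrightarrow> \<tau> d > 0"
    by metis
  have onlyH: "linear_part g = id" if g: "g \<in> \<Gamma>" and d: "d \<in> H" "linear_part g d \<in> H" for g d
    using lin[OF g] d cr[of d] unfolding H_def by auto
  have formsH: "\<And>d. d \<in> H \<Longrightarrow> is_line_form d (\<Phi> d) (X d)" using forms(1) HW by blast
  have "\<exists>(I :: ('v \<times> int) set) len. fst ` I \<subseteq> H \<and> (\<forall>R \<epsilon>. level_lines R \<epsilon> \<longrightarrow>
      line_reps_on R H I (\<lambda>i. (of_int (snd i) + \<epsilon>) *\<^sub>R X (fst i)) fst len)"
    by (rule line_reps_on_translations[OF HW _ formsH]) (erule (2) onlyH)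
  then obtain I :: "('v \<times> int) set" and lenH where IH: "fst ` I \<subseteq> H" and repsH':
    "\<forall>R \<epsilon>. level_lines R \<epsilon> \<longrightarrow> line_reps_on R H I (\<lambda>i. (of_int (snd i) + \<epsilon>) *\<^sub>R X (fst i)) fst lenH"
    by (elim exE conjE)
  note repsH = repsH'[rule_format]
  define J where "J = (\<lambda>e d. {j. q d \<le> 2 * j + e \<and> 2 * j + e \<le> q d + \<tau> d})"
  define lenF where "lenF = (\<lambda>e i. if 2 * snd i + e = q (fst i) \<or> 2 * snd i + e = q (fst i) + \<tau> (fst i)
      then of_nat k / 2 else of_nat k :: real)"
  define len where "len = (\<lambda>e i. if fst i \<in> F then lenF e i else lenH i)"
  have HF: "H \<inter> F = {}" unfolding H_def F_def by auto
  have formsF: "\<And>d. d \<in> F \<Longrightarrow> is_line_form d (\<Phi> d) (X d)" using forms(1) FW by blast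
  have axis: "line_reps_on R F (Sigma F (J e)) (\<lambda>i. (of_int (snd i) + of_int e / 2) *\<^sub>R X (fst i)) fst (lenF e)"
    if "level_lines R (of_int e / 2)" for R e
    using line_reps_on_axis(1)[OF c(2-6,8,9) struct FW Fa formsF q that] unfolding J_def lenF_def .
  have reps: "line_reps R (I \<union> Sigma F (J e)) (\<lambda>i. (of_int (snd i) + of_int e / 2) *\<^sub>R X (fst i)) fst (len e)"
    if lev: "level_lines R (of_int e / 2)" for R e
  proof (rule line_reps_combine[OF _ _ lev HW FW])
    show "line_reps_on R H I (\<lambda>i. (of_int (snd i) + of_int e / 2) *\<^sub>R X (fst i)) fst (len e)"
      by (rule line_reps_on_cong[OF repsH[OF lev]]) (use IH HF in \<open>auto simp: len_def\<close>)
    show "line_reps_on R F (Sigma F (J e)) (\<lambda>i. (of_int (snd i) + of_int e / 2) *\<^sub>R X (fst i)) fst (len e)"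
      by (rule line_reps_on_cong[OF axis[OF lev]]) (auto simp: len_def)
    show "linear_part g d \<notin> F" if "g \<in> \<Gamma>" "d \<in> H" for g d
      using lin[OF that(1)] that(2) cr[of d] unfolding H_def F_def by auto
    show "linear_part g d \<notin> H" if "g \<in> \<Gamma>" "d \<in> F" for g d
      using lin[OF that(1)] that(2) cr[of d] unfolding H_def F_def by auto
    show "\<exists>g\<in>\<Gamma>. linear_part g d \<in> H \<union> F" if d: "d \<in> weights A \<pi>'" for d
    proof (cases "c \<bullet> d \<ge> 0")
      case True
      then have "linear_part id d \<in> H \<union> F" using d unfolding H_def F_def by (auto simp: linear_part_def)
      then show ?thesis using id_mem by blast
    next
      case False
      then have "linear_part \<sigma> d \<in> H" using cr[of d] linear_part_weights[OF c(3) d] unfolding H_def c(4) by simp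
      then show ?thesis using c(3) by blast
    qed
  qed
  have lev1: "level_lines (semirational_line A) (of_int 1 / 2)" and lev0: "level_lines (rational_line A) (of_int 0 / 2)"
    using level_lines_semirational level_lines_rational by simp_all
  note semi = reps[OF lev1] and rat = reps[OF lev0]
  show "Z_gallery A \<Gamma> \<pi> (exp w) = Z_semi A \<Gamma> \<pi>' (2 / of_nat (n_rep \<pi>') * w) ^ n_rep \<pi>'"
    by (rule Z_gallery_line_reps[OF semi])
  show "Z_semi A \<Gamma> \<pi>' z = Z_walk A \<Gamma> \<pi>' z *
      (((1 + exp (of_nat k / 2 * z)) / (1 - exp (of_nat k / 2 * z))) powi (1 - int (rational_axes A t \<sigma> a)))
        ^ delta A \<pi> a"
    if small: "norm (exp (of_nat k / 2 * z)) < 1"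
  proof -
    define x where "x = exp (of_nat k / 2 * z)"
    have x: "x \<noteq> 1" "x \<noteq> - 1" using small unfolding x_def[symmetric] by auto
    have x2: "exp (of_nat k * z) = x\<^sup>2" unfolding x_def power2_eq_square exp_add[symmetric] by (simp add: field_simps)
    define fct where "fct = (\<lambda>l. inverse (1 - exp (of_real l * z)))"
    have fk: "fct (of_nat k / 2) = inverse (1 - x)" "fct (of_nat k) = inverse (1 - x\<^sup>2)"
      unfolding fct_def x2[symmetric] by (simp_all add: x_def)
    have finF: "finite F" using FW finite_weights finite_subset by blast
    have finJ: "finite (J e d)" for e d unfolding J_def
      by (rule finite_subset[of _ "{- \<bar>q d\<bar> - \<bar>e\<bar>..\<bar>q d\<bar> + \<bar>\<tau> d\<bar> + \<bar>e\<bar>}"]) auto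
    have finI: "finite I" using repsH[OF level_lines_rational] unfolding line_reps_on_def by blast
    have disj: "I \<inter> Sigma F (J e) = {}" for e using IH HF by fastforce
    have split: "(\<Prod>i\<in>I \<union> Sigma F (J e). fct (len e i)) =
        (\<Prod>i\<in>I. fct (lenH i)) * (\<Prod>d\<in>F. \<Prod>j\<in>J e d. fct (lenF e (d, j)))" for e
    proof -
      have "(\<Prod>i\<in>I \<union> Sigma F (J e). fct (len e i)) = (\<Prod>i\<in>I. fct (len e i)) * (\<Prod>i\<in>Sigma F (J e). fct (len e i))"
        using finI finF finJ disj by (intro prod.union_disjoint) auto
      also have "(\<Prod>i\<in>I. fct (len e i)) = (\<Prod>i\<in>I. fct (lenH i))"
        by (rule prod.cong) (use IH HF in \<open>auto simp: len_def\<close>)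
      also have "(\<Prod>i\<in>Sigma F (J e). fct (len e i)) = (\<Prod>d\<in>F. \<Prod>j\<in>J e d. fct (lenF e (d, j)))"
        unfolding prod.Sigma[OF finF ballI[OF finJ]] by (rule prod.cong) (auto simp: len_def)
      finally show ?thesis .
    qed
    let ?r = "((1 + x) / (1 - x)) powi (1 - int (rational_axes A t \<sigma> a))"
    have axisprod: "(\<Prod>j\<in>J 1 d. fct (lenF 1 (d, j))) = (\<Prod>j\<in>J 0 d. fct (lenF 0 (d, j))) * ?r" if d: "d \<in> F" for d
    proof -
      have "rational_line A (glide_axis (\<lambda>x. \<sigma> x + of_int i *\<^sub>R c) a) \<longleftrightarrow> even (q d + i * \<tau> d)" for i
        using line_reps_on_axis(2)[OF c(2-6,8,9) struct FW Fa formsF q lev0 d] .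
      from this[of 0] this[of 1] have ax: "int (rational_axes A t \<sigma> a) = of_bool (even (q d)) + of_bool (even (q d + \<tau> d))"
        unfolding rational_axes_def c(1) by (simp add: comp_def)
      have "fct (lenF e (d, j)) = (if 2 * j + e = q d \<or> 2 * j + e = q d + \<tau> d then inverse (1 - x) else inverse (1 - x\<^sup>2))" for e j
        unfolding lenF_def by (simp add: fk)
      then show ?thesis
        unfolding J_def ax using prod_parity_half[of "q d" "q d + \<tau> d" x] q(3)[OF d] x by simp
    qed
    have "Z_semi A \<Gamma> \<pi>' z = (\<Prod>i\<in>I. fct (lenH i)) * (\<Prod>d\<in>F. \<Prod>j\<in>J 1 d. fct (lenF 1 (d, j)))"
      using split[of 1] unfolding Z_semi_line_reps[OF semi] fct_def .
    also have "(\<Prod>d\<in>F. \<Prod>j\<in>J 1 d. fct (lenF 1 (d, j))) = (\<Prod>d\<in>F. (\<Prod>j\<in>J 0 d. fct (lenF 0 (d, j))) * ?r)"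
      by (rule prod.cong[OF refl axisprod])
    also have "\<dots> = (\<Prod>d\<in>F. \<Prod>j\<in>J 0 d. fct (lenF 0 (d, j))) * ?r ^ card F"
      by (simp add: prod.distrib)
    also have "card F = delta A \<pi> a" unfolding F using card_parallel_dual_weights[OF dual c(9)] .
    finally have "Z_semi A \<Gamma> \<pi>' z = ((\<Prod>i\<in>I. fct (lenH i)) * (\<Prod>d\<in>F. \<Prod>j\<in>J 0 d. fct (lenF 0 (d, j)))) * ?r ^ delta A \<pi> a"
      by (simp only: mult.assoc)
    also have "(\<Prod>i\<in>I. fct (lenH i)) * (\<Prod>d\<in>F. \<Prod>j\<in>J 0 d. fct (lenF 0 (d, j))) = Z_walk A \<Gamma> \<pi>' z"
      using split[of 0] unfolding Z_walk_line_reps[OF rat] fct_def by (rule sym)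
    finally show ?thesis unfolding x_def .
  qed
qed

end

theorem theorem5p2:
  fixes A :: "'v::euclidean_space apartment" and \<Gamma> :: "('v \<Rightarrow> 'v) set"
    and \<pi> \<pi>' :: rep and u w :: complex
  assumes "apartment_frame A"
    and "(is_PGL3 A \<and> {\<pi>, \<pi>'} = {Pi1, Pi2}) \<or> (is_PGSp4 A \<and> {\<pi>, \<pi>'} = {Spin, St})"
    and "subgroup \<Gamma> (affine_weyl A)"
    and "finite (rcosets\<^bsub>affine_weyl A\<^esub> \<Gamma>)"
    and "torsion_free \<Gamma>"
    and "u = exp w" and "norm u < 1"
  shows
    "Z_gallery A \<Gamma> \<pi> u = Z_semi A \<Gamma> \<pi>' (2 / of_nat (n_rep \<pi>') * w) ^ n_rep \<pi>' \<and>
     (\<Gamma> \<subseteq> coroot_translations A \<longrightarrow>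
        Z_semi A \<Gamma> \<pi>' (2 / of_nat (n_rep \<pi>') * w) ^ n_rep \<pi>' =
        Z_walk A \<Gamma> \<pi>' (2 / of_nat (n_rep \<pi>') * w) ^ n_rep \<pi>') \<and>
     (\<not> \<Gamma> \<subseteq> coroot_translations A \<longrightarrow>
        (\<exists>t \<sigma> a k. klein_choice A \<Gamma> t \<sigma> a k) \<and>
        (\<forall>t \<sigma> a k. klein_choice A \<Gamma> t \<sigma> a k \<longrightarrow>
           Z_semi A \<Gamma> \<pi>' (2 / of_nat (n_rep \<pi>') * w) ^ n_rep \<pi>' =
           Z_walk A \<Gamma> \<pi>' (2 / of_nat (n_rep \<pi>') * w) ^ n_rep \<pi>' *
           ((1 + exp (of_nat k / of_nat (n_rep \<pi>') * w)) /
            (1 - exp (of_nat k / of_nat (n_rep \<pi>') * w)))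
             powi (int (delta A \<pi> a) * (1 - int (rational_axes A t \<sigma> a)) * int (n_rep \<pi>'))))"
proof -
  interpret quotient_apartment A \<pi> \<pi>' \<Gamma>
    using assms unfolding quotient_apartment_def dual_reps_def by blast
  have gal: "Z_gallery A \<Gamma> \<pi> u = Z_semi A \<Gamma> \<pi>' (2 / of_nat (n_rep \<pi>') * w) ^ n_rep \<pi>'"
  proof (cases "\<Gamma> \<subseteq> coroot_translations A")
    case True
    then show ?thesis using torus_zeta(1) assms(6) by blast
  next
    case False
    then obtain t \<sigma> a k where "klein_choice A \<Gamma> t \<sigma> a k" using klein_choice_exists by blast
    then show ?thesis using klein_zeta(1) assms(6) by blast
  qed
  have kl: "Z_semi A \<Gamma> \<pi>' (2 / of_nat (n_rep \<pi>') * w) ^ n_rep \<pi>' =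
       Z_walk A \<Gamma> \<pi>' (2 / of_nat (n_rep \<pi>') * w) ^ n_rep \<pi>' *
       ((1 + exp (of_nat k / of_nat (n_rep \<pi>') * w)) / (1 - exp (of_nat k / of_nat (n_rep \<pi>') * w)))
         powi (int (delta A \<pi> a) * (1 - int (rational_axes A t \<sigma> a)) * int (n_rep \<pi>'))"
    if k: "klein_choice A \<Gamma> t \<sigma> a k" for t \<sigma> a k
  proof -
    let ?N = "of_nat (n_rep \<pi>') :: complex"
    define x where "x = exp (of_nat k / ?N * w)"
    have e: "of_nat k / 2 * (2 / ?N * w) = of_nat k / ?N * w" by simp
    have "k > 0" using k unfolding klein_choice_def by blast
    have "exp (Re w) < 1" using assms(6,7) by simp
    then have "Re w < 0" by simp
    then have "(of_nat k / of_nat (n_rep \<pi>')) * Re w < (0::real)"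
      using \<open>k > 0\<close> n_rep_pos by (intro mult_pos_neg) simp_all
    moreover have "Re (of_nat k / ?N * w) = (of_nat k / of_nat (n_rep \<pi>')) * Re w"
    proof -
      have "of_nat k / ?N = of_real (of_nat k / of_nat (n_rep \<pi>'))" by simp
      then show ?thesis by (simp only: Re_complex_of_real times_complex.sel Im_complex_of_real mult_zero_left diff_0_right)
    qed
    ultimately have "norm x < 1" unfolding x_def by simp
    then have z: "Z_semi A \<Gamma> \<pi>' (2 / ?N * w) = Z_walk A \<Gamma> \<pi>' (2 / ?N * w) *
      (((1 + x) / (1 - x)) powi (1 - int (rational_axes A t \<sigma> a))) ^ delta A \<pi> a"
      using klein_zeta(2)[OF k, of "2 / ?N * w"] unfolding e x_def by blast
    have "((((1 + x) / (1 - x)) powi (1 - int (rational_axes A t \<sigma> a))) ^ delta A \<pi> a) ^ n_rep \<pi>' =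
        ((1 + x) / (1 - x)) powi ((1 - int (rational_axes A t \<sigma> a)) * int (delta A \<pi> a) * int (n_rep \<pi>'))"
      by (simp only: power_int_mult power_int_of_nat)
    then show ?thesis unfolding z power_mult_distrib x_def[symmetric] by (simp only: mult.commute)
  qed
  show ?thesis using gal kl klein_choice_exists torus_zeta(2) by auto
qed

end
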